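(* Let $0<p,q\le\infty$, $s=\frac12\left[\max(1,1/p)-\min(1,1/q)\right]$ and $\alpha_1,\alpha_2\in\mathbb{R}$. Let $\lambda=0$ if $0<p\le1$ or $\lambda>d(p-1)/p$ if $1<p<\infty$, and suppose $$2d+\lambda+2(\alpha_1+s(d-1))<(d+1)(\alpha_2+1).$$ Then $$\mathbf{B}^{\alpha_2,q}_p(AB)\hookrightarrow\mathbf{B}^{\alpha_1,q}_p.$$
   Context: $X\hookrightarrow Y$ means $X\subset Y$ and $\|f\|_Y\le C\|f\|_X$ for all $f\in X$. Let $d\ge2$. Frequency vectors $\xi\in\hat{\mathbb{R}}^d$ are row vectors, and $\hat g(\xi)=\int_{\mathbb{R}^d}g(x)e^{-2\pi i\xi x}dx$. $\mathcal{S}$, $\mathcal{S}'$ are the Schwartz class and tempered distributions on $\mathbb{R}^d$. No value of $\lambda$ is specified for $p=\infty$. Classical (dyadic isotropic) inhomogeneous Besov space. Let $\varphi,\Phi\in\mathcal{S}$ with $\operatorname{supp}\hat\varphi\subseteq\{\frac12\le|\xi|\le2\}$, $\operatorname{supp}\hat\Phi\subseteq\{|\xi|\le2\}$, $|\hat\varphi(\xi)|\ge c>0$ for $\frac35\le|\xi|\le\frac53$, $|\hat\Phi(\xi)|\ge c>0$ for $|\xi|\le\frac53$; $\varphi_{2^\nu I}(x)=2^{d\nu}\varphi(2^\nu x)$. $\mathbf{B}^{\alpha,q}_p$ is the set of $f\in\mathcal{S}'$ with $\|f\|_{\mathbf{B}^{\alpha,q}_p}=\|\Phi*f\|_{L^p}+\big(\sum_{\nu=0}^\infty(2^{\nu\alpha}\|\varphi_{2^\nu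 I}*f\|_{L^p})^q\big)^{1/q}<\infty$ (supremum when $q=\infty$). Shearlets. Fix $\hat\psi_1,\hat\psi_2\in C^\infty(\mathbb{R})$ with $\operatorname{supp}\hat\psi_1\subset[-\frac12,-\frac1{16}]\cup[\frac1{16},\frac12]$, $\operatorname{supp}\hat\psi_2\subset[-1,1]$, $\sum_{j\ge0}|\hat\psi_1(2^{-2j}\omega)|^2=1$ for $|\omega|\ge\frac18$, and $|\hat\psi_2(\omega-1)|^2+|\hat\psi_2(\omega)|^2+|\hat\psi_2(\omega+1)|^2=1$ for $|\omega|\le1$. For $\mathfrak d=1,\dots,d$ let $\hat\psi^{(\mathfrak d)}(\xi)=\hat\psi_1(\xi_{\mathfrak d})\prod_{i\ne\mathfrak d}\hat\psi_2(\xi_i/\xi_{\mathfrak d})$. Let $A_{(\mathfrak d)}$ be the diagonal $d\times d$ matrix with entry $4$ in position $\mathfrak d$ and $2$ elsewhere. For $\ell\in\mathbb{Z}^{d-1}$ let $B^{[\ell]}_{(\mathfrak d)}$ be the identity matrix with the off-diagonal entries of row $\mathfrak d$ replaced, in order, by $\ell_1,\dots,\ell_{d-1}$; its inverse is $B^{[-\ell]}_{(\mathfrak d)}$. Write $|[\ell]|\preceq2^j$ if $|\ell_i|\le2^j$ for all $i$. For an invertible matrix $M$, $\psi_M(x)=|\det M|^{-1}\psi(M^{-1}x)$. Let $\hat\Psi\in C_c^\infty(\hat{\mathbb{R}}^d)$ with $\operatorname{supp}\hat\Psi\subset[-\frac14,\frac14]^d$ and $|\hat\Psi|=1$ on $\mathcal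 R=[-\frac18,\frac18]^d$ be such that for all $\xi$ $$|\hat\Psi(\xi)|^2\chi_{\mathcal R}(\xi)+\sum_{\mathfrak d=1}^d\sum_{j\ge0}\sum_{|[\ell]|\preceq2^j}|\hat\psi^{(\mathfrak d)}(\xi A^{-j}_{(\mathfrak d)}B^{[-\ell]}_{(\mathfrak d)})|^2\chi_{\mathcal D^{(\mathfrak d)}}(\xi)=1,$$ where $\mathcal D^{(\mathfrak d)}=\{\xi:|\xi_{\mathfrak d}|\ge\frac18,\ |\xi_i/\xi_{\mathfrak d}|\le1\ (i\ne\mathfrak d)\}$. Put $|Q_j|=2^{-(d+1)j}$. Shear anisotropic inhomogeneous Besov space. $\mathbf{B}^{\alpha,q}_p(AB)$ is the set of $f\in\mathcal{S}'$ with $$\|f\|_{\mathbf{B}^{\alpha,q}_p(AB)}=\|f*\Psi\|_{L^p}+\Big(\sum_{\mathfrak d=1}^d\sum_{j\ge0}\sum_{|[\ell]|\preceq2^j}\big[|Q_j|^{-\alpha}\|f*\psi^{(\mathfrak d)}_{A^{-j}_{(\mathfrak d)}B^{[-\ell]}_{(\mathfrak d)}}\|_{L^p}\big]^q\Big)^{1/q}<\infty$$ (supremum when $q=\infty$).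
   Formalization: The identity defining the shearlet system is required only for almost every ξ, since it fails pointwise where the closed cones D^(𝔡) overlap (value 2); the case p=∞, for which no λ is specified, is left out. *)

theory Defs
  imports "HOL-Probability.Essential_Supremum"
begin

section \<open>Schwartz functions and tempered distributions\<close>

definition partial_derivative :: "'a::euclidean_space \<Rightarrow> ('a \<Rightarrow> complex) \<Rightarrow> 'a \<Rightarrow> complex" where
  "partial_derivative b f = (\<lambda>x. frechet_derivative f (at x) b)"

text \<open>A multi-index is a list \<open>bs\<close> of elements of \<open>Basis\<close>; for smooth functions the order of the
  list is irrelevant.\<close>

definition iterated_partial :: "'a::euclidean_space list \<Rightarrow> ('a \<Rightarrow> complex) \<Rightarrow> 'a \<Rightarrow> complex" where
  "iterated_partial bs f = foldr partial_derivative bs f"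

definition C_infinity :: "('a::euclidean_space \<Rightarrow> complex) \<Rightarrow> bool" where
  "C_infinity f \<longleftrightarrow> (\<forall>bs. set bs \<subseteq> Basis \<longrightarrow> iterated_partial bs f differentiable_on UNIV)"

definition supp :: "('a::topological_space \<Rightarrow> complex) \<Rightarrow> 'a set" where
  "supp f = closure {x. f x \<noteq> 0}"

definition schwartz :: "('a::euclidean_space \<Rightarrow> complex) set" where
  "schwartz = {f. C_infinity f \<and>
     (\<forall>(k::nat) bs. set bs \<subseteq> Basis \<longrightarrow>
        bounded (range (\<lambda>x. (1 + norm x) ^ k *\<^sub>R iterated_partial bs f x)))}"

definition schwartz_seminorm :: "nat \<Rightarrow> ('a::euclidean_space \<Rightarrow> complex) \<Rightarrow> real" where
  "schwartz_seminorm m f =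
     (\<Sum>bs | set bs \<subseteq> Basis \<and> length bs \<le> m.
        SUP x. (1 + norm x) ^ m * norm (iterated_partial bs f x))"

text \<open>Tempered distributions are the linear functionals on the Schwartz space that are continuous
  for the Frechet topology of the (increasing) seminorms above. Since HOL functionals are total,
  their value outside the Schwartz space is fixed to be \<open>0\<close>.\<close>

definition tempered_distributions :: "(('a::euclidean_space \<Rightarrow> complex) \<Rightarrow> complex) set" where
  "tempered_distributions = {u.
     (\<forall>f\<in>schwartz. \<forall>g\<in>schwartz. u (\<lambda>x. f x + g x) = u f + u g) \<and>
     (\<forall>f\<in>schwartz. \<forall>c. u (\<lambda>x. c * f x) = c * u f) \<and>
     (\<exists>C m. \<forall>f\<in>schwartz. norm (u f) \<le> C * schwartz_seminorm m f) \<and>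
     (\<forall>f. f \<notin> schwartz \<longrightarrow> u f = 0)}"

definition dist_convolution ::
  "(('a::euclidean_space \<Rightarrow> complex) \<Rightarrow> complex) \<Rightarrow> ('a \<Rightarrow> complex) \<Rightarrow> 'a \<Rightarrow> complex"
  (infixl \<open>\<star>\<close> 75) where
  "u \<star> g = (\<lambda>x. u (\<lambda>y. g (x - y)))"

definition fourier :: "('a::euclidean_space \<Rightarrow> complex) \<Rightarrow> 'a \<Rightarrow> complex" where
  "fourier g \<xi> = (\<integral>x. g x * exp (- 2 * pi * \<i> * complex_of_real (\<xi> \<bullet> x)) \<partial>lborel)"

definition inverse_fourier :: "('a::euclidean_space \<Rightarrow> complex) \<Rightarrow> 'a \<Rightarrow> complex" where
  "inverse_fourier h x = (\<integral>\<xi>. h \<xi> * exp (2 * pi * \<i> * complex_of_real (\<xi> \<bullet> x)) \<partial>lborel)"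

section \<open>Quasi-norms and embeddings\<close>

text \<open>Only used for exponents \<open>a > 0\<close>.\<close>

definition ennreal_powr :: "ennreal \<Rightarrow> real \<Rightarrow> ennreal" where
  "ennreal_powr x a = (if x = \<infinity> then \<infinity> else ennreal (enn2real x powr a))"

definition Lp_norm :: "ennreal \<Rightarrow> ('a::euclidean_space \<Rightarrow> complex) \<Rightarrow> ennreal" where
  "Lp_norm p g =
     (if p = \<infinity> then esssup lborel (\<lambda>x. ennreal (norm (g x)))
      else ennreal_powr (\<integral>\<^sup>+x. ennreal (norm (g x) powr enn2real p) \<partial>lborel) (1 / enn2real p))"

text \<open>\<open>X\<close> and \<open>Y\<close> are the spaces of those elements of \<open>S\<close> whose extended (quasi-)norm is finite.\<close>

definition finite_norm_space :: "'f set \<Rightarrow> ('f \<Rightarrow> ennreal) \<Rightarrow> 'f set" where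
  "finite_norm_space S N = {f \<in> S. N f < \<infinity>}"

definition embeds :: "'f set \<Rightarrow> ('f \<Rightarrow> ennreal) \<Rightarrow> 'f set \<Rightarrow> ('f \<Rightarrow> ennreal) \<Rightarrow> bool" where
  "embeds X NX Y NY \<longleftrightarrow> X \<subseteq> Y \<and> (\<exists>C::real. C > 0 \<and> (\<forall>f\<in>X. NY f \<le> ennreal C * NX f))"

section \<open>Classical dyadic Besov spaces\<close>

definition besov_generators :: "(real^'d \<Rightarrow> complex) \<Rightarrow> (real^'d \<Rightarrow> complex) \<Rightarrow> bool" where
  "besov_generators \<phi> \<Phi> \<longleftrightarrow>
     \<phi> \<in> schwartz \<and> \<Phi> \<in> schwartz \<and>
     supp (fourier \<phi>) \<subseteq> {\<xi>. 1/2 \<le> norm \<xi> \<and> norm \<xi> \<le> 2} \<and>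
     supp (fourier \<Phi>) \<subseteq> {\<xi>. norm \<xi> \<le> 2} \<and>
     (\<exists>c>0. (\<forall>\<xi>. 3/5 \<le> norm \<xi> \<and> norm \<xi> \<le> 5/3 \<longrightarrow> c \<le> norm (fourier \<phi> \<xi>)) \<and>
            (\<forall>\<xi>. norm \<xi> \<le> 5/3 \<longrightarrow> c \<le> norm (fourier \<Phi> \<xi>)))"

definition dyadic_dilation :: "nat \<Rightarrow> (real^'d \<Rightarrow> complex) \<Rightarrow> real^'d \<Rightarrow> complex" where
  "dyadic_dilation \<nu> \<phi> x = 2 ^ (CARD('d) * \<nu>) * \<phi> (2 ^ \<nu> *\<^sub>R x)"

definition besov_norm ::
  "(real^'d \<Rightarrow> complex) \<Rightarrow> (real^'d \<Rightarrow> complex) \<Rightarrow> real \<Rightarrow> ennreal \<Rightarrow> ennreal \<Rightarrow>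
   ((real^'d \<Rightarrow> complex) \<Rightarrow> complex) \<Rightarrow> ennreal" where
  "besov_norm \<phi> \<Phi> \<alpha> p q f =
     (let a = (\<lambda>\<nu>. ennreal (2 powr (real \<nu> * \<alpha>)) * Lp_norm p (f \<star> dyadic_dilation \<nu> \<phi>))
      in Lp_norm p (f \<star> \<Phi>) +
         (if q = \<infinity> then (SUP \<nu>. a \<nu>)
          else ennreal_powr (\<Sum>\<nu>. ennreal_powr (a \<nu>) (enn2real q)) (1 / enn2real q)))"

definition besov_space ::
  "(real^'d \<Rightarrow> complex) \<Rightarrow> (real^'d \<Rightarrow> complex) \<Rightarrow> real \<Rightarrow> ennreal \<Rightarrow> ennreal \<Rightarrow>
   ((real^'d \<Rightarrow> complex) \<Rightarrow> complex) set" where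
  "besov_space \<phi> \<Phi> \<alpha> p q = finite_norm_space tempered_distributions (besov_norm \<phi> \<Phi> \<alpha> p q)"

section \<open>Shearlets\<close>

text \<open>\<open>\<psi>1\<close>, \<open>\<psi>2\<close> and \<open>\<Psi>h\<close> stand for the functions written with a hat in the literature, i.e. they live
  on the frequency side.\<close>

definition shearlet_hat :: "(real \<Rightarrow> complex) \<Rightarrow> (real \<Rightarrow> complex) \<Rightarrow> 'd \<Rightarrow> real^'d \<Rightarrow> complex" where
  "shearlet_hat \<psi>1 \<psi>2 k \<xi> = \<psi>1 (\<xi> $ k) * (\<Prod>i\<in>UNIV - {k}. \<psi>2 (\<xi> $ i / \<xi> $ k))"

definition A_matrix :: "'d \<Rightarrow> real^'d^'d" where
  "A_matrix k = (\<chi> r c. if r \<noteq> c then 0 else if r = k then 4 else 2)"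

text \<open>The power is taken with respect to the matrix product \<open>**\<close>, as \<open>^\<close> is componentwise.\<close>

definition A_neg_power :: "'d \<Rightarrow> nat \<Rightarrow> real^'d^'d" where
  "A_neg_power k j = (((**) (matrix_inv (A_matrix k))) ^^ j) (mat 1)"

text \<open>Shear parameters in \<open>\<int>\<^sup>d\<^sup>-\<^sup>1\<close> are indexed by the off-diagonal positions of row \<open>k\<close>: they are
  the vectors \<open>l\<close> with \<open>l $ k = 0\<close>, and \<open>l $ k\<close> is never used by \<open>B_matrix\<close>.\<close>

definition B_matrix :: "'d \<Rightarrow> int^'d \<Rightarrow> real^'d^'d" where
  "B_matrix k l = (\<chi> r c. if r = c then 1 else if r = k then of_int (l $ c) else 0)"

definition shears :: "'d \<Rightarrow> nat \<Rightarrow> (int^'d) set" where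
  "shears k j = {l. l $ k = 0 \<and> (\<forall>i. \<bar>l $ i\<bar> \<le> 2 ^ j)}"

definition matrix_dilation :: "real^'d^'d \<Rightarrow> (real^'d \<Rightarrow> complex) \<Rightarrow> real^'d \<Rightarrow> complex" where
  "matrix_dilation M \<psi> x = complex_of_real (inverse \<bar>det M\<bar>) * \<psi> (matrix_inv M *v x)"

definition low_frequency_cube :: "(real^'d) set" where
  "low_frequency_cube = {\<xi>. \<forall>i. \<bar>\<xi> $ i\<bar> \<le> 1/8}"

definition frequency_cone :: "'d \<Rightarrow> (real^'d) set" where
  "frequency_cone k = {\<xi>. 1/8 \<le> \<bar>\<xi> $ k\<bar> \<and> (\<forall>i. i \<noteq> k \<longrightarrow> \<bar>\<xi> $ i / \<xi> $ k\<bar> \<le> 1)}"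

text \<open>The Parseval identity is required almost everywhere: it necessarily fails on the null set
  where the closed cones and the closed cube overlap. All sums over \<open>j\<close> below have
  only finitely many nonzero terms, by the support condition on \<open>\<psi>1\<close>.\<close>

definition shearlet_generators ::
  "(real \<Rightarrow> complex) \<Rightarrow> (real \<Rightarrow> complex) \<Rightarrow> (real^'d \<Rightarrow> complex) \<Rightarrow> bool" where
  "shearlet_generators \<psi>1 \<psi>2 \<Psi>h \<longleftrightarrow>
     C_infinity \<psi>1 \<and> C_infinity \<psi>2 \<and>
     supp \<psi>1 \<subseteq> {- 1/2 .. - 1/16} \<union> {1/16 .. 1/2} \<and>
     supp \<psi>2 \<subseteq> {- 1 .. 1} \<and>
     (\<forall>\<omega>. 1/8 \<le> \<bar>\<omega>\<bar> \<longrightarrow> (\<Sum>j. (norm (\<psi>1 (\<omega> / 2 ^ (2 * j))))\<^sup>2) = 1) \<and>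
     (\<forall>\<omega>. \<bar>\<omega>\<bar> \<le> 1 \<longrightarrow>
        (norm (\<psi>2 (\<omega> - 1)))\<^sup>2 + (norm (\<psi>2 \<omega>))\<^sup>2 + (norm (\<psi>2 (\<omega> + 1)))\<^sup>2 = 1) \<and>
     C_infinity \<Psi>h \<and>
     supp \<Psi>h \<subseteq> {\<xi>. \<forall>i. \<bar>\<xi> $ i\<bar> \<le> 1/4} \<and>
     (\<forall>\<xi>\<in>low_frequency_cube. norm (\<Psi>h \<xi>) = 1) \<and>
     (AE \<xi> in lborel.
        (norm (\<Psi>h \<xi>))\<^sup>2 * indicator low_frequency_cube \<xi> +
        (\<Sum>k\<in>UNIV. \<Sum>j. \<Sum>l\<in>shears k j.
           (norm (shearlet_hat \<psi>1 \<psi>2 k (\<xi> v* (A_neg_power k j ** B_matrix k (- l)))))\<^sup>2 *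
           indicator (frequency_cone k) \<xi>) = 1)"

definition shearlet ::
  "(real \<Rightarrow> complex) \<Rightarrow> (real \<Rightarrow> complex) \<Rightarrow> 'd \<Rightarrow> real^'d \<Rightarrow> complex" where
  "shearlet \<psi>1 \<psi>2 k = inverse_fourier (shearlet_hat \<psi>1 \<psi>2 k)"

definition shear_besov_norm ::
  "(real \<Rightarrow> complex) \<Rightarrow> (real \<Rightarrow> complex) \<Rightarrow> (real^'d \<Rightarrow> complex) \<Rightarrow>
   real \<Rightarrow> ennreal \<Rightarrow> ennreal \<Rightarrow> ((real^'d \<Rightarrow> complex) \<Rightarrow> complex) \<Rightarrow> ennreal" where
  "shear_besov_norm \<psi>1 \<psi>2 \<Psi>h \<alpha> p q f =
     (let Q = (\<lambda>j::nat. 2 powr (- (real (CARD('d) + 1) * real j)));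
          a = (\<lambda>k j l. ennreal (Q j powr (- \<alpha>)) *
                 Lp_norm p (f \<star> matrix_dilation (A_neg_power k j ** B_matrix k (- l))
                                  (shearlet \<psi>1 \<psi>2 k)))
      in Lp_norm p (f \<star> inverse_fourier \<Psi>h) +
         (if q = \<infinity> then (SUP k. SUP j. SUP l\<in>shears k j. a k j l)
          else ennreal_powr
                 (\<Sum>k\<in>UNIV. \<Sum>j. \<Sum>l\<in>shears k j. ennreal_powr (a k j l) (enn2real q))
                 (1 / enn2real q)))"

definition shear_besov_space ::
  "(real \<Rightarrow> complex) \<Rightarrow> (real \<Rightarrow> complex) \<Rightarrow> (real^'d \<Rightarrow> complex) \<Rightarrow>
   real \<Rightarrow> ennreal \<Rightarrow> ennreal \<Rightarrow> ((real^'d \<Rightarrow> complex) \<Rightarrow> complex) set" where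
  "shear_besov_space \<psi>1 \<psi>2 \<Psi>h \<alpha> p q =
     finite_norm_space tempered_distributions (shear_besov_norm \<psi>1 \<psi>2 \<Psi>h \<alpha> p q)"

end

theory Submission
  imports Defs "HOL-Probability.Sinc_Integral" "HOL-Probability.Characteristic_Functions"
begin

text \<open>Call the frequency profiles of the shearlet system (the low-pass function and all the sheared and
  dilated generators) atoms. If \<open>u\<close> is supported in a set that a matrix \<open>M\<close> maps into a fixed cube, then
  passing from \<open>f \<star> u\<^sup>\<or>\<close> to \<open>f \<star> (u v(\<cdot> M))\<^sup>\<or>\<close> costs a constant in \<open>L\<^sup>p\<close> that does not depend on \<open>M\<close>; for
  \<open>p < 1\<close> this rests on a band limited function being reproduced by convolution with a fixed kernel.
  Atoms with overlapping supports have comparable matrices, so this applies to products of atoms.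

  The cut-offs to the cones in the Parseval identity are not smooth, but every frequency lies in the cube
  or in a cone, so at every frequency at least one of the \<open>d + 1\<close> groups of atoms (low-pass, or one of the
  \<open>d\<close> directions) has \<open>\<Sum> |a|\<^sup>2 = 1\<close>. Hence \<open>\<Prod> (1 - \<Sum> |a|\<^sup>2) = 0\<close>, the product being over the groups, and
  expanding this product decomposes any \<open>\<theta>\<close> into terms of the form \<open>a * cnj a * \<theta>\<close> times a smooth factor.

  Let \<open>\<theta>\<close> be the dyadic profile at frequency \<open>2\<^sup>\<nu>\<close>. Only the \<open>O(2 powr (\<nu>(d - 1)/2))\<close> atoms with \<open>4\<^sup>j\<close>
  comparable to \<open>2\<^sup>\<nu>\<close> meet its support, and summing \<open>N\<close> functions costs a factor \<open>N powr m\<close> in \<open>L\<^sup>p\<close>, where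
  \<open>m = max 1 (1/p)\<close>. Therefore the \<open>\<nu>\<close>-th term of the Besov norm is at most
  \<open>C * 2 powr (- \<epsilon> \<nu>)\<close> times the shear Besov norm, where \<open>2 \<epsilon> = (d + 1) \<alpha>2 - 2 \<alpha>1 - (d - 1) m\<close> is positive by
  the hypothesis, and the geometric series is summable for every \<open>q\<close>.\<close>

section \<open>Smooth functions and their decay\<close>

text \<open>Expanding the product naively would be ruinous: each group contributes about
  \<open>2 powr (\<nu>(d - 1)/2)\<close> atoms on the band, and every further factor 1 -
  \<open>level_sum\<close> would cost another power of that number. Therefore each term keeps an
  atom a as a factor. On its support only boundedly many atoms of any group survive, so all factors
  other than the one that produced a cost constants. The large count enters additively, once for
  each group, and is never raised to a higher power than m.

  Both the bounded overlap and the uniformity in the matrix rest on one geometric fact: at scale j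
  the support of an atom is a wedge of length about 4 ^ j and width about 2 ^ j, so two frequencies
  in it have a small cross product. In the coordinates of any atom that it meets, the wedge lies in
  a cube of fixed size. Hence a single cut-off, \<open>bump 2100\<close>, can serve as reproducing
  kernel for all pairs of atoms and for the dyadic profile.\<close>

lemma iterated_partial_Nil [simp]: "iterated_partial [] f = f"
  by (simp add: iterated_partial_def)

lemma iterated_partial_Cons [simp]:
  "iterated_partial (b # bs) f = partial_derivative b (iterated_partial bs f)"
  by (simp add: iterated_partial_def)

lemma iterated_partial_append:
  "iterated_partial (bs @ cs) f = iterated_partial bs (iterated_partial cs f)"
  by (simp add: iterated_partial_def)

lemma partial_derivative_eq:
  assumes "(f has_derivative f') (at x)"
  shows "partial_derivative b f x = f' b"
  using frechet_derivative_at[OF assms] by (simp add: partial_derivative_def)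

lemma has_derivative_frechet:
  assumes "f differentiable_on UNIV"
  shows "(f has_derivative frechet_derivative f (at x)) (at x)"
  using assms frechet_derivative_works by (force simp: differentiable_on_def)

lemma frechet_derivative_eq_sum_partial:
  assumes "f differentiable_on UNIV"
  shows "frechet_derivative f (at x) h = (\<Sum>b\<in>Basis. (h \<bullet> b) *\<^sub>R partial_derivative b f x)"
proof -
  interpret bounded_linear "frechet_derivative f (at x)"
    using has_derivative_frechet[OF assms] by (rule has_derivative_bounded_linear)
  have "frechet_derivative f (at x) h = frechet_derivative f (at x) (\<Sum>b\<in>Basis. (h \<bullet> b) *\<^sub>R b)"
    by (simp add: euclidean_representation)
  also have "\<dots> = (\<Sum>b\<in>Basis. (h \<bullet> b) *\<^sub>R partial_derivative b f x)"
    by (simp add: sum scaleR partial_derivative_def)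
  finally show ?thesis .
qed

text \<open>The linear span, in inductive form so that properties pass from the generators to all
  members. Spans are needed because the product and chain rules turn one generator into a sum of
  several.\<close>

inductive_set lin_hull :: "('a \<Rightarrow> complex) set \<Rightarrow> ('a \<Rightarrow> complex) set"
  for X :: "('a \<Rightarrow> complex) set" where
  lin_hull_base: "f \<in> X \<Longrightarrow> f \<in> lin_hull X"
| lin_hull_zero: "(\<lambda>x. 0) \<in> lin_hull X"
| lin_hull_add: "f \<in> lin_hull X \<Longrightarrow> g \<in> lin_hull X \<Longrightarrow> (\<lambda>x. f x + g x) \<in> lin_hull X"
| lin_hull_scale: "f \<in> lin_hull X \<Longrightarrow> (\<lambda>x. c * f x) \<in> lin_hull X"

lemma lin_hull_sum:
  assumes "finite I" "\<And>i. i \<in> I \<Longrightarrow> f i \<in> lin_hull X"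
  shows "(\<lambda>x. \<Sum>i\<in>I. f i x) \<in> lin_hull X"
  using assms by (induction I rule: finite_induct) (auto intro: lin_hull.intros)

text \<open>A class of functions closed under partial derivatives up to linear combinations
  consists of smooth functions, and growth conditions pass to all derivatives.\<close>

lemma smooth_coinduct:
  fixes f :: "'a::euclidean_space \<Rightarrow> complex"
  assumes f: "f \<in> lin_hull X"
    and diff: "\<And>g. g \<in> X \<Longrightarrow> g differentiable_on UNIV"
    and G: "\<And>g. g \<in> X \<Longrightarrow> G g" "G (\<lambda>x. 0)" "\<And>g h. G g \<Longrightarrow> G h \<Longrightarrow> G (\<lambda>x. g x + h x)"
      "\<And>c g. G g \<Longrightarrow> G (\<lambda>x. c * g x)"
    and partial: "\<And>g b. g \<in> X \<Longrightarrow> b \<in> Basis \<Longrightarrow> partial_derivative b g \<in> lin_hull X"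
  shows "C_infinity f \<and> (\<forall>bs. set bs \<subseteq> Basis \<longrightarrow> G (iterated_partial bs f))"
proof -
  have diff': "g differentiable_on UNIV" if "g \<in> lin_hull X" for g
    using that
  proof induction
    case (lin_hull_add f g)
    then show ?case by (intro differentiable_on_add)
  next
    case (lin_hull_scale f c)
    then show ?case by (intro differentiable_on_mult) auto
  qed (auto intro: diff)
  have G': "G g" if "g \<in> lin_hull X" for g
    using that by induction (auto intro: G)
  have partial': "partial_derivative b g \<in> lin_hull X" if "g \<in> lin_hull X" "b \<in> Basis" for g b
    using that(1)
  proof induction
    case (lin_hull_base f)
    then show ?case using partial that by simp
  next
    case lin_hull_zero
    have "partial_derivative b (\<lambda>x. 0 :: complex) = (\<lambda>x::'a. 0)"
      by (auto simp: fun_eq_iff intro!: partial_derivative_eq[THEN trans])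
    then show ?case by (simp add: lin_hull.lin_hull_zero)
  next
    case (lin_hull_add f g)
    have "partial_derivative b (\<lambda>x. f x + g x) = (\<lambda>x. partial_derivative b f x + partial_derivative b g x)"
      using has_derivative_frechet[OF diff'[OF lin_hull_add.hyps(1)]]
        has_derivative_frechet[OF diff'[OF lin_hull_add.hyps(2)]]
      by (intro ext) (subst partial_derivative_eq[OF has_derivative_add], auto simp: partial_derivative_def)
    then show ?case using lin_hull_add.IH by (simp add: lin_hull.lin_hull_add)
  next
    case (lin_hull_scale f c)
    have "partial_derivative b (\<lambda>x. c * f x) = (\<lambda>x. c * partial_derivative b f x)"
      using has_derivative_frechet[OF diff'[OF lin_hull_scale.hyps(1)]]
      by (intro ext) (subst partial_derivative_eq[OF has_derivative_mult_right], auto simp: partial_derivative_def)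
    then show ?case using lin_hull_scale.IH by (simp add: lin_hull.lin_hull_scale)
  qed
  have "iterated_partial bs f \<in> lin_hull X" if "set bs \<subseteq> Basis" for bs
    using that by (induction bs) (auto intro: f partial')
  then show ?thesis
    by (auto simp: C_infinity_def intro: diff' G')
qed

section \<open>Rapid decrease and polynomial growth\<close>

definition rapidly_decreasing :: "('a::euclidean_space \<Rightarrow> complex) \<Rightarrow> bool" where
  "rapidly_decreasing f \<longleftrightarrow> (\<forall>k. \<exists>C. \<forall>x. (1 + norm x) ^ k * norm (f x) \<le> C)"

definition poly_bounded :: "('a::euclidean_space \<Rightarrow> complex) \<Rightarrow> bool" where
  "poly_bounded f \<longleftrightarrow> (\<exists>C k. \<forall>x. norm (f x) \<le> C * (1 + norm x) ^ k)"

lemma rapidly_decreasing_0: "rapidly_decreasing (\<lambda>x. 0)"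
  by (auto simp: rapidly_decreasing_def)

lemma rapidly_decreasing_add:
  assumes "rapidly_decreasing f" "rapidly_decreasing g"
  shows "rapidly_decreasing (\<lambda>x. f x + g x)"
  unfolding rapidly_decreasing_def
proof
  fix k
  obtain C D where C: "\<And>x. (1 + norm x) ^ k * norm (f x) \<le> C"
    and D: "\<And>x. (1 + norm x) ^ k * norm (g x) \<le> D"
    using assms unfolding rapidly_decreasing_def by meson
  have "(1 + norm x) ^ k * norm (f x + g x) \<le> C + D" for x
  proof -
    have "(1 + norm x) ^ k * norm (f x + g x) \<le> (1 + norm x) ^ k * (norm (f x) + norm (g x))"
      by (intro mult_left_mono norm_triangle_ineq) auto
    also have "\<dots> \<le> C + D"
      using C[of x] D[of x] by (simp add: algebra_simps)
    finally show ?thesis .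
  qed
  then show "\<exists>C. \<forall>x. (1 + norm x) ^ k * norm (f x + g x) \<le> C" by blast
qed

lemma rapidly_decreasing_mult:
  assumes "poly_bounded m" "rapidly_decreasing f"
  shows "rapidly_decreasing (\<lambda>x. m x * f x)"
  unfolding rapidly_decreasing_def
proof
  fix k
  obtain D n where D: "\<And>x. norm (m x) \<le> D * (1 + norm x) ^ n"
    using assms unfolding poly_bounded_def by meson
  obtain C where C: "\<And>x. (1 + norm x) ^ (k + n) * norm (f x) \<le> C"
    using assms unfolding rapidly_decreasing_def by meson
  have "0 \<le> D" using order_trans[OF norm_ge_zero D[of 0]] by simp
  have "(1 + norm x) ^ k * norm (m x * f x) \<le> D * C" for x
  proof -
    have "(1 + norm x) ^ k * norm (m x * f x) \<le> (1 + norm x) ^ k * (D * (1 + norm x) ^ n * norm (f x))"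
      unfolding norm_mult by (intro mult_left_mono mult_right_mono D) auto
    also have "\<dots> = D * ((1 + norm x) ^ (k + n) * norm (f x))"
      by (simp add: power_add algebra_simps)
    also have "\<dots> \<le> D * C" using C \<open>0 \<le> D\<close> by (intro mult_left_mono) auto
    finally show ?thesis .
  qed
  then show "\<exists>C. \<forall>x. (1 + norm x) ^ k * norm (m x * f x) \<le> C" by blast
qed

lemma poly_bounded_const: "poly_bounded (\<lambda>x. c)"
  unfolding poly_bounded_def by (rule exI[of _ "norm c"], rule exI[of _ 0]) simp

lemma rapidly_decreasing_scale: "rapidly_decreasing f \<Longrightarrow> rapidly_decreasing (\<lambda>x. c * f x)"
  by (rule rapidly_decreasing_mult[OF poly_bounded_const])

lemma rapidly_decreasing_imp_poly_bounded: "rapidly_decreasing f \<Longrightarrow> poly_bounded f"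
  unfolding rapidly_decreasing_def poly_bounded_def
  by (metis mult.commute mult.right_neutral power_0)

lemma poly_bounded_add:
  assumes "poly_bounded f" "poly_bounded g"
  shows "poly_bounded (\<lambda>x. f x + g x)"
proof -
  obtain C D k n where C: "\<And>x. norm (f x) \<le> C * (1 + norm x) ^ k"
    and D: "\<And>x. norm (g x) \<le> D * (1 + norm x) ^ n"
    using assms unfolding poly_bounded_def by meson
  have pos: "0 \<le> C" "0 \<le> D" using order_trans[OF norm_ge_zero C[of 0]] order_trans[OF norm_ge_zero D[of 0]] by auto
  have "norm (f x + g x) \<le> (C + D) * (1 + norm x) ^ (k + n)" for x
  proof -
    have "norm (f x) \<le> C * (1 + norm x) ^ (k + n)"
      by (rule order_trans[OF C]) (intro mult_left_mono power_increasing, auto simp: pos)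
    moreover have "norm (g x) \<le> D * (1 + norm x) ^ (k + n)"
      by (rule order_trans[OF D]) (intro mult_left_mono power_increasing, auto simp: pos)
    ultimately show ?thesis
      using norm_triangle_ineq[of "f x" "g x"] by (simp add: algebra_simps)
  qed
  then show ?thesis unfolding poly_bounded_def by blast
qed

lemma poly_bounded_mult:
  assumes "poly_bounded f" "poly_bounded g"
  shows "poly_bounded (\<lambda>x. f x * g x)"
proof -
  obtain C D k n where C: "\<And>x. norm (f x) \<le> C * (1 + norm x) ^ k"
    and D: "\<And>x. norm (g x) \<le> D * (1 + norm x) ^ n"
    using assms unfolding poly_bounded_def by meson
  have pos: "0 \<le> C" "0 \<le> D" using order_trans[OF norm_ge_zero C[of 0]] order_trans[OF norm_ge_zero D[of 0]] by auto
  have "norm (f x * g x) \<le> (C * D) * (1 + norm x) ^ (k + n)" for x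
    using mult_mono[OF C[of x] D[of x]] pos by (simp add: norm_mult power_add algebra_simps)
  then show ?thesis unfolding poly_bounded_def by blast
qed

lemma schwartz_iff:
  "f \<in> schwartz \<longleftrightarrow> C_infinity f \<and> (\<forall>bs. set bs \<subseteq> Basis \<longrightarrow> rapidly_decreasing (iterated_partial bs f))"
proof -
  have "bounded (range (\<lambda>x. (1 + norm x) ^ k *\<^sub>R g x)) \<longleftrightarrow> (\<exists>C. \<forall>x. (1 + norm x) ^ k * norm (g x) \<le> C)"
    for k and g :: "'a \<Rightarrow> complex"
    by (simp add: bounded_iff)
  then show ?thesis unfolding schwartz_def rapidly_decreasing_def by auto
qed

text \<open>The multipliers of the Schwartz class, usually written O_M. Characters and polynomials
  belong to it without being Schwartz functions.\<close>

definition slowly_increasing :: "('a::euclidean_space \<Rightarrow> complex) set" where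
  "slowly_increasing = {f. C_infinity f \<and> (\<forall>bs. set bs \<subseteq> Basis \<longrightarrow> poly_bounded (iterated_partial bs f))}"

lemma schwartz_coinduct:
  assumes "f \<in> lin_hull X" "\<And>g. g \<in> X \<Longrightarrow> g differentiable_on UNIV"
    "\<And>g. g \<in> X \<Longrightarrow> rapidly_decreasing g"
    "\<And>g b. g \<in> X \<Longrightarrow> b \<in> Basis \<Longrightarrow> partial_derivative b g \<in> lin_hull X"
  shows "f \<in> schwartz"
  unfolding schwartz_iff
  by (rule smooth_coinduct[OF assms(1)])
    (auto intro: assms rapidly_decreasing_0 rapidly_decreasing_add rapidly_decreasing_scale)

lemma slowly_increasing_coinduct:
  assumes "f \<in> lin_hull X" "\<And>g. g \<in> X \<Longrightarrow> g differentiable_on UNIV"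
    "\<And>g. g \<in> X \<Longrightarrow> poly_bounded g"
    "\<And>g b. g \<in> X \<Longrightarrow> b \<in> Basis \<Longrightarrow> partial_derivative b g \<in> lin_hull X"
  shows "f \<in> slowly_increasing"
  unfolding slowly_increasing_def mem_Collect_eq
  by (rule smooth_coinduct[OF assms(1)])
    (auto intro: assms poly_bounded_const poly_bounded_add poly_bounded_mult[OF poly_bounded_const])

lemma C_infinity_coinduct:
  assumes "f \<in> lin_hull X" "\<And>g. g \<in> X \<Longrightarrow> g differentiable_on UNIV"
    "\<And>g b. g \<in> X \<Longrightarrow> b \<in> Basis \<Longrightarrow> partial_derivative b g \<in> lin_hull X"
  shows "C_infinity f"
  using smooth_coinduct[OF assms(1,2), of "\<lambda>_. True"] assms(3) by auto

lemma C_infinity_partial: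
  assumes "C_infinity f" "b \<in> Basis" shows "C_infinity (partial_derivative b f)"
  unfolding C_infinity_def
proof (intro allI impI)
  fix bs :: "'a list" assume "set bs \<subseteq> Basis"
  then show "iterated_partial bs (partial_derivative b f) differentiable_on UNIV"
    using assms unfolding C_infinity_def
    by (auto simp: iterated_partial_append[of bs "[b]" f, simplified, symmetric])
qed

lemma C_infinity_differentiable: "C_infinity f \<Longrightarrow> f differentiable_on UNIV"
  unfolding C_infinity_def by (metis empty_subsetI iterated_partial_Nil list.set(1))

lemma schwartz_rapidly_decreasing: "f \<in> schwartz \<Longrightarrow> rapidly_decreasing f"
  unfolding schwartz_iff by (metis empty_subsetI iterated_partial_Nil list.set(1))

lemma slowly_increasing_poly_bounded: "f \<in> slowly_increasing \<Longrightarrow> poly_bounded f"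
  unfolding slowly_increasing_def by (auto dest: spec[of _ "[]"])

lemma schwartz_differentiable: "f \<in> schwartz \<Longrightarrow> f differentiable_on UNIV"
  by (simp add: schwartz_iff C_infinity_differentiable)

lemma slowly_increasing_differentiable: "f \<in> slowly_increasing \<Longrightarrow> f differentiable_on UNIV"
  by (simp add: slowly_increasing_def C_infinity_differentiable)

lemma schwartz_partial:
  assumes "f \<in> schwartz" "b \<in> Basis" shows "partial_derivative b f \<in> schwartz"
  unfolding schwartz_iff
proof (intro conjI allI impI)
  show "C_infinity (partial_derivative b f)"
    using assms by (intro C_infinity_partial) (auto simp: schwartz_iff)
  fix bs :: "'a list" assume "set bs \<subseteq> Basis"
  then show "rapidly_decreasing (iterated_partial bs (partial_derivative b f))"
    using assms unfolding schwartz_iff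
    by (auto simp: iterated_partial_append[of bs "[b]" f, simplified, symmetric])
qed

lemma slowly_increasing_partial:
  assumes "f \<in> slowly_increasing" "b \<in> Basis" shows "partial_derivative b f \<in> slowly_increasing"
  unfolding slowly_increasing_def mem_Collect_eq
proof (intro conjI allI impI)
  show "C_infinity (partial_derivative b f)"
    using assms by (intro C_infinity_partial) (auto simp: slowly_increasing_def)
  fix bs :: "'a list" assume "set bs \<subseteq> Basis"
  then show "poly_bounded (iterated_partial bs (partial_derivative b f))"
    using assms unfolding slowly_increasing_def
    by (auto simp: iterated_partial_append[of bs "[b]" f, simplified, symmetric])
qed

lemma schwartz_iterated_partial:
  "f \<in> schwartz \<Longrightarrow> set bs \<subseteq> Basis \<Longrightarrow> iterated_partial bs f \<in> schwartz"
  by (induction bs) (auto intro: schwartz_partial)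

lemma schwartz_imp_slowly_increasing: "f \<in> schwartz \<Longrightarrow> f \<in> slowly_increasing"
  unfolding schwartz_iff slowly_increasing_def using rapidly_decreasing_imp_poly_bounded by auto

section \<open>Closure properties of the Schwartz class\<close>

lemma partial_derivative_mult:
  assumes "f differentiable_on UNIV" "g differentiable_on UNIV"
  shows "partial_derivative b (\<lambda>x. f x * g x) =
    (\<lambda>x. f x * partial_derivative b g x + partial_derivative b f x * g x)"
  using has_derivative_frechet[OF assms(1)] has_derivative_frechet[OF assms(2)]
  by (intro ext) (subst partial_derivative_eq[OF has_derivative_mult], auto simp: partial_derivative_def)

lemma schwartz_lin_hull: "f \<in> lin_hull schwartz \<Longrightarrow> f \<in> schwartz"
  by (rule schwartz_coinduct[of _ schwartz])
    (auto intro: schwartz_differentiable schwartz_rapidly_decreasing schwartz_partial lin_hull_base)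

lemma schwartz_zero: "(\<lambda>x. 0) \<in> schwartz"
  by (rule schwartz_lin_hull[OF lin_hull_zero])

lemma schwartz_add: "f \<in> schwartz \<Longrightarrow> g \<in> schwartz \<Longrightarrow> (\<lambda>x. f x + g x) \<in> schwartz"
  by (rule schwartz_lin_hull, rule lin_hull_add; rule lin_hull_base)

lemma schwartz_scale: "f \<in> schwartz \<Longrightarrow> (\<lambda>x. c * f x) \<in> schwartz"
  by (rule schwartz_lin_hull, rule lin_hull_scale, rule lin_hull_base)

lemma schwartz_sum:
  "finite I \<Longrightarrow> (\<And>i. i \<in> I \<Longrightarrow> h i \<in> schwartz) \<Longrightarrow> (\<lambda>x. \<Sum>i\<in>I. h i x) \<in> schwartz"
  by (rule schwartz_lin_hull, rule lin_hull_sum) (auto intro: lin_hull_base)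

lemma C_infinity_mult:
  assumes "C_infinity f" "C_infinity g"
  shows "C_infinity (\<lambda>x. f x * g x)"
proof (rule C_infinity_coinduct)
  let ?X = "{\<lambda>x. f x * g x | f g :: 'a \<Rightarrow> complex. C_infinity f \<and> C_infinity g}"
  show "(\<lambda>x. f x * g x) \<in> lin_hull ?X" using assms by (auto intro: lin_hull_base)
  show "h differentiable_on UNIV" if "h \<in> ?X" for h
    using that by (auto intro!: differentiable_on_mult intro: C_infinity_differentiable)
  show "partial_derivative b h \<in> lin_hull ?X" if "h \<in> ?X" "b \<in> Basis" for h b
  proof -
    obtain f g where *: "C_infinity f" "C_infinity g" "h = (\<lambda>x. f x * g x)" using \<open>h \<in> ?X\<close> by auto
    show ?thesis
      unfolding *(3) partial_derivative_mult[OF *(1,2)[THEN C_infinity_differentiable]]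
      by (intro lin_hull_add lin_hull_base) (use * C_infinity_partial[OF _ that(2)] in auto)
  qed
qed

lemma schwartz_mult:
  assumes "f \<in> slowly_increasing" "g \<in> schwartz"
  shows "(\<lambda>x. f x * g x) \<in> schwartz"
proof (rule schwartz_coinduct)
  let ?X = "{\<lambda>x. f x * g x | f g :: 'a \<Rightarrow> complex. f \<in> slowly_increasing \<and> g \<in> schwartz}"
  show "(\<lambda>x. f x * g x) \<in> lin_hull ?X" using assms by (auto intro: lin_hull_base)
  show "h differentiable_on UNIV" if "h \<in> ?X" for h
    using that by (auto intro!: differentiable_on_mult intro: slowly_increasing_differentiable schwartz_differentiable)
  show "rapidly_decreasing h" if "h \<in> ?X" for h
    using that by (auto intro!: rapidly_decreasing_mult intro: slowly_increasing_poly_bounded schwartz_rapidly_decreasing)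
  show "partial_derivative b h \<in> lin_hull ?X" if "h \<in> ?X" "b \<in> Basis" for h b
  proof -
    obtain f g where *: "f \<in> slowly_increasing" "g \<in> schwartz" "h = (\<lambda>x. f x * g x)" using \<open>h \<in> ?X\<close> by auto
    show ?thesis
      unfolding *(3) partial_derivative_mult[OF *(1)[THEN slowly_increasing_differentiable] *(2)[THEN schwartz_differentiable]]
      by (intro lin_hull_add lin_hull_base)
        (use * slowly_increasing_partial[OF _ that(2)] schwartz_partial[OF _ that(2)] in auto)
  qed
qed

lemma schwartz_mult': "f \<in> schwartz \<Longrightarrow> g \<in> schwartz \<Longrightarrow> (\<lambda>x. f x * g x) \<in> schwartz"
  by (rule schwartz_mult[OF schwartz_imp_slowly_increasing])

lemma slowly_increasing_inner: "(\<lambda>x. complex_of_real (x \<bullet> a)) \<in> slowly_increasing"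
proof (rule slowly_increasing_coinduct)
  let ?X = "{\<lambda>x::'a. complex_of_real (x \<bullet> a), \<lambda>x. 1}"
  show "(\<lambda>x. complex_of_real (x \<bullet> a)) \<in> lin_hull ?X" by (auto intro: lin_hull_base)
  have d1: "((\<lambda>x. complex_of_real (x \<bullet> a)) has_derivative (\<lambda>h. complex_of_real (h \<bullet> a))) (at x)" for x
    by (auto intro!: derivative_eq_intros)
  have d2: "((\<lambda>x. 1::complex) has_derivative (\<lambda>h. 0)) (at x)" for x :: 'a
    by (auto intro!: derivative_eq_intros)
  show "h differentiable_on UNIV" if "h \<in> ?X" for h
    using that differentiableI[OF d1] differentiableI[OF d2] by (auto simp: differentiable_on_def)
  show "poly_bounded h" if "h \<in> ?X" for h
  proof -
    have "poly_bounded (\<lambda>x. complex_of_real (x \<bullet> a))"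
      unfolding poly_bounded_def
    proof (intro exI allI)
      fix x
      have "norm (complex_of_real (x \<bullet> a)) \<le> norm x * norm a"
        by (simp add: Cauchy_Schwarz_ineq2)
      also have "\<dots> \<le> norm a * (1 + norm x) ^ 1" by (simp add: algebra_simps)
      finally show "norm (complex_of_real (x \<bullet> a)) \<le> norm a * (1 + norm x) ^ 1" .
    qed
    then show ?thesis using that by (auto intro: poly_bounded_const)
  qed
  show "partial_derivative b h \<in> lin_hull ?X" if "h \<in> ?X" for h b
  proof -
    have "partial_derivative b (\<lambda>x. complex_of_real (x \<bullet> a)) = (\<lambda>x. complex_of_real (b \<bullet> a) * 1)"
      by (intro ext) (simp add: partial_derivative_eq[OF d1])
    moreover have "partial_derivative b (\<lambda>x. 1) = (\<lambda>x. 0)"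
      by (intro ext) (simp add: partial_derivative_eq[OF d2])
    moreover have "(\<lambda>x. complex_of_real (b \<bullet> a) * 1) \<in> lin_hull ?X"
      by (rule lin_hull_scale) (auto intro: lin_hull_base)
    ultimately show ?thesis using that lin_hull_zero by auto
  qed
qed

lemma schwartz_cnj:
  assumes "f \<in> schwartz" shows "(\<lambda>x. cnj (f x)) \<in> schwartz"
proof (rule schwartz_coinduct)
  let ?X = "{\<lambda>x. cnj (f x) | f :: 'a \<Rightarrow> complex. f \<in> schwartz}"
  show "(\<lambda>x. cnj (f x)) \<in> lin_hull ?X" using assms by (auto intro: lin_hull_base)
  have d: "((\<lambda>x. cnj (f x)) has_derivative (\<lambda>h. cnj (frechet_derivative f (at x) h))) (at x)"
    if "f \<in> schwartz" for f :: "'a \<Rightarrow> complex" and x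
    using has_derivative_frechet[OF schwartz_differentiable[OF that]]
    by (auto intro!: derivative_eq_intros)
  show "h differentiable_on UNIV" if "h \<in> ?X" for h
    using that differentiableI[OF d] by (auto simp: differentiable_on_def)
  show "rapidly_decreasing h" if "h \<in> ?X" for h
    using that schwartz_rapidly_decreasing by (fastforce simp: rapidly_decreasing_def)
  show "partial_derivative b h \<in> lin_hull ?X" if "h \<in> ?X" "b \<in> Basis" for h b
  proof -
    obtain f where f: "f \<in> schwartz" "h = (\<lambda>x. cnj (f x))" using \<open>h \<in> ?X\<close> by auto
    have "partial_derivative b h = (\<lambda>x. cnj (partial_derivative b f x))"
      unfolding f(2) by (intro ext) (simp add: partial_derivative_eq[OF d[OF f(1)]], simp add: partial_derivative_def)
    then show ?thesis using schwartz_partial[OF f(1) that(2)] by (auto intro: lin_hull_base)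
  qed
qed

text \<open>An injective linear map of a finite-dimensional space is bounded below, so the weights 1
  + norm x and 1 + norm (a + L x) are comparable and decay is inherited. Derivatives produce linear
  combinations with constant coefficients of functions of the same form.\<close>

lemma schwartz_affine:
  fixes L :: "'a::euclidean_space \<Rightarrow> 'a"
  assumes f: "f \<in> schwartz" and L: "linear L" "inj L"
  shows "(\<lambda>x. f (a + L x)) \<in> schwartz"
proof (rule schwartz_coinduct)
  interpret L: bounded_linear L by (simp add: L linear_conv_bounded_linear[symmetric])
  obtain B where B: "B > 0" "\<And>x. B * norm x \<le> norm (L x)"
    using linear_inj_bounded_below_pos[OF L] by auto
  let ?X = "{\<lambda>x. f (a + L x) | f :: 'a \<Rightarrow> complex. f \<in> schwartz}"
  show "(\<lambda>x. f (a + L x)) \<in> lin_hull ?X" using assms by (auto intro: lin_hull_base)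
  have d: "((\<lambda>x. f (a + L x)) has_derivative (\<lambda>h. frechet_derivative f (at (a + L x)) (L h))) (at x)"
    if "f \<in> schwartz" for f :: "'a \<Rightarrow> complex" and x
  proof (rule has_derivative_compose[of "\<lambda>x. a + L x"])
    show "((\<lambda>x. a + L x) has_derivative L) (at x)"
      by (auto intro!: derivative_eq_intros L.has_derivative)
    show "(f has_derivative frechet_derivative f (at (a + L x))) (at (a + L x))"
      by (rule has_derivative_frechet[OF schwartz_differentiable[OF that]])
  qed
  show "h differentiable_on UNIV" if "h \<in> ?X" for h
    using that differentiableI[OF d] by (auto simp: differentiable_on_def)
  define D where "D = 1 + 1 / B + norm a / B"
  have D: "1 + norm x \<le> D * (1 + norm (a + L x))" for x
  proof -
    have "norm (L x) \<le> norm (a + L x) + norm a"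
      by (metis add_diff_cancel_left' norm_triangle_ineq4)
    then have "norm x \<le> norm (a + L x) / B + norm a / B"
      using B(2)[of x] B(1) by (simp add: field_simps)
    moreover have "0 \<le> 1 / B + norm (a + L x) + norm a / B * norm (a + L x)"
      using B(1) by simp
    ultimately show ?thesis by (simp add: D_def algebra_simps)
  qed
  show "rapidly_decreasing h" if "h \<in> ?X" for h
  proof -
    obtain f where f: "f \<in> schwartz" "h = (\<lambda>x. f (a + L x))" using \<open>h \<in> ?X\<close> by auto
    show ?thesis unfolding rapidly_decreasing_def f
    proof
      fix k
      obtain C where C: "\<And>x. (1 + norm x) ^ k * norm (f x) \<le> C"
        using schwartz_rapidly_decreasing[OF f(1)] unfolding rapidly_decreasing_def by meson
      have "(1 + norm x) ^ k * norm (f (a + L x)) \<le> D ^ k * C" for x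
      proof -
        have "(1 + norm x) ^ k * norm (f (a + L x)) \<le> (D * (1 + norm (a + L x))) ^ k * norm (f (a + L x))"
          by (intro mult_right_mono power_mono D) auto
        also have "\<dots> = D ^ k * ((1 + norm (a + L x)) ^ k * norm (f (a + L x)))"
          by (simp add: power_mult_distrib)
        also have "\<dots> \<le> D ^ k * C" using B(1) by (intro mult_left_mono C) (auto simp: D_def)
        finally show ?thesis .
      qed
      then show "\<exists>C. \<forall>x. (1 + norm x) ^ k * norm (f (a + L x)) \<le> C" by blast
    qed
  qed
  show "partial_derivative b h \<in> lin_hull ?X" if "h \<in> ?X" "b \<in> Basis" for h b
  proof -
    obtain f where f: "f \<in> schwartz" "h = (\<lambda>x. f (a + L x))" using \<open>h \<in> ?X\<close> by auto
    have "partial_derivative b h = (\<lambda>x. \<Sum>c\<in>Basis. complex_of_real (L b \<bullet> c) * partial_derivative c f (a + L x))"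
      unfolding f(2)
      by (intro ext) (simp add: partial_derivative_eq[OF d[OF f(1)]] scaleR_conv_of_real
          frechet_derivative_eq_sum_partial[OF schwartz_differentiable[OF f(1)]])
    moreover have "\<dots> \<in> lin_hull ?X"
      by (intro lin_hull_sum lin_hull_scale lin_hull_base) (use schwartz_partial[OF f(1)] in auto)
    ultimately show ?thesis by simp
  qed
qed

text \<open>The class is stable under differentiation with the same R, because a function that
  vanishes on an open set has derivative 0 there. On the closed ball every weighted function is
  bounded by compactness.\<close>

lemma schwartz_compact_support:
  assumes "C_infinity f" and R: "\<And>x. norm x > R \<Longrightarrow> f x = 0"
  shows "f \<in> schwartz"
proof (rule schwartz_coinduct)
  let ?X = "{f :: 'a \<Rightarrow> complex. C_infinity f \<and> (\<forall>x. norm x > R \<longrightarrow> f x = 0)}"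
  show "f \<in> lin_hull ?X" using assms by (auto intro: lin_hull_base)
  show "h differentiable_on UNIV" if "h \<in> ?X" for h
    using that by (auto intro: C_infinity_differentiable)
  show "rapidly_decreasing h" if "h \<in> ?X" for h
    unfolding rapidly_decreasing_def
  proof
    fix k
    have "continuous_on UNIV h" using that C_infinity_differentiable differentiable_imp_continuous_on by blast
    then have "continuous_on (cball 0 R) (\<lambda>x. (1 + norm x) ^ k * norm (h x))"
      by (intro continuous_intros) (auto intro: continuous_on_subset)
    then have "bounded ((\<lambda>x. (1 + norm x) ^ k * norm (h x)) ` cball 0 R)"
      by (intro compact_imp_bounded compact_continuous_image) auto
    then obtain C where C: "\<And>x. norm x \<le> R \<Longrightarrow> (1 + norm x) ^ k * norm (h x) \<le> C"
      unfolding bounded_iff by (fastforce simp: abs_le_iff)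
    have "(1 + norm x) ^ k * norm (h x) \<le> max C 0" for x
      using C[of x] that by (cases "norm x \<le> R") auto
    then show "\<exists>C. \<forall>x. (1 + norm x) ^ k * norm (h x) \<le> C" by blast
  qed
  show "partial_derivative b h \<in> lin_hull ?X" if "h \<in> ?X" "b \<in> Basis" for h b
  proof (rule lin_hull_base, simp, intro conjI allI impI)
    show "C_infinity (partial_derivative b h)" using that by (auto intro: C_infinity_partial)
    fix x :: 'a assume x: "R < norm x"
    have "(h has_derivative (\<lambda>_. 0)) (at x)"
    proof (rule has_derivative_transform_within_open)
      show "((\<lambda>_. 0) has_derivative (\<lambda>_. 0)) (at x)" by simp
      show "open {x::'a. R < norm x}" by (intro open_Collect_less continuous_intros)
    qed (use x that in auto)
    then show "partial_derivative b h x = 0" by (rule partial_derivative_eq)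
  qed
qed

section \<open>Integration by parts and decay of integrals\<close>

lemma schwartz_continuous: "f \<in> schwartz \<Longrightarrow> continuous_on A f"
  using differentiable_imp_continuous_on[OF schwartz_differentiable] continuous_on_subset by blast

lemma schwartz_measurable: "f \<in> schwartz \<Longrightarrow> f \<in> borel_measurable borel"
  by (intro borel_measurable_continuous_onI schwartz_continuous)

text \<open>The exponent 2 * DIM gives each coordinate its own factor (1 + norm x)^2, which
  dominates 1 plus the square of that coordinate. The integral is thus at most a product of
  one-dimensional integrals of 1/(1 + t^2).\<close>

lemma integrable_inverse_one_plus_norm:
  "integrable lborel (\<lambda>x::'a::euclidean_space. 1 / (1 + norm x) ^ (2 * DIM('a)))"
proof (rule integrableI_bounded)
  show "(\<lambda>x::'a. 1 / (1 + norm x) ^ (2 * DIM('a))) \<in> borel_measurable lborel" by measurable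
  have fin: "(\<integral>\<^sup>+x. ennreal (inverse (1 + x\<^sup>2)) \<partial>lborel) < \<infinity>"
    using integrable_inverse_1_plus_square
    by (simp add: set_integrable_def integrable_iff_bounded)
  have "(\<integral>\<^sup>+x. ennreal (norm (1 / (1 + norm x) ^ (2 * DIM('a)))) \<partial>(lborel::'a measure)) \<le>
    (\<integral>\<^sup>+x. (\<Prod>b\<in>Basis. ennreal (inverse (1 + (x \<bullet> b)\<^sup>2))) \<partial>(lborel::'a measure))"
  proof (rule nn_integral_mono)
    fix x :: 'a
    have "norm (1 / (1 + norm x) ^ (2 * DIM('a))) = (\<Prod>b\<in>(Basis::'a set). inverse ((1 + norm x)\<^sup>2))"
      by (simp add: power_mult divide_inverse power_inverse)
    also have "\<dots> \<le> (\<Prod>b\<in>Basis. inverse (1 + (x \<bullet> b)\<^sup>2))"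
    proof (intro prod_mono conjI le_imp_inverse_le)
      fix b :: 'a assume b: "b \<in> Basis"
      have "(x \<bullet> b)\<^sup>2 \<le> (norm x)\<^sup>2"
        using Basis_le_norm[OF b, of x] by (simp add: abs_le_square_iff[symmetric])
      then show "1 + (x \<bullet> b)\<^sup>2 \<le> (1 + norm x)\<^sup>2"
        using norm_ge_zero[of x] by (simp add: power2_sum del: norm_ge_zero)
    qed (auto intro: add_pos_nonneg)
    finally show "ennreal (norm (1 / (1 + norm x) ^ (2 * DIM('a)))) \<le>
        (\<Prod>b\<in>Basis. ennreal (inverse (1 + (x \<bullet> b)\<^sup>2)))"
      by (subst prod_ennreal) (auto intro: ennreal_leI)
  qed
  also have "\<dots> = (\<Prod>b\<in>(Basis::'a set). (\<integral>\<^sup>+x. ennreal (inverse (1 + x\<^sup>2)) \<partial>lborel))"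
    by (rule nn_integral_lborel_prod) auto
  also have "\<dots> < \<infinity>" using fin by (simp add: power_less_top_ennreal)
  finally show "(\<integral>\<^sup>+x. ennreal (norm (1 / (1 + norm x) ^ (2 * DIM('a)))) \<partial>(lborel::'a measure)) < \<infinity>" .
qed

lemma rapidly_decreasing_bound:
  assumes "rapidly_decreasing f"
  obtains C where "C > 0" "\<And>x. norm (f x) \<le> C / (1 + norm x) ^ k"
proof -
  obtain C where C: "\<And>x. (1 + norm x) ^ k * norm (f x) \<le> C"
    using assms unfolding rapidly_decreasing_def by meson
  have "norm (f x) \<le> max C 1 / (1 + norm x) ^ k" for x
  proof -
    have pos: "(1 + norm x) ^ k > 0" by (simp add: add_pos_nonneg)
    have "(1 + norm x) ^ k * norm (f x) \<le> max C 1" using C[of x] by simp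
    then show ?thesis using pos by (simp add: field_simps)
  qed
  then show ?thesis using that[of "max C 1"] by auto
qed

lemma rapidly_decreasing_integrable_weight:
  fixes f :: "'a::euclidean_space \<Rightarrow> complex"
  assumes "rapidly_decreasing f" "f \<in> borel_measurable borel"
  shows "integrable lborel (\<lambda>x. (1 + norm x) ^ k * norm (f x))"
proof -
  obtain C where C: "C > 0" "\<And>x. norm (f x) \<le> C / (1 + norm x) ^ (k + 2 * DIM('a))"
    using rapidly_decreasing_bound[OF assms(1)] by blast
  show ?thesis
  proof (rule Bochner_Integration.integrable_bound)
    show "integrable lborel (\<lambda>x::'a. C * (1 / (1 + norm x) ^ (2 * DIM('a))))"
      by (intro integrable_mult_right integrable_inverse_one_plus_norm)
    show "AE x in lborel. norm ((1 + norm x) ^ k * norm (f x)) \<le> norm (C * (1 / (1 + norm x) ^ (2 * DIM('a))))"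
    proof (rule AE_I2)
      fix x :: 'a
      have pos: "(1 + norm x) ^ n > 0" for n by (simp add: add_pos_nonneg)
      have "(1 + norm x) ^ k * norm (f x) \<le> (1 + norm x) ^ k * (C / (1 + norm x) ^ (k + 2 * DIM('a)))"
        by (intro mult_left_mono C) auto
      also have "\<dots> = C * (1 / (1 + norm x) ^ (2 * DIM('a)))"
        using pos[of k] pos by (simp add: power_add field_simps)
      finally show "norm ((1 + norm x) ^ k * norm (f x)) \<le> norm (C * (1 / (1 + norm x) ^ (2 * DIM('a))))"
        using C(1) by (simp add: abs_mult)
    qed
    show "(\<lambda>x. (1 + norm x) ^ k * norm (f x)) \<in> borel_measurable lborel"
      using assms(2) by measurable
  qed
qed

lemma rapidly_decreasing_integrable:
  fixes f :: "'a::euclidean_space \<Rightarrow> complex"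
  assumes "rapidly_decreasing f" "f \<in> borel_measurable borel"
  shows "integrable lborel f"
  using rapidly_decreasing_integrable_weight[OF assms, of 0] assms(2)
  by (subst integrable_norm_iff[symmetric]) auto

lemma schwartz_integrable: "f \<in> schwartz \<Longrightarrow> integrable lborel f"
  by (intro rapidly_decreasing_integrable schwartz_rapidly_decreasing schwartz_measurable)

section \<open>Invariance of the integral and integration by parts\<close>

lemma lborel_integral_translate:
  fixes f :: "'a::euclidean_space \<Rightarrow> 'b::{banach, second_countable_topology}"
  assumes "f \<in> borel_measurable borel"
  shows "(\<integral>x. f (c + x) \<partial>lborel) = (\<integral>x. f x \<partial>lborel)"
  using integral_distr[of "(+) c" lborel borel f] assms by (simp add: lborel_distr_plus)

lemma lborel_integral_affine:
  fixes f :: "'a::euclidean_space \<Rightarrow> 'b::{banach, second_countable_topology}"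
  assumes "f \<in> borel_measurable borel" "c \<noteq> 0"
  shows "(\<integral>x. f x \<partial>lborel) = \<bar>c\<bar> ^ DIM('a) *\<^sub>R (\<integral>x. f (t + c *\<^sub>R x) \<partial>lborel)"
proof -
  have "(\<integral>x. f x \<partial>lborel) = (\<integral>x. f x \<partial>density (distr lborel borel (\<lambda>x. t + c *\<^sub>R x)) (\<lambda>_. \<bar>c\<bar> ^ DIM('a)))"
    using lborel_affine[OF assms(2), of t] by simp
  also have "\<dots> = \<bar>c\<bar> ^ DIM('a) *\<^sub>R (\<integral>x. f x \<partial>distr lborel borel (\<lambda>x. t + c *\<^sub>R x))"
    using assms(1) by (subst integral_density) auto
  also have "(\<integral>x. f x \<partial>distr lborel borel (\<lambda>x. t + c *\<^sub>R x)) = (\<integral>x. f (t + c *\<^sub>R x) \<partial>lborel)"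
    using assms(1) by (subst integral_distr) auto
  finally show ?thesis .
qed

lemma nn_integral_lborel_reflect:
  fixes f :: "'a::euclidean_space \<Rightarrow> ennreal"
  assumes [measurable]: "f \<in> borel_measurable borel"
  shows "(\<integral>\<^sup>+x. f (t - x) \<partial>lborel) = (\<integral>\<^sup>+x. f x \<partial>lborel)"
proof -
  have "(\<integral>\<^sup>+x. f x \<partial>lborel) = (\<integral>\<^sup>+x. f x \<partial>density (distr lborel borel (\<lambda>x. t + (-1) *\<^sub>R x)) (\<lambda>_. \<bar>- 1 :: real\<bar> ^ DIM('a)))"
    using lborel_affine[of "-1" t] by simp
  also have "\<dots> = (\<integral>\<^sup>+x. f (t - x) \<partial>lborel)"
    by (subst nn_integral_density) (auto simp: nn_integral_distr)
  finally show ?thesis by simp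
qed

lemma lborel_integral_reflect:
  fixes f :: "'a::euclidean_space \<Rightarrow> 'b::{banach, second_countable_topology}"
  assumes "f \<in> borel_measurable borel"
  shows "(\<integral>x. f (t - x) \<partial>lborel) = (\<integral>x. f x \<partial>lborel)"
  using lborel_integral_affine[OF assms, of "-1" t] by simp

lemma lborel_integrable_reflect:
  fixes f :: "'a::euclidean_space \<Rightarrow> 'b::{banach, second_countable_topology}"
  assumes "integrable lborel f"
  shows "integrable lborel (\<lambda>x. f (t - x))"
proof -
  have [measurable]: "f \<in> borel_measurable borel" using assms by auto
  show ?thesis
    using assms nn_integral_lborel_reflect[of "\<lambda>x. norm (f x)" t] by (simp add: integrable_iff_bounded)
qed

text \<open>The derivative bound is requested on the segment only: in the weighted estimates it
  depends on where the segment lies.\<close>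

lemma norm_diff_le_partial:
  fixes B :: real
  assumes f: "f differentiable_on UNIV"
    and B: "\<And>b y. b \<in> Basis \<Longrightarrow> y \<in> closed_segment x x' \<Longrightarrow> norm (partial_derivative b f y) \<le> B"
  shows "norm (f x - f x') \<le> real DIM('a) * B * norm (x - x' :: 'a::euclidean_space)"
proof (rule differentiable_bound)
  show "convex (closed_segment x x')" by simp
  show "(f has_derivative frechet_derivative f (at y)) (at y within closed_segment x x')" for y
    using has_derivative_frechet[OF f] by (rule has_derivative_at_withinI)
  fix y assume y: "y \<in> closed_segment x x'"
  have "B \<ge> 0" using order_trans[OF norm_ge_zero B[OF _ y]] nonempty_Basis by blast
  show "onorm (frechet_derivative f (at y)) \<le> DIM('a) * B"
  proof (rule onorm_le)
    fix h
    have "norm (frechet_derivative f (at y) h) \<le> (\<Sum>b\<in>Basis. norm ((h \<bullet> b) *\<^sub>R partial_derivative b f y))"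
      unfolding frechet_derivative_eq_sum_partial[OF f] by (rule norm_sum)
    also have "\<dots> \<le> (\<Sum>b\<in>(Basis::'a set). norm h * B)"
      unfolding norm_scaleR using B y by (intro sum_mono mult_mono) (auto intro: Basis_le_norm)
    finally show "norm (frechet_derivative f (at y) h) \<le> DIM('a) * B * norm h" by (simp add: algebra_simps)
  qed
qed auto

text \<open>Translation invariance takes the place of Fubini and the fundamental theorem of
  calculus: every difference quotient in direction b has integral 0, and the quotients converge
  dominatedly to the partial derivative.\<close>

lemma integral_partial_derivative_eq_0:
  fixes u :: "'a::euclidean_space \<Rightarrow> complex"
  assumes u: "u \<in> schwartz" and b: "b \<in> Basis"
  shows "(\<integral>x. partial_derivative b u x \<partial>lborel) = 0"
proof -
  let ?N = "2 * DIM('a)"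
  obtain C where C: "C > 0" "\<And>x. norm (partial_derivative b u x) \<le> C / (1 + norm x) ^ ?N"
    using rapidly_decreasing_bound[OF schwartz_rapidly_decreasing[OF schwartz_partial[OF u b]]] by blast
  define s where "s n x = real (Suc n) *\<^sub>R (u (inverse (Suc n) *\<^sub>R b + x) - u x)" for n x
  have d: "((\<lambda>t. u (x + t *\<^sub>R b)) has_vector_derivative partial_derivative b u (x + t *\<^sub>R b)) (at t within A)" for x t A
  proof -
    have "((\<lambda>t. u (x + t *\<^sub>R b)) has_derivative (\<lambda>h. frechet_derivative u (at (x + t *\<^sub>R b)) (h *\<^sub>R b))) (at t within A)"
      by (rule has_derivative_compose[OF _ has_derivative_frechet[OF schwartz_differentiable[OF u]]])
        (auto intro!: derivative_eq_intros)
    moreover have "frechet_derivative u (at (x + t *\<^sub>R b)) (h *\<^sub>R b) = h *\<^sub>R partial_derivative b u (x + t *\<^sub>R b)" for h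
      using has_derivative_bounded_linear[OF has_derivative_frechet[OF schwartz_differentiable[OF u]]]
      by (simp add: partial_derivative_def linear_scale bounded_linear.linear)
    ultimately show ?thesis by (simp add: has_vector_derivative_def)
  qed
  have lim: "(\<lambda>n. s n x) \<longlonglongrightarrow> partial_derivative b u x" for x
  proof -
    have "(\<lambda>h. norm (u (x + h *\<^sub>R b) - u x - h *\<^sub>R partial_derivative b u x) / norm h) \<midarrow>0\<rightarrow> 0"
      using d[of x 0 UNIV] by (simp add: has_vector_derivative_def has_derivative_at)
    then have "(\<lambda>n. norm (u (x + inverse (Suc n) *\<^sub>R b) - u x - inverse (Suc n) *\<^sub>R partial_derivative b u x)
        / norm (inverse (Suc n))) \<longlonglongrightarrow> 0"
      by (rule filterlim_compose) (use LIMSEQ_inverse_real_of_nat in \<open>auto simp: filterlim_at\<close>)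
    moreover have "norm (u (x + inverse (Suc n) *\<^sub>R b) - u x - inverse (Suc n) *\<^sub>R partial_derivative b u x)
        / norm (inverse (Suc n)) = norm (s n x - partial_derivative b u x)" for n
    proof -
      have "s n x - partial_derivative b u x = real (Suc n) *\<^sub>R
          (u (x + inverse (Suc n) *\<^sub>R b) - u x - inverse (Suc n) *\<^sub>R partial_derivative b u x)"
        by (simp add: s_def scaleR_diff_right add.commute del: of_nat_Suc)
      then show ?thesis by (simp add: divide_inverse mult.commute del: of_nat_Suc)
    qed
    ultimately show ?thesis by (simp add: LIM_zero_iff tendsto_norm_zero_iff)
  qed
  have "(\<lambda>n. \<integral>x. s n x \<partial>lborel) \<longlonglongrightarrow> (\<integral>x. partial_derivative b u x \<partial>lborel)"
  proof (rule integral_dominated_convergence)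
    show "integrable lborel (\<lambda>x::'a. (C * 2 ^ ?N) * (1 / (1 + norm x) ^ ?N))"
      by (intro integrable_mult_right integrable_inverse_one_plus_norm)
    show "partial_derivative b u \<in> borel_measurable lborel"
      using schwartz_measurable[OF schwartz_partial[OF u b]] by simp
    show "s n \<in> borel_measurable lborel" for n
      using schwartz_measurable[OF u] unfolding s_def[abs_def] by measurable
    show "AE x in lborel. (\<lambda>n. s n x) \<longlonglongrightarrow> partial_derivative b u x" using lim by simp
    show "AE x in lborel. norm (s n x) \<le> (C * 2 ^ ?N) * (1 / (1 + norm x) ^ ?N)" for n
    proof (rule AE_I2)
      fix x :: 'a
      define t where "t = inverse (real (Suc n))"
      have t: "0 < t" "t \<le> 1" by (auto simp: t_def field_simps)
      have "norm (u (x + t *\<^sub>R b) - u (x + 0 *\<^sub>R b)) \<le> (C * 2 ^ ?N) * (1 / (1 + norm x) ^ ?N) * norm (t - 0)"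
      proof (rule differentiable_bound[of "{0..t}"])
        show "((\<lambda>t. u (x + t *\<^sub>R b)) has_derivative (\<lambda>h. h *\<^sub>R partial_derivative b u (x + r *\<^sub>R b))) (at r within {0..t})" for r
          using d by (simp add: has_vector_derivative_def)
        fix r assume r: "r \<in> {0..t}"
        have "norm x \<le> norm (x + r *\<^sub>R b) + norm (r *\<^sub>R b)"
          by (metis add_diff_cancel_right' norm_triangle_ineq4)
        also have "norm (r *\<^sub>R b) \<le> 1" using r t b by simp
        \<comment> \<open>A shift by at most 1 changes the weight by at most a factor 2, whence the
          constant 2 ^ ?N in the dominating function.\<close>
        finally have le: "1 + norm x \<le> 2 * (1 + norm (x + r *\<^sub>R b))" by (auto intro: order_trans)
        have "norm (partial_derivative b u (x + r *\<^sub>R b)) \<le> C / (1 + norm (x + r *\<^sub>R b)) ^ ?N" by (rule C)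
        also have "\<dots> \<le> C / ((1 + norm x) / 2) ^ ?N"
          using le C(1) by (intro divide_left_mono power_mono mult_pos_pos zero_less_power) (auto intro: add_pos_nonneg)
        finally have "norm (partial_derivative b u (x + r *\<^sub>R b)) \<le> (C * 2 ^ ?N) * (1 / (1 + norm x) ^ ?N)"
          by (simp add: power_divide)
        then show "onorm (\<lambda>h. h *\<^sub>R partial_derivative b u (x + r *\<^sub>R b)) \<le> (C * 2 ^ ?N) * (1 / (1 + norm x) ^ ?N)"
          by (intro onorm_le) (simp only: norm_scaleR real_norm_def mult.commute[of "\<bar>_\<bar>"] mult_right_mono abs_ge_zero)
      qed (use t in auto)
      then have "norm (u (x + t *\<^sub>R b) - u x) * real (Suc n) \<le> (C * 2 ^ ?N) * (1 / (1 + norm x) ^ ?N) * t * real (Suc n)"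
        using t by (intro mult_right_mono) auto
      also have "\<dots> = (C * 2 ^ ?N) * (1 / (1 + norm x) ^ ?N)" by (simp add: t_def)
      finally show "norm (s n x) \<le> (C * 2 ^ ?N) * (1 / (1 + norm x) ^ ?N)"
        by (simp add: s_def t_def add.commute mult.commute)
    qed
  qed
  moreover have "(\<integral>x. s n x \<partial>lborel) = 0" for n
  proof -
    have int: "integrable lborel (\<lambda>x. u (inverse (Suc n) *\<^sub>R b + x))"
    proof -
      have "(\<lambda>x. u (inverse (Suc n) *\<^sub>R b + id x)) \<in> schwartz"
        by (rule schwartz_affine[OF u linear_id]) simp
      from schwartz_integrable[OF this] show ?thesis by simp
    qed
    show ?thesis
      unfolding s_def using int schwartz_integrable[OF u]
      by (simp add: lborel_integral_translate[OF schwartz_measurable[OF u]])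
  qed
  ultimately show ?thesis using LIMSEQ_unique[OF _ tendsto_const] by force
qed

section \<open>The Fourier transform on the Schwartz space\<close>

definition wave :: "'a::euclidean_space \<Rightarrow> 'a \<Rightarrow> complex" where
  "wave \<xi> x = exp (2 * pi * \<i> * complex_of_real (\<xi> \<bullet> x))"

lemma wave_0 [simp]: "wave 0 x = 1" "wave \<xi> 0 = 1"
  by (simp_all add: wave_def)

lemma wave_add: "wave (\<xi> + \<eta>) x = wave \<xi> x * wave \<eta> x"
  and wave_add_right: "wave \<xi> (x + y) = wave \<xi> x * wave \<xi> y"
  by (simp_all add: wave_def inner_add algebra_simps flip: exp_add)

lemma wave_commute: "wave \<xi> x = wave x \<xi>"
  by (simp add: wave_def inner_commute)

lemma wave_minus: "wave (- \<xi>) x = wave \<xi> (- x)"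
  by (simp add: wave_def)

lemma norm_wave [simp]: "norm (wave \<xi> x) = 1"
  by (simp add: wave_def norm_exp_eq_Re)

lemma wave_measurable [measurable (raw)]: "(\<lambda>p. wave (f p) (g p)) \<in> borel_measurable M"
  if [measurable]: "f \<in> borel_measurable M" "g \<in> borel_measurable M"
  unfolding wave_def by measurable

lemma inverse_fourier_wave: "inverse_fourier u x = (\<integral>\<xi>. u \<xi> * wave \<xi> x \<partial>lborel)"
  by (simp add: inverse_fourier_def wave_def)

lemma fourier_wave: "fourier u \<xi> = (\<integral>x. u x * wave (- \<xi>) x \<partial>lborel)"
  by (simp add: fourier_def wave_def)

lemma fourier_eq_inverse_fourier: "fourier u \<xi> = inverse_fourier u (- \<xi>)"
  by (simp add: fourier_wave inverse_fourier_wave wave_commute)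

lemma integrable_mult_wave:
  assumes "integrable lborel u"
  shows "integrable lborel (\<lambda>\<xi>. u \<xi> * wave \<xi> x)"
  by (rule Bochner_Integration.integrable_bound[OF assms]) (use assms in \<open>auto simp: norm_mult\<close>)

text \<open>A remainder bound that is quadratic in h survives integration over a parameter.
  Differentiation under the integral sign then needs no limit theorem.\<close>

lemma has_derivativeI_quadratic:
  assumes D: "bounded_linear D" and K: "\<And>h. norm (f (x + h) - f x - D h) \<le> K * (norm h)\<^sup>2"
  shows "(f has_derivative D) (at x)"
  unfolding has_derivative_at
proof (intro conjI D)
  show "(\<lambda>h. norm (f (x + h) - f x - D h) / norm h) \<midarrow>0\<rightarrow> 0"
  proof (rule tendsto_sandwich[of "\<lambda>_. 0" _ _ "\<lambda>h. K * norm h"])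
    show "\<forall>\<^sub>F h in at 0. norm (f (x + h) - f x - D h) / norm h \<le> K * norm h"
      using K by (intro always_eventually) (auto simp: divide_simps power2_eq_square mult.assoc)
    show "((\<lambda>h. K * norm h) \<longlongrightarrow> 0) (at 0)" by (auto intro!: tendsto_eq_intros)
  qed auto
qed

text \<open>This is the Taylor bound t^2/2 for exp (i t) - 1 - i t, taken at t = 2 pi times the
  inner product.\<close>

lemma wave_remainder:
  "norm (wave \<xi> h - 1 - 2 * pi * \<i> * complex_of_real (\<xi> \<bullet> h)) \<le> 2 * pi\<^sup>2 * (norm \<xi>)\<^sup>2 * (norm h)\<^sup>2"
proof -
  have eq: "wave \<xi> h - 1 - 2 * pi * \<i> * complex_of_real (\<xi> \<bullet> h) =
    iexp (2 * pi * (\<xi> \<bullet> h)) - (\<Sum>k\<le>1. (\<i> * complex_of_real (2 * pi * (\<xi> \<bullet> h))) ^ k / fact k)"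
    by (simp add: wave_def algebra_simps)
  have "norm (wave \<xi> h - 1 - 2 * pi * \<i> * complex_of_real (\<xi> \<bullet> h)) \<le> \<bar>2 * pi * (\<xi> \<bullet> h)\<bar> ^ Suc 1 / fact (Suc 1)"
    unfolding eq by (rule iexp_approx1)
  also have "\<dots> = 2 * pi\<^sup>2 * \<bar>\<xi> \<bullet> h\<bar>\<^sup>2" by (simp add: power2_eq_square)
  also have "\<dots> \<le> 2 * pi\<^sup>2 * (norm \<xi> * norm h)\<^sup>2"
    by (intro mult_left_mono power_mono Cauchy_Schwarz_ineq2) auto
  finally show ?thesis by (simp add: power_mult_distrib)
qed

lemma schwartz_inner_mult: "u \<in> schwartz \<Longrightarrow> (\<lambda>x. complex_of_real (x \<bullet> b) * u x) \<in> schwartz"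
  by (rule schwartz_mult[OF slowly_increasing_inner])

lemma inverse_fourier_scale: "inverse_fourier (\<lambda>\<xi>. c * u \<xi>) x = c * inverse_fourier u x"
  by (simp add: inverse_fourier_wave mult.assoc)

lemma inverse_fourier_has_derivative:
  fixes u :: "'a::euclidean_space \<Rightarrow> complex"
  assumes u: "u \<in> schwartz"
  shows "(inverse_fourier u has_derivative
    (\<lambda>h. \<Sum>b\<in>Basis. (h \<bullet> b) *\<^sub>R (2 * pi * \<i> * inverse_fourier (\<lambda>\<xi>. complex_of_real (\<xi> \<bullet> b) * u \<xi>) x))) (at x)"
proof (rule has_derivativeI_quadratic)
  let ?D = "\<lambda>h. \<Sum>b\<in>Basis. (h \<bullet> b) *\<^sub>R (2 * pi * \<i> * inverse_fourier (\<lambda>\<xi>. complex_of_real (\<xi> \<bullet> b) * u \<xi>) x)"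
  show "bounded_linear ?D"
    by (intro bounded_linear_sum bounded_linear_scaleR_const bounded_linear_inner_left)
  have int: "integrable lborel (\<lambda>\<xi>. (norm \<xi>)\<^sup>2 * norm (u \<xi>))"
  proof (rule Bochner_Integration.integrable_bound)
    show "integrable lborel (\<lambda>\<xi>. (1 + norm \<xi>)\<^sup>2 * norm (u \<xi>))"
      by (intro rapidly_decreasing_integrable_weight schwartz_rapidly_decreasing schwartz_measurable u)
    show "(\<lambda>\<xi>. (norm \<xi>)\<^sup>2 * norm (u \<xi>)) \<in> borel_measurable lborel"
      using schwartz_measurable[OF u] by measurable
    show "AE \<xi> in lborel. norm ((norm \<xi>)\<^sup>2 * norm (u \<xi>)) \<le> norm ((1 + norm \<xi>)\<^sup>2 * norm (u \<xi>))"
      by (intro AE_I2) (auto simp: abs_mult intro!: mult_right_mono power_mono)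
  qed
  fix h :: 'a
  have iu: "integrable lborel (\<lambda>\<xi>. u \<xi> * wave \<xi> y)" for y
    by (intro integrable_mult_wave schwartz_integrable u)
  have ib: "integrable lborel (\<lambda>\<xi>. complex_of_real (\<xi> \<bullet> b) * u \<xi> * wave \<xi> y)" for b y
    by (intro integrable_mult_wave schwartz_integrable schwartz_inner_mult u)
  have "?D h = (\<Sum>b\<in>Basis. \<integral>\<xi>. complex_of_real (h \<bullet> b) * (2 * pi * \<i>) * (complex_of_real (\<xi> \<bullet> b) * u \<xi> * wave \<xi> x) \<partial>lborel)"
    unfolding inverse_fourier_wave by (simp add: scaleR_conv_of_real mult.assoc)
  also have "\<dots> = (\<integral>\<xi>. (\<Sum>b\<in>Basis. complex_of_real (h \<bullet> b) * (2 * pi * \<i>) * (complex_of_real (\<xi> \<bullet> b) * u \<xi> * wave \<xi> x)) \<partial>lborel)"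
    by (subst Bochner_Integration.integral_sum) (auto intro!: integrable_mult_right ib simp del: of_real_mult)
  also have "\<dots> = (\<integral>\<xi>. u \<xi> * wave \<xi> x * (2 * pi * \<i> * complex_of_real (\<xi> \<bullet> h)) \<partial>lborel)"
  proof (rule Bochner_Integration.integral_cong)
    fix \<xi> :: 'a
    have "complex_of_real (\<xi> \<bullet> h) = (\<Sum>b\<in>Basis. complex_of_real (h \<bullet> b) * complex_of_real (\<xi> \<bullet> b))"
      by (subst euclidean_inner) (simp add: mult.commute)
    then show "(\<Sum>b\<in>Basis. complex_of_real (h \<bullet> b) * (2 * pi * \<i>) * (complex_of_real (\<xi> \<bullet> b) * u \<xi> * wave \<xi> x)) =
        u \<xi> * wave \<xi> x * (2 * pi * \<i> * complex_of_real (\<xi> \<bullet> h))"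
      by (simp add: sum_distrib_left sum_distrib_right algebra_simps)
  qed simp
  finally have D: "?D h = (\<integral>\<xi>. u \<xi> * wave \<xi> x * (2 * pi * \<i> * complex_of_real (\<xi> \<bullet> h)) \<partial>lborel)" .
  have ih: "integrable lborel (\<lambda>\<xi>. u \<xi> * wave \<xi> x * (2 * pi * \<i> * complex_of_real (\<xi> \<bullet> h)))"
    using integrable_mult_right[OF ib[of h x], of "2 * pi * \<i>"] by (simp add: algebra_simps)
  have "(\<integral>\<xi>. u \<xi> * wave \<xi> x * (wave \<xi> h - 1 - 2 * pi * \<i> * complex_of_real (\<xi> \<bullet> h)) \<partial>lborel) =
    (\<integral>\<xi>. u \<xi> * wave \<xi> (x + h) - u \<xi> * wave \<xi> x - u \<xi> * wave \<xi> x * (2 * pi * \<i> * complex_of_real (\<xi> \<bullet> h)) \<partial>lborel)"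
    by (simp add: wave_add_right algebra_simps)
  also have "\<dots> = inverse_fourier u (x + h) - inverse_fourier u x - ?D h"
    unfolding D by (subst Bochner_Integration.integral_diff Bochner_Integration.integrable_diff; (intro Bochner_Integration.integrable_diff iu ih)?)+ (simp add: inverse_fourier_wave)
  finally have "inverse_fourier u (x + h) - inverse_fourier u x - ?D h =
    (\<integral>\<xi>. u \<xi> * wave \<xi> x * (wave \<xi> h - 1 - 2 * pi * \<i> * complex_of_real (\<xi> \<bullet> h)) \<partial>lborel)" ..
  also have "norm \<dots> \<le> (\<integral>\<xi>. 2 * pi\<^sup>2 * (norm h)\<^sup>2 * ((norm \<xi>)\<^sup>2 * norm (u \<xi>)) \<partial>lborel)"
  proof (rule Bochner_Integration.integral_norm_bound_integral)
    show "integrable lborel (\<lambda>\<xi>. u \<xi> * wave \<xi> x * (wave \<xi> h - 1 - 2 * pi * \<i> * complex_of_real (\<xi> \<bullet> h)))"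
      using iu[of "x + h"] iu[of x] ih by (simp add: right_diff_distrib wave_add_right mult.assoc[symmetric])
    show "integrable lborel (\<lambda>\<xi>. 2 * pi\<^sup>2 * (norm h)\<^sup>2 * ((norm \<xi>)\<^sup>2 * norm (u \<xi>)))"
      by (intro integrable_mult_right int)
    show "norm (u \<xi> * wave \<xi> x * (wave \<xi> h - 1 - 2 * pi * \<i> * complex_of_real (\<xi> \<bullet> h)))
        \<le> 2 * pi\<^sup>2 * (norm h)\<^sup>2 * ((norm \<xi>)\<^sup>2 * norm (u \<xi>))" for \<xi>
      using mult_left_mono[OF wave_remainder[of \<xi> h] norm_ge_zero[of "u \<xi>"]]
      by (simp only: norm_mult norm_wave mult_1_right mult_1_left mult_ac)
  qed
  also have "(\<integral>\<xi>. 2 * pi\<^sup>2 * (norm h)\<^sup>2 * ((norm \<xi>)\<^sup>2 * norm (u \<xi>)) \<partial>lborel) =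
      2 * pi\<^sup>2 * (norm h)\<^sup>2 * (\<integral>\<xi>. (norm \<xi>)\<^sup>2 * norm (u \<xi>) \<partial>lborel)"
    by (rule integral_mult_right_zero)
  finally show "norm (inverse_fourier u (x + h) - inverse_fourier u x - ?D h) \<le>
      (2 * pi\<^sup>2 * (\<integral>\<xi>. (norm \<xi>)\<^sup>2 * norm (u \<xi>) \<partial>lborel)) * (norm h)\<^sup>2"
    by (simp only: mult_ac)
qed

lemma partial_inverse_fourier:
  assumes u: "u \<in> schwartz" and b: "b \<in> Basis"
  shows "partial_derivative b (inverse_fourier u) x =
    2 * pi * \<i> * inverse_fourier (\<lambda>\<xi>. complex_of_real (\<xi> \<bullet> b) * u \<xi>) x"
  using partial_derivative_eq[OF inverse_fourier_has_derivative[OF u], of b x] b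
  by (simp add: inner_Basis sum.delta if_distrib if_distribR cong: if_cong)

lemma slowly_increasing_wave: "(\<lambda>\<xi>. wave \<xi> x) \<in> slowly_increasing"
  and partial_wave: "partial_derivative b (\<lambda>\<xi>. wave \<xi> x) \<xi> = 2 * pi * \<i> * complex_of_real (b \<bullet> x) * wave \<xi> x"
proof -
  have d: "((\<lambda>\<xi>. wave \<xi> x) has_derivative (\<lambda>h. 2 * pi * \<i> * complex_of_real (h \<bullet> x) * wave \<xi> x)) (at \<xi>)" for \<xi>
  proof (rule has_derivativeI_quadratic)
    show "bounded_linear (\<lambda>h. 2 * pi * \<i> * complex_of_real (h \<bullet> x) * wave \<xi> x)"
      by (intro bounded_linear_mult_const bounded_linear_const_mult bounded_linear_of_real
          bounded_linear_compose[OF bounded_linear_of_real] bounded_linear_inner_left)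
    fix h
    have "wave (\<xi> + h) x - wave \<xi> x - 2 * pi * \<i> * complex_of_real (h \<bullet> x) * wave \<xi> x =
      wave \<xi> x * (wave x h - 1 - 2 * pi * \<i> * complex_of_real (x \<bullet> h))"
      by (simp add: wave_add wave_commute[of h] inner_commute algebra_simps)
    then show "norm (wave (\<xi> + h) x - wave \<xi> x - 2 * pi * \<i> * complex_of_real (h \<bullet> x) * wave \<xi> x)
        \<le> (2 * pi\<^sup>2 * (norm x)\<^sup>2) * (norm h)\<^sup>2"
      using wave_remainder[of x h] by (simp add: norm_mult)
  qed
  show p: "partial_derivative b (\<lambda>\<xi>. wave \<xi> x) \<xi> = 2 * pi * \<i> * complex_of_real (b \<bullet> x) * wave \<xi> x" for b \<xi>
    by (rule partial_derivative_eq[OF d])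
  show "(\<lambda>\<xi>. wave \<xi> x) \<in> slowly_increasing"
  proof (rule slowly_increasing_coinduct)
    let ?X = "{\<lambda>\<xi>. wave \<xi> x}"
    show "(\<lambda>\<xi>. wave \<xi> x) \<in> lin_hull ?X" by (auto intro: lin_hull_base)
    show "g differentiable_on UNIV" if "g \<in> ?X" for g
      using that differentiableI[OF d] by (auto simp: differentiable_on_def)
    show "poly_bounded g" if "g \<in> ?X" for g
      using that unfolding poly_bounded_def by (intro exI[of _ "1::real"] exI[of _ "0::nat"]) simp
    show "partial_derivative b g \<in> lin_hull ?X" if "g \<in> ?X" for g b
      using that by (auto simp: p[abs_def] intro!: lin_hull_scale intro: lin_hull_base)
  qed
qed

text \<open>Integration by parts: the derivative of u * wave integrates to 0, and the derivative of
  the character is a multiple of the character.\<close>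

lemma inverse_fourier_partial:
  assumes u: "u \<in> schwartz" and b: "b \<in> Basis"
  shows "inverse_fourier (partial_derivative b u) x =
    - 2 * pi * \<i> * complex_of_real (x \<bullet> b) * inverse_fourier u x"
proof -
  have s: "(\<lambda>\<xi>. wave \<xi> x * u \<xi>) \<in> schwartz"
    by (rule schwartz_mult[OF slowly_increasing_wave u])
  have i1: "integrable lborel (\<lambda>\<xi>. partial_derivative b u \<xi> * wave \<xi> x)"
    by (intro integrable_mult_wave schwartz_integrable schwartz_partial u b)
  have i2: "integrable lborel (\<lambda>\<xi>. (2 * pi * \<i> * complex_of_real (b \<bullet> x)) * (u \<xi> * wave \<xi> x))"
    by (intro integrable_mult_right integrable_mult_wave schwartz_integrable u)
  have "0 = (\<integral>\<xi>. partial_derivative b (\<lambda>\<xi>. wave \<xi> x * u \<xi>) \<xi> \<partial>lborel)"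
    by (rule integral_partial_derivative_eq_0[OF s b, symmetric])
  also have "partial_derivative b (\<lambda>\<xi>. wave \<xi> x * u \<xi>) =
      (\<lambda>\<xi>. partial_derivative b u \<xi> * wave \<xi> x + (2 * pi * \<i> * complex_of_real (b \<bullet> x)) * (u \<xi> * wave \<xi> x))"
    unfolding partial_derivative_mult[OF slowly_increasing_differentiable[OF slowly_increasing_wave] schwartz_differentiable[OF u]]
    by (simp add: partial_wave algebra_simps)
  also have "(\<integral>\<xi>. partial_derivative b u \<xi> * wave \<xi> x + (2 * pi * \<i> * complex_of_real (b \<bullet> x)) * (u \<xi> * wave \<xi> x) \<partial>lborel) =
      inverse_fourier (partial_derivative b u) x + (2 * pi * \<i> * complex_of_real (b \<bullet> x)) * inverse_fourier u x"
    unfolding inverse_fourier_wave using i1 i2 by (subst Bochner_Integration.integral_add) auto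
  finally show ?thesis by (simp add: inner_commute eq_neg_iff_add_eq_0)
qed

text \<open>Each additional weight factor is bounded by 1 plus the sum of the absolute coordinates,
  and multiplication by a coordinate is traded for a derivative of u. Hence the induction runs over
  all Schwartz functions u at once.\<close>

lemma rapidly_decreasing_inverse_fourier:
  fixes u :: "'a::euclidean_space \<Rightarrow> complex"
  assumes "u \<in> schwartz"
  shows "rapidly_decreasing (inverse_fourier u)"
  unfolding rapidly_decreasing_def
proof
  fix k
  show "\<exists>C. \<forall>x. (1 + norm x) ^ k * norm (inverse_fourier u x) \<le> C"
    using assms
  proof (induction k arbitrary: u)
    case 0
    have "norm (inverse_fourier u x) \<le> (\<integral>\<xi>. norm (u \<xi>) \<partial>lborel)" for x
    proof -
      have "norm (inverse_fourier u x) \<le> (\<integral>\<xi>. norm (u \<xi> * wave \<xi> x) \<partial>lborel)"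
        unfolding inverse_fourier_wave by (rule integral_norm_bound)
      then show ?thesis by (simp add: norm_mult)
    qed
    then show ?case by auto
  next
    case (Suc k)
    obtain C where C: "\<And>x. (1 + norm x) ^ k * norm (inverse_fourier u x) \<le> C"
      using Suc.IH[OF Suc.prems] by blast
    have "\<forall>b\<in>Basis. \<exists>D. \<forall>x. (1 + norm x) ^ k * norm (inverse_fourier (partial_derivative b u) x) \<le> D"
      using Suc.IH[OF schwartz_partial[OF Suc.prems]] by blast
    then obtain D where D: "\<And>b x. b \<in> Basis \<Longrightarrow> (1 + norm x) ^ k * norm (inverse_fourier (partial_derivative b u) x) \<le> D b"
      by metis
    have "(1 + norm x) ^ Suc k * norm (inverse_fourier u x) \<le> C + (\<Sum>b\<in>Basis. D b)" for x
    proof -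
      have *: "\<bar>x \<bullet> b\<bar> * norm (inverse_fourier u x) \<le> norm (inverse_fourier (partial_derivative b u) x)" if "b \<in> Basis" for b
      proof -
        have "norm (inverse_fourier (partial_derivative b u) x) = 2 * pi * (\<bar>x \<bullet> b\<bar> * norm (inverse_fourier u x))"
          unfolding inverse_fourier_partial[OF Suc.prems that] by (simp add: norm_mult)
        moreover have "1 * (\<bar>x \<bullet> b\<bar> * norm (inverse_fourier u x)) \<le> 2 * pi * (\<bar>x \<bullet> b\<bar> * norm (inverse_fourier u x))"
          using pi_gt3 by (intro mult_right_mono) auto
        ultimately show ?thesis by simp
      qed
      have "(1 + norm x) ^ Suc k * norm (inverse_fourier u x) \<le> (1 + norm x) ^ k * ((1 + (\<Sum>b\<in>Basis. \<bar>x \<bullet> b\<bar>)) * norm (inverse_fourier u x))"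
        using norm_le_l1[of x] unfolding power_Suc2 mult.assoc
        by (intro mult_left_mono mult_right_mono add_mono) auto
      also have "\<dots> = (1 + norm x) ^ k * norm (inverse_fourier u x) + (\<Sum>b\<in>Basis. (1 + norm x) ^ k * (\<bar>x \<bullet> b\<bar> * norm (inverse_fourier u x)))"
        by (simp add: algebra_simps sum_distrib_left sum_distrib_right)
      also have "\<dots> \<le> C + (\<Sum>b\<in>Basis. D b)"
        by (intro add_mono C sum_mono order_trans[OF mult_left_mono[OF *] D]) auto
      finally show ?thesis .
    qed
    then show ?case by blast
  qed
qed

theorem schwartz_inverse_fourier:
  assumes "u \<in> schwartz"
  shows "inverse_fourier u \<in> schwartz"
proof (rule schwartz_coinduct)
  let ?X = "inverse_fourier ` schwartz"
  show "inverse_fourier u \<in> lin_hull ?X" using assms by (auto intro: lin_hull_base)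
  show "g differentiable_on UNIV" if "g \<in> ?X" for g
    using that differentiableI[OF inverse_fourier_has_derivative] by (auto simp: differentiable_on_def)
  show "rapidly_decreasing g" if "g \<in> ?X" for g
    using that rapidly_decreasing_inverse_fourier by auto
  show "partial_derivative b g \<in> lin_hull ?X" if "g \<in> ?X" "b \<in> Basis" for g b
  proof -
    obtain v where v: "v \<in> schwartz" "g = inverse_fourier v" using \<open>g \<in> ?X\<close> by auto
    have "partial_derivative b g = (\<lambda>x. 2 * pi * \<i> * inverse_fourier (\<lambda>\<xi>. complex_of_real (\<xi> \<bullet> b) * v \<xi>) x)"
      unfolding v(2) by (intro ext partial_inverse_fourier v that)
    then show ?thesis using schwartz_inner_mult[OF v(1)] by (auto intro!: lin_hull_scale intro: lin_hull_base)
  qed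
qed

lemma schwartz_fourier:
  assumes "u \<in> schwartz" shows "fourier u \<in> schwartz"
proof -
  have "(\<lambda>\<xi>. inverse_fourier u (0 + - \<xi>)) \<in> schwartz"
    by (rule schwartz_affine[OF schwartz_inverse_fourier[OF assms]]) (auto simp: inj_on_def intro: linear_uminus)
  then show ?thesis by (simp add: fourier_eq_inverse_fourier[abs_def])
qed

lemma slowly_increasing_mult:
  assumes "f \<in> slowly_increasing" "g \<in> slowly_increasing"
  shows "(\<lambda>x. f x * g x) \<in> slowly_increasing"
proof (rule slowly_increasing_coinduct)
  let ?X = "{\<lambda>x. f x * g x | f g :: 'a \<Rightarrow> complex. f \<in> slowly_increasing \<and> g \<in> slowly_increasing}"
  show "(\<lambda>x. f x * g x) \<in> lin_hull ?X" using assms by (auto intro: lin_hull_base)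
  show "h differentiable_on UNIV" if "h \<in> ?X" for h
    using that by (auto intro!: differentiable_on_mult intro: slowly_increasing_differentiable)
  show "poly_bounded h" if "h \<in> ?X" for h
    using that by (auto intro!: poly_bounded_mult intro: slowly_increasing_poly_bounded)
  show "partial_derivative b h \<in> lin_hull ?X" if "h \<in> ?X" "b \<in> Basis" for h b
  proof -
    obtain f g where *: "f \<in> slowly_increasing" "g \<in> slowly_increasing" "h = (\<lambda>x. f x * g x)" using \<open>h \<in> ?X\<close> by auto
    show ?thesis
      unfolding *(3) partial_derivative_mult[OF *(1,2)[THEN slowly_increasing_differentiable]]
      by (intro lin_hull_add lin_hull_base)
        (use * slowly_increasing_partial[OF _ that(2)] in auto)
  qed
qed

section \<open>The Gaussian and Fourier inversion\<close>

definition gaussian :: "'a::euclidean_space \<Rightarrow> complex" where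
  "gaussian x = complex_of_real (exp (- pi * (x \<bullet> x)))"

lemma gaussian_has_derivative:
  "(gaussian has_derivative (\<lambda>h. - 2 * pi * complex_of_real (h \<bullet> x) * gaussian x)) (at x)"
proof -
  have "((\<lambda>x::'a. x \<bullet> x) has_derivative (\<lambda>h. x \<bullet> h + h \<bullet> x)) (at x)"
    by (rule has_derivative_inner) (rule has_derivative_ident)+
  then have "((\<lambda>x::'a. complex_of_real (exp (- pi * (x \<bullet> x)))) has_derivative
      (\<lambda>h. complex_of_real (- pi * (x \<bullet> h + h \<bullet> x) * exp (- pi * (x \<bullet> x))))) (at x)"
    by (intro has_derivative_of_real has_derivative_exp has_derivative_mult_right)
  then show ?thesis by (simp add: gaussian_def[abs_def] inner_commute algebra_simps)
qed

lemma rapidly_decreasing_gaussian: "rapidly_decreasing gaussian"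
  unfolding rapidly_decreasing_def
proof
  fix k
  have "(1 + norm x) ^ k * norm (gaussian x) \<le> exp ((real k)\<^sup>2)" for x :: 'a
  proof -
    \<comment> \<open>Completing the square leaves the surplus 3/4 k^2, so k t - t^2 never exceeds
      k^2.\<close>
    have "real k * norm x - norm x ^ 2 \<le> (real k)\<^sup>2"
    proof -
      have "0 \<le> (norm x - real k / 2)\<^sup>2 + 3 / 4 * (real k)\<^sup>2" by simp
      then show ?thesis by (simp add: power2_eq_square algebra_simps)
    qed
    moreover have "norm x ^ 2 \<le> pi * (norm x)\<^sup>2"
      using mult_right_mono[of 1 pi "(norm x)\<^sup>2"] pi_gt3 by simp
    ultimately have *: "real k * norm x + - pi * (x \<bullet> x) \<le> (real k)\<^sup>2"
      by (simp add: power2_norm_eq_inner)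
    have "(1 + norm x) ^ k \<le> exp (norm x) ^ k"
      by (intro power_mono exp_ge_add_one_self) auto
    then have "(1 + norm x) ^ k * norm (gaussian x) \<le> exp (norm x) ^ k * exp (- pi * (x \<bullet> x))"
      by (simp add: gaussian_def)
    also have "\<dots> = exp (real k * norm x + - pi * (x \<bullet> x))"
      by (simp only: exp_of_nat_mult exp_add)
    also have "\<dots> \<le> exp ((real k)\<^sup>2)" using * by simp
    finally show ?thesis .
  qed
  then show "\<exists>C. \<forall>x::'a. (1 + norm x) ^ k * norm (gaussian x) \<le> C" by blast
qed

lemma partial_gaussian: "partial_derivative b gaussian x = - 2 * pi * (complex_of_real (x \<bullet> b) * gaussian x)"
  using partial_derivative_eq[OF gaussian_has_derivative, of b x] by (simp add: inner_commute)

lemma schwartz_gaussian: "gaussian \<in> schwartz"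
proof (rule schwartz_coinduct)
  let ?X = "{\<lambda>x. f x * gaussian x | f :: 'a \<Rightarrow> complex. f \<in> slowly_increasing}"
  have one: "(\<lambda>x::'a. 1) \<in> slowly_increasing"
    using slowly_increasing_wave[of 0] by simp
  show "gaussian \<in> lin_hull ?X" by (rule lin_hull_base) (use one in \<open>auto intro!: exI[of _ "\<lambda>x. 1"]\<close>)
  have dg: "(gaussian :: 'a \<Rightarrow> complex) differentiable_on UNIV"
    using differentiableI[OF gaussian_has_derivative] by (auto simp: differentiable_on_def)
  show "h differentiable_on UNIV" if "h \<in> ?X" for h
    using that by (auto intro!: differentiable_on_mult dg intro: slowly_increasing_differentiable)
  show "rapidly_decreasing h" if "h \<in> ?X" for h
    using that by (auto intro!: rapidly_decreasing_mult rapidly_decreasing_gaussian intro: slowly_increasing_poly_bounded)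
  show "partial_derivative b h \<in> lin_hull ?X" if "h \<in> ?X" "b \<in> Basis" for h b
  proof -
    obtain f where f: "f \<in> slowly_increasing" "h = (\<lambda>x. f x * gaussian x)" using \<open>h \<in> ?X\<close> by auto
    have "partial_derivative b h = (\<lambda>x. (- 2 * pi) * ((f x * complex_of_real (x \<bullet> b)) * gaussian x) + partial_derivative b f x * gaussian x)"
      unfolding f(2) partial_derivative_mult[OF slowly_increasing_differentiable[OF f(1)] dg]
      by (simp add: partial_gaussian algebra_simps)
    moreover have "\<dots> \<in> lin_hull ?X"
    proof (rule lin_hull_add)
      show "(\<lambda>x. (- 2 * pi) * ((f x * complex_of_real (x \<bullet> b)) * gaussian x)) \<in> lin_hull ?X"
        by (rule lin_hull_scale, rule lin_hull_base) (use slowly_increasing_mult[OF f(1) slowly_increasing_inner] in auto)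
      show "(\<lambda>x. partial_derivative b f x * gaussian x) \<in> lin_hull ?X"
        by (rule lin_hull_base) (use slowly_increasing_partial[OF f(1) that(2)] in auto)
    qed
    ultimately show ?thesis by simp
  qed
qed

lemma nn_integral_gaussian:
  "(\<integral>\<^sup>+x. ennreal (exp (- pi * (x \<bullet> x))) \<partial>(lborel :: 'a::euclidean_space measure)) = 1"
proof -
  define g where "g = (\<lambda>t::real. exp (- pi * t\<^sup>2))"
  \<comment> \<open>With standard deviation 1 / sqrt (2 pi) the normalizing factor of the normal
    density is 1, so total mass 1 is inherited.\<close>
  have "normal_density 0 (1 / sqrt (2 * pi)) t = g t" for t
    by (simp add: normal_density_def g_def power_divide)
  then have one: "(\<integral>\<^sup>+t. ennreal (g t) \<partial>lborel) = 1"
  proof -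
    have "1 = emeasure (density lborel (normal_density 0 (1 / sqrt (2 * pi)))) UNIV"
      using prob_space.emeasure_space_1[OF prob_space_normal_density, of "1 / sqrt (2 * pi)" 0] by simp
    also have "\<dots> = (\<integral>\<^sup>+t. ennreal (g t) \<partial>lborel)"
      by (subst emeasure_density) (auto simp: \<open>\<And>t. normal_density 0 (1 / sqrt (2 * pi)) t = g t\<close> g_def)
    finally show ?thesis ..
  qed
  have eq: "ennreal (exp (- pi * (x \<bullet> x))) = (\<Prod>b\<in>Basis. ennreal (g (x \<bullet> b)))" for x :: 'a
  proof -
    have "exp (- pi * (x \<bullet> x)) = (\<Prod>b\<in>Basis. g (x \<bullet> b))"
      unfolding g_def by (subst euclidean_inner, subst exp_sum[symmetric]) (auto simp: sum_distrib_left power2_eq_square)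
    then show ?thesis by (subst prod_ennreal) (auto simp: g_def)
  qed
  have [measurable]: "g \<in> borel_measurable borel" by (simp add: g_def)
  show ?thesis unfolding eq by (subst nn_integral_lborel_prod) (auto simp: one)
qed

lemma integral_gaussian: "(\<integral>x. gaussian x \<partial>(lborel::'a::euclidean_space measure)) = 1"
proof -
  have "has_bochner_integral lborel (\<lambda>x::'a. exp (- pi * (x \<bullet> x))) 1"
    by (rule has_bochner_integral_nn_integral) (use nn_integral_gaussian in auto)
  from has_bochner_integral_integral_eq[OF this] show ?thesis
    unfolding gaussian_def by simp
qed

lemma integrable_product_wave:
  fixes u v :: "'a::euclidean_space \<Rightarrow> complex"
  assumes u: "integrable lborel u" and v: "integrable lborel v"
  shows "integrable (lborel \<Otimes>\<^sub>M lborel) (\<lambda>(x, \<xi>). u x * v \<xi> * wave \<xi> x)"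
proof (rule lborel_pair.Fubini_integrable)
  have [measurable]: "u \<in> borel_measurable borel" "v \<in> borel_measurable borel" using u v by auto
  show "(\<lambda>(x, \<xi>). u x * v \<xi> * wave \<xi> x) \<in> borel_measurable (lborel \<Otimes>\<^sub>M lborel)" by measurable
  show "integrable lborel (\<lambda>x. \<integral>\<xi>. norm (case (x, \<xi>) of (x, \<xi>) \<Rightarrow> u x * v \<xi> * wave \<xi> x) \<partial>lborel)"
    using u by (simp add: norm_mult)
  show "AE x in lborel. integrable lborel (\<lambda>\<xi>. case (x, \<xi>) of (x, \<xi>) \<Rightarrow> u x * v \<xi> * wave \<xi> x)"
    using integrable_mult_wave[OF integrable_mult_right[OF v]] by (intro AE_I2) simp
qed

lemma multiplication_formula:
  assumes u: "integrable lborel u" and v: "integrable lborel v"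
  shows "(\<integral>x. u x * inverse_fourier v x \<partial>lborel) = (\<integral>\<xi>. inverse_fourier u \<xi> * v \<xi> \<partial>lborel)"
proof -
  have "(\<integral>x. u x * inverse_fourier v x \<partial>lborel) = (\<integral>x. (\<integral>\<xi>. u x * v \<xi> * wave \<xi> x \<partial>lborel) \<partial>lborel)"
    by (simp add: inverse_fourier_wave mult.assoc)
  also have "\<dots> = (\<integral>\<xi>. (\<integral>x. u x * v \<xi> * wave \<xi> x \<partial>lborel) \<partial>lborel)"
    by (rule lborel_pair.Fubini_integral[symmetric, OF integrable_product_wave[OF u v]])
  also have "\<dots> = (\<integral>\<xi>. inverse_fourier u \<xi> * v \<xi> \<partial>lborel)"
    unfolding inverse_fourier_wave
    by (intro Bochner_Integration.integral_cong refl, subst integral_mult_left_zero[symmetric])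
      (simp add: wave_commute algebra_simps)
  finally show ?thesis .
qed

text \<open>The transform satisfies the same first-order differential equation as the Gaussian,
  since differentiation and multiplication by coordinates are exchanged. The quotient of the two is
  therefore constant, and its value at 0 is the total mass 1.\<close>

lemma inverse_fourier_gaussian: "inverse_fourier gaussian = gaussian"
proof -
  let ?G = "inverse_fourier gaussian :: 'a \<Rightarrow> complex"
  define R where "R \<xi> = ?G \<xi> * complex_of_real (exp (pi * (\<xi> \<bullet> \<xi>)))" for \<xi>
  have p: "partial_derivative b ?G \<xi> = - 2 * pi * complex_of_real (\<xi> \<bullet> b) * ?G \<xi>" if b: "b \<in> Basis" for b \<xi>
  proof -
    have "(\<lambda>x::'a. complex_of_real (x \<bullet> b) * gaussian x) = (\<lambda>x. (- 1 / (2 * pi)) * partial_derivative b gaussian x)"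
      by (simp add: partial_gaussian)
    then have "inverse_fourier (\<lambda>x::'a. complex_of_real (x \<bullet> b) * gaussian x) \<xi> =
        (- 1 / (2 * pi)) * inverse_fourier (partial_derivative b gaussian) \<xi>"
      by (simp only: inverse_fourier_scale)
    then have "partial_derivative b ?G \<xi> = 2 * pi * \<i> * ((- 1 / (2 * pi)) * (- 2 * pi * \<i> * complex_of_real (\<xi> \<bullet> b) * ?G \<xi>))"
      by (simp only: partial_inverse_fourier[OF schwartz_gaussian b] inverse_fourier_partial[OF schwartz_gaussian b])
    also have "\<dots> = (\<i> * \<i>) * (2 * pi) * complex_of_real (\<xi> \<bullet> b) * ?G \<xi>" by (simp del: complex_i_mult_minus i_squared)
    finally show ?thesis by simp
  qed
  have dG: "(?G has_derivative (\<lambda>h. - 2 * pi * complex_of_real (\<xi> \<bullet> h) * ?G \<xi>)) (at \<xi>)" for \<xi>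
  proof -
    have diff: "?G differentiable_on UNIV" by (intro schwartz_differentiable schwartz_inverse_fourier schwartz_gaussian)
    have "frechet_derivative ?G (at \<xi>) h = - 2 * pi * complex_of_real (\<xi> \<bullet> h) * ?G \<xi>" for h
    proof -
      have "frechet_derivative ?G (at \<xi>) h = (\<Sum>b\<in>Basis. (h \<bullet> b) *\<^sub>R (- 2 * pi * complex_of_real (\<xi> \<bullet> b) * ?G \<xi>))"
        unfolding frechet_derivative_eq_sum_partial[OF diff] using p by (intro sum.cong) auto
      also have "\<dots> = - 2 * pi * complex_of_real (\<Sum>b\<in>Basis. (\<xi> \<bullet> b) * (h \<bullet> b)) * ?G \<xi>"
        by (simp add: scaleR_conv_of_real sum_distrib_left sum_distrib_right algebra_simps sum_negf)
      finally show ?thesis by (simp add: euclidean_inner[symmetric])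
    qed
    then have "frechet_derivative ?G (at \<xi>) = (\<lambda>h. - 2 * pi * complex_of_real (\<xi> \<bullet> h) * ?G \<xi>)"
      by (rule ext)
    then show ?thesis using has_derivative_frechet[OF diff, of \<xi>] by (simp only:)
  qed
  have dR: "(R has_derivative (\<lambda>h. 0)) (at \<xi>)" for \<xi>
  proof -
    have "((\<lambda>x::'a. x \<bullet> x) has_derivative (\<lambda>h. \<xi> \<bullet> h + h \<bullet> \<xi>)) (at \<xi>)"
      by (rule has_derivative_inner) (rule has_derivative_ident)+
    then have "(R has_derivative (\<lambda>h. ?G \<xi> * complex_of_real (pi * (\<xi> \<bullet> h + h \<bullet> \<xi>) * exp (pi * (\<xi> \<bullet> \<xi>)))
        + - 2 * pi * complex_of_real (\<xi> \<bullet> h) * ?G \<xi> * complex_of_real (exp (pi * (\<xi> \<bullet> \<xi>))))) (at \<xi>)"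
      unfolding R_def[abs_def]
      by (intro has_derivative_mult dG has_derivative_of_real has_derivative_exp has_derivative_mult_right)
    then show ?thesis by (simp add: inner_commute algebra_simps)
  qed
  have const: "R \<xi> = R 0" for \<xi>
    using has_derivative_zero_unique[of UNIV R \<xi> 0] dR by auto
  have "R 0 = 1" unfolding R_def by (simp add: inverse_fourier_wave integral_gaussian)
  show ?thesis
  proof
    fix \<xi> :: 'a
    have "?G \<xi> = R \<xi> * gaussian \<xi>"
      unfolding R_def gaussian_def by (simp add: mult.assoc flip: of_real_mult exp_add)
    then show "?G \<xi> = gaussian \<xi>" using const[of \<xi>] \<open>R 0 = 1\<close> by simp
  qed
qed

text \<open>Inversion at the origin. The transform of u is damped by a wide Gaussian; the
  multiplication formula moves the damping to the other side, where it becomes a narrow Gaussian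
  averaging u around 0. Both sides converge as \<epsilon> tends to 0.\<close>

lemma integral_inverse_fourier:
  fixes u :: "'a::euclidean_space \<Rightarrow> complex"
  assumes u: "u \<in> schwartz"
  shows "(\<integral>x. inverse_fourier u x \<partial>lborel) = u 0"
proof -
  define \<epsilon> where "\<epsilon> n = inverse (real (Suc n))" for n
  have eps: "\<epsilon> n > 0" "\<epsilon> \<longlonglongrightarrow> 0" for n
    using LIMSEQ_inverse_real_of_nat by (auto simp: \<epsilon>_def[abs_def])
  have cg: "isCont (gaussian :: 'a \<Rightarrow> complex) x" "isCont u x" for x
    using schwartz_continuous[OF schwartz_gaussian, of UNIV] schwartz_continuous[OF u, of UNIV]
    by (auto simp: continuous_on_eq_continuous_at)
  have m: "u \<in> borel_measurable borel" "inverse_fourier u \<in> borel_measurable borel"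
    "(gaussian :: 'a \<Rightarrow> complex) \<in> borel_measurable borel"
    by (auto intro: schwartz_measurable schwartz_gaussian schwartz_inverse_fourier u)
  have ig: "integrable lborel (gaussian :: 'a \<Rightarrow> complex)" by (intro schwartz_integrable schwartz_gaussian)
  obtain B where B: "\<And>x. norm (u x) \<le> B"
    using rapidly_decreasing_bound[OF schwartz_rapidly_decreasing[OF u], of 0] by auto
  have g1: "norm (gaussian x) \<le> 1" for x :: 'a by (simp add: gaussian_def)
  have scaled: "(\<integral>x. inverse_fourier u x * gaussian (\<epsilon> n *\<^sub>R x) \<partial>lborel) = (\<integral>y. u (\<epsilon> n *\<^sub>R y) * gaussian y \<partial>lborel)" for n
  proof -
    have "(\<lambda>x. gaussian (0 + (\<lambda>x. \<epsilon> n *\<^sub>R x) x)) \<in> (schwartz :: ('a \<Rightarrow> complex) set)"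
      using eps(1)[of n] by (intro schwartz_affine schwartz_gaussian) (auto simp: inj_on_def)
    then have ge: "(\<lambda>x. gaussian (\<epsilon> n *\<^sub>R x)) \<in> (schwartz :: ('a \<Rightarrow> complex) set)" by simp
    have "(\<integral>x. inverse_fourier u x * gaussian (\<epsilon> n *\<^sub>R x) \<partial>lborel) =
        (\<integral>x. u x * inverse_fourier (\<lambda>x. gaussian (\<epsilon> n *\<^sub>R x)) x \<partial>lborel)"
      by (rule multiplication_formula[symmetric]) (intro schwartz_integrable u ge)+
    also have "\<dots> = \<bar>\<epsilon> n\<bar> ^ DIM('a) *\<^sub>R (\<integral>y. u (0 + \<epsilon> n *\<^sub>R y) * inverse_fourier (\<lambda>x. gaussian (\<epsilon> n *\<^sub>R x)) (0 + \<epsilon> n *\<^sub>R y) \<partial>lborel)"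
      using eps(1)[of n] m schwartz_measurable[OF schwartz_inverse_fourier[OF ge]]
      by (intro lborel_integral_affine borel_measurable_times) auto
    also have "\<dots> = (\<integral>y. u (\<epsilon> n *\<^sub>R y) * (\<bar>\<epsilon> n\<bar> ^ DIM('a) *\<^sub>R inverse_fourier (\<lambda>x. gaussian (\<epsilon> n *\<^sub>R x)) (\<epsilon> n *\<^sub>R y)) \<partial>lborel)"
      by (simp flip: integral_scaleR_right)
    finally have "(\<integral>x. inverse_fourier u x * gaussian (\<epsilon> n *\<^sub>R x) \<partial>lborel) =
        (\<integral>y. u (\<epsilon> n *\<^sub>R y) * (\<bar>\<epsilon> n\<bar> ^ DIM('a) *\<^sub>R inverse_fourier (\<lambda>x. gaussian (\<epsilon> n *\<^sub>R x)) (\<epsilon> n *\<^sub>R y)) \<partial>lborel)" .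
    moreover have "\<bar>\<epsilon> n\<bar> ^ DIM('a) *\<^sub>R inverse_fourier (\<lambda>x. gaussian (\<epsilon> n *\<^sub>R x)) (\<epsilon> n *\<^sub>R y) = inverse_fourier gaussian y" for y :: 'a
    proof -
      have "inverse_fourier gaussian y = \<bar>\<epsilon> n\<bar> ^ DIM('a) *\<^sub>R (\<integral>x. gaussian (0 + \<epsilon> n *\<^sub>R x) * wave (0 + \<epsilon> n *\<^sub>R x) y \<partial>lborel)"
        unfolding inverse_fourier_wave using eps(1)[of n] m
        by (intro lborel_integral_affine borel_measurable_times wave_measurable) auto
      moreover have "wave (0 + \<epsilon> n *\<^sub>R x) y = wave x (\<epsilon> n *\<^sub>R y)" for x :: 'a by (simp add: wave_def)
      ultimately show ?thesis by (simp add: inverse_fourier_wave)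
    qed
    ultimately show ?thesis by (simp add: inverse_fourier_gaussian)
  qed
  have "(\<lambda>n. \<integral>x. inverse_fourier u x * gaussian (\<epsilon> n *\<^sub>R x) \<partial>lborel) \<longlonglongrightarrow> (\<integral>x. inverse_fourier u x * 1 \<partial>lborel)"
  proof (rule integral_dominated_convergence)
    show "integrable lborel (\<lambda>x. norm (inverse_fourier u x))"
      by (intro integrable_norm schwartz_integrable schwartz_inverse_fourier u)
    show "AE x in lborel. (\<lambda>n. inverse_fourier u x * gaussian (\<epsilon> n *\<^sub>R x)) \<longlonglongrightarrow> inverse_fourier u x * 1"
    proof (rule AE_I2)
      fix x :: 'a
      have "(\<lambda>n. gaussian (\<epsilon> n *\<^sub>R x)) \<longlonglongrightarrow> gaussian (0 *\<^sub>R x)"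
        by (rule isCont_tendsto_compose[OF cg(1)]) (intro tendsto_intros eps)
      then show "(\<lambda>n. inverse_fourier u x * gaussian (\<epsilon> n *\<^sub>R x)) \<longlonglongrightarrow> inverse_fourier u x * 1"
        by (intro tendsto_intros) (simp add: gaussian_def)
    qed
    show "AE x in lborel. norm (inverse_fourier u x * gaussian (\<epsilon> n *\<^sub>R x)) \<le> norm (inverse_fourier u x)" for n
      using g1 by (intro AE_I2) (simp add: norm_mult mult_left_le)
  qed (use m in measurable)
  moreover have "(\<lambda>n. \<integral>y. u (\<epsilon> n *\<^sub>R y) * gaussian y \<partial>lborel) \<longlonglongrightarrow> (\<integral>y. u 0 * gaussian y \<partial>(lborel :: 'a measure))"
  proof (rule integral_dominated_convergence)
    show "integrable lborel (\<lambda>y::'a. B * norm (gaussian y))"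
      by (intro integrable_mult_right integrable_norm ig)
    show "AE y in lborel. (\<lambda>n. u (\<epsilon> n *\<^sub>R y) * gaussian y) \<longlonglongrightarrow> u 0 * gaussian y"
    proof (rule AE_I2)
      fix y :: 'a
      have "(\<lambda>n. u (\<epsilon> n *\<^sub>R y)) \<longlonglongrightarrow> u (0 *\<^sub>R y)"
        by (rule isCont_tendsto_compose[OF cg(2)]) (intro tendsto_intros eps)
      then show "(\<lambda>n. u (\<epsilon> n *\<^sub>R y) * gaussian y) \<longlonglongrightarrow> u 0 * gaussian y"
        by (intro tendsto_intros) simp
    qed
    show "AE y in lborel. norm (u (\<epsilon> n *\<^sub>R y) * gaussian y) \<le> B * norm (gaussian y)" for n
      using B by (intro AE_I2) (simp add: norm_mult mult_right_mono)
  qed (use m in measurable)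
  ultimately have "(\<integral>x. inverse_fourier u x * 1 \<partial>lborel) = (\<integral>y. u 0 * gaussian y \<partial>(lborel :: 'a measure))"
    unfolding scaled by (rule LIMSEQ_unique)
  then show ?thesis by (simp add: integral_gaussian)
qed

text \<open>Multiplying the transform by the character of -\<xi> translates u by \<xi>, which
  reduces inversion at \<xi> to inversion at the origin.\<close>

theorem fourier_inverse_fourier:
  fixes u :: "'a::euclidean_space \<Rightarrow> complex"
  assumes u: "u \<in> schwartz"
  shows "fourier (inverse_fourier u) = u"
proof
  fix \<xi> :: 'a
  have s: "(\<lambda>\<eta>. u (\<xi> + id \<eta>)) \<in> schwartz"
    by (rule schwartz_affine[OF u linear_id]) simp
  have "inverse_fourier u x * wave (- \<xi>) x = inverse_fourier (\<lambda>\<eta>. u (\<xi> + id \<eta>)) x" for x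
  proof -
    have "inverse_fourier u x = (\<integral>\<eta>. u (\<xi> + \<eta>) * wave (\<xi> + \<eta>) x \<partial>lborel)"
      unfolding inverse_fourier_wave using schwartz_measurable[OF u]
      by (intro lborel_integral_translate[symmetric] borel_measurable_times wave_measurable) auto
    moreover have "wave (\<xi> + \<eta>) x * wave (- \<xi>) x = wave \<eta> x" for \<eta>
      by (simp flip: wave_add)
    ultimately show ?thesis
      by (simp add: inverse_fourier_wave mult.assoc flip: integral_mult_left_zero)
  qed
  then show "fourier (inverse_fourier u) \<xi> = u \<xi>"
    using integral_inverse_fourier[OF s] by (simp add: fourier_wave)
qed

text \<open>The two transforms differ by a reflection, so a reflection in the outer integral reduces
  this to the other order.\<close>

lemma inverse_fourier_fourier:
  fixes u :: "'a::euclidean_space \<Rightarrow> complex"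
  assumes u: "u \<in> schwartz"
  shows "inverse_fourier (fourier u) = u"
proof
  fix x :: 'a
  have m: "inverse_fourier u \<in> borel_measurable borel"
    by (intro schwartz_measurable schwartz_inverse_fourier u)
  have "inverse_fourier (fourier u) x = (\<integral>\<xi>. inverse_fourier u (0 - \<xi>) * wave (- x) (0 - \<xi>) \<partial>lborel)"
    by (simp add: inverse_fourier_wave[of "fourier u"] fourier_eq_inverse_fourier wave_commute wave_minus)
  also have "\<dots> = (\<integral>\<xi>. inverse_fourier u \<xi> * wave (- x) \<xi> \<partial>lborel)"
    using m by (intro lborel_integral_reflect borel_measurable_times wave_measurable) auto
  also have "\<dots> = fourier (inverse_fourier u) x" by (simp add: fourier_wave)
  finally show "inverse_fourier (fourier u) x = u x" by (simp add: fourier_inverse_fourier[OF u])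
qed

section \<open>Convolution with tempered distributions\<close>

lemma partial_reflect:
  assumes "g differentiable_on UNIV"
  shows "((\<lambda>w. g (y - w)) has_derivative (\<lambda>h. frechet_derivative g (at (y - w)) (- h))) (at w)"
    and "partial_derivative b (\<lambda>w. g (y - w)) = (\<lambda>w. - partial_derivative b g (y - w))"
proof -
  show d: "((\<lambda>w. g (y - w)) has_derivative (\<lambda>h. frechet_derivative g (at (y - w)) (- h))) (at w)" for w
    by (rule has_derivative_compose[OF _ has_derivative_frechet[OF assms]]) (auto intro!: derivative_eq_intros)
  show "partial_derivative b (\<lambda>w. g (y - w)) = (\<lambda>w. - partial_derivative b g (y - w))"
    using has_derivative_bounded_linear[OF has_derivative_frechet[OF assms]]
    by (intro ext) (simp add: partial_derivative_eq[OF d] linear_neg bounded_linear.linear,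
      simp add: partial_derivative_def linear_neg bounded_linear.linear)
qed

lemma schwartz_reflect: "u \<in> schwartz \<Longrightarrow> (\<lambda>w. u (y - w)) \<in> schwartz"
  using schwartz_affine[of u uminus y] by (simp add: linear_uminus inj_on_def)

lemma partial_derivative_lin:
  assumes "f differentiable_on UNIV" "g differentiable_on UNIV"
  shows "partial_derivative b (\<lambda>x. f x + c * g x) = (\<lambda>x. partial_derivative b f x + c * partial_derivative b g x)"
  using has_derivative_frechet[OF assms(1)] has_derivative_frechet[OF assms(2)]
  by (intro ext) (subst partial_derivative_eq[OF has_derivative_add[OF _ has_derivative_mult_right]],
    auto simp: partial_derivative_def)

lemma iterated_partial_lin:
  assumes "f \<in> schwartz" "g \<in> schwartz" "set bs \<subseteq> Basis"
  shows "iterated_partial bs (\<lambda>x. f x + c * g x) = (\<lambda>x. iterated_partial bs f x + c * iterated_partial bs g x)"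
  using assms(3)
  by (induction bs)
    (auto simp: partial_derivative_lin schwartz_differentiable schwartz_iterated_partial assms(1,2))

text \<open>K does not depend on z, because second derivatives are bounded on the whole space. This
  uniformity is what lets the remainder be integrated in
  \<open>correlate_has_derivative\<close>.\<close>

lemma schwartz_taylor:
  fixes \<psi> :: "'a::euclidean_space \<Rightarrow> complex"
  assumes \<psi>: "\<psi> \<in> schwartz"
  obtains K where "\<And>z h. norm (\<psi> (z + h) - \<psi> z - frechet_derivative \<psi> (at z) h) \<le> K * (norm h)\<^sup>2"
proof -
  have diff: "\<psi> differentiable_on UNIV" by (rule schwartz_differentiable[OF \<psi>])
  have "\<forall>b\<in>Basis. \<forall>c\<in>Basis. \<exists>B. \<forall>x. norm (partial_derivative c (partial_derivative b \<psi>) x) \<le> B"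
  proof (intro ballI)
    fix b c :: 'a assume "b \<in> Basis" "c \<in> Basis"
    then have "rapidly_decreasing (partial_derivative c (partial_derivative b \<psi>))"
      by (intro schwartz_rapidly_decreasing schwartz_partial \<psi>)
    from rapidly_decreasing_bound[OF this, of 0] show "\<exists>B. \<forall>x. norm (partial_derivative c (partial_derivative b \<psi>) x) \<le> B"
      by (metis div_by_1 power_0)
  qed
  then obtain B where B: "\<And>b c x. b \<in> Basis \<Longrightarrow> c \<in> Basis \<Longrightarrow> norm (partial_derivative c (partial_derivative b \<psi>) x) \<le> B b c"
    by metis
  define M where "M = (\<Sum>b\<in>Basis. \<Sum>c\<in>Basis. B b c)"
  have B0: "0 \<le> B b c" if "b \<in> Basis" "c \<in> Basis" for b c
    using order_trans[OF norm_ge_zero B[OF that]] .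
  have M: "norm (partial_derivative c (partial_derivative b \<psi>) x) \<le> M" if "b \<in> Basis" "c \<in> Basis" for b c x
  proof -
    have "B b c \<le> (\<Sum>c\<in>Basis. B b c)" using that B0 by (intro member_le_sum) auto
    also have "\<dots> \<le> M" unfolding M_def using that B0 by (intro member_le_sum[of b Basis "\<lambda>b. \<Sum>c\<in>Basis. B b c"]) (auto intro: sum_nonneg)
    finally show ?thesis using B[OF that, of x] by simp
  qed
  let ?d = "real DIM('a)"
  show ?thesis
  proof (rule that)
    fix z h :: 'a
    have "norm (\<psi> (z + h) - \<psi> z - frechet_derivative \<psi> (at z) ((z + h) - z)) \<le> norm ((z + h) - z) * (?d * (?d * M * norm h))"
    proof (rule differentiable_bound_linearization[where S = "closed_segment z (z + h)"])
      show "z + t *\<^sub>R (z + h - z) \<in> closed_segment z (z + h)" if "t \<in> {0..1}" for t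
        using that by (auto simp: closed_segment_def algebra_simps intro!: exI[of _ t])
      show "(\<psi> has_derivative frechet_derivative \<psi> (at x)) (at x within closed_segment z (z + h))" for x
        by (rule has_derivative_at_withinI[OF has_derivative_frechet[OF diff]])
      show "z \<in> closed_segment z (z + h)" by simp
      fix x assume x: "x \<in> closed_segment z (z + h)"
      have p: "norm (partial_derivative b \<psi> x - partial_derivative b \<psi> z) \<le> ?d * M * norm h" if b: "b \<in> Basis" for b
      proof -
        have "norm (partial_derivative b \<psi> x - partial_derivative b \<psi> z) \<le> ?d * M * norm (x - z)"
          using norm_diff_le_partial[OF schwartz_differentiable[OF schwartz_partial[OF \<psi> b]], of x z M] M[OF b] by blast
        also have "\<dots> \<le> ?d * M * norm h"
        proof (rule mult_left_mono)
          show "norm (x - z) \<le> norm h" using segment_bound1[OF x] by (simp add: norm_minus_commute)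
          show "0 \<le> ?d * M" using M_def B0 by (auto intro!: mult_nonneg_nonneg sum_nonneg)
        qed
        finally show ?thesis .
      qed
      show "onorm (frechet_derivative \<psi> (at x) - frechet_derivative \<psi> (at z)) \<le> ?d * (?d * M * norm h)"
        unfolding fun_diff_def
      proof (rule onorm_le)
        fix v
        have "frechet_derivative \<psi> (at x) v - frechet_derivative \<psi> (at z) v =
            (\<Sum>b\<in>Basis. (v \<bullet> b) *\<^sub>R (partial_derivative b \<psi> x - partial_derivative b \<psi> z))"
          unfolding frechet_derivative_eq_sum_partial[OF diff] by (simp add: sum_subtractf scaleR_diff_right)
        also have "norm \<dots> \<le> (\<Sum>b\<in>Basis. norm ((v \<bullet> b) *\<^sub>R (partial_derivative b \<psi> x - partial_derivative b \<psi> z)))"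
          by (rule norm_sum)
        also have "\<dots> \<le> (\<Sum>b\<in>(Basis::'a set). norm v * (?d * M * norm h))"
          unfolding norm_scaleR using p by (intro sum_mono mult_mono) (auto intro: Basis_le_norm)
        finally show "norm (frechet_derivative \<psi> (at x) v - frechet_derivative \<psi> (at z) v) \<le> ?d * (?d * M * norm h) * norm v"
          by (simp add: algebra_simps)
      qed
    qed
    then show "norm (\<psi> (z + h) - \<psi> z - frechet_derivative \<psi> (at z) h) \<le> (?d * ?d * M) * (norm h)\<^sup>2"
      by (simp add: power2_eq_square algebra_simps)
  qed
qed

text \<open>On the segment from y - w to y' - w, a point s satisfies 1 + norm w \<le> (1 + norm s) *
  (1 + norm y + norm y'). The weight in w is thus absorbed by the decay of the derivatives at s, at
  the price of polynomial growth in y and y'.\<close>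

lemma schwartz_weighted_lipschitz:
  fixes \<psi> :: "'a::euclidean_space \<Rightarrow> complex"
  assumes \<psi>: "\<psi> \<in> schwartz"
  obtains L where "L \<ge> 0" "\<And>y y' w. (1 + norm w) ^ m * norm (\<psi> (y - w) - \<psi> (y' - w)) \<le>
      L * norm (y - y') * (1 + norm y + norm y') ^ m"
proof -
  have "\<forall>b\<in>Basis. \<exists>B. \<forall>x. (1 + norm x) ^ m * norm (partial_derivative b \<psi> x) \<le> B"
    using schwartz_rapidly_decreasing[OF schwartz_partial[OF \<psi>]] unfolding rapidly_decreasing_def by blast
  then obtain B where B: "\<And>b x. b \<in> Basis \<Longrightarrow> (1 + norm x) ^ m * norm (partial_derivative b \<psi> x) \<le> B b"
    by metis
  have B0: "0 \<le> B b" if "b \<in> Basis" for b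
    by (rule order_trans[OF _ B[OF that, of 0]]) auto
  define M where "M = (\<Sum>b\<in>Basis. B b)"
  have M: "(1 + norm x) ^ m * norm (partial_derivative b \<psi> x) \<le> M" if "b \<in> Basis" for b x
    unfolding M_def using that B0 by (intro order_trans[OF B[OF that]] member_le_sum) auto
  show ?thesis
  proof (rule that)
    show "0 \<le> DIM('a) * M" using B0 by (auto simp: M_def intro!: mult_nonneg_nonneg sum_nonneg)
    fix y y' w :: 'a
    let ?R = "1 + norm y + norm y'"
    have R: "?R > 0" "1 + norm w > 0"
      using norm_ge_zero[of y] norm_ge_zero[of y'] norm_ge_zero[of w] by linarith+
    have "norm (\<psi> (y - w) - \<psi> (y' - w)) \<le> DIM('a) * (M * ?R ^ m / (1 + norm w) ^ m) * norm ((y - w) - (y' - w))"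
    proof (rule norm_diff_le_partial[OF schwartz_differentiable[OF \<psi>]])
      fix b s :: 'a assume b: "b \<in> Basis" and s: "s \<in> closed_segment (y - w) (y' - w)"
      have "s + w \<in> closed_segment y y'"
        using s closed_segment_translation_eq[of w s "y - w" "y' - w"] by (simp add: add.commute)
      from segment_furthest_le[OF this, of 0] have "norm (s + w) \<le> norm y + norm y'"
        using norm_ge_zero[of y] norm_ge_zero[of y'] by (simp only: diff_0 norm_minus_cancel) linarith
      moreover have "norm w \<le> norm s + norm (s + w)"
        using norm_triangle_ineq4[of "s + w" s] by simp
      ultimately have "1 + norm w \<le> 1 + (norm s + (norm y + norm y'))" by simp
      also have "1 + (norm s + (norm y + norm y')) \<le> (1 + norm s) * ?R"
        by (simp add: algebra_simps)
      finally have le: "1 + norm w \<le> (1 + norm s) * ?R" .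
      have "(1 + norm w) ^ m * norm (partial_derivative b \<psi> s) \<le> ((1 + norm s) * ?R) ^ m * norm (partial_derivative b \<psi> s)"
        using le by (intro mult_right_mono power_mono) auto
      also have "\<dots> = ?R ^ m * ((1 + norm s) ^ m * norm (partial_derivative b \<psi> s))"
        by (simp add: power_mult_distrib)
      also have "\<dots> \<le> ?R ^ m * M" using R by (intro mult_left_mono M b) auto
      finally show "norm (partial_derivative b \<psi> s) \<le> M * ?R ^ m / (1 + norm w) ^ m"
        using R by (simp add: field_simps)
    qed
    then have "(1 + norm w) ^ m * norm (\<psi> (y - w) - \<psi> (y' - w)) \<le>
        (1 + norm w) ^ m * (DIM('a) * (M * ?R ^ m / (1 + norm w) ^ m) * norm ((y - w) - (y' - w)))"
      using R by (intro mult_left_mono) auto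
    also have "\<dots> = DIM('a) * M * norm (y - y') * ?R ^ m"
      using R(2) by simp
    finally show "(1 + norm w) ^ m * norm (\<psi> (y - w) - \<psi> (y' - w)) \<le> DIM('a) * M * norm (y - y') * ?R ^ m" .
  qed
qed

text \<open>With \<open>\<sigma> = id\<close> this is the correlation of \<open>\<psi>\<close> and \<open>\<rho>\<close>; with a simple function \<open>\<sigma>\<close> close
  to the identity it is a finite linear combination of translates of \<open>\<psi>\<close> approximating it.\<close>

definition correlate :: "('a::euclidean_space \<Rightarrow> 'a) \<Rightarrow> ('a \<Rightarrow> complex) \<Rightarrow> ('a \<Rightarrow> complex) \<Rightarrow> 'a \<Rightarrow> complex" where
  "correlate \<sigma> \<rho> \<psi> w = (\<integral>y. \<psi> (\<sigma> y - w) * \<rho> y \<partial>lborel)"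

text \<open>The bound by 2 * norm y is the one that holds for the standard approximation of the
  identity by simple functions, and it holds for the identity itself. Both cases of
  \<open>correlate\<close> are thus treated together.\<close>

context
  fixes \<sigma> :: "'a::euclidean_space \<Rightarrow> 'a" and \<rho> :: "'a \<Rightarrow> complex"
  assumes \<sigma> [measurable]: "\<sigma> \<in> borel_measurable borel" and \<sigma>_le: "\<And>y. norm (\<sigma> y) \<le> 2 * norm y"
    and \<rho> [measurable]: "\<rho> \<in> borel_measurable borel" and \<rho>_rapid: "rapidly_decreasing \<rho>"
begin

lemma integrable_correlate:
  assumes \<psi>: "\<psi> \<in> schwartz"
  shows "integrable lborel (\<lambda>y. \<psi> (\<sigma> y - w) * \<rho> y)"
proof -
  obtain B where B: "\<And>x. norm (\<psi> x) \<le> B"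
    using rapidly_decreasing_bound[OF schwartz_rapidly_decreasing[OF \<psi>], of 0] by auto
  have B0: "0 \<le> B" using order_trans[OF norm_ge_zero B] .
  have [measurable]: "\<psi> \<in> borel_measurable borel" by (rule schwartz_measurable[OF \<psi>])
  show ?thesis
  proof (rule Bochner_Integration.integrable_bound)
    show "integrable lborel (\<lambda>y. B * norm (\<rho> y))"
      by (intro integrable_mult_right integrable_norm rapidly_decreasing_integrable \<rho>_rapid \<rho>)
    show "AE y in lborel. norm (\<psi> (\<sigma> y - w) * \<rho> y) \<le> norm (B * norm (\<rho> y))"
      using B B0 by (intro AE_I2) (auto simp: norm_mult intro!: mult_right_mono)
  qed measurable
qed

lemma correlate_has_derivative:
  assumes \<psi>: "\<psi> \<in> schwartz"
  shows "(correlate \<sigma> \<rho> \<psi> has_derivative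
    (\<lambda>h. \<Sum>b\<in>Basis. (h \<bullet> b) *\<^sub>R - correlate \<sigma> \<rho> (partial_derivative b \<psi>) w)) (at w)"
proof -
  obtain K where K: "\<And>z h. norm (\<psi> (z + h) - \<psi> z - frechet_derivative \<psi> (at z) h) \<le> K * (norm h)\<^sup>2"
    using schwartz_taylor[OF \<psi>] by blast
  let ?D = "\<lambda>h. \<Sum>b\<in>Basis. (h \<bullet> b) *\<^sub>R - correlate \<sigma> \<rho> (partial_derivative b \<psi>) w"
  show ?thesis
  proof (rule has_derivativeI_quadratic)
    show "bounded_linear ?D"
      by (intro bounded_linear_sum bounded_linear_scaleR_const bounded_linear_inner_left)
    fix h :: 'a
    let ?F = "\<lambda>y. frechet_derivative \<psi> (at (\<sigma> y - w)) (- h)"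
    have F: "?F y * \<rho> y = (\<Sum>b\<in>Basis. - complex_of_real (h \<bullet> b) * (partial_derivative b \<psi> (\<sigma> y - w) * \<rho> y))" for y
      by (simp add: frechet_derivative_eq_sum_partial[OF schwartz_differentiable[OF \<psi>]] sum_distrib_right
          scaleR_conv_of_real mult.assoc)
    have iF: "integrable lborel (\<lambda>y. ?F y * \<rho> y)"
      unfolding F by (intro Bochner_Integration.integrable_sum integrable_mult_right integrable_correlate schwartz_partial \<psi>)
    have "(\<integral>y. ?F y * \<rho> y \<partial>lborel) =
        (\<integral>y. (\<Sum>b\<in>Basis. - complex_of_real (h \<bullet> b) * (partial_derivative b \<psi> (\<sigma> y - w) * \<rho> y)) \<partial>lborel)"
      by (simp only: F)
    also have "\<dots> = (\<Sum>b\<in>Basis. (\<integral>y. - complex_of_real (h \<bullet> b) * (partial_derivative b \<psi> (\<sigma> y - w) * \<rho> y) \<partial>lborel))"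
      by (intro Bochner_Integration.integral_sum integrable_mult_right integrable_correlate schwartz_partial \<psi>)
    also have "\<dots> = ?D h"
    proof (rule sum.cong[OF refl])
      fix b
      have "(\<integral>y. - complex_of_real (h \<bullet> b) * (partial_derivative b \<psi> (\<sigma> y - w) * \<rho> y) \<partial>lborel) =
          - complex_of_real (h \<bullet> b) * correlate \<sigma> \<rho> (partial_derivative b \<psi>) w"
        unfolding correlate_def by (rule integral_mult_right_zero)
      then show "(\<integral>y. - complex_of_real (h \<bullet> b) * (partial_derivative b \<psi> (\<sigma> y - w) * \<rho> y) \<partial>lborel) =
          (h \<bullet> b) *\<^sub>R - correlate \<sigma> \<rho> (partial_derivative b \<psi>) w"
        by (simp only: scaleR_conv_of_real mult_minus_left mult_minus_right)
    qed
    finally have D: "?D h = (\<integral>y. ?F y * \<rho> y \<partial>lborel)" ..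
    have i: "integrable lborel (\<lambda>y. \<psi> (\<sigma> y - w') * \<rho> y)" for w' by (rule integrable_correlate[OF \<psi>])
    have eq: "correlate \<sigma> \<rho> \<psi> (w + h) - correlate \<sigma> \<rho> \<psi> w - ?D h =
      (\<integral>y. \<psi> (\<sigma> y - (w + h)) * \<rho> y - \<psi> (\<sigma> y - w) * \<rho> y - ?F y * \<rho> y \<partial>lborel)"
      unfolding D unfolding correlate_def
      by (subst Bochner_Integration.integral_diff; (intro Bochner_Integration.integrable_diff i iF)?)+ simp
    have "norm (\<integral>y. \<psi> (\<sigma> y - (w + h)) * \<rho> y - \<psi> (\<sigma> y - w) * \<rho> y - ?F y * \<rho> y \<partial>lborel) \<le> (\<integral>y. K * (norm h)\<^sup>2 * norm (\<rho> y) \<partial>lborel)"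
    proof (rule Bochner_Integration.integral_norm_bound_integral)
      show "integrable lborel (\<lambda>y. \<psi> (\<sigma> y - (w + h)) * \<rho> y - \<psi> (\<sigma> y - w) * \<rho> y - ?F y * \<rho> y)"
        by (intro Bochner_Integration.integrable_diff i iF)
      show "integrable lborel (\<lambda>y. K * (norm h)\<^sup>2 * norm (\<rho> y))"
        by (intro integrable_mult_right integrable_norm rapidly_decreasing_integrable \<rho>_rapid \<rho>)
      show "norm (\<psi> (\<sigma> y - (w + h)) * \<rho> y - \<psi> (\<sigma> y - w) * \<rho> y - ?F y * \<rho> y) \<le> K * (norm h)\<^sup>2 * norm (\<rho> y)" for y
      proof -
        have "\<sigma> y - (w + h) = (\<sigma> y - w) + - h" by simp
        then show ?thesis
          using mult_right_mono[OF K[of "\<sigma> y - w" "- h"] norm_ge_zero[of "\<rho> y"]]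
          by (simp only: norm_mult[symmetric] left_diff_distrib norm_minus_cancel)
      qed
    qed
    then show "norm (correlate \<sigma> \<rho> \<psi> (w + h) - correlate \<sigma> \<rho> \<psi> w - ?D h) \<le> (K * (\<integral>y. norm (\<rho> y) \<partial>lborel)) * (norm h)\<^sup>2"
      unfolding eq by (simp add: algebra_simps)
  qed
qed

lemma partial_correlate:
  assumes "\<psi> \<in> schwartz" "b \<in> Basis"
  shows "partial_derivative b (correlate \<sigma> \<rho> \<psi>) = (\<lambda>w. - correlate \<sigma> \<rho> (partial_derivative b \<psi>) w)"
proof
  fix w
  have "partial_derivative b (correlate \<sigma> \<rho> \<psi>) w = (\<Sum>c\<in>Basis. (b \<bullet> c) *\<^sub>R - correlate \<sigma> \<rho> (partial_derivative c \<psi>) w)"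
    by (rule partial_derivative_eq[OF correlate_has_derivative[OF assms(1)]])
  also have "\<dots> = - correlate \<sigma> \<rho> (partial_derivative b \<psi>) w"
    using assms(2) by (simp add: inner_Basis sum.delta if_distrib if_distribR cong: if_cong)
  finally show "partial_derivative b (correlate \<sigma> \<rho> \<psi>) w = - correlate \<sigma> \<rho> (partial_derivative b \<psi>) w" .
qed

text \<open>Decay in w comes from splitting its weight between two factors: if w is large then
  either it is far from \<open>\<sigma> y\<close>, where \<psi> is small, or y is large and \<rho>
  is small.\<close>

lemma schwartz_correlate:
  assumes "\<psi> \<in> schwartz"
  shows "correlate \<sigma> \<rho> \<psi> \<in> schwartz"
proof (rule schwartz_coinduct)
  let ?X = "correlate \<sigma> \<rho> ` schwartz"
  show "correlate \<sigma> \<rho> \<psi> \<in> lin_hull ?X" using assms by (auto intro: lin_hull_base)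
  show "g differentiable_on UNIV" if "g \<in> ?X" for g
    using that differentiableI[OF correlate_has_derivative] by (auto simp: differentiable_on_def)
  show "partial_derivative b g \<in> lin_hull ?X" if "g \<in> ?X" "b \<in> Basis" for g b
  proof -
    obtain \<psi> where \<psi>: "\<psi> \<in> schwartz" "g = correlate \<sigma> \<rho> \<psi>" using \<open>g \<in> ?X\<close> by auto
    have "partial_derivative b g = (\<lambda>w. (- 1) * correlate \<sigma> \<rho> (partial_derivative b \<psi>) w)"
      unfolding \<psi>(2) partial_correlate[OF \<psi>(1) that(2)] by simp
    then show ?thesis using schwartz_partial[OF \<psi>(1) that(2)] by (simp only:) (rule lin_hull_scale, auto intro: lin_hull_base)
  qed
  show "rapidly_decreasing g" if "g \<in> ?X" for g
    unfolding rapidly_decreasing_def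
  proof
    fix k
    obtain \<psi> where \<psi>: "\<psi> \<in> schwartz" "g = correlate \<sigma> \<rho> \<psi>" using \<open>g \<in> ?X\<close> by auto
    obtain C where C: "\<And>x. (1 + norm x) ^ k * norm (\<psi> x) \<le> C"
      using schwartz_rapidly_decreasing[OF \<psi>(1)] unfolding rapidly_decreasing_def by meson
    have C0: "0 \<le> C" by (rule order_trans[OF _ C[of 0]]) simp
    have "(1 + norm w) ^ k * norm (g w) \<le> (\<integral>y. (2 ^ k * C) * ((1 + norm y) ^ k * norm (\<rho> y)) \<partial>lborel)" for w
    proof -
      have "(1 + norm w) ^ k * norm (g w) = norm (\<integral>y. complex_of_real ((1 + norm w) ^ k) * (\<psi> (\<sigma> y - w) * \<rho> y) \<partial>lborel)"
        unfolding \<psi>(2) correlate_def by (simp add: norm_mult norm_power flip: of_real_power of_real_add del: of_real_power of_real_add)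
      also have "\<dots> \<le> (\<integral>y. (2 ^ k * C) * ((1 + norm y) ^ k * norm (\<rho> y)) \<partial>lborel)"
      proof (rule Bochner_Integration.integral_norm_bound_integral)
        show "integrable lborel (\<lambda>y. complex_of_real ((1 + norm w) ^ k) * (\<psi> (\<sigma> y - w) * \<rho> y))"
          by (intro integrable_mult_right integrable_correlate \<psi>)
        show "integrable lborel (\<lambda>y. (2 ^ k * C) * ((1 + norm y) ^ k * norm (\<rho> y)))"
          by (intro integrable_mult_right rapidly_decreasing_integrable_weight \<rho>_rapid \<rho>)
        fix y
        have "norm w \<le> norm (\<sigma> y - w) + norm (\<sigma> y)"
          by (metis add.commute add_diff_cancel_left' diff_add_cancel norm_minus_commute norm_triangle_ineq4)
        also have "\<dots> \<le> norm (\<sigma> y - w) + 2 * norm y" using \<sigma>_le[of y] by simp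
        finally have "norm w \<le> norm (\<sigma> y - w) + 2 * norm y" .
        moreover have "(1 + norm (\<sigma> y - w)) * (2 * (1 + norm y)) =
            2 + 2 * norm (\<sigma> y - w) + 2 * norm y + 2 * (norm (\<sigma> y - w) * norm y)"
          by (simp add: algebra_simps)
        moreover have "0 \<le> norm (\<sigma> y - w) * norm y" by simp
        ultimately have le: "1 + norm w \<le> (1 + norm (\<sigma> y - w)) * (2 * (1 + norm y))"
          using norm_ge_zero[of "\<sigma> y - w"] by linarith
        have "(1 + norm w) ^ k * (norm (\<psi> (\<sigma> y - w)) * norm (\<rho> y)) \<le>
            ((1 + norm (\<sigma> y - w)) * (2 * (1 + norm y))) ^ k * (norm (\<psi> (\<sigma> y - w)) * norm (\<rho> y))"
          using le by (intro mult_right_mono power_mono) auto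
        also have "\<dots> = ((1 + norm (\<sigma> y - w)) ^ k * norm (\<psi> (\<sigma> y - w))) * (2 ^ k * (1 + norm y) ^ k * norm (\<rho> y))"
          by (simp only: power_mult_distrib mult_ac)
        also have "\<dots> \<le> C * (2 ^ k * (1 + norm y) ^ k * norm (\<rho> y))"
          by (intro mult_right_mono C) auto
        finally show "norm (complex_of_real ((1 + norm w) ^ k) * (\<psi> (\<sigma> y - w) * \<rho> y)) \<le> (2 ^ k * C) * ((1 + norm y) ^ k * norm (\<rho> y))"
          by (simp add: norm_mult norm_power mult_ac flip: of_real_power of_real_add del: of_real_power of_real_add)
      qed
      finally show ?thesis .
    qed
    then show "\<exists>C. \<forall>w. (1 + norm w) ^ k * norm (g w) \<le> C" by blast
  qed
qed

lemma iterated_partial_correlate: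
  assumes "\<psi> \<in> schwartz" "set bs \<subseteq> Basis"
  shows "iterated_partial bs (correlate \<sigma> \<rho> \<psi>) = (\<lambda>w. (- 1) ^ length bs * correlate \<sigma> \<rho> (iterated_partial bs \<psi>) w)"
  using assms(2)
proof (induction bs)
  case (Cons b bs)
  have s: "iterated_partial bs \<psi> \<in> schwartz" using Cons.prems by (auto intro: schwartz_iterated_partial assms)
  have "partial_derivative b (\<lambda>w. (- 1) ^ length bs * correlate \<sigma> \<rho> (iterated_partial bs \<psi>) w) =
    partial_derivative b (\<lambda>w. 0 + (- 1) ^ length bs * correlate \<sigma> \<rho> (iterated_partial bs \<psi>) w)" by simp
  also have "\<dots> = (\<lambda>w. partial_derivative b (\<lambda>w. 0) w + (- 1) ^ length bs * partial_derivative b (correlate \<sigma> \<rho> (iterated_partial bs \<psi>)) w)"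
    by (rule partial_derivative_lin) (auto intro: schwartz_differentiable schwartz_correlate s)
  also have "partial_derivative b (\<lambda>w::'a. 0 :: complex) = (\<lambda>w. 0)"
    by (intro ext) (subst partial_derivative_eq[of _ "\<lambda>_. 0"], auto)
  finally show ?case using Cons by (simp add: partial_correlate[OF s] s)
qed simp

end

section \<open>Interchanging a tempered distribution with an integral\<close>

lemma tempered_add: "f \<in> tempered_distributions \<Longrightarrow> u \<in> schwartz \<Longrightarrow> v \<in> schwartz \<Longrightarrow> f (\<lambda>x. u x + v x) = f u + f v"
  and tempered_scale: "f \<in> tempered_distributions \<Longrightarrow> u \<in> schwartz \<Longrightarrow> f (\<lambda>x. c * u x) = c * f u"
  by (auto simp: tempered_distributions_def)

lemma tempered_sum:
  assumes f: "f \<in> tempered_distributions" and I: "finite I" "\<And>i. i \<in> I \<Longrightarrow> u i \<in> schwartz"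
  shows "f (\<lambda>x. \<Sum>i\<in>I. c i * u i x) = (\<Sum>i\<in>I. c i * f (u i))"
  using I
proof (induction I rule: finite_induct)
  case empty
  show ?case using tempered_scale[OF f schwartz_zero, of 0] by simp
next
  case (insert i I)
  have "f (\<lambda>x. c i * u i x + (\<Sum>i\<in>I. c i * u i x)) = f (\<lambda>x. c i * u i x) + f (\<lambda>x. \<Sum>i\<in>I. c i * u i x)"
    using insert by (intro tempered_add f schwartz_scale schwartz_sum) auto
  then show ?case using insert tempered_scale[OF f, of "u i" "c i"] by simp
qed

text \<open>The suprema in \<open>schwartz_seminorm\<close> are real suprema and are meaningful for
  bounded sets only. An explicit uniform bound B provides the boundedness, and the number of
  multi-indices goes into the constant.\<close>

lemma tempered_bound:
  assumes f: "f \<in> tempered_distributions"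
  obtains C :: real and m where "C \<ge> 0"
    "\<And>g B. g \<in> schwartz \<Longrightarrow>
      (\<And>bs w. set bs \<subseteq> Basis \<Longrightarrow> length bs \<le> m \<Longrightarrow> (1 + norm w) ^ m * norm (iterated_partial bs g w) \<le> B) \<Longrightarrow>
      norm (f g) \<le> C * B"
proof -
  obtain C m where C: "\<And>g. g \<in> schwartz \<Longrightarrow> norm (f g) \<le> C * schwartz_seminorm m g"
  proof -
    have "\<exists>C m. \<forall>g\<in>schwartz. norm (f g) \<le> C * schwartz_seminorm m g"
      using f by (simp add: tempered_distributions_def)
    then show ?thesis using that by blast
  qed
  let ?A = "{bs :: 'a list. set bs \<subseteq> Basis \<and> length bs \<le> m}"
  show ?thesis
  proof (rule that[of "\<bar>C\<bar> * card ?A" m])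
    fix g :: "'a \<Rightarrow> complex" and B :: real assume g: "g \<in> schwartz"
      and B: "\<And>bs w. set bs \<subseteq> Basis \<Longrightarrow> length bs \<le> m \<Longrightarrow> (1 + norm w) ^ m * norm (iterated_partial bs g w) \<le> B"
    have le: "schwartz_seminorm m g \<le> (\<Sum>bs\<in>?A. B)"
      unfolding schwartz_seminorm_def
    proof (rule sum_mono)
      fix bs :: "'a list" assume "bs \<in> ?A"
      then show "(SUP x. (1 + norm x) ^ m * norm (iterated_partial bs g x)) \<le> B"
        using B by (intro cSUP_least) auto
    qed
    have nn: "0 \<le> schwartz_seminorm m g"
      unfolding schwartz_seminorm_def
    proof (intro sum_nonneg)
      fix bs :: "'a list" assume bs: "bs \<in> ?A"
      have "(0::real) \<le> (1 + norm (0::'a)) ^ m * norm (iterated_partial bs g 0)" by simp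
      also have "\<dots> \<le> (SUP x. (1 + norm x) ^ m * norm (iterated_partial bs g x))"
        by (intro cSUP_upper) (use B bs in \<open>auto intro!: bdd_aboveI2[where M = B]\<close>)
      finally show "0 \<le> (SUP x. (1 + norm x) ^ m * norm (iterated_partial bs g x))" .
    qed
    have "norm (f g) \<le> C * schwartz_seminorm m g" by (rule C[OF g])
    also have "\<dots> \<le> \<bar>C\<bar> * schwartz_seminorm m g" using nn by (intro mult_right_mono) auto
    also have "\<dots> \<le> \<bar>C\<bar> * (\<Sum>bs\<in>?A. B)" using le by (intro mult_left_mono) auto
    finally show "norm (f g) \<le> \<bar>C\<bar> * card ?A * B" by simp
  qed simp
qed

lemma iterated_partial_reflect:
  assumes "\<psi> \<in> schwartz" "set bs \<subseteq> Basis"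
  shows "iterated_partial bs (\<lambda>w. \<psi> (y - w)) = (\<lambda>w. (- 1) ^ length bs * iterated_partial bs \<psi> (y - w))"
  using assms(2)
proof (induction bs)
  case (Cons b bs)
  have s: "iterated_partial bs \<psi> \<in> schwartz" using Cons.prems by (auto intro: schwartz_iterated_partial assms)
  have "partial_derivative b (\<lambda>w. (- 1) ^ length bs * iterated_partial bs \<psi> (y - w)) =
    partial_derivative b (\<lambda>w. 0 + (- 1) ^ length bs * iterated_partial bs \<psi> (y - w))" by simp
  also have "\<dots> = (\<lambda>w. partial_derivative b (\<lambda>w. 0) w + (- 1) ^ length bs * partial_derivative b (\<lambda>w. iterated_partial bs \<psi> (y - w)) w)"
    by (rule partial_derivative_lin) (auto intro: schwartz_differentiable schwartz_reflect s)
  also have "partial_derivative b (\<lambda>w::'a. 0 :: complex) = (\<lambda>w. 0)"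
    by (intro ext) (subst partial_derivative_eq[of _ "\<lambda>_. 0"], auto)
  finally show ?case using Cons by (simp add: partial_reflect(2)[OF schwartz_differentiable[OF s]])
qed simp

lemma schwartz_uniform_lipschitz:
  fixes \<psi> :: "'a::euclidean_space \<Rightarrow> complex"
  assumes \<psi>: "\<psi> \<in> schwartz"
  obtains L where "L \<ge> 0" "\<And>bs y y' w. set bs \<subseteq> Basis \<Longrightarrow> length bs \<le> n \<Longrightarrow>
    (1 + norm w) ^ m * norm (iterated_partial bs \<psi> (y - w) - iterated_partial bs \<psi> (y' - w)) \<le>
      L * norm (y - y') * (1 + norm y + norm y') ^ m"
proof -
  let ?A = "{bs :: 'a list. set bs \<subseteq> Basis \<and> length bs \<le> n}"
  have "\<forall>bs\<in>?A. \<exists>L\<ge>0. \<forall>y y' w. (1 + norm w) ^ m * norm (iterated_partial bs \<psi> (y - w) - iterated_partial bs \<psi> (y' - w)) \<le>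
      L * norm (y - y') * (1 + norm y + norm y') ^ m"
  proof
    fix bs assume "bs \<in> ?A"
    then have "iterated_partial bs \<psi> \<in> schwartz" by (auto intro: schwartz_iterated_partial \<psi>)
    then show "\<exists>L\<ge>0. \<forall>y y' w. (1 + norm w) ^ m * norm (iterated_partial bs \<psi> (y - w) - iterated_partial bs \<psi> (y' - w)) \<le>
      L * norm (y - y') * (1 + norm y + norm y') ^ m"
      by (rule schwartz_weighted_lipschitz[where m = m]) blast
  qed
  from bchoice[OF this] obtain L where L': "\<forall>bs\<in>?A. L bs \<ge> 0 \<and> (\<forall>y y' w. (1 + norm w) ^ m *
      norm (iterated_partial bs \<psi> (y - w) - iterated_partial bs \<psi> (y' - w)) \<le>
      L bs * norm (y - y') * (1 + norm y + norm y') ^ m)" ..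
  have L0: "L bs \<ge> 0" if "bs \<in> ?A" for bs using bspec[OF L' that] by (rule conjunct1)
  have L: "(1 + norm w) ^ m * norm (iterated_partial bs \<psi> (y - w) - iterated_partial bs \<psi> (y' - w)) \<le>
      L bs * norm (y - y') * (1 + norm y + norm y') ^ m" if "bs \<in> ?A" for bs and y y' w :: 'a
    using conjunct2[OF bspec[OF L' that]] by (elim allE)
  have fin: "finite ?A" by (rule finite_lists_length_le) simp
  show ?thesis
  proof (rule that)
    show "0 \<le> sum L ?A" by (intro sum_nonneg L0)
    fix bs :: "'a list" and y y' w :: 'a assume "set bs \<subseteq> Basis" "length bs \<le> n"
    then have bs: "bs \<in> ?A" by simp
    have "L bs \<le> sum L ?A" using bs fin L0 by (intro member_le_sum) auto
    then have "L bs * norm (y - y') * (1 + norm y + norm y') ^ m \<le> sum L ?A * norm (y - y') * (1 + norm y + norm y') ^ m"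
      by (intro mult_right_mono) auto
    with L[OF bs, of w y y'] show "(1 + norm w) ^ m * norm (iterated_partial bs \<psi> (y - w) - iterated_partial bs \<psi> (y' - w)) \<le>
      sum L ?A * norm (y - y') * (1 + norm y + norm y') ^ m" by simp
  qed
qed

text \<open>A single estimate that yields both continuity of the convolution and, by comparison with
  the point 0, its polynomial growth.\<close>

lemma convolution_lipschitz:
  fixes f :: "('a::euclidean_space \<Rightarrow> complex) \<Rightarrow> complex"
  assumes f: "f \<in> tempered_distributions" and \<psi>: "\<psi> \<in> schwartz"
  obtains L m where "L \<ge> 0" "\<And>y y'. norm ((f \<star> \<psi>) y - (f \<star> \<psi>) y') \<le> L * norm (y - y') * (1 + norm y + norm y') ^ m"
proof -
  obtain C m where C: "C \<ge> 0" "\<And>g B. g \<in> schwartz \<Longrightarrow>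
      (\<And>bs w. set bs \<subseteq> Basis \<Longrightarrow> length bs \<le> m \<Longrightarrow> (1 + norm w) ^ m * norm (iterated_partial bs g w) \<le> B) \<Longrightarrow>
      norm (f g) \<le> C * B"
    using tempered_bound[OF f] by blast
  obtain L where L: "L \<ge> 0" "\<And>bs y y' w. set bs \<subseteq> Basis \<Longrightarrow> length bs \<le> m \<Longrightarrow>
    (1 + norm w) ^ m * norm (iterated_partial bs \<psi> (y - w) - iterated_partial bs \<psi> (y' - w)) \<le>
      L * norm (y - y') * (1 + norm y + norm y') ^ m"
    using schwartz_uniform_lipschitz[OF \<psi>] by blast
  show ?thesis
  proof (rule that)
    show "0 \<le> C * L" using C L by simp
    fix y y'
    let ?g = "\<lambda>w. \<psi> (y - w) + (- 1) * \<psi> (y' - w)"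
    have sy: "(\<lambda>w. \<psi> (y - w)) \<in> schwartz" for y by (rule schwartz_reflect[OF \<psi>])
    have "norm (f ?g) \<le> C * (L * norm (y - y') * (1 + norm y + norm y') ^ m)"
    proof (rule C(2))
      show "?g \<in> schwartz" by (intro schwartz_add schwartz_scale sy)
      fix bs :: "'a list" and w assume bs: "set bs \<subseteq> Basis" "length bs \<le> m"
      have "iterated_partial bs ?g w = (- 1) ^ length bs * (iterated_partial bs \<psi> (y - w) - iterated_partial bs \<psi> (y' - w))"
        by (simp only: iterated_partial_lin[OF sy sy bs(1)] iterated_partial_reflect[OF \<psi> bs(1)])
          (simp add: algebra_simps)
      then show "(1 + norm w) ^ m * norm (iterated_partial bs ?g w) \<le> L * norm (y - y') * (1 + norm y + norm y') ^ m"
        using L(2)[OF bs, of w y y'] by (simp add: norm_mult norm_power)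
    qed
    moreover have "f ?g = (f \<star> \<psi>) y + (- 1) * (f \<star> \<psi>) y'"
      unfolding dist_convolution_def
      by (simp only: tempered_add[OF f sy schwartz_scale[OF sy]] tempered_scale[OF f sy])
    ultimately show "norm ((f \<star> \<psi>) y - (f \<star> \<psi>) y') \<le> C * L * norm (y - y') * (1 + norm y + norm y') ^ m"
      by (simp add: mult.assoc)
  qed
qed

lemma convolution_continuous:
  assumes f: "f \<in> tempered_distributions" and \<psi>: "\<psi> \<in> schwartz"
  shows "isCont (f \<star> \<psi>) y"
proof -
  obtain L m where L: "L \<ge> 0" "\<And>y y'. norm ((f \<star> \<psi>) y - (f \<star> \<psi>) y') \<le> L * norm (y - y') * (1 + norm y + norm y') ^ m"
    using convolution_lipschitz[OF f \<psi>] by blast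
  have "((\<lambda>x. (f \<star> \<psi>) x - (f \<star> \<psi>) y) \<longlongrightarrow> 0) (at y)"
  proof (rule Lim_null_comparison)
    show "\<forall>\<^sub>F x in at y. norm ((f \<star> \<psi>) x - (f \<star> \<psi>) y) \<le> L * norm (x - y) * (1 + norm x + norm y) ^ m"
      using L by (intro always_eventually) auto
    show "((\<lambda>x. L * norm (x - y) * (1 + norm x + norm y) ^ m) \<longlongrightarrow> 0) (at y)"
      by (auto intro!: tendsto_eq_intros)
  qed
  then show ?thesis by (simp add: isCont_def LIM_zero_iff)
qed

lemma convolution_measurable:
  assumes f: "f \<in> tempered_distributions" and \<psi>: "\<psi> \<in> schwartz"
  shows "f \<star> \<psi> \<in> borel_measurable borel"
  using convolution_continuous[OF assms]
  by (intro borel_measurable_continuous_onI) (auto simp: continuous_on_eq_continuous_at)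

lemma convolution_poly_bounded:
  assumes f: "f \<in> tempered_distributions" and \<psi>: "\<psi> \<in> schwartz"
  shows "poly_bounded (f \<star> \<psi>)"
proof -
  obtain L m where L: "L \<ge> 0" "\<And>y y'. norm ((f \<star> \<psi>) y - (f \<star> \<psi>) y') \<le> L * norm (y - y') * (1 + norm y + norm y') ^ m"
    using convolution_lipschitz[OF f \<psi>] by blast
  have "norm ((f \<star> \<psi>) y) \<le> (norm ((f \<star> \<psi>) 0) + L) * (1 + norm y) ^ Suc m" for y
  proof -
    have "norm ((f \<star> \<psi>) y) \<le> norm ((f \<star> \<psi>) 0) + norm ((f \<star> \<psi>) y - (f \<star> \<psi>) 0)"
      by (metis add.commute diff_add_cancel norm_triangle_ineq)
    also have "norm ((f \<star> \<psi>) y - (f \<star> \<psi>) 0) \<le> L * norm y * (1 + norm y) ^ m"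
      using L(2)[of y 0] by simp
    also have "\<dots> \<le> L * (1 + norm y) * (1 + norm y) ^ m"
      using L(1) by (intro mult_right_mono mult_left_mono) auto
    also have "norm ((f \<star> \<psi>) 0) \<le> norm ((f \<star> \<psi>) 0) * (1 + norm y) ^ Suc m"
      using one_le_power[of "1 + norm y" "Suc m"] by (intro mult_le_cancel_left1[THEN iffD2]) auto
    finally show ?thesis by (simp add: algebra_simps)
  qed
  then show ?thesis unfolding poly_bounded_def by blast
qed

text \<open>A distribution commutes with finite sums, and its continuity extends this to the
  integral. With y replaced by a simple function \<open>F n y\<close> inside the kernel both sides
  become the same finite sum. The left side converges by dominated convergence, the right side
  because the relevant seminorms of the difference of the correlations tend to 0.\<close>

theorem tempered_correlate:
  fixes f :: "('a::euclidean_space \<Rightarrow> complex) \<Rightarrow> complex"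
  assumes f: "f \<in> tempered_distributions" and \<psi>: "\<psi> \<in> schwartz"
    and \<rho> [measurable]: "\<rho> \<in> borel_measurable borel" and \<rho>_rapid: "rapidly_decreasing \<rho>"
  shows "(\<integral>y. (f \<star> \<psi>) y * \<rho> y \<partial>lborel) = f (\<lambda>w. \<integral>y. \<psi> (y - w) * \<rho> y \<partial>lborel)"
proof -
  obtain F :: "nat \<Rightarrow> 'a \<Rightarrow> 'a" where F: "\<And>n. simple_function lborel (F n)"
    "\<And>y. (\<lambda>n. F n y) \<longlonglongrightarrow> y" "\<And>n y. norm (F n y) \<le> 2 * norm y"
  proof -
    have "(\<lambda>y::'a. y) \<in> borel_measurable lborel" by simp
    from borel_measurable_implies_sequence_metric[OF this, of 0] show ?thesis
      using that by (auto simp: dist_norm)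
  qed
  have Fm [measurable]: "F n \<in> borel_measurable borel" for n
    using borel_measurable_simple_function[OF F(1)] by simp
  have fin: "finite (range (F n))" for n using F(1)[of n] by (simp add: simple_function_def)
  note \<sigma> = Fm F(3) \<rho> \<rho>_rapid
  have id: "(\<lambda>y::'a. y) \<in> borel_measurable borel" "norm ((\<lambda>y. y) y) \<le> 2 * norm y" for y :: 'a by auto
  define r where "r n c = (\<integral>y. indicator {y. F n y = c} y * \<rho> y \<partial>lborel)" for n c
  have i\<rho>: "integrable lborel \<rho>" by (intro rapidly_decreasing_integrable \<rho>_rapid \<rho>)
  \<comment> \<open>As \<open>F n\<close> has finite range, the integral splits over its level sets,
    with the weights \<open>r n c\<close>.\<close>
  have step: "(\<integral>y. G (F n y) * \<rho> y \<partial>lborel) = (\<Sum>c\<in>range (F n). r n c * G c)" for n and G :: "'a \<Rightarrow> complex"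
  proof -
    have i: "integrable lborel (\<lambda>y. G c * (indicator {y. F n y = c} y * \<rho> y))" for c
    proof (intro integrable_mult_right Bochner_Integration.integrable_bound[OF i\<rho>])
      show "AE y in lborel. norm (indicator {y. F n y = c} y * \<rho> y) \<le> norm (\<rho> y)"
        by (intro AE_I2) (auto simp: norm_mult indicator_def)
    qed measurable
    have "G (F n y) * \<rho> y = (\<Sum>c\<in>range (F n). G c * (indicator {y. F n y = c} y * \<rho> y))" for y
    proof -
      have "(\<Sum>c\<in>range (F n). G c * (indicator {y. F n y = c} y * \<rho> y)) =
          (\<Sum>c\<in>range (F n). if c = F n y then G c * \<rho> y else 0)"
        by (intro sum.cong) (auto simp: indicator_def)
      then show ?thesis using fin[of n] by (simp add: sum.delta')
    qed
    then have "(\<integral>y. G (F n y) * \<rho> y \<partial>lborel) = (\<Sum>c\<in>range (F n). \<integral>y. G c * (indicator {y. F n y = c} y * \<rho> y) \<partial>lborel)"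
      using i by (simp add: Bochner_Integration.integral_sum)
    then show ?thesis by (simp add: r_def mult.commute)
  qed
  have fF: "f (correlate (F n) \<rho> \<psi>) = (\<integral>y. (f \<star> \<psi>) (F n y) * \<rho> y \<partial>lborel)" for n
  proof -
    have "correlate (F n) \<rho> \<psi> = (\<lambda>w. \<Sum>c\<in>range (F n). r n c * \<psi> (c - w))"
      unfolding correlate_def by (intro ext) (rule step[of "\<lambda>c. \<psi> (c - _)"])
    then have "f (correlate (F n) \<rho> \<psi>) = (\<Sum>c\<in>range (F n). r n c * f (\<lambda>w. \<psi> (c - w)))"
      by (simp only:) (rule tempered_sum[OF f fin schwartz_reflect[OF \<psi>]])
    also have "\<dots> = (\<integral>y. (f \<star> \<psi>) (F n y) * \<rho> y \<partial>lborel)"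
      unfolding step by (simp add: dist_convolution_def)
    finally show ?thesis .
  qed
  obtain D k where D: "\<And>y. norm ((f \<star> \<psi>) y) \<le> D * (1 + norm y) ^ k"
    using convolution_poly_bounded[OF f \<psi>] unfolding poly_bounded_def by blast
  have D0: "0 \<le> D" using order_trans[OF norm_ge_zero D[of 0]] by simp
  have fm [measurable]: "f \<star> \<psi> \<in> borel_measurable borel" by (rule convolution_measurable[OF f \<psi>])
  have lim1: "(\<lambda>n. \<integral>y. (f \<star> \<psi>) (F n y) * \<rho> y \<partial>lborel) \<longlonglongrightarrow> (\<integral>y. (f \<star> \<psi>) y * \<rho> y \<partial>lborel)"
  proof (rule integral_dominated_convergence)
    show "integrable lborel (\<lambda>y. D * 2 ^ k * ((1 + norm y) ^ k * norm (\<rho> y)))"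
      by (intro integrable_mult_right rapidly_decreasing_integrable_weight \<rho>_rapid \<rho>)
    show "AE y in lborel. (\<lambda>n. (f \<star> \<psi>) (F n y) * \<rho> y) \<longlonglongrightarrow> (f \<star> \<psi>) y * \<rho> y"
      by (intro AE_I2 tendsto_intros isCont_tendsto_compose[OF convolution_continuous[OF f \<psi>]] F(2))
    show "AE y in lborel. norm ((f \<star> \<psi>) (F n y) * \<rho> y) \<le> D * 2 ^ k * ((1 + norm y) ^ k * norm (\<rho> y))" for n
    proof (rule AE_I2)
      fix y
      have "norm ((f \<star> \<psi>) (F n y)) \<le> D * (1 + norm (F n y)) ^ k" by (rule D)
      also have "\<dots> \<le> D * (2 * (1 + norm y)) ^ k"
        using F(3)[of n y] by (intro mult_left_mono power_mono D0) auto
      finally have "norm ((f \<star> \<psi>) (F n y)) * norm (\<rho> y) \<le> D * (2 * (1 + norm y)) ^ k * norm (\<rho> y)"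
        by (rule mult_right_mono) simp
      then show "norm ((f \<star> \<psi>) (F n y) * \<rho> y) \<le> D * 2 ^ k * ((1 + norm y) ^ k * norm (\<rho> y))"
        by (simp only: norm_mult power_mult_distrib mult_ac)
    qed
  qed measurable
  obtain C m where C: "C \<ge> 0" "\<And>g B. g \<in> schwartz \<Longrightarrow>
      (\<And>bs w. set bs \<subseteq> Basis \<Longrightarrow> length bs \<le> m \<Longrightarrow> (1 + norm w) ^ m * norm (iterated_partial bs g w) \<le> B) \<Longrightarrow>
      norm (f g) \<le> C * B"
    using tempered_bound[OF f] by blast
  obtain L where L: "L \<ge> 0" "\<And>bs y y' w. set bs \<subseteq> Basis \<Longrightarrow> length bs \<le> m \<Longrightarrow>
    (1 + norm w) ^ m * norm (iterated_partial bs \<psi> (y - w) - iterated_partial bs \<psi> (y' - w)) \<le>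
      L * norm (y - y') * (1 + norm y + norm y') ^ m"
    using schwartz_uniform_lipschitz[OF \<psi>] by blast
  \<comment> \<open>A majorant of the weighted integrand of the difference of correlations, uniform
    in w and in the multi-index. Its integral therefore bounds all the seminorms involved.\<close>
  define E where "E n y = L * norm (F n y - y) * (1 + norm (F n y) + norm y) ^ m * norm (\<rho> y)" for n y
  have E_le: "norm (E n y) \<le> L * 3 * 3 ^ m * ((1 + norm y) ^ (Suc m) * norm (\<rho> y))" for n y
  proof -
    have "norm (F n y - y) \<le> norm (F n y) + norm y" by (rule norm_triangle_ineq4)
    then have 1: "norm (F n y - y) \<le> 3 * (1 + norm y)" using F(3)[of n y] by simp
    have "(1 + norm (F n y) + norm y) ^ m \<le> (3 * (1 + norm y)) ^ m"
      using F(3)[of n y] by (intro power_mono) auto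
    with 1 have "L * norm (F n y - y) * (1 + norm (F n y) + norm y) ^ m * norm (\<rho> y) \<le>
        L * (3 * (1 + norm y)) * (3 * (1 + norm y)) ^ m * norm (\<rho> y)"
      using L(1) by (intro mult_right_mono mult_mono) auto
    also have "\<dots> = L * 3 * 3 ^ m * ((1 + norm y) ^ (Suc m) * norm (\<rho> y))"
      by (simp only: power_mult_distrib power_Suc mult_ac)
    finally show ?thesis using L(1) by (simp add: E_def abs_mult)
  qed
  have E_int: "integrable lborel (\<lambda>y. L * 3 * 3 ^ m * ((1 + norm y) ^ (Suc m) * norm (\<rho> y)))"
    by (intro integrable_mult_right rapidly_decreasing_integrable_weight \<rho>_rapid \<rho>)
  have Em [measurable]: "E n \<in> borel_measurable borel" for n unfolding E_def[abs_def] by measurable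
  have iE: "integrable lborel (E n)" for n
    by (rule Bochner_Integration.integrable_bound[OF E_int])
      (use E_le in \<open>auto intro!: AE_I2 intro: order_trans[OF _ abs_ge_self]\<close>)
  have limE: "(\<lambda>n. \<integral>y. E n y \<partial>lborel) \<longlonglongrightarrow> (\<integral>y. 0 \<partial>(lborel :: 'a measure))"
  proof (rule integral_dominated_convergence[OF _ _ E_int])
    show "AE y in lborel. (\<lambda>n. E n y) \<longlonglongrightarrow> 0"
    proof (rule AE_I2)
      fix y
      have "(\<lambda>n. E n y) \<longlonglongrightarrow> L * norm (y - y) * (1 + norm y + norm y) ^ m * norm (\<rho> y)"
        unfolding E_def by (intro tendsto_intros F(2))
      then show "(\<lambda>n. E n y) \<longlonglongrightarrow> 0" by simp
    qed
  qed (use E_le in auto)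
  have diff: "norm (f (correlate (F n) \<rho> \<psi>) - f (correlate (\<lambda>y. y) \<rho> \<psi>)) \<le> C * (\<integral>y. E n y \<partial>lborel)" for n
  proof -
    let ?g = "\<lambda>w. correlate (F n) \<rho> \<psi> w + (- 1) * correlate (\<lambda>y. y) \<rho> \<psi> w"
    have s1: "correlate (F n) \<rho> u \<in> schwartz" and s2: "correlate (\<lambda>y. y) \<rho> u \<in> schwartz" if "u \<in> schwartz" for u
      by (rule schwartz_correlate[OF \<sigma> that]) (rule schwartz_correlate[OF id \<rho> \<rho>_rapid that])
    have "norm (f ?g) \<le> C * (\<integral>y. E n y \<partial>lborel)"
    proof (rule C(2))
      show "?g \<in> schwartz" by (intro schwartz_add schwartz_scale s1 s2 \<psi>)
      fix bs :: "'a list" and w assume bs: "set bs \<subseteq> Basis" "length bs \<le> m"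
      let ?p = "iterated_partial bs \<psi>"
      have p: "?p \<in> schwartz" by (rule schwartz_iterated_partial[OF \<psi> bs(1)])
      have "iterated_partial bs ?g w = (- 1) ^ length bs * (correlate (F n) \<rho> ?p w - correlate (\<lambda>y. y) \<rho> ?p w)"
        by (simp only: iterated_partial_lin[OF s1[OF \<psi>] s2[OF \<psi>] bs(1)] iterated_partial_correlate[OF \<sigma> \<psi> bs(1)]
            iterated_partial_correlate[OF id \<rho> \<rho>_rapid \<psi> bs(1)]) (simp add: algebra_simps)
      then have "(1 + norm w) ^ m * norm (iterated_partial bs ?g w) =
          (1 + norm w) ^ m * norm (correlate (F n) \<rho> ?p w - correlate (\<lambda>y. y) \<rho> ?p w)"
        by (simp add: norm_mult norm_power)
      also have "correlate (F n) \<rho> ?p w - correlate (\<lambda>y. y) \<rho> ?p w =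
          (\<integral>y. ?p (F n y - w) * \<rho> y - ?p (y - w) * \<rho> y \<partial>lborel)"
        unfolding correlate_def
        by (rule Bochner_Integration.integral_diff[symmetric])
          (rule integrable_correlate[OF \<sigma> p], rule integrable_correlate[OF id \<rho> \<rho>_rapid p])
      finally have eq: "(1 + norm w) ^ m * norm (iterated_partial bs ?g w) =
          (1 + norm w) ^ m * norm (\<integral>y. ?p (F n y - w) * \<rho> y - ?p (y - w) * \<rho> y \<partial>lborel)" .
      have cw: "norm (complex_of_real ((1 + norm w) ^ m)) = (1 + norm w) ^ m"
        by (subst norm_of_real) simp
      have "(1 + norm w) ^ m * norm (iterated_partial bs ?g w) =
          norm (\<integral>y. complex_of_real ((1 + norm w) ^ m) * (?p (F n y - w) * \<rho> y - ?p (y - w) * \<rho> y) \<partial>lborel)"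
        unfolding eq by (simp only: integral_mult_right_zero norm_mult cw)
      also have "\<dots> \<le> (\<integral>y. E n y \<partial>lborel)"
      proof (rule Bochner_Integration.integral_norm_bound_integral[OF _ iE])
        show "integrable lborel (\<lambda>y. complex_of_real ((1 + norm w) ^ m) * (?p (F n y - w) * \<rho> y - ?p (y - w) * \<rho> y))"
          by (intro integrable_mult_right Bochner_Integration.integrable_diff)
            (rule integrable_correlate[OF \<sigma> p], rule integrable_correlate[OF id \<rho> \<rho>_rapid p])
        fix y
        have "norm (complex_of_real ((1 + norm w) ^ m) * (?p (F n y - w) * \<rho> y - ?p (y - w) * \<rho> y)) =
            (1 + norm w) ^ m * norm (?p (F n y - w) - ?p (y - w)) * norm (\<rho> y)"
          by (simp only: left_diff_distrib[symmetric] norm_mult cw mult.assoc)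
        also have "\<dots> \<le> E n y"
          unfolding E_def by (intro mult_right_mono L(2) bs) auto
        finally show "norm (complex_of_real ((1 + norm w) ^ m) * (?p (F n y - w) * \<rho> y - ?p (y - w) * \<rho> y)) \<le> E n y" .
      qed
      finally show "(1 + norm w) ^ m * norm (iterated_partial bs ?g w) \<le> (\<integral>y. E n y \<partial>lborel)" .
    qed
    moreover have "f ?g = f (correlate (F n) \<rho> \<psi>) + (- 1) * f (correlate (\<lambda>y. y) \<rho> \<psi>)"
      by (simp only: tempered_add[OF f s1[OF \<psi>] schwartz_scale[OF s2[OF \<psi>]]] tempered_scale[OF f s2[OF \<psi>]])
    ultimately show ?thesis by simp
  qed
  have "(\<lambda>n. f (correlate (F n) \<rho> \<psi>) - f (correlate (\<lambda>y. y) \<rho> \<psi>)) \<longlonglongrightarrow> 0"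
  proof (rule Lim_null_comparison)
    show "\<forall>\<^sub>F n in sequentially. norm (f (correlate (F n) \<rho> \<psi>) - f (correlate (\<lambda>y. y) \<rho> \<psi>)) \<le> C * (\<integral>y. E n y \<partial>lborel)"
      using diff by (intro always_eventually) auto
    show "(\<lambda>n. C * (\<integral>y. E n y \<partial>lborel)) \<longlonglongrightarrow> 0"
      using tendsto_mult_left[OF limE, of C] by simp
  qed
  then have "(\<lambda>n. f (correlate (F n) \<rho> \<psi>)) \<longlonglongrightarrow> f (correlate (\<lambda>y. y) \<rho> \<psi>)"
    by (simp add: LIM_zero_iff)
  then have "f (correlate (\<lambda>y. y) \<rho> \<psi>) = (\<integral>y. (f \<star> \<psi>) y * \<rho> y \<partial>lborel)"
    using lim1 unfolding fF by (rule LIMSEQ_unique)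
  then show ?thesis by (simp add: correlate_def[abs_def])
qed

section \<open>The convolution theorem and spectra of products\<close>

lemma multiplication_formula_fourier:
  assumes u: "u \<in> schwartz" and v: "v \<in> schwartz"
  shows "(\<integral>x. u x * fourier v x \<partial>lborel) = (\<integral>\<xi>. fourier u \<xi> * v \<xi> \<partial>lborel)"
proof -
  have m: "u \<in> borel_measurable borel" "inverse_fourier v \<in> borel_measurable borel"
    by (auto intro: schwartz_measurable schwartz_inverse_fourier u v)
  have r: "(\<lambda>x. u (- x)) \<in> schwartz" using schwartz_reflect[OF u, of 0] by simp
  have "(\<integral>x. u x * fourier v x \<partial>lborel) = (\<integral>x. u (0 - x) * fourier v (0 - x) \<partial>lborel)"
    by (rule lborel_integral_reflect[symmetric])
      (intro borel_measurable_times m schwartz_measurable schwartz_fourier v)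
  also have "\<dots> = (\<integral>x. u (- x) * inverse_fourier v x \<partial>lborel)"
    by (simp add: fourier_eq_inverse_fourier)
  also have "\<dots> = (\<integral>\<xi>. inverse_fourier (\<lambda>x. u (- x)) \<xi> * v \<xi> \<partial>lborel)"
    by (rule multiplication_formula) (intro schwartz_integrable r v)+
  finally have eq: "(\<integral>x. u x * fourier v x \<partial>lborel) = (\<integral>\<xi>. inverse_fourier (\<lambda>x. u (- x)) \<xi> * v \<xi> \<partial>lborel)" .
  have "inverse_fourier (\<lambda>x. u (- x)) \<xi> = fourier u \<xi>" for \<xi>
  proof -
    have "fourier u \<xi> = (\<integral>x. u (0 - x) * wave (- \<xi>) (0 - x) \<partial>lborel)"
      unfolding fourier_wave
      by (rule lborel_integral_reflect[symmetric]) (intro borel_measurable_times m wave_measurable, auto)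
    then show ?thesis by (simp add: inverse_fourier_wave wave_minus wave_commute)
  qed
  then show ?thesis unfolding eq by simp
qed

lemma schwartz_mult_wave: "v \<in> schwartz \<Longrightarrow> (\<lambda>\<xi>. v \<xi> * wave \<xi> z) \<in> schwartz"
  using schwartz_mult[OF slowly_increasing_wave] by (simp add: mult.commute)

lemma inverse_fourier_reflect: "inverse_fourier v (z - y) = fourier (\<lambda>\<xi>. v \<xi> * wave \<xi> z) y"
  by (simp add: inverse_fourier_wave fourier_wave wave_add_right[of _ z "- y", simplified] wave_minus wave_commute[of y] wave_commute[of "- y"] mult.assoc)

text \<open>A reflected and translated inverse transform is the Fourier transform of a modulated
  function, so the multiplication formula and inversion give the claim.\<close>

lemma convolution_inverse_fourier:
  assumes u: "u \<in> schwartz" and v: "v \<in> schwartz"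
  shows "(\<integral>y. inverse_fourier u y * inverse_fourier v (z - y) \<partial>lborel) = inverse_fourier (\<lambda>\<xi>. u \<xi> * v \<xi>) z"
  unfolding inverse_fourier_reflect multiplication_formula_fourier[OF schwartz_inverse_fourier[OF u] schwartz_mult_wave[OF v]]
    fourier_inverse_fourier[OF u] by (simp add: inverse_fourier_wave mult.assoc)

text \<open>Once f has been moved outside the integral, what remains is the convolution of two
  Schwartz functions, translated by w.\<close>

theorem tempered_convolution_inverse_fourier:
  assumes f: "f \<in> tempered_distributions" and u: "u \<in> schwartz" and v: "v \<in> schwartz"
  shows "(\<integral>y. (f \<star> inverse_fourier u) y * inverse_fourier v (x - y) \<partial>lborel) = (f \<star> inverse_fourier (\<lambda>\<xi>. u \<xi> * v \<xi>)) x"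
proof -
  have s: "(\<lambda>y. inverse_fourier v (x - y)) \<in> schwartz"
    by (intro schwartz_reflect schwartz_inverse_fourier v)
  have m: "inverse_fourier u \<in> borel_measurable borel" "inverse_fourier v \<in> borel_measurable borel"
    by (auto intro: schwartz_measurable schwartz_inverse_fourier u v)
  have "(\<integral>y. inverse_fourier u (y - w) * inverse_fourier v (x - y) \<partial>lborel) = inverse_fourier (\<lambda>\<xi>. u \<xi> * v \<xi>) (x - w)" for w
  proof -
    have "(\<integral>y. inverse_fourier u (y - w) * inverse_fourier v (x - y) \<partial>lborel) =
        (\<integral>y. inverse_fourier u ((w + y) - w) * inverse_fourier v (x - (w + y)) \<partial>lborel)"
      by (rule lborel_integral_translate[symmetric])
        (intro borel_measurable_times measurable_compose[OF _ m(1)] measurable_compose[OF _ m(2)], auto)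
    then show ?thesis
      using convolution_inverse_fourier[OF u v, of "x - w"] by (simp add: diff_diff_eq)
  qed
  then show ?thesis
    using tempered_correlate[OF f schwartz_inverse_fourier[OF u] schwartz_measurable[OF s] schwartz_rapidly_decreasing[OF s]]
    by (simp add: dist_convolution_def)
qed

text \<open>If \<open>\<kappa> = 1\<close> on the difference of the spectra, then the product \<open>y \<mapsto> (f \<star> u\<^sup>\<or>) y \<cdot> v\<^sup>\<or> (x - y)\<close> is
  reproduced by convolution with \<open>\<kappa>\<^sup>\<or>\<close>.\<close>

lemma inverse_fourier_product_reproducing:
  assumes u: "u \<in> schwartz" and v: "v \<in> schwartz" and \<kappa>: "\<kappa> \<in> schwartz"
    and one: "\<And>\<xi> \<eta>. u \<xi> \<noteq> 0 \<Longrightarrow> v \<eta> \<noteq> 0 \<Longrightarrow> \<kappa> (\<xi> - \<eta>) = 1"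
  shows "(\<integral>y. inverse_fourier u y * inverse_fourier v (x - y) * inverse_fourier \<kappa> (z - y) \<partial>lborel) =
    inverse_fourier u z * inverse_fourier v (x - z)"
proof -
  define V where "V = (\<lambda>\<eta>. v \<eta> * wave \<eta> x)"
  have V: "V \<in> schwartz" unfolding V_def by (rule schwartz_mult_wave[OF v])
  have vV: "inverse_fourier v (x - y) = fourier V y" for y
    unfolding V_def by (rule inverse_fourier_reflect)
  have m: "inverse_fourier u \<in> borel_measurable borel" "u \<in> borel_measurable borel"
    by (auto intro: schwartz_measurable schwartz_inverse_fourier u)
  have s: "(\<lambda>y. inverse_fourier u y * inverse_fourier \<kappa> (z - y)) \<in> schwartz"
    by (intro schwartz_mult' schwartz_reflect schwartz_inverse_fourier u \<kappa>)
  \<comment> \<open>Multiplication by the character of -\<eta> shifts u by \<eta>. For \<eta> in the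
    support of v the function \<kappa> equals 1 wherever the shifted u is nonzero, so convolution
    with the kernel reproduces it.\<close>
  have F: "fourier (\<lambda>y. inverse_fourier u y * inverse_fourier \<kappa> (z - y)) \<eta> * V \<eta> =
      inverse_fourier u z * wave (- \<eta>) z * V \<eta>" for \<eta>
  proof (cases "v \<eta> = 0")
    case True
    then show ?thesis by (simp add: V_def)
  next
    case False
    have su: "(\<lambda>\<xi>. u (\<eta> + \<xi>)) \<in> schwartz"
      using schwartz_affine[OF u linear_id, of \<eta>] by simp
    have shift: "inverse_fourier u y * wave (- \<eta>) y = inverse_fourier (\<lambda>\<xi>. u (\<eta> + \<xi>)) y" for y
    proof -
      have "inverse_fourier u y = (\<integral>\<xi>. u (\<eta> + \<xi>) * wave (\<eta> + \<xi>) y \<partial>lborel)"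
        unfolding inverse_fourier_wave
        by (rule lborel_integral_translate[symmetric]) (intro borel_measurable_times m wave_measurable, auto)
      moreover have "wave (\<eta> + \<xi>) y * wave (- \<eta>) y = wave \<xi> y" for \<xi>
        by (simp flip: wave_add)
      ultimately show ?thesis
        by (simp add: inverse_fourier_wave mult.assoc flip: integral_mult_left_zero)
    qed
    have "u (\<eta> + \<xi>) * \<kappa> \<xi> = u (\<eta> + \<xi>)" for \<xi>
      using one[of "\<eta> + \<xi>" \<eta>] False by (cases "u (\<eta> + \<xi>) = 0") auto
    then have "inverse_fourier u z * wave (- \<eta>) z = inverse_fourier (\<lambda>\<xi>. u (\<eta> + \<xi>) * \<kappa> \<xi>) z"
      unfolding shift by (simp only:)
    also have "\<dots> = (\<integral>y. inverse_fourier (\<lambda>\<xi>. u (\<eta> + \<xi>)) y * inverse_fourier \<kappa> (z - y) \<partial>lborel)"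
      by (rule convolution_inverse_fourier[OF su \<kappa>, symmetric])
    also have "\<dots> = fourier (\<lambda>y. inverse_fourier u y * inverse_fourier \<kappa> (z - y)) \<eta>"
      by (simp add: fourier_wave mult_ac flip: shift)
    finally show ?thesis by simp
  qed
  have "(\<integral>y. inverse_fourier u y * inverse_fourier v (x - y) * inverse_fourier \<kappa> (z - y) \<partial>lborel) =
      (\<integral>y. (inverse_fourier u y * inverse_fourier \<kappa> (z - y)) * fourier V y \<partial>lborel)"
    by (simp add: vV mult_ac)
  also have "\<dots> = (\<integral>\<eta>. inverse_fourier u z * wave (- \<eta>) z * V \<eta> \<partial>lborel)"
    unfolding multiplication_formula_fourier[OF s V] F ..
  also have "\<dots> = (\<integral>\<eta>. inverse_fourier u z * (V \<eta> * wave (- z) \<eta>) \<partial>lborel)"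
  proof -
    have "wave (- \<eta>) z = wave (- z) \<eta>" for \<eta> by (simp add: wave_def inner_commute)
    then show ?thesis by (simp only: mult_ac)
  qed
  also have "\<dots> = inverse_fourier u z * fourier V z"
    unfolding fourier_wave by (rule integral_mult_right_zero)
  finally show ?thesis by (simp add: vV)
qed

text \<open>f is moved outside and the Schwartz case is applied for every translation w. Translating
  the transform of u multiplies u by a character, which changes neither its support nor the
  condition on \<kappa>.\<close>

theorem tempered_product_reproducing:
  assumes f: "f \<in> tempered_distributions" and u: "u \<in> schwartz" and v: "v \<in> schwartz" and \<kappa>: "\<kappa> \<in> schwartz"
    and one: "\<And>\<xi> \<eta>. u \<xi> \<noteq> 0 \<Longrightarrow> v \<eta> \<noteq> 0 \<Longrightarrow> \<kappa> (\<xi> - \<eta>) = 1"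
  shows "(\<integral>y. (f \<star> inverse_fourier u) y * inverse_fourier v (x - y) * inverse_fourier \<kappa> (z - y) \<partial>lborel) =
    (f \<star> inverse_fourier u) z * inverse_fourier v (x - z)"
proof -
  let ?\<rho> = "\<lambda>y. inverse_fourier v (x - y) * inverse_fourier \<kappa> (z - y)"
  have s: "?\<rho> \<in> schwartz"
    by (intro schwartz_mult' schwartz_reflect schwartz_inverse_fourier v \<kappa>)
  have "(\<integral>y. inverse_fourier u (y - w) * ?\<rho> y \<partial>lborel) = inverse_fourier v (x - z) * inverse_fourier u (z - w)" for w
  proof -
    let ?U = "\<lambda>\<xi>. u \<xi> * wave \<xi> (- w)"
    have U: "inverse_fourier u (y - w) = inverse_fourier ?U y" for y
      by (simp add: inverse_fourier_wave wave_add_right[of _ y "- w", simplified] mult_ac)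
    have "(\<integral>y. inverse_fourier ?U y * inverse_fourier v (x - y) * inverse_fourier \<kappa> (z - y) \<partial>lborel) =
        inverse_fourier ?U z * inverse_fourier v (x - z)"
      by (rule inverse_fourier_product_reproducing[OF schwartz_mult_wave[OF u] v \<kappa>]) (use one in auto)
    then show ?thesis by (simp add: U mult_ac)
  qed
  then have "(\<integral>y. (f \<star> inverse_fourier u) y * ?\<rho> y \<partial>lborel) = f (\<lambda>w. inverse_fourier v (x - z) * inverse_fourier u (z - w))"
    using tempered_correlate[OF f schwartz_inverse_fourier[OF u] schwartz_measurable[OF s] schwartz_rapidly_decreasing[OF s]]
    by simp
  also have "\<dots> = inverse_fourier v (x - z) * (f \<star> inverse_fourier u) z"
    unfolding dist_convolution_def by (rule tempered_scale[OF f schwartz_reflect[OF schwartz_inverse_fourier[OF u]]])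
  finally show ?thesis by (simp add: mult_ac)
qed

section \<open>Linear changes of variables\<close>

lemma nn_integral_lborel_translate:
  fixes f :: "'a::euclidean_space \<Rightarrow> ennreal"
  assumes "f \<in> borel_measurable borel"
  shows "(\<integral>\<^sup>+x. f (c + x) \<partial>lborel) = (\<integral>\<^sup>+x. f x \<partial>lborel)"
  using nn_integral_distr[of "(+) c" lborel borel f] assms by (simp add: lborel_distr_plus)

text \<open>Uniqueness of translation invariant measures, by evaluating a double integral in two ways.\<close>

lemma nn_integral_linear_ex:
  fixes T T' :: "'a::euclidean_space \<Rightarrow> 'a"
  assumes T: "linear T" "inj T" and T': "\<And>y. T (T' y) = y"
  obtains c where "c > 0" "\<And>f. f \<in> borel_measurable borel \<Longrightarrow>
    (\<integral>\<^sup>+x. f (T x) \<partial>lborel) = ennreal c * (\<integral>\<^sup>+x. f x \<partial>lborel)"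
proof -
  have [measurable]: "T \<in> borel_measurable borel"
    using T(1) by (intro borel_measurable_continuous_onI linear_continuous_on) (simp add: linear_conv_bounded_linear)
  define g :: "'a \<Rightarrow> ennreal" where "g x = ennreal (exp (- pi * (x \<bullet> x)))" for x
  have [measurable]: "g \<in> borel_measurable borel" unfolding g_def[abs_def] by measurable
  have g1: "(\<integral>\<^sup>+x. g x \<partial>lborel) = 1" unfolding g_def by (rule nn_integral_gaussian)
  \<comment> \<open>The double integral identifies this number as the scaling factor. It is finite
    because a Gaussian composed with an injective linear map is a Schwartz function, and nonzero
    because the integrand is positive.\<close>
  define I where "I = (\<integral>\<^sup>+x. g (- T x) \<partial>lborel)"
  have fin: "I < \<infinity>"
  proof -
    have "(\<lambda>x. gaussian (0 + T x)) \<in> schwartz" by (rule schwartz_affine[OF schwartz_gaussian T])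
    then have "integrable lborel (\<lambda>x. gaussian (T x))" by (auto dest: schwartz_integrable)
    then have "(\<integral>\<^sup>+x. ennreal (norm (gaussian (T x))) \<partial>lborel) < \<infinity>"
      by (simp add: integrable_iff_bounded)
    then show ?thesis by (simp add: I_def g_def gaussian_def)
  qed
  have "I \<noteq> 0"
  proof
    assume "I = 0"
    then have "AE x in lborel. g (- T x) = 0"
      unfolding I_def by (subst (asm) nn_integral_0_iff_AE) auto
    then have "AE x in (lborel :: 'a measure). False" by eventually_elim (simp add: g_def)
    then show False by (simp add: eventually_False ae_filter_eq_bot_iff)
  qed
  with fin obtain c where c: "c > 0" "I = ennreal c"
    by (cases I) (auto simp: less_le)
  show ?thesis
  proof (rule that[OF c(1)])
    fix f :: "'a \<Rightarrow> ennreal" assume [measurable]: "f \<in> borel_measurable borel"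
    have "(\<integral>\<^sup>+x. f (T x) \<partial>lborel) = (\<integral>\<^sup>+y. g y * (\<integral>\<^sup>+x. f (T x) \<partial>lborel) \<partial>lborel)"
      by (simp add: nn_integral_multc g1)
    also have "\<dots> = (\<integral>\<^sup>+y. (\<integral>\<^sup>+x. g y * f (T x + y) \<partial>lborel) \<partial>lborel)"
    proof (rule nn_integral_cong)
      fix y
      have "(\<integral>\<^sup>+x. f (T x) \<partial>lborel) = (\<integral>\<^sup>+x. f (T (T' y + x)) \<partial>lborel)"
        by (rule nn_integral_lborel_translate[symmetric]) measurable
      then show "g y * (\<integral>\<^sup>+x. f (T x) \<partial>lborel) = (\<integral>\<^sup>+x. g y * f (T x + y) \<partial>lborel)"
        by (simp add: linear_add[OF T(1)] T' nn_integral_cmult add.commute)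
    qed
    also have "\<dots> = (\<integral>\<^sup>+x. (\<integral>\<^sup>+y. g y * f (T x + y) \<partial>lborel) \<partial>lborel)"
      by (rule lborel_pair.Fubini') measurable
    also have "\<dots> = (\<integral>\<^sup>+x. (\<integral>\<^sup>+y. f y * g (y - T x) \<partial>lborel) \<partial>lborel)"
    proof (rule nn_integral_cong)
      fix x
      have "(\<integral>\<^sup>+y. g y * f (T x + y) \<partial>lborel) = (\<integral>\<^sup>+y. g (- T x + y) * f (T x + (- T x + y)) \<partial>lborel)"
        by (rule nn_integral_lborel_translate[symmetric]) measurable
      then show "(\<integral>\<^sup>+y. g y * f (T x + y) \<partial>lborel) = (\<integral>\<^sup>+y. f y * g (y - T x) \<partial>lborel)"
        by (simp add: mult.commute)
    qed
    also have "\<dots> = (\<integral>\<^sup>+y. (\<integral>\<^sup>+x. f y * g (y - T x) \<partial>lborel) \<partial>lborel)"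
      by (rule lborel_pair.Fubini') measurable
    also have "\<dots> = (\<integral>\<^sup>+y. f y * I \<partial>lborel)"
    proof (rule nn_integral_cong)
      fix y
      have T_eq: "- T (- T' y + x) = y - T x" for x
        using linear_add[OF T(1), of "- T' y" x] linear_neg[OF T(1), of "T' y"] T' by simp
      have "I = (\<integral>\<^sup>+x. g (- T (- T' y + x)) \<partial>lborel)"
        unfolding I_def by (rule nn_integral_lborel_translate[symmetric]) measurable
      then show "(\<integral>\<^sup>+x. f y * g (y - T x) \<partial>lborel) = f y * I"
        using T_eq by (simp only:) (simp add: nn_integral_cmult)
    qed
    also have "\<dots> = I * (\<integral>\<^sup>+y. f y \<partial>lborel)"
      by (subst nn_integral_multc) (auto simp: mult.commute)
    finally show "(\<integral>\<^sup>+x. f (T x) \<partial>lborel) = ennreal c * (\<integral>\<^sup>+x. f x \<partial>lborel)"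
      unfolding c(2) .
  qed
qed

lemma nn_integral_matrix_ex:
  fixes A :: "real^'d^'d"
  assumes "det A \<noteq> 0"
  obtains c where "c > 0" "\<And>f. f \<in> borel_measurable borel \<Longrightarrow>
    (\<integral>\<^sup>+x. f (A *v x) \<partial>lborel) = ennreal c * (\<integral>\<^sup>+x. f x \<partial>lborel)"
proof -
  obtain A' where A': "A ** A' = mat 1" using assms by (auto simp: invertible_det_nz[symmetric] invertible_def)
  show ?thesis
  proof (rule nn_integral_linear_ex[of "(*v) A" "(*v) A'"])
    show "inj ((*v) A)" using assms by (simp add: invertible_det_nz[symmetric] inj_matrix_vector_mult)
    show "A *v (A' *v y) = y" for y by (simp add: matrix_vector_mul_assoc A')
  qed (use that in auto)
qed

text \<open>The scaling factor is multiplicative, so it suffices to determine it for elementary matrices.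
  A transposition \<open>S\<close> satisfies \<open>S ** S = 1\<close>, and an elementary shear \<open>S\<close> satisfies \<open>D ** S = S ** S ** D\<close>
  for a diagonal matrix \<open>D\<close>; both relations force the factors of \<open>S\<close> to be 1.\<close>

lemma nn_integral_matrix:
  fixes A :: "real^'d^'d"
  assumes "det A \<noteq> 0" "f \<in> borel_measurable borel"
  shows "ennreal \<bar>det A\<bar> * (\<integral>\<^sup>+x. f (A *v x) \<partial>lborel) = (\<integral>\<^sup>+x. f x \<partial>lborel)"
proof -
  have mv [measurable]: "(\<lambda>x. B *v x) \<in> borel_measurable borel" for B :: "real^'d^'d"
    by (intro borel_measurable_continuous_onI linear_continuous_on) simp
  let ?Q = "\<lambda>A::real^'d^'d. \<forall>f\<in>borel_measurable borel. ennreal \<bar>det A\<bar> * (\<integral>\<^sup>+x. f (A *v x) \<partial>lborel) = (\<integral>\<^sup>+x. f x \<partial>lborel)"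
  have diag: "?Q A" if "det A \<noteq> 0" and A: "\<And>i j. i \<noteq> j \<Longrightarrow> A$i$j = 0" for A :: "real^'d^'d"
  proof
    fix f :: "real^'d \<Rightarrow> ennreal" assume [measurable]: "f \<in> borel_measurable borel"
    define c where "c b = (A *v b) \<bullet> b" for b
    have ca: "c (axis i 1) = A $ i $ i" for i
      by (simp add: c_def matrix_vector_mult_basis column_def inner_axis)
    have det: "det A = (\<Prod>i\<in>UNIV. A $ i $ i)" using A by (rule det_diagonal)
    have B: "(Basis :: (real^'d) set) = range (\<lambda>i. axis i 1)" by (auto simp: Basis_vec_def)
    have inj: "inj (\<lambda>i::'d. axis i (1::real))" by (auto simp: inj_on_def axis_eq_axis)
    have prod: "(\<Prod>b\<in>Basis. \<bar>c b\<bar>) = \<bar>det A\<bar>"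
      unfolding B by (simp add: prod.reindex[OF inj] o_def ca det abs_prod)
    have T: "(\<Sum>b\<in>Basis. (c b * (x \<bullet> b)) *\<^sub>R b) = A *v x" for x
    proof -
      have "(\<Sum>b\<in>Basis. (c b * (x \<bullet> b)) *\<^sub>R b) = (\<Sum>i\<in>UNIV. (A $ i $ i * x $ i) *\<^sub>R axis i 1)"
        unfolding B by (simp add: sum.reindex[OF inj] o_def ca inner_axis)
      moreover have "(\<Sum>i\<in>UNIV. (A $ i $ i * x $ i) *\<^sub>R axis i (1::real)) $ k = (A *v x) $ k" for k
        using sum.remove[of UNIV k "\<lambda>j. A $ k $ j * x $ j"]
        by (simp add: A axis_def matrix_vector_mult_def if_distrib cong: if_cong)
      ultimately show ?thesis unfolding vec_eq_iff by simp
    qed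
    have "c b \<noteq> 0" if "b \<in> Basis" for b
      using \<open>det A \<noteq> 0\<close> that prod by (metis abs_zero finite_Basis prod_zero abs_eq_0)
    then have eq: "lborel = density (distr lborel borel (\<lambda>x. 0 + (\<Sum>b\<in>Basis. (c b * (x \<bullet> b)) *\<^sub>R b))) (\<lambda>_. \<Prod>b\<in>Basis. \<bar>c b\<bar>)"
      by (rule lborel_affine_euclidean)
    have "(\<integral>\<^sup>+x. f x \<partial>lborel) = (\<integral>\<^sup>+x. f x \<partial>density (distr lborel borel ((*v) A)) (\<lambda>_. ennreal \<bar>det A\<bar>))"
      by (subst eq) (simp add: T prod)
    also have "\<dots> = ennreal \<bar>det A\<bar> * (\<integral>\<^sup>+x. f (A *v x) \<partial>lborel)"
      by (subst nn_integral_density) (auto simp: nn_integral_cmult nn_integral_distr)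
    finally show "ennreal \<bar>det A\<bar> * (\<integral>\<^sup>+x. f (A *v x) \<partial>lborel) = (\<integral>\<^sup>+x. f x \<partial>lborel)" ..
  qed
  have "det A \<noteq> 0 \<longrightarrow> ?Q A"
  proof (rule induct_matrix_elementary_alt[of "\<lambda>A. det A \<noteq> 0 \<longrightarrow> ?Q A"])
    fix A B :: "real^'d^'d"
    assume A: "det A \<noteq> 0 \<longrightarrow> ?Q A" and B: "det B \<noteq> 0 \<longrightarrow> ?Q B"
    show "det (A ** B) \<noteq> 0 \<longrightarrow> ?Q (A ** B)"
    proof (intro impI ballI)
      fix f :: "real^'d \<Rightarrow> ennreal" assume det: "det (A ** B) \<noteq> 0" and f [measurable]: "f \<in> borel_measurable borel"
      have "(\<lambda>x. f (A *v x)) \<in> borel_measurable borel" by measurable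
      then have "ennreal \<bar>det B\<bar> * (\<integral>\<^sup>+x. f (A *v (B *v x)) \<partial>lborel) = (\<integral>\<^sup>+x. f (A *v x) \<partial>lborel)"
        using det B by (auto simp: det_mul)
      moreover have "ennreal \<bar>det A\<bar> * (\<integral>\<^sup>+x. f (A *v x) \<partial>lborel) = (\<integral>\<^sup>+x. f x \<partial>lborel)"
        using det A f by (auto simp: det_mul)
      ultimately show "ennreal \<bar>det (A ** B)\<bar> * (\<integral>\<^sup>+x. f ((A ** B) *v x) \<partial>lborel) = (\<integral>\<^sup>+x. f x \<partial>lborel)"
        by (simp add: det_mul abs_mult ennreal_mult matrix_vector_mul_assoc mult.assoc)
    qed
  next
    fix A :: "real^'d^'d" and i assume "row i A = 0"
    then show "det A \<noteq> 0 \<longrightarrow> ?Q A" using det_zero_row(2)[of i A] by simp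
  next
    fix A :: "real^'d^'d" assume "\<And>i j. i \<noteq> j \<Longrightarrow> A $ i $ j = 0"
    then show "det A \<noteq> 0 \<longrightarrow> ?Q A" using diag by blast
  next
    fix m n :: 'd assume "m \<noteq> n"
    let ?S = "\<chi> i j. mat 1 $ i $ Transposition.transpose m n j :: real^'d^'d"
    have S: "(?S *v x) $ i = x $ Transposition.transpose m n i" for x i
    proof -
      have "i = Transposition.transpose m n j \<longleftrightarrow> j = Transposition.transpose m n i" for j
        by (auto simp: Transposition.transpose_def)
      then have "(?S *v x) $ i = (\<Sum>j\<in>UNIV. if j = Transposition.transpose m n i then x $ j else 0)"
        by (simp add: matrix_vector_mult_def mat_def if_distrib[of "\<lambda>y. y * _"] cong: if_cong)
      then show ?thesis by simp
    qed
    have SS: "?S ** ?S = mat 1"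
      by (subst matrix_eq) (simp add: vec_eq_iff S flip: matrix_vector_mul_assoc)
    have "det ?S * det ?S = 1" using SS by (metis det_mul det_I)
    then have "(det ?S)\<^sup>2 = 1" by (simp only: power2_eq_square)
    then have d1: "\<bar>det ?S\<bar> = 1" unfolding power2_eq_1_iff by auto
    then have dS: "det ?S \<noteq> 0" by auto
    obtain c where c: "c > 0" "\<And>f. f \<in> borel_measurable borel \<Longrightarrow>
      (\<integral>\<^sup>+x. f (?S *v x) \<partial>lborel) = ennreal c * (\<integral>\<^sup>+x. f x \<partial>lborel)"
      using nn_integral_matrix_ex[OF dS] by blast
    \<comment> \<open>A Gaussian has integral 1, so testing the relation for S applied twice on it
      gives c * c = 1.\<close>
    have "c = 1"
    proof -
      let ?g = "\<lambda>x::real^'d. ennreal (exp (- pi * (x \<bullet> x)))"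
      have [measurable]: "?g \<in> borel_measurable borel" by measurable
      have "(\<integral>\<^sup>+x. ?g (?S *v (?S *v x)) \<partial>lborel) = ennreal c * (\<integral>\<^sup>+x. ?g (?S *v x) \<partial>lborel)"
        by (rule c(2)) measurable
      also have "\<dots> = ennreal c * (ennreal c * (\<integral>\<^sup>+x. ?g x \<partial>lborel))" by (subst c(2)) auto
      finally have "ennreal (c * c) = ennreal 1"
        using nn_integral_gaussian[where 'a = "real^'d"] c(1) by (simp add: matrix_vector_mul_assoc SS ennreal_mult)
      then have "c * c = 1" using c(1) by (subst (asm) ennreal_inj) auto
      then have "c\<^sup>2 = 1" by (simp only: power2_eq_square)
      then show ?thesis using c(1) unfolding power2_eq_1_iff by auto
    qed
    then show "det ?S \<noteq> 0 \<longrightarrow> ?Q ?S" using c(2) d1 by simp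
  next
    fix m n :: 'd assume mn: "m \<noteq> n"
    let ?S = "\<chi> i j. of_bool (i = m \<and> j = n \<or> i = j) :: real^'d^'d"
    \<comment> \<open>\<open>?D\<close> doubles coordinate m. Conjugation by it doubles the shear,
      and the doubled shear is the shear applied twice.\<close>
    let ?D = "\<chi> i j. if i = j then (if i = m then 2 else 1) else 0 :: real^'d^'d"
    show "det ?S \<noteq> 0 \<longrightarrow> ?Q ?S"
    proof (intro impI ballI)
      fix f :: "real^'d \<Rightarrow> ennreal" assume dS: "det ?S \<noteq> 0" and f [measurable]: "f \<in> borel_measurable borel"
      have S: "(?S *v x) $ i = (if i = m then x $ m + x $ n else x $ i)" for x i
      proof -
        have "(?S *v x) $ i = (\<Sum>j\<in>UNIV. (if j = i then x $ j else 0) + (if j = n then if i = m then x $ j else 0 else 0))"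
          using mn by (auto simp: matrix_vector_mult_def intro!: sum.cong)
        then show ?thesis by (simp add: sum.distrib)
      qed
      have D: "(?D *v x) $ i = (if i = m then 2 * x $ i else x $ i)" for x i
        by (simp add: matrix_vector_mult_def if_distrib[of "\<lambda>y. y * _"] cong: if_cong)
      have rel: "?D *v (?S *v x) = ?S *v (?S *v (?D *v x))" for x
        by (simp only: vec_eq_iff S D) (use mn in auto)
      have dD: "det ?D \<noteq> 0" by (subst det_diagonal) auto
      have "det ?D * det ?S = det ?S * det ?S * det ?D"
      proof -
        have "?D ** ?S = ?S ** ?S ** ?D"
          unfolding matrix_eq by (intro allI) (simp only: matrix_vector_mul_assoc[symmetric] rel)
        then show ?thesis by (simp only: det_mul[symmetric])
      qed
      moreover have "y = 1" if "x * y = y * y * x" "x \<noteq> 0" "y \<noteq> 0" for x y :: real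
        using that by simp
      ultimately have d1: "det ?S = 1" using dD dS by blast
      obtain c where c: "c > 0" "\<And>f. f \<in> borel_measurable borel \<Longrightarrow>
        (\<integral>\<^sup>+x. f (?S *v x) \<partial>lborel) = ennreal c * (\<integral>\<^sup>+x. f x \<partial>lborel)"
        using nn_integral_matrix_ex[OF dS] by blast
      obtain e where e: "e > 0" "\<And>f. f \<in> borel_measurable borel \<Longrightarrow>
        (\<integral>\<^sup>+x. f (?D *v x) \<partial>lborel) = ennreal e * (\<integral>\<^sup>+x. f x \<partial>lborel)"
        using nn_integral_matrix_ex[OF dD] by blast
      let ?g = "\<lambda>x::real^'d. ennreal (exp (- pi * (x \<bullet> x)))"
      have "(\<integral>\<^sup>+x. ?g (?D *v (?S *v x)) \<partial>lborel) = ennreal c * (\<integral>\<^sup>+x. ?g (?D *v x) \<partial>lborel)"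
        by (rule c(2)) measurable
      also have "\<dots> = ennreal c * (ennreal e * (\<integral>\<^sup>+x. ?g x \<partial>lborel))" by (subst e(2)) auto
      finally have 1: "(\<integral>\<^sup>+x. ?g (?D *v (?S *v x)) \<partial>lborel) = ennreal (c * e)"
        using c(1) e(1) by (simp only: nn_integral_gaussian) (simp add: ennreal_mult)
      have "(\<integral>\<^sup>+x. ?g (?S *v (?S *v (?D *v x))) \<partial>lborel) = ennreal e * (\<integral>\<^sup>+x. ?g (?S *v (?S *v x)) \<partial>lborel)"
        by (rule e(2)) measurable
      also have "(\<integral>\<^sup>+x. ?g (?S *v (?S *v x)) \<partial>lborel) = ennreal c * (\<integral>\<^sup>+x. ?g (?S *v x) \<partial>lborel)"
        by (rule c(2)) measurable
      also have "(\<integral>\<^sup>+x. ?g (?S *v x) \<partial>lborel) = ennreal c * (\<integral>\<^sup>+x. ?g x \<partial>lborel)" by (rule c(2)) measurable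
      finally have "(\<integral>\<^sup>+x. ?g (?S *v (?S *v (?D *v x))) \<partial>lborel) = ennreal (e * (c * c))"
        using c(1) e(1) by (simp only: nn_integral_gaussian) (simp add: ennreal_mult)
      with 1 have "ennreal (c * e) = ennreal (e * (c * c))" unfolding rel by simp
      then have "c * e = e * (c * c)" using c(1) e(1) by (subst (asm) ennreal_inj) auto
      then have "c = 1" using c(1) e(1) by simp
      then show "ennreal \<bar>det ?S\<bar> * (\<integral>\<^sup>+x. f (?S *v x) \<partial>lborel) = (\<integral>\<^sup>+x. f x \<partial>lborel)"
        using c(2) d1 by simp
    qed
  qed
  then show ?thesis using assms by blast
qed

section \<open>Powers of extended nonnegative reals\<close>

lemma ennreal_powr_ennreal: "0 \<le> x \<Longrightarrow> ennreal_powr (ennreal x) a = ennreal (x powr a)"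
  by (simp add: ennreal_powr_def)

lemma ennreal_powr_top [simp]: "ennreal_powr top a = top"
  by (simp add: ennreal_powr_def)

lemma ennreal_powr_mono:
  assumes "x \<le> y" "0 \<le> a" shows "ennreal_powr x a \<le> ennreal_powr y a"
proof (cases y)
  case (real r)
  with assms(1) obtain t where "x = ennreal t" "0 \<le> t" "t \<le> r"
    by (cases x) (auto simp: top_unique)
  then show ?thesis using real assms(2) by (simp add: ennreal_powr_ennreal powr_mono2 ennreal_leI)
qed simp

lemma ennreal_powr_mult:
  assumes "0 < c" shows "ennreal_powr (ennreal c * x) a = ennreal (c powr a) * ennreal_powr x a"
proof (cases x)
  case (real r)
  have "ennreal c * ennreal r = ennreal (c * r)" using real assms by (simp add: ennreal_mult)
  then have "ennreal_powr (ennreal c * x) a = ennreal ((c * r) powr a)"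
    unfolding real(2) using real(1) assms by (simp only:) (simp add: ennreal_powr_ennreal)
  then show ?thesis using real assms by (simp add: powr_mult ennreal_mult ennreal_powr_ennreal)
next
  case top
  then show ?thesis using assms by (simp add: ennreal_mult_top)
qed

lemma ennreal_powr_powr:
  assumes "0 < a" shows "ennreal_powr (ennreal_powr x a) (1 / a) = x"
  using assms by (cases x) (simp_all add: ennreal_powr_ennreal powr_powr)

section \<open>Matrix substitutions and their effect on transforms\<close>

lemma lborel_matrix:
  fixes A :: "real^'d^'d"
  assumes "det A \<noteq> 0"
  shows "density (distr lborel borel ((*v) A)) (\<lambda>_. ennreal \<bar>det A\<bar>) = lborel"
proof (rule measure_eqI)
  have mv [measurable]: "(\<lambda>x. A *v x) \<in> borel_measurable borel"
    by (intro borel_measurable_continuous_onI linear_continuous_on) simp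
  fix X assume "X \<in> sets (density (distr lborel borel ((*v) A)) (\<lambda>_. ennreal \<bar>det A\<bar>))"
  then have [measurable]: "X \<in> sets borel" by simp
  have "emeasure (density (distr lborel borel ((*v) A)) (\<lambda>_. ennreal \<bar>det A\<bar>)) X =
      ennreal \<bar>det A\<bar> * (\<integral>\<^sup>+x. indicator X (A *v x) \<partial>lborel)"
  proof -
    have "(\<integral>\<^sup>+x. indicator X (A *v x) \<partial>lborel) = emeasure (distr lborel borel ((*v) A)) X"
      using nn_integral_distr[of "(*v) A" lborel borel "indicator X"] by simp
    then show ?thesis by (simp add: emeasure_density nn_integral_cmult)
  qed
  also have "\<dots> = (\<integral>\<^sup>+x. indicator X x \<partial>lborel)"
    by (rule nn_integral_matrix[OF assms]) measurable
  finally show "emeasure (density (distr lborel borel ((*v) A)) (\<lambda>_. ennreal \<bar>det A\<bar>)) X = emeasure lborel X"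
    by simp
qed simp

lemma lborel_integral_matrix:
  fixes A :: "real^'d^'d" and f :: "real^'d \<Rightarrow> 'b::{banach, second_countable_topology}"
  assumes "det A \<noteq> 0" and [measurable]: "f \<in> borel_measurable borel"
  shows "(\<integral>x. f x \<partial>lborel) = \<bar>det A\<bar> *\<^sub>R (\<integral>x. f (A *v x) \<partial>lborel)"
proof -
  have mv [measurable]: "(\<lambda>x. A *v x) \<in> borel_measurable borel"
    by (intro borel_measurable_continuous_onI linear_continuous_on) simp
  have "(\<integral>x. f x \<partial>lborel) = (\<integral>x. f x \<partial>density (distr lborel borel ((*v) A)) (\<lambda>_. ennreal \<bar>det A\<bar>))"
    by (simp add: lborel_matrix[OF assms(1)])
  also have "\<dots> = \<bar>det A\<bar> *\<^sub>R (\<integral>x. f (A *v x) \<partial>lborel)"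
    by (subst integral_density) (auto simp: integral_distr)
  finally show ?thesis .
qed

lemma matrix_inv_cancel:
  fixes M :: "real^'d^'d"
  assumes "det M \<noteq> 0"
  shows "M ** matrix_inv M = mat 1" "matrix_inv M ** M = mat 1" "det (matrix_inv M) = inverse (det M)"
proof -
  have "invertible M" using assms by (simp add: invertible_det_nz)
  then show *: "M ** matrix_inv M = mat 1" "matrix_inv M ** M = mat 1"
    by (auto simp: invertible_def matrix_inv_def intro: someI2_ex)
  have "det M * det (matrix_inv M) = 1" using *(1) by (metis det_mul det_I)
  then show "det (matrix_inv M) = inverse (det M)" by (metis inverse_unique)
qed

text \<open>The pairing of \<xi> M with the inverse of M applied to x equals the pairing of \<xi>
  with x. Substitution in the frequency variable therefore moves M to the space side and contributes
  the determinant.\<close>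

lemma inverse_fourier_matrix:
  assumes M: "det M \<noteq> 0" and u: "u \<in> borel_measurable borel"
  shows "inverse_fourier (\<lambda>\<xi>. u (\<xi> v* M)) = matrix_dilation M (inverse_fourier u)"
proof
  fix x
  have "inverse_fourier u (matrix_inv M *v x) = (\<integral>\<xi>. u \<xi> * wave \<xi> (matrix_inv M *v x) \<partial>lborel)"
    by (rule inverse_fourier_wave)
  also have "(\<integral>\<xi>. u \<xi> * wave \<xi> (matrix_inv M *v x) \<partial>lborel) =
      \<bar>det (transpose M)\<bar> *\<^sub>R (\<integral>\<xi>. u (transpose M *v \<xi>) * wave (transpose M *v \<xi>) (matrix_inv M *v x) \<partial>lborel)"
    by (rule lborel_integral_matrix) (use M in simp, intro borel_measurable_times u wave_measurable, auto)
  finally have "inverse_fourier u (matrix_inv M *v x) =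
      \<bar>det (transpose M)\<bar> *\<^sub>R (\<integral>\<xi>. u (transpose M *v \<xi>) * wave (transpose M *v \<xi>) (matrix_inv M *v x) \<partial>lborel)" .
  moreover have "wave (transpose M *v \<xi>) (matrix_inv M *v x) = wave \<xi> x" for \<xi>
    by (simp add: wave_def dot_lmul_matrix matrix_vector_mul_assoc matrix_inv_cancel[OF M])
  ultimately show "inverse_fourier (\<lambda>\<xi>. u (\<xi> v* M)) x = matrix_dilation M (inverse_fourier u) x"
    using M by (simp add: matrix_dilation_def inverse_fourier_wave[of "\<lambda>\<xi>. u (\<xi> v* M)"] scaleR_conv_of_real)
qed

lemma schwartz_matrix:
  fixes u :: "real^'d \<Rightarrow> complex"
  assumes "u \<in> schwartz" "det M \<noteq> 0"
  shows "(\<lambda>\<xi>. u (\<xi> v* M)) \<in> schwartz"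
proof -
  have "(\<lambda>\<xi>. u (0 + transpose M *v \<xi>)) \<in> schwartz"
  proof (rule schwartz_affine[OF assms(1)])
    have "linear ((*v) N)" for N :: "real^'d^'d" by simp
    then show "linear ((*v) (transpose M))" .
    show "inj ((*v) (transpose M))"
      by (rule inj_matrix_vector_mult) (simp only: invertible_det_nz det_transpose assms(2) not_False_eq_True)
  qed
  then show ?thesis by simp
qed

section \<open>Fourier multipliers and Lp norms\<close>

lemma nn_integral_convolution:
  fixes F G :: "'a::euclidean_space \<Rightarrow> ennreal"
  assumes [measurable]: "F \<in> borel_measurable borel" "G \<in> borel_measurable borel"
  shows "(\<integral>\<^sup>+x. (\<integral>\<^sup>+y. F y * G (x - y) \<partial>lborel) \<partial>lborel) = (\<integral>\<^sup>+y. F y \<partial>lborel) * (\<integral>\<^sup>+x. G x \<partial>lborel)"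
proof -
  have "(\<integral>\<^sup>+x. (\<integral>\<^sup>+y. F y * G (x - y) \<partial>lborel) \<partial>lborel) = (\<integral>\<^sup>+y. (\<integral>\<^sup>+x. F y * G (x - y) \<partial>lborel) \<partial>lborel)"
    by (rule lborel_pair.Fubini') measurable
  also have "\<dots> = (\<integral>\<^sup>+y. F y * (\<integral>\<^sup>+x. G x \<partial>lborel) \<partial>lborel)"
  proof (rule nn_integral_cong)
    fix y
    have "(\<integral>\<^sup>+x. G (- y + x) \<partial>lborel) = (\<integral>\<^sup>+x. G x \<partial>lborel)" by (rule nn_integral_lborel_translate) measurable
    then show "(\<integral>\<^sup>+x. F y * G (x - y) \<partial>lborel) = F y * (\<integral>\<^sup>+x. G x \<partial>lborel)"
      by (simp add: nn_integral_cmult)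
  qed
  finally show ?thesis by (simp add: nn_integral_multc)
qed

text \<open>For \<open>P < 1\<close> convolution is controlled by the pointwise bound of a reproduced product by its own
  integral: \<open>\<integral>|h| \<le> (sup |h|) powr (1 - P) * \<integral>|h| powr P\<close>.\<close>

lemma Lp_convolution_le_one:
  fixes g k :: "'a::euclidean_space \<Rightarrow> complex"
  assumes P: "0 < P" "P \<le> 1" and [measurable]: "g \<in> borel_measurable borel" "k \<in> borel_measurable borel"
    and int: "\<And>x. integrable lborel (\<lambda>y. g y * k (x - y))"
    and B: "0 \<le> B" "\<And>x z. norm (g z * k (x - z)) \<le> B * (\<integral>y. norm (g y * k (x - y)) \<partial>lborel)"
  shows "(\<integral>\<^sup>+x. ennreal (norm (\<integral>y. g y * k (x - y) \<partial>lborel) powr P) \<partial>lborel) \<le>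
    ennreal (B powr (1 - P)) * ((\<integral>\<^sup>+x. ennreal (norm (g x) powr P) \<partial>lborel) * (\<integral>\<^sup>+x. ennreal (norm (k x) powr P) \<partial>lborel))"
proof -
  have "ennreal (norm (\<integral>y. g y * k (x - y) \<partial>lborel) powr P) \<le>
      ennreal (B powr (1 - P)) * (\<integral>\<^sup>+y. ennreal (norm (g y) powr P) * ennreal (norm (k (x - y)) powr P) \<partial>lborel)" for x
  proof -
    define h where "h y = norm (g y * k (x - y))" for y
    define A where "A = (\<integral>y. h y \<partial>lborel)"
    have [measurable]: "h \<in> borel_measurable borel" unfolding h_def[abs_def] by measurable
    have ih: "integrable lborel h" unfolding h_def using int by (rule integrable_norm)
    have A0: "0 \<le> A" unfolding A_def h_def by simp
    have hB: "h y \<le> B * A" for y unfolding h_def A_def by (rule B(2))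
    have le: "norm (\<integral>y. g y * k (x - y) \<partial>lborel) \<le> A"
      unfolding A_def h_def by (rule integral_norm_bound)
    have eq: "(\<integral>\<^sup>+y. ennreal (norm (g y) powr P) * ennreal (norm (k (x - y)) powr P) \<partial>lborel) = (\<integral>\<^sup>+y. ennreal (h y powr P) \<partial>lborel)"
      by (simp add: h_def norm_mult powr_mult ennreal_mult)
    show ?thesis
    proof (cases "A = 0")
      case True
      then show ?thesis using le by simp
    next
      case False
      then have A: "A > 0" using A0 by simp
      have "B \<noteq> 0"
      proof
        assume "B = 0"
        then have "h y = 0" for y using hB[of y] by (simp add: h_def)
        then have "h = (\<lambda>_. 0)" by auto
        then have "A = 0" unfolding A_def by simp
        then show False using A by simp
      qed
      then have B0: "B > 0" using B(1) by simp
      have "ennreal A = (\<integral>\<^sup>+y. ennreal (h y) \<partial>lborel)"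
        unfolding A_def using ih by (intro nn_integral_eq_integral[symmetric]) (auto simp: h_def)
      also have "\<dots> \<le> (\<integral>\<^sup>+y. ennreal ((B * A) powr (1 - P)) * ennreal (h y powr P) \<partial>lborel)"
      proof (rule nn_integral_mono)
        fix y
        have h0: "0 \<le> h y" by (simp add: h_def)
        have "h y \<le> (B * A) powr (1 - P) * h y powr P"
        proof (cases "h y = 0")
          case False
          then have "h y = h y powr (1 - P) * h y powr P" using h0 by (simp flip: powr_add)
          also have "\<dots> \<le> (B * A) powr (1 - P) * h y powr P"
            using P h0 hB by (intro mult_right_mono powr_mono2) auto
          finally show ?thesis .
        qed simp
        then show "ennreal (h y) \<le> ennreal ((B * A) powr (1 - P)) * ennreal (h y powr P)"
          by (simp flip: ennreal_mult add: ennreal_leI)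
      qed
      also have "\<dots> = ennreal ((B * A) powr (1 - P)) * (\<integral>\<^sup>+y. ennreal (h y powr P) \<partial>lborel)"
        by (rule nn_integral_cmult) measurable
      finally have *: "ennreal A \<le> ennreal ((B * A) powr (1 - P)) * (\<integral>\<^sup>+y. ennreal (h y powr P) \<partial>lborel)" .
      \<comment> \<open>The preceding estimate is divided by A powr (1 - P), which is possible
        because A is a positive real number.\<close>
      have "ennreal (A powr P) = ennreal (A powr (P - 1)) * ennreal A"
        using A by (simp flip: ennreal_mult add: powr_diff)
      also have "\<dots> \<le> ennreal (A powr (P - 1)) * (ennreal ((B * A) powr (1 - P)) * (\<integral>\<^sup>+y. ennreal (h y powr P) \<partial>lborel))"
        by (intro mult_left_mono *) auto
      also have "\<dots> = ennreal (A powr (P - 1) * (B * A) powr (1 - P)) * (\<integral>\<^sup>+y. ennreal (h y powr P) \<partial>lborel)"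
        by (simp add: ennreal_mult mult.assoc)
      also have "A powr (P - 1) * (B * A) powr (1 - P) = B powr (1 - P)"
        using A B0 by (simp add: powr_mult powr_diff)
      finally have "ennreal (A powr P) \<le> ennreal (B powr (1 - P)) * (\<integral>\<^sup>+y. ennreal (h y powr P) \<partial>lborel)" .
      moreover have "ennreal (norm (\<integral>y. g y * k (x - y) \<partial>lborel) powr P) \<le> ennreal (A powr P)"
        using le P by (intro ennreal_leI powr_mono2) auto
      ultimately show ?thesis unfolding eq by (rule order_trans[rotated])
    qed
  qed
  then have "(\<integral>\<^sup>+x. ennreal (norm (\<integral>y. g y * k (x - y) \<partial>lborel) powr P) \<partial>lborel) \<le>
      (\<integral>\<^sup>+x. ennreal (B powr (1 - P)) * (\<integral>\<^sup>+y. ennreal (norm (g y) powr P) * ennreal (norm (k (x - y)) powr P) \<partial>lborel) \<partial>lborel)"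
    by (intro nn_integral_mono)
  also have "\<dots> = ennreal (B powr (1 - P)) * (\<integral>\<^sup>+x. (\<integral>\<^sup>+y. ennreal (norm (g y) powr P) * ennreal (norm (k (x - y)) powr P) \<partial>lborel) \<partial>lborel)"
    by (rule nn_integral_cmult) measurable
  finally show ?thesis
    by (subst (asm) nn_integral_convolution[of "\<lambda>y. ennreal (norm (g y) powr P)" "\<lambda>y. ennreal (norm (k y) powr P)"]) auto
qed

text \<open>Replaces Jensen's inequality below, both for integrals against a kernel and for finite
  sums. The point t = 0 is separate because convexity is taken on the open half-line.\<close>

lemma powr_ge_tangent:
  fixes t c P :: real
  assumes "0 \<le> t" "0 < c" "1 \<le> P"
  shows "c powr P + P * c powr (P - 1) * (t - c) \<le> t powr P"
proof (cases "t = 0")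
  case True
  have "c powr (P - 1) * c = c powr P" using assms(2) by (simp add: powr_diff)
  moreover have "c powr P \<le> P * c powr P" using assms by (simp add: mult_le_cancel_right1)
  ultimately show ?thesis using True assms by (simp add: algebra_simps)
next
  case False
  have "t powr P - c powr P \<ge> P * c powr (P - 1) * (t - c)"
  proof (rule convex_on_imp_above_tangent[OF powr_convex[OF assms(3)]])
    show "connected {0::real<..}" by (rule convex_connected) simp
    show "c \<in> interior {0<..}" using assms by (simp add: interior_open)
    show "t \<in> {0<..}" using False assms by simp
    show "((\<lambda>x. x powr P) has_field_derivative P * c powr (P - 1)) (at c within {0<..})"
      using assms by (auto intro!: derivative_eq_intros)
  qed
  then show ?thesis by simp
qed

text \<open>Jensen's inequality with respect to the mass norm (k (x - y)) dy, followed by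
  Tonelli.\<close>

lemma Lp_convolution_ge_one:
  fixes g k :: "'a::euclidean_space \<Rightarrow> complex"
  assumes P: "1 \<le> P" and [measurable]: "g \<in> borel_measurable borel" "k \<in> borel_measurable borel"
    and int: "\<And>x. integrable lborel (\<lambda>y. g y * k (x - y))" and k: "integrable lborel k"
  shows "(\<integral>\<^sup>+x. ennreal (norm (\<integral>y. g y * k (x - y) \<partial>lborel) powr P) \<partial>lborel) \<le>
    ennreal ((1 + (\<integral>x. norm (k x) \<partial>lborel)) powr P) * (\<integral>\<^sup>+x. ennreal (norm (g x) powr P) \<partial>lborel)"
proof -
  define I where "I = (\<integral>x. norm (k x) \<partial>lborel)"
  have I0: "0 \<le> I" by (simp add: I_def)
  \<comment> \<open>The added 1 keeps J positive even when the kernel vanishes almost everywhere;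
    the argument only requires that the mass I is at most J.\<close>
  define J where "J = 1 + I"
  have J: "J > 0" "I \<le> J" using I0 by (auto simp: J_def)
  have Ie: "(\<integral>\<^sup>+x. ennreal (norm (k x)) \<partial>lborel) = ennreal I"
    unfolding I_def using k by (intro nn_integral_eq_integral integrable_norm) auto
  have "ennreal (norm (\<integral>y. g y * k (x - y) \<partial>lborel) powr P) \<le>
      ennreal (J powr (P - 1)) * (\<integral>\<^sup>+y. ennreal (norm (g y) powr P) * ennreal (norm (k (x - y))) \<partial>lborel)" for x
  proof -
    define A where "A = (\<integral>y. norm (g y * k (x - y)) \<partial>lborel)"
    have A0: "0 \<le> A" by (simp add: A_def)
    have le: "norm (\<integral>y. g y * k (x - y) \<partial>lborel) \<le> A"
      unfolding A_def by (rule integral_norm_bound)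
    show ?thesis
    proof (cases "A = 0")
      case True
      then show ?thesis using le by simp
    next
      case False
      \<comment> \<open>The tangent is taken at the mean of norm (g y) relative to total mass J.
        Integrated against the kernel, the tangent line gives at least c powr P * J.\<close>
      define c where "c = A / J"
      have c: "c > 0" "A = c * J" using False A0 J by (auto simp: c_def)
      have ik: "integrable lborel (\<lambda>y. norm (k (x - y)))"
        by (intro integrable_norm lborel_integrable_reflect k)
      have iI: "(\<integral>y. norm (k (x - y)) \<partial>lborel) = I"
        unfolding I_def by (rule lborel_integral_reflect) measurable
      define b where "b y = (c powr P - P * c powr (P - 1) * c) * norm (k (x - y)) + P * c powr (P - 1) * norm (g y * k (x - y))" for y
      have ib: "integrable lborel b"
        unfolding b_def by (intro Bochner_Integration.integrable_add integrable_mult_right ik integrable_norm int)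
      have "(\<integral>y. b y \<partial>lborel) = (c powr P - P * c powr (P - 1) * c) * I + P * c powr (P - 1) * A"
        unfolding b_def A_def using ik int[of x]
        by (subst Bochner_Integration.integral_add) (auto simp: iI)
      also have "c powr (P - 1) * c = c powr P" using c(1) by (simp add: powr_diff)
      then have "(c powr P - P * c powr (P - 1) * c) * I + P * c powr (P - 1) * A = c powr P * (I + P * (J - I))"
        unfolding c(2) by (simp add: algebra_simps)
      also have "\<dots> \<ge> c powr P * J"
      proof (rule mult_left_mono)
        have "1 * (J - I) \<le> P * (J - I)" using P J by (intro mult_right_mono) auto
        then show "J \<le> I + P * (J - I)" by simp
      qed simp
      finally have "c powr P * J \<le> (\<integral>y. b y \<partial>lborel)" .
      then have "ennreal (c powr P * J) \<le> ennreal (\<integral>y. b y \<partial>lborel)" by (rule ennreal_leI)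
      \<comment> \<open>The integrand b can be negative where norm (g y) is small, hence its
        positive part before passing to a nonnegative integral.\<close>
      also have "\<dots> \<le> ennreal (\<integral>y. max 0 (b y) \<partial>lborel)"
        by (intro ennreal_leI integral_mono ib Bochner_Integration.integrable_max integrable_zero) auto
      also have "\<dots> = (\<integral>\<^sup>+y. ennreal (max 0 (b y)) \<partial>lborel)"
        by (intro nn_integral_eq_integral[symmetric] Bochner_Integration.integrable_max integrable_zero ib) auto
      also have "\<dots> \<le> (\<integral>\<^sup>+y. ennreal (norm (g y) powr P) * ennreal (norm (k (x - y))) \<partial>lborel)"
      proof (rule nn_integral_mono)
        fix y
        have "b y = (c powr P + P * c powr (P - 1) * (norm (g y) - c)) * norm (k (x - y))"
          by (simp add: b_def norm_mult algebra_simps)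
        also have "\<dots> \<le> norm (g y) powr P * norm (k (x - y))"
          using c(1) P by (intro mult_right_mono powr_ge_tangent) auto
        finally have "max 0 (b y) \<le> norm (g y) powr P * norm (k (x - y))" by simp
        then show "ennreal (max 0 (b y)) \<le> ennreal (norm (g y) powr P) * ennreal (norm (k (x - y)))"
          by (simp flip: ennreal_mult add: ennreal_leI)
      qed
      finally have *: "ennreal (c powr P * J) \<le> (\<integral>\<^sup>+y. ennreal (norm (g y) powr P) * ennreal (norm (k (x - y))) \<partial>lborel)" .
      have "ennreal (norm (\<integral>y. g y * k (x - y) \<partial>lborel) powr P) \<le> ennreal (A powr P)"
        using le P by (intro ennreal_leI powr_mono2) auto
      also have "A powr P = J powr (P - 1) * (c powr P * J)"
        using c J by (simp add: powr_mult powr_diff)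
      also have "ennreal (J powr (P - 1) * (c powr P * J)) = ennreal (J powr (P - 1)) * ennreal (c powr P * J)"
        using J by (intro ennreal_mult) auto
      also have "\<dots> \<le> ennreal (J powr (P - 1)) * (\<integral>\<^sup>+y. ennreal (norm (g y) powr P) * ennreal (norm (k (x - y))) \<partial>lborel)"
        by (intro mult_left_mono *) auto
      finally show ?thesis .
    qed
  qed
  then have "(\<integral>\<^sup>+x. ennreal (norm (\<integral>y. g y * k (x - y) \<partial>lborel) powr P) \<partial>lborel) \<le>
      (\<integral>\<^sup>+x. ennreal (J powr (P - 1)) * (\<integral>\<^sup>+y. ennreal (norm (g y) powr P) * ennreal (norm (k (x - y))) \<partial>lborel) \<partial>lborel)"
    by (intro nn_integral_mono)
  also have "\<dots> = ennreal (J powr (P - 1)) * (\<integral>\<^sup>+x. (\<integral>\<^sup>+y. ennreal (norm (g y) powr P) * ennreal (norm (k (x - y))) \<partial>lborel) \<partial>lborel)"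
    by (rule nn_integral_cmult) measurable
  also have "\<dots> = ennreal (J powr (P - 1)) * ((\<integral>\<^sup>+x. ennreal (norm (g x) powr P) \<partial>lborel) * ennreal I)"
    by (subst nn_integral_convolution[of "\<lambda>y. ennreal (norm (g y) powr P)" "\<lambda>y. ennreal (norm (k y))"]) (auto simp: Ie)
  also have "\<dots> = ennreal (J powr (P - 1) * I) * (\<integral>\<^sup>+x. ennreal (norm (g x) powr P) \<partial>lborel)"
    using I0 by (simp add: ennreal_mult mult_ac)
  also have "\<dots> \<le> ennreal (J powr P) * (\<integral>\<^sup>+x. ennreal (norm (g x) powr P) \<partial>lborel)"
  proof (intro mult_right_mono ennreal_leI)
    have "J powr (P - 1) * I \<le> J powr (P - 1) * J" using J by (intro mult_left_mono) auto
    also have "\<dots> = J powr P" using J by (simp add: powr_diff)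
    finally show "J powr (P - 1) * I \<le> J powr P" .
  qed simp
  finally show ?thesis unfolding J_def I_def .
qed

text \<open>Decay of order n with n * P \<ge> 2 * DIM is enough. A small P asks for a large n, which
  rapid decrease provides.\<close>

lemma nn_integral_schwartz_powr_finite:
  fixes k :: "'a::euclidean_space \<Rightarrow> complex"
  assumes k: "k \<in> schwartz" and P: "0 < P"
  shows "(\<integral>\<^sup>+x. ennreal (norm (k x) powr P) \<partial>lborel) < \<infinity>"
proof -
  let ?N = "2 * DIM('a)"
  define n where "n = nat \<lceil>real ?N / P\<rceil>"
  have "real ?N / P \<le> real n" unfolding n_def by (rule real_nat_ceiling_ge)
  then have n: "real ?N \<le> real n * P" using P by (simp add: field_simps)
  obtain C where C: "C > 0" "\<And>x. norm (k x) \<le> C / (1 + norm x) ^ n"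
    using rapidly_decreasing_bound[OF schwartz_rapidly_decreasing[OF k]] by blast
  have "(\<integral>\<^sup>+x. ennreal (norm (k x) powr P) \<partial>lborel) \<le> (\<integral>\<^sup>+x. ennreal (norm (C powr P * (1 / (1 + norm x) ^ ?N))) \<partial>(lborel :: 'a measure))"
  proof (rule nn_integral_mono, rule ennreal_leI)
    fix x :: 'a
    have pos: "0 < 1 + norm x" by (simp add: add_pos_nonneg)
    have "norm (k x) powr P \<le> (C / (1 + norm x) ^ n) powr P"
      using C P by (intro powr_mono2) auto
    also have "\<dots> = C powr P / (1 + norm x) powr (real n * P)"
      using C(1) pos by (simp add: powr_divide powr_powr flip: powr_realpow)
    also have "\<dots> \<le> C powr P / (1 + norm x) powr (real ?N)"
      using n pos by (intro divide_left_mono powr_mono) (auto intro!: mult_pos_pos)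
    also have "(1 + norm x) powr (real ?N) = (1 + norm x) ^ ?N" by (rule powr_realpow[OF pos])
    finally show "norm (k x) powr P \<le> norm (C powr P * (1 / (1 + norm x) ^ ?N))" by simp
  qed
  also have "\<dots> < \<infinity>"
    using integrable_mult_right[OF integrable_inverse_one_plus_norm, of "C powr P"]
    unfolding integrable_iff_bounded by blast
  finally show ?thesis .
qed

text \<open>The constant does not depend on \<open>M\<close>: the powers of \<open>det M\<close> coming from the size of the spectrum
  and from the normalization of the kernel cancel.\<close>

theorem Lp_multiplier_bound:
  fixes v \<kappa> :: "real^'d \<Rightarrow> complex" and p :: ennreal
  assumes v: "v \<in> schwartz" and \<kappa>: "\<kappa> \<in> schwartz" and p: "0 < p" "p < \<infinity>"
  obtains C :: real where "C > 0"
    "\<And>f u M. f \<in> tempered_distributions \<Longrightarrow> u \<in> schwartz \<Longrightarrow> det M \<noteq> 0 \<Longrightarrow>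
      (\<And>\<xi> \<eta>. u \<xi> \<noteq> 0 \<Longrightarrow> v \<eta> \<noteq> 0 \<Longrightarrow> \<kappa> (\<xi> v* M - \<eta>) = 1) \<Longrightarrow>
      Lp_norm p (f \<star> inverse_fourier (\<lambda>\<xi>. u \<xi> * v (\<xi> v* M))) \<le> ennreal C * Lp_norm p (f \<star> inverse_fourier u)"
proof -
  define P where "P = enn2real p"
  have P: "P > 0" using p by (auto simp: P_def enn2real_positive_iff)
  let ?k = "inverse_fourier v"
  have sk: "?k \<in> schwartz" by (rule schwartz_inverse_fourier[OF v])
  have [measurable]: "?k \<in> borel_measurable borel" by (rule schwartz_measurable[OF sk])
  have Lp: "Lp_norm p g = ennreal_powr (\<integral>\<^sup>+x. ennreal (norm (g x) powr P) \<partial>lborel) (1 / P)" for g :: "real^'d \<Rightarrow> complex"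
    using p by (auto simp: Lp_norm_def P_def)
  define K1 where "K1 = (\<integral>x. norm (?k x) \<partial>lborel)"
  have "(\<integral>\<^sup>+x. ennreal (norm (?k x) powr P) \<partial>lborel) < \<infinity>"
    by (rule nn_integral_schwartz_powr_finite[OF sk P])
  then obtain K2 where K2: "0 \<le> K2" "(\<integral>\<^sup>+x. ennreal (norm (?k x) powr P) \<partial>lborel) = ennreal K2"
    by (cases "\<integral>\<^sup>+x. ennreal (norm (?k x) powr P) \<partial>lborel") auto
  \<comment> \<open>One constant for both regimes: K2 is the one for P \<le> 1, and 1 + K1 the one
    for P > 1.\<close>
  define K where "K = 1 + K1 + K2"
  have K1: "0 \<le> K1" by (simp add: K1_def)
  have K: "K > 0" "K2 \<le> K" "1 + K1 \<le> K" using K1 K2(1) by (auto simp: K_def)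
  \<comment> \<open>The normalization of the dilated kernel contributes the determinant to the power
    -P, the substitution contributes it once more to the power 1.\<close>
  have dil: "(\<integral>\<^sup>+x. ennreal (norm (matrix_dilation M ?k x) powr P) \<partial>lborel) = ennreal (K2 * \<bar>det M\<bar> powr (1 - P))"
    if M: "det M \<noteq> 0" for M
  proof -
    have [measurable]: "(\<lambda>x. matrix_inv M *v x) \<in> borel_measurable borel"
      by (intro borel_measurable_continuous_onI linear_continuous_on) simp
    have iM: "det (matrix_inv M) \<noteq> 0" using M by (simp add: matrix_inv_cancel[OF M])
    have "(\<lambda>x. ennreal (norm (?k x) powr P)) \<in> borel_measurable borel" by measurable
    from nn_integral_matrix[OF iM this]
    have "ennreal (inverse \<bar>det M\<bar>) * (\<integral>\<^sup>+x. ennreal (norm (?k (matrix_inv M *v x)) powr P) \<partial>lborel) = ennreal K2"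
      by (simp only: K2(2) matrix_inv_cancel[OF M] abs_inverse)
    then have "ennreal \<bar>det M\<bar> * (ennreal (inverse \<bar>det M\<bar>) * (\<integral>\<^sup>+x. ennreal (norm (?k (matrix_inv M *v x)) powr P) \<partial>lborel)) =
        ennreal \<bar>det M\<bar> * ennreal K2" by simp
    moreover have "ennreal \<bar>det M\<bar> * ennreal (inverse \<bar>det M\<bar>) = 1"
      using M by (simp flip: ennreal_mult)
    ultimately have nn: "(\<integral>\<^sup>+x. ennreal (norm (?k (matrix_inv M *v x)) powr P) \<partial>lborel) = ennreal (\<bar>det M\<bar> * K2)"
      using K2(1) by (simp add: mult.assoc[symmetric] ennreal_mult)
    have "(\<integral>\<^sup>+x. ennreal (norm (matrix_dilation M ?k x) powr P) \<partial>lborel) =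
        (\<integral>\<^sup>+x. ennreal (\<bar>det M\<bar> powr (- P)) * ennreal (norm (?k (matrix_inv M *v x)) powr P) \<partial>lborel)"
      using M by (simp add: matrix_dilation_def norm_mult norm_inverse powr_mult inverse_powr powr_minus flip: ennreal_mult)
    also have "\<dots> = ennreal (\<bar>det M\<bar> powr (- P)) * ennreal (\<bar>det M\<bar> * K2)"
      by (subst nn_integral_cmult) (simp_all add: nn, measurable)
    also have "\<dots> = ennreal (\<bar>det M\<bar> powr (- P) * (\<bar>det M\<bar> * K2))"
      using K2(1) by (intro ennreal_mult[symmetric]) auto
    also have "\<bar>det M\<bar> powr (- P) * (\<bar>det M\<bar> * K2) = K2 * \<bar>det M\<bar> powr (1 - P)"
      using M by (simp add: powr_diff powr_minus divide_inverse)
    finally show ?thesis .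
  qed
  have dil1: "(\<integral>x. norm (matrix_dilation M ?k x) \<partial>lborel) = K1" if M: "det M \<noteq> 0" for M
  proof -
    have "K1 = \<bar>det (matrix_inv M)\<bar> *\<^sub>R (\<integral>x. norm (?k (matrix_inv M *v x)) \<partial>lborel)"
      unfolding K1_def by (rule lborel_integral_matrix) (use M in \<open>simp_all add: matrix_inv_cancel\<close>)
    then show ?thesis using M by (simp add: matrix_dilation_def norm_mult norm_inverse matrix_inv_cancel)
  qed
  obtain B where B: "B > 0" "\<And>x. norm (inverse_fourier \<kappa> x) \<le> B"
    using rapidly_decreasing_bound[OF schwartz_rapidly_decreasing[OF schwartz_inverse_fourier[OF \<kappa>]], of 0] by auto
  define C where "C = (max (B powr (1 - P) * K) (K powr P)) powr (1 / P)"
  show ?thesis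
  proof (rule that[of C])
    have "0 < max (B powr (1 - P) * K) (K powr P)" using K(1) by (simp add: less_max_iff_disj)
    then show "C > 0" unfolding C_def powr_gt_zero by (rule less_imp_neq[symmetric])
    fix f :: "(real^'d \<Rightarrow> complex) \<Rightarrow> complex" and u :: "real^'d \<Rightarrow> complex" and M :: "real^'d^'d"
    assume f: "f \<in> tempered_distributions" and u: "u \<in> schwartz" and M: "det M \<noteq> 0"
      and one: "\<And>\<xi> \<eta>. u \<xi> \<noteq> 0 \<Longrightarrow> v \<eta> \<noteq> 0 \<Longrightarrow> \<kappa> (\<xi> v* M - \<eta>) = 1"
    let ?vM = "\<lambda>\<xi>. v (\<xi> v* M)" and ?\<kappa>M = "\<lambda>\<xi>. \<kappa> (\<xi> v* M)" and ?g = "f \<star> inverse_fourier u"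
    have vM: "?vM \<in> schwartz" and \<kappa>M: "?\<kappa>M \<in> schwartz" by (intro schwartz_matrix v \<kappa> M)+
    let ?kM = "inverse_fourier ?vM"
    have kM: "?kM = matrix_dilation M ?k" by (rule inverse_fourier_matrix[OF M schwartz_measurable[OF v]])
    have skM: "?kM \<in> schwartz" by (rule schwartz_inverse_fourier[OF vM])
    have gm: "?g \<in> borel_measurable borel" by (rule convolution_measurable[OF f schwartz_inverse_fourier[OF u]])
    have int: "integrable lborel (\<lambda>y. ?g y * ?kM (x - y))" for x
    proof (rule rapidly_decreasing_integrable)
      show "rapidly_decreasing (\<lambda>y. ?g y * ?kM (x - y))"
        by (intro rapidly_decreasing_mult convolution_poly_bounded f schwartz_inverse_fourier u
            schwartz_rapidly_decreasing schwartz_reflect skM)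
      show "(\<lambda>y. ?g y * ?kM (x - y)) \<in> borel_measurable borel"
        by (intro borel_measurable_times gm schwartz_measurable schwartz_reflect skM)
    qed
    have conv: "(f \<star> inverse_fourier (\<lambda>\<xi>. u \<xi> * v (\<xi> v* M))) x = (\<integral>y. ?g y * ?kM (x - y) \<partial>lborel)" for x
      by (rule tempered_convolution_inverse_fourier[OF f u vM, symmetric])
    have main: "(\<integral>\<^sup>+x. ennreal (norm (\<integral>y. ?g y * ?kM (x - y) \<partial>lborel) powr P) \<partial>lborel) \<le>
        ennreal (max (B powr (1 - P) * K) (K powr P)) * (\<integral>\<^sup>+x. ennreal (norm (?g x) powr P) \<partial>lborel)"
    proof (cases "P \<le> 1")
      case True
      \<comment> \<open>Supremum bound of the dilated reproducing kernel. Its inverse determinant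
        enters to the power 1 - P and cancels the determinant in \<open>dil\<close>.\<close>
      define BM where "BM = inverse \<bar>det M\<bar> * B"
      have BM0: "0 \<le> BM" using B by (simp add: BM_def)
      have bound: "norm (?g z * ?kM (x - z)) \<le> BM * (\<integral>y. norm (?g y * ?kM (x - y)) \<partial>lborel)" for x z
      proof -
        have \<kappa>b: "norm (inverse_fourier ?\<kappa>M y) \<le> BM" for y
          unfolding inverse_fourier_matrix[OF M schwartz_measurable[OF \<kappa>]] matrix_dilation_def BM_def
          using B by (simp add: norm_mult norm_inverse mult_left_mono)
        have "?g z * ?kM (x - z) = (\<integral>y. ?g y * ?kM (x - y) * inverse_fourier ?\<kappa>M (z - y) \<partial>lborel)"
        proof (rule tempered_product_reproducing[OF f u vM \<kappa>M, symmetric])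
          fix \<xi> \<eta> assume "u \<xi> \<noteq> 0" "v (\<eta> v* M) \<noteq> 0"
          then show "\<kappa> ((\<xi> - \<eta>) v* M) = 1" using one by (simp add: vector_matrix_mult_diff_distrib)
        qed
        also have "norm \<dots> \<le> (\<integral>y. BM * norm (?g y * ?kM (x - y)) \<partial>lborel)"
        proof (rule Bochner_Integration.integral_norm_bound_integral)
          show "integrable lborel (\<lambda>y. BM * norm (?g y * ?kM (x - y)))"
            by (intro integrable_mult_right integrable_norm int)
          show le: "norm (?g y * ?kM (x - y) * inverse_fourier ?\<kappa>M (z - y)) \<le> BM * norm (?g y * ?kM (x - y))" for y
            using mult_right_mono[OF \<kappa>b[of "z - y"] norm_ge_zero[of "?g y * ?kM (x - y)"]]
            by (simp only: norm_mult mult_ac)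
          show "integrable lborel (\<lambda>y. ?g y * ?kM (x - y) * inverse_fourier ?\<kappa>M (z - y))"
          proof (rule Bochner_Integration.integrable_bound)
            show "integrable lborel (\<lambda>y. BM * norm (?g y * ?kM (x - y)))"
              by (intro integrable_mult_right integrable_norm int)
            show "(\<lambda>y. ?g y * ?kM (x - y) * inverse_fourier ?\<kappa>M (z - y)) \<in> borel_measurable lborel"
              using schwartz_measurable[OF schwartz_reflect[OF schwartz_inverse_fourier[OF \<kappa>M]], of z] int[of x] by auto
            show "AE y in lborel. norm (?g y * ?kM (x - y) * inverse_fourier ?\<kappa>M (z - y)) \<le> norm (BM * norm (?g y * ?kM (x - y)))"
              using le BM0 by (intro AE_I2) (auto simp: abs_mult intro: order_trans)
          qed
        qed
        finally show ?thesis by simp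
      qed
      have "(\<integral>\<^sup>+x. ennreal (norm (\<integral>y. ?g y * ?kM (x - y) \<partial>lborel) powr P) \<partial>lborel) \<le>
          ennreal (BM powr (1 - P)) * ((\<integral>\<^sup>+x. ennreal (norm (?g x) powr P) \<partial>lborel) * (\<integral>\<^sup>+x. ennreal (norm (?kM x) powr P) \<partial>lborel))"
        by (rule Lp_convolution_le_one[OF P True gm schwartz_measurable[OF skM] int BM0 bound])
      also have "\<dots> \<le> ennreal (BM powr (1 - P)) * ((\<integral>\<^sup>+x. ennreal (norm (?g x) powr P) \<partial>lborel) * ennreal (K * \<bar>det M\<bar> powr (1 - P)))"
        unfolding kM dil[OF M] using K(2) by (intro mult_left_mono ennreal_leI mult_right_mono) auto
      also have "\<dots> = ennreal (BM powr (1 - P) * (K * \<bar>det M\<bar> powr (1 - P))) * (\<integral>\<^sup>+x. ennreal (norm (?g x) powr P) \<partial>lborel)"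
        using K(1) by (simp add: ennreal_mult mult_ac)
      also have "BM powr (1 - P) * (K * \<bar>det M\<bar> powr (1 - P)) = B powr (1 - P) * K"
        using M B by (simp add: BM_def powr_mult inverse_powr)
      finally show ?thesis
        by (rule order_trans) (intro mult_right_mono ennreal_leI, auto)
    next
      case False
      then have P1: "1 \<le> P" by simp
      have "(\<integral>\<^sup>+x. ennreal (norm (\<integral>y. ?g y * ?kM (x - y) \<partial>lborel) powr P) \<partial>lborel) \<le>
          ennreal ((1 + (\<integral>x. norm (?kM x) \<partial>lborel)) powr P) * (\<integral>\<^sup>+x. ennreal (norm (?g x) powr P) \<partial>lborel)"
        by (rule Lp_convolution_ge_one[OF P1 gm schwartz_measurable[OF skM] int schwartz_integrable[OF skM]])
      also have "\<dots> \<le> ennreal (max (B powr (1 - P) * K) (K powr P)) * (\<integral>\<^sup>+x. ennreal (norm (?g x) powr P) \<partial>lborel)"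
      proof (intro mult_right_mono ennreal_leI)
        have "(1 + (\<integral>x. norm (?kM x) \<partial>lborel)) powr P \<le> K powr P"
          unfolding kM dil1[OF M] using K(3) K1 P by (intro powr_mono2) auto
        then show "(1 + (\<integral>x. norm (?kM x) \<partial>lborel)) powr P \<le> max (B powr (1 - P) * K) (K powr P)" by simp
      qed simp
      finally show ?thesis .
    qed
    have "Lp_norm p (f \<star> inverse_fourier (\<lambda>\<xi>. u \<xi> * v (\<xi> v* M))) \<le>
        ennreal_powr (ennreal (max (B powr (1 - P) * K) (K powr P)) * (\<integral>\<^sup>+x. ennreal (norm (?g x) powr P) \<partial>lborel)) (1 / P)"
      unfolding Lp conv using P by (intro ennreal_powr_mono main) auto
    also have "\<dots> = ennreal C * Lp_norm p ?g"
      unfolding Lp C_def using K(1) by (intro ennreal_powr_mult) (simp add: less_max_iff_disj)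
    finally show "Lp_norm p (f \<star> inverse_fourier (\<lambda>\<xi>. u \<xi> * v (\<xi> v* M))) \<le> ennreal C * Lp_norm p ?g" .
  qed
qed

section \<open>Frequency supports of shearlets\<close>

lemma C_infinity_has_vector_derivative:
  fixes a :: "real \<Rightarrow> complex"
  assumes "C_infinity a"
  shows "(a has_derivative (\<lambda>h. h *\<^sub>R partial_derivative 1 a t)) (at t)"
proof -
  have d: "(a has_derivative frechet_derivative a (at t)) (at t)"
    by (rule has_derivative_frechet[OF C_infinity_differentiable[OF assms]])
  have "frechet_derivative a (at t) h = h *\<^sub>R partial_derivative 1 a t" for h
    using frechet_derivative_eq_sum_partial[OF C_infinity_differentiable[OF assms], of t h] by simp
  then have "frechet_derivative a (at t) = (\<lambda>h. h *\<^sub>R partial_derivative 1 a t)" by (rule ext)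
  with d show ?thesis by simp
qed

text \<open>A shearlet profile with general radial and angular factors and n additional powers of
  the inverse of the k-th coordinate. Each derivative of a slope produces one more such power, so
  that this family, unlike the profiles alone, is closed under partial derivatives up to linear
  combinations.\<close>

definition cone_function :: "'d::finite \<Rightarrow> (real \<Rightarrow> complex) \<Rightarrow> nat \<Rightarrow> ('d \<Rightarrow> real \<Rightarrow> complex) \<Rightarrow> real^'d \<Rightarrow> complex" where
  "cone_function k a n b \<xi> =
     a (\<xi> $ k) * complex_of_real (inverse (\<xi> $ k)) ^ n * (\<Prod>i\<in>UNIV - {k}. b i (\<xi> $ i / \<xi> $ k))"

context
  fixes k :: "'d::finite" and r :: real
  assumes r: "r > 0"
begin

text \<open>Vanishing near 0 keeps the slopes away from the hyperplane where they are singular, and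
  differentiation preserves it with the same r.\<close>

definition radial :: "(real \<Rightarrow> complex) set" where
  "radial = {a. C_infinity a \<and> (\<forall>t. \<bar>t\<bar> < r \<longrightarrow> a t = 0)}"

lemma partial_radial:
  assumes "a \<in> radial" shows "partial_derivative 1 a \<in> radial"
  unfolding radial_def mem_Collect_eq
proof (intro conjI allI impI)
  show "C_infinity (partial_derivative 1 a)" using assms by (intro C_infinity_partial) (auto simp: radial_def)
  fix t :: real assume t: "\<bar>t\<bar> < r"
  have "(a has_derivative (\<lambda>_. 0)) (at t)"
  proof (rule has_derivative_transform_within_open[of "\<lambda>_. 0"])
    show "open {t::real. \<bar>t\<bar> < r}" by (intro open_Collect_less continuous_intros)
  qed (use t assms in \<open>auto simp: radial_def\<close>)
  then show "partial_derivative 1 a t = 0" by (rule partial_derivative_eq)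
qed

lemma cone_function_has_derivative_0:
  assumes "a \<in> radial" "\<bar>\<xi> $ k\<bar> < r"
  shows "(cone_function k a n b has_derivative (\<lambda>_. 0)) (at \<xi>)"
proof (rule has_derivative_transform_within_open[of "\<lambda>_. 0"])
  show "open {\<xi>::real^'d. \<bar>\<xi> $ k\<bar> < r}" by (intro open_Collect_less continuous_intros)
qed (use assms in \<open>auto simp: radial_def cone_function_def\<close>)

text \<open>The angular factor t * b' t arises because the derivative of a slope t in direction k is
  -t divided by the k-th coordinate.\<close>

lemma cone_function_has_derivative:
  assumes a: "a \<in> radial" and b: "\<And>i. C_infinity (b i)" and nz: "\<xi> $ k \<noteq> 0"
  shows "(cone_function k a n b has_derivative (\<lambda>h.
      (h $ k) *\<^sub>R (cone_function k (partial_derivative 1 a) n b \<xi> - of_nat n * cone_function k a (Suc n) b \<xi>)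
      + (\<Sum>i\<in>UNIV - {k}. (h $ i) *\<^sub>R cone_function k a (Suc n) (b(i := partial_derivative 1 (b i))) \<xi>
          - (h $ k) *\<^sub>R cone_function k a (Suc n) (b(i := \<lambda>t. t * partial_derivative 1 (b i) t)) \<xi>))) (at \<xi>)"
proof -
  let ?I = "UNIV - {k}"
  have dnth: "((\<lambda>\<xi>::real^'d. \<xi> $ i) has_derivative (\<lambda>h. h $ i)) (at \<xi>)" for i
    by (rule bounded_linear_imp_has_derivative[OF bounded_linear_vec_nth])
  have da: "((\<lambda>\<xi>. a (\<xi> $ k)) has_derivative (\<lambda>h. (h $ k) *\<^sub>R partial_derivative 1 a (\<xi> $ k))) (at \<xi>)"
    by (rule has_derivative_compose[of "\<lambda>\<xi>. \<xi> $ k", OF dnth C_infinity_has_vector_derivative])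
      (use a in \<open>auto simp: radial_def\<close>)
  have dinv: "((\<lambda>\<xi>. complex_of_real (inverse (\<xi> $ k)) ^ n) has_derivative
      (\<lambda>h. - of_nat n * (h $ k) *\<^sub>R complex_of_real (inverse (\<xi> $ k)) ^ Suc n)) (at \<xi>)"
  proof -
    have "((\<lambda>\<xi>. inverse (\<xi> $ k) ^ n) has_derivative (\<lambda>h. - of_nat n * (h $ k) * inverse (\<xi> $ k) ^ Suc n)) (at \<xi>)"
      by (rule has_derivative_eq_rhs[OF has_derivative_power[OF Deriv.has_derivative_inverse[OF nz dnth]]], rule ext, cases n)
        (simp_all add: algebra_simps)
    then have "((\<lambda>\<xi>. complex_of_real (inverse (\<xi> $ k) ^ n)) has_derivative
        (\<lambda>h. complex_of_real (- of_nat n * (h $ k) * inverse (\<xi> $ k) ^ Suc n))) (at \<xi>)"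
      by (rule has_derivative_of_real)
    then show ?thesis by (simp add: scaleR_conv_of_real algebra_simps)
  qed
  have db: "((\<lambda>\<xi>. b i (\<xi> $ i / \<xi> $ k)) has_derivative
      (\<lambda>h. (h $ i * inverse (\<xi> $ k) - \<xi> $ i / \<xi> $ k * h $ k * inverse (\<xi> $ k)) *\<^sub>R partial_derivative 1 (b i) (\<xi> $ i / \<xi> $ k))) (at \<xi>)" for i
  proof (rule has_derivative_compose[of "\<lambda>\<xi>. \<xi> $ i / \<xi> $ k", OF _ C_infinity_has_vector_derivative[OF b]])
    show "((\<lambda>\<xi>. \<xi> $ i / \<xi> $ k) has_derivative (\<lambda>h. h $ i * inverse (\<xi> $ k) - \<xi> $ i / \<xi> $ k * h $ k * inverse (\<xi> $ k))) (at \<xi>)"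
      by (rule has_derivative_eq_rhs[OF has_derivative_divide[OF dnth dnth nz]]) (simp add: fun_eq_iff divide_inverse algebra_simps)
  qed
  have upd: "(\<Prod>j\<in>?I. (b(i := c)) j (\<xi> $ j / \<xi> $ k)) = c (\<xi> $ i / \<xi> $ k) * (\<Prod>j\<in>?I - {i}. b j (\<xi> $ j / \<xi> $ k))"
    if "i \<in> ?I" for i c
  proof -
    have "(\<Prod>j\<in>?I - {i}. (b(i := c)) j (\<xi> $ j / \<xi> $ k)) = (\<Prod>j\<in>?I - {i}. b j (\<xi> $ j / \<xi> $ k))"
      by (rule prod.cong) auto
    then show ?thesis using prod.remove[of ?I i "\<lambda>j. (b(i := c)) j (\<xi> $ j / \<xi> $ k)"] that by simp
  qed
  have dF: "(cone_function k a n b has_derivative (\<lambda>h.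
      a (\<xi> $ k) * complex_of_real (inverse (\<xi> $ k)) ^ n *
        (\<Sum>i\<in>?I. (h $ i * inverse (\<xi> $ k) - \<xi> $ i / \<xi> $ k * h $ k * inverse (\<xi> $ k)) *\<^sub>R partial_derivative 1 (b i) (\<xi> $ i / \<xi> $ k) *
          (\<Prod>j\<in>?I - {i}. b j (\<xi> $ j / \<xi> $ k)))
      + (a (\<xi> $ k) * (- of_nat n * (h $ k) *\<^sub>R complex_of_real (inverse (\<xi> $ k)) ^ Suc n)
          + (h $ k) *\<^sub>R partial_derivative 1 a (\<xi> $ k) * complex_of_real (inverse (\<xi> $ k)) ^ n) *
        (\<Prod>i\<in>?I. b i (\<xi> $ i / \<xi> $ k)))) (at \<xi>)"
    unfolding cone_function_def[abs_def]
    by (intro has_derivative_mult has_derivative_prod da dinv db)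
  show ?thesis
  proof (rule has_derivative_eq_rhs[OF dF], rule ext)
    fix h :: "real^'d"
    have summand: "a (\<xi> $ k) * complex_of_real (inverse (\<xi> $ k)) ^ n *
        ((h $ i * inverse (\<xi> $ k) - \<xi> $ i / \<xi> $ k * h $ k * inverse (\<xi> $ k)) *\<^sub>R partial_derivative 1 (b i) (\<xi> $ i / \<xi> $ k) *
          (\<Prod>j\<in>?I - {i}. b j (\<xi> $ j / \<xi> $ k))) =
        (h $ i) *\<^sub>R cone_function k a (Suc n) (b(i := partial_derivative 1 (b i))) \<xi>
          - (h $ k) *\<^sub>R cone_function k a (Suc n) (b(i := \<lambda>t. t * partial_derivative 1 (b i) t)) \<xi>"
      if "i \<in> ?I" for i
      unfolding cone_function_def upd[OF that] by (simp add: scaleR_conv_of_real algebra_simps)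
    have "a (\<xi> $ k) * complex_of_real (inverse (\<xi> $ k)) ^ n *
        (\<Sum>i\<in>?I. (h $ i * inverse (\<xi> $ k) - \<xi> $ i / \<xi> $ k * h $ k * inverse (\<xi> $ k)) *\<^sub>R partial_derivative 1 (b i) (\<xi> $ i / \<xi> $ k) *
          (\<Prod>j\<in>?I - {i}. b j (\<xi> $ j / \<xi> $ k))) =
        (\<Sum>i\<in>?I. (h $ i) *\<^sub>R cone_function k a (Suc n) (b(i := partial_derivative 1 (b i))) \<xi>
          - (h $ k) *\<^sub>R cone_function k a (Suc n) (b(i := \<lambda>t. t * partial_derivative 1 (b i) t)) \<xi>)"
      unfolding sum_distrib_left by (intro sum.cong refl summand)
    moreover have "(a (\<xi> $ k) * (- of_nat n * (h $ k) *\<^sub>R complex_of_real (inverse (\<xi> $ k)) ^ Suc n)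
          + (h $ k) *\<^sub>R partial_derivative 1 a (\<xi> $ k) * complex_of_real (inverse (\<xi> $ k)) ^ n) *
        (\<Prod>i\<in>?I. b i (\<xi> $ i / \<xi> $ k)) =
        (h $ k) *\<^sub>R (cone_function k (partial_derivative 1 a) n b \<xi> - of_nat n * cone_function k a (Suc n) b \<xi>)"
      unfolding cone_function_def by (simp add: scaleR_conv_of_real algebra_simps)
    ultimately show "a (\<xi> $ k) * complex_of_real (inverse (\<xi> $ k)) ^ n *
        (\<Sum>i\<in>?I. (h $ i * inverse (\<xi> $ k) - \<xi> $ i / \<xi> $ k * h $ k * inverse (\<xi> $ k)) *\<^sub>R partial_derivative 1 (b i) (\<xi> $ i / \<xi> $ k) *
          (\<Prod>j\<in>?I - {i}. b j (\<xi> $ j / \<xi> $ k)))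
      + (a (\<xi> $ k) * (- of_nat n * (h $ k) *\<^sub>R complex_of_real (inverse (\<xi> $ k)) ^ Suc n)
          + (h $ k) *\<^sub>R partial_derivative 1 a (\<xi> $ k) * complex_of_real (inverse (\<xi> $ k)) ^ n) *
        (\<Prod>i\<in>?I. b i (\<xi> $ i / \<xi> $ k)) =
      (h $ k) *\<^sub>R (cone_function k (partial_derivative 1 a) n b \<xi> - of_nat n * cone_function k a (Suc n) b \<xi>)
      + (\<Sum>i\<in>?I. (h $ i) *\<^sub>R cone_function k a (Suc n) (b(i := partial_derivative 1 (b i))) \<xi>
          - (h $ k) *\<^sub>R cone_function k a (Suc n) (b(i := \<lambda>t. t * partial_derivative 1 (b i) t)) \<xi>)"
      by (simp only: add.commute)
  qed
qed

lemma C_infinity_cone_function: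
  assumes "a \<in> radial" "\<And>i. C_infinity (b i)"
  shows "C_infinity (cone_function k a n b)"
proof (rule C_infinity_coinduct)
  let ?X = "{cone_function k a n b | a n b. a \<in> radial \<and> (\<forall>i. C_infinity (b i))}"
  show "cone_function k a n b \<in> lin_hull ?X" using assms by (auto intro!: lin_hull_base)
  have base: "cone_function k a n b \<in> lin_hull ?X" if "a \<in> radial" "\<forall>i. C_infinity (b i)" for a n b
    by (rule lin_hull_base) (use that in auto)
  show "g differentiable_on UNIV" if "g \<in> ?X" for g
  proof -
    obtain a n b where g: "g = cone_function k a n b" "a \<in> radial" "\<forall>i. C_infinity (b i)" using \<open>g \<in> ?X\<close> by auto
    have "g differentiable (at \<xi>)" for \<xi>
    proof (cases "\<xi> $ k = 0")
      case True
      then show ?thesis unfolding g(1) using r by (intro differentiableI[OF cone_function_has_derivative_0] g) auto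
    next
      case False
      then show ?thesis unfolding g(1) using g(3) by (intro differentiableI[OF cone_function_has_derivative] g) auto
    qed
    then show ?thesis by (simp add: differentiable_on_def)
  qed
  show "partial_derivative e g \<in> lin_hull ?X" if "g \<in> ?X" "e \<in> Basis" for g e
  proof -
    obtain a n b where g: "g = cone_function k a n b" "a \<in> radial" "\<forall>i. C_infinity (b i)" using \<open>g \<in> ?X\<close> by auto
    \<comment> \<open>The span consists of functions on the whole space, so one expression has to be
      valid everywhere. On the hyperplane it gives 0, since a and its derivative vanish
      there.\<close>
    let ?D = "\<lambda>\<xi>. complex_of_real (e $ k) * (cone_function k (partial_derivative 1 a) n b \<xi> + - of_nat n * cone_function k a (Suc n) b \<xi>)
      + (\<Sum>i\<in>UNIV - {k}. complex_of_real (e $ i) * cone_function k a (Suc n) (b(i := partial_derivative 1 (b i))) \<xi>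
          + - complex_of_real (e $ k) * cone_function k a (Suc n) (b(i := \<lambda>t. t * partial_derivative 1 (b i) t)) \<xi>)"
    have "partial_derivative e g = ?D"
    proof
      fix \<xi>
      show "partial_derivative e g \<xi> = ?D \<xi>"
      proof (cases "\<xi> $ k = 0")
        case True
        then have z: "a (\<xi> $ k) = 0" "partial_derivative 1 a (\<xi> $ k) = 0"
          using g(2) partial_radial[OF g(2)] r by (auto simp: radial_def)
        have "partial_derivative e g \<xi> = 0"
          unfolding g(1) using True r by (intro partial_derivative_eq[OF cone_function_has_derivative_0] g) auto
        then show ?thesis using z by (simp add: cone_function_def)
      next
        case False
        show ?thesis
          unfolding g(1) using g(3) False
          by (subst partial_derivative_eq[OF cone_function_has_derivative]) (auto simp: g scaleR_conv_of_real)
      qed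
    qed
    moreover have "?D \<in> lin_hull ?X"
    proof (intro lin_hull_add lin_hull_scale lin_hull_sum base)
      have id: "C_infinity (\<lambda>t::real. complex_of_real t)"
        using slowly_increasing_inner[of "1::real"] by (simp add: slowly_increasing_def)
      show "\<forall>j. C_infinity ((b(i := partial_derivative 1 (b i))) j)" for i
        using g(3) C_infinity_partial[of "b i" 1] by auto
      show "\<forall>j. C_infinity ((b(i := \<lambda>t. t * partial_derivative 1 (b i) t)) j)" for i
        using g(3) C_infinity_mult[OF id C_infinity_partial[of "b i" 1]] by auto
    qed (use g partial_radial in auto)
    ultimately show ?thesis by simp
  qed
qed

end

lemma supp_subsetD: "supp f \<subseteq> A \<Longrightarrow> f x \<noteq> 0 \<Longrightarrow> x \<in> A"
  using closure_subset by (force simp: supp_def)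

text \<open>Slopes bounded by 1 make coordinate k the largest one on the support, and the radial
  factor bounds that coordinate by 1/2. This yields compactness as well as the coordinate
  bound.\<close>

lemma shearlet_hat_schwartz:
  fixes k :: "'d::finite"
  assumes \<psi>: "C_infinity \<psi>1" "C_infinity \<psi>2"
    and supp1: "\<And>t. \<psi>1 t \<noteq> 0 \<Longrightarrow> 1/16 \<le> \<bar>t\<bar> \<and> \<bar>t\<bar> \<le> 1/2"
    and supp2: "\<And>t. \<psi>2 t \<noteq> 0 \<Longrightarrow> \<bar>t\<bar> \<le> 1"
  shows "shearlet_hat \<psi>1 \<psi>2 k \<in> schwartz"
    and "shearlet_hat \<psi>1 \<psi>2 k \<xi> \<noteq> 0 \<Longrightarrow> \<bar>\<xi> $ i\<bar> \<le> 1/2"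
proof -
  show le: "\<bar>\<xi> $ i\<bar> \<le> 1/2" if "shearlet_hat \<psi>1 \<psi>2 k \<xi> \<noteq> 0" for \<xi> i
  proof (cases "i = k")
    case False
    have "\<psi>1 (\<xi> $ k) \<noteq> 0" "\<psi>2 (\<xi> $ i / \<xi> $ k) \<noteq> 0"
      using that False by (auto simp: shearlet_hat_def)
    from supp1[OF this(1)] supp2[OF this(2)] show ?thesis by (auto simp: abs_divide divide_simps split: if_splits)
  qed (use that supp1 in \<open>auto simp: shearlet_hat_def\<close>)
  have "C_infinity (cone_function k \<psi>1 0 (\<lambda>_. \<psi>2))"
    by (rule C_infinity_cone_function[of "1/16"]) (use \<psi> supp1 in \<open>force simp: radial_def\<close>)+
  moreover have "cone_function k \<psi>1 0 (\<lambda>_. \<psi>2) = shearlet_hat \<psi>1 \<psi>2 k"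
    by (simp add: cone_function_def shearlet_hat_def fun_eq_iff)
  ultimately have C: "C_infinity (shearlet_hat \<psi>1 \<psi>2 k)" by simp
  show "shearlet_hat \<psi>1 \<psi>2 k \<in> schwartz"
  proof (rule schwartz_compact_support[OF C])
    fix \<xi> :: "real^'d" assume *: "norm \<xi> > real CARD('d)"
    show "shearlet_hat \<psi>1 \<psi>2 k \<xi> = 0"
    proof (rule ccontr)
      assume "shearlet_hat \<psi>1 \<psi>2 k \<xi> \<noteq> 0"
      then have "(\<Sum>i\<in>UNIV. \<bar>\<xi> $ i\<bar>) \<le> (\<Sum>i\<in>(UNIV::'d set). 1)"
        by (intro sum_mono order_trans[OF le]) auto
      then show False using * norm_le_l1_cart[of \<xi>] by simp
    qed
  qed
qed

section \<open>Dilation and shear matrices acting on row vectors\<close>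

lemma diagonal_matrix_mult:
  "(\<chi> r c. if r \<noteq> c then 0 else f r) ** (\<chi> r c. if r \<noteq> c then 0 else g r) =
    (\<chi> r c. if r \<noteq> c then 0 else f r * g r :: real^'d^'d)"
proof -
  have "(\<Sum>m\<in>UNIV. (if r \<noteq> m then 0 else f r) * (if m \<noteq> c then 0 else g m)) =
      (\<Sum>m\<in>UNIV. if m = r then if r \<noteq> c then 0 else f r * g r else 0)" for r c :: 'd
    by (rule sum.cong) auto
  then show ?thesis by (simp only: matrix_matrix_mult_def vec_lambda_beta vec_eq_iff) simp
qed

text \<open>\<open>matrix_inv\<close> is defined by choice. It is identified by invertibility:
  multiplied from the left, it turns the explicit right inverse into itself.\<close>

lemma matrix_inv_A_matrix:
  "matrix_inv (A_matrix k) = (\<chi> r c. if r \<noteq> c then 0 else if r = k then 1 / 4 else 1 / 2 :: real^'d^'d)"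
    (is "_ = ?A'")
proof -
  have r: "A_matrix k ** ?A' = mat 1"
    unfolding A_matrix_def diagonal_matrix_mult by (auto simp: mat_def vec_eq_iff)
  have "det (A_matrix k ** ?A') = 1" unfolding r by simp
  then have "det (A_matrix k) * det ?A' = 1" by (simp only: det_mul)
  then have "det (A_matrix k) \<noteq> 0" by auto
  then have "matrix_inv (A_matrix k) ** A_matrix k = mat 1" by (rule matrix_inv_cancel)
  then have "?A' = (matrix_inv (A_matrix k) ** A_matrix k) ** ?A'" by simp
  also have "\<dots> = matrix_inv (A_matrix k)" unfolding matrix_mul_assoc[symmetric] r by simp
  finally show ?thesis ..
qed

lemma A_neg_power_eq:
  "A_neg_power k j = (\<chi> r c. if r \<noteq> c then 0 else if r = k then 1 / 4 ^ j else 1 / 2 ^ j :: real^'d^'d)"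
proof (induction j)
  case 0
  show ?case by (auto simp: A_neg_power_def mat_def vec_eq_iff)
next
  case (Suc j)
  have "A_neg_power k (Suc j) = matrix_inv (A_matrix k) ** A_neg_power k j" by (simp add: A_neg_power_def)
  also have "\<dots> = (\<chi> r c. if r \<noteq> c then 0 else if r = k then 1 / 4 ^ Suc j else 1 / 2 ^ Suc j)"
    unfolding Suc.IH matrix_inv_A_matrix diagonal_matrix_mult by (auto simp: vec_eq_iff)
  finally show ?case .
qed

lemma vector_A_neg_power: "(\<xi> v* A_neg_power k j) $ c = (if c = k then \<xi> $ k / 4 ^ j else \<xi> $ c / 2 ^ j)"
proof -
  have "(\<xi> v* A_neg_power k j) $ c = (\<Sum>i\<in>UNIV. if i = c then if c = k then \<xi> $ k / 4 ^ j else \<xi> $ c / 2 ^ j else 0)"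
    unfolding vector_matrix_mult_def A_neg_power_eq vec_lambda_beta by (rule sum.cong) auto
  then show ?thesis by simp
qed

lemma vector_B_matrix: "(\<xi> v* B_matrix k l) $ c = (if c = k then \<xi> $ k else \<xi> $ c + of_int (l $ c) * \<xi> $ k)"
proof -
  have "(\<xi> v* B_matrix k l) $ c = (\<Sum>i\<in>UNIV. (if i = c then \<xi> $ i else 0) + (if i = k then if c = k then 0 else of_int (l $ c) * \<xi> $ i else 0))"
    unfolding vector_matrix_mult_def B_matrix_def vec_lambda_beta by (rule sum.cong) auto
  then show ?thesis by (simp add: sum.distrib)
qed

lemma vector_shear_matrix:
  "(\<xi> v* (A_neg_power k j ** B_matrix k (- l))) $ c =
    (if c = k then \<xi> $ k / 4 ^ j else \<xi> $ c / 2 ^ j - of_int (l $ c) * \<xi> $ k / 4 ^ j)"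
  by (simp add: vector_B_matrix vector_A_neg_power flip: vector_matrix_mul_assoc)

lemma det_shear_matrix: "det (A_neg_power k j ** B_matrix k l) \<noteq> (0::real)"
proof -
  have "v v* (B_matrix k l ** B_matrix k (- l)) = v" for v :: "real^'a"
    by (simp add: vec_eq_iff vector_B_matrix flip: vector_matrix_mul_assoc)
  then have "transpose (B_matrix k l ** B_matrix k (- l)) = (mat 1 :: real^'a^'a)"
    by (subst matrix_eq) simp
  then have "det (B_matrix k l) * det (B_matrix k (- l)) = (1::real)"
    by (metis det_I det_mul det_transpose)
  then have "det (B_matrix k l) \<noteq> (0::real)" by auto
  moreover have "det (A_neg_power k j) \<noteq> (0::real)"
    by (subst det_diagonal) (auto simp: A_neg_power_eq)
  ultimately show ?thesis by (simp add: det_mul)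
qed

lemma power4: "(4::real) ^ j = 2 ^ j * 2 ^ j" and power8: "(8::real) ^ j = 2 ^ j * 4 ^ j"
  by (simp_all flip: power_mult_distrib)

text \<open>\<open>None\<close> is the low-pass function and \<open>Some (k, j, l)\<close> the
  shearlet of direction k, scale j and shear l. With this encoding \<open>atom_group\<close> takes
  the d + 1 values over which the product in the decomposition runs.\<close>

type_synonym 'd atom = "('d \<times> nat \<times> (int^'d)) option"

definition atom_group :: "'d::finite atom \<Rightarrow> 'd option" where
  "atom_group a = map_option fst a"

definition atom_scale :: "'d::finite atom \<Rightarrow> nat" where
  "atom_scale a = (case a of None \<Rightarrow> 0 | Some (k, j, l) \<Rightarrow> j)"

definition atom_matrix :: "'d::finite atom \<Rightarrow> real^'d^'d" where
  "atom_matrix a = (case a of None \<Rightarrow> mat 1 | Some (k, j, l) \<Rightarrow> A_neg_power k j ** B_matrix k (- l))"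

definition atoms :: "'d::finite atom set" where
  "atoms = insert None {Some (k, j, l) | k j l. l \<in> shears k j}"

lemma det_atom_matrix: "det (atom_matrix a) \<noteq> 0"
  by (auto simp: atom_matrix_def det_shear_matrix split: option.split)

section \<open>Atoms and the geometry of their supports\<close>

locale shearlet_system =
  fixes \<psi>1 \<psi>2 :: "real \<Rightarrow> complex" and \<Psi>h :: "real^'d \<Rightarrow> complex"
  assumes generators: "shearlet_generators \<psi>1 \<psi>2 \<Psi>h"
begin

definition generator :: "'d option \<Rightarrow> real^'d \<Rightarrow> complex" where
  "generator g = (case g of None \<Rightarrow> \<Psi>h | Some k \<Rightarrow> shearlet_hat \<psi>1 \<psi>2 k)"

definition atom_hat :: "'d atom \<Rightarrow> real^'d \<Rightarrow> complex" where
  "atom_hat a \<xi> = generator (atom_group a) (\<xi> v* atom_matrix a)"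

lemma \<psi>1_nonzero: "\<psi>1 t \<noteq> 0 \<Longrightarrow> 1/16 \<le> \<bar>t\<bar> \<and> \<bar>t\<bar> \<le> 1/2"
  using generators supp_subsetD[of \<psi>1 "{- 1/2 .. - 1/16} \<union> {1/16 .. 1/2}" t]
  by (auto simp: shearlet_generators_def)

lemma \<psi>2_nonzero: "\<psi>2 t \<noteq> 0 \<Longrightarrow> \<bar>t\<bar> \<le> 1"
  using generators supp_subsetD[of \<psi>2 "{- 1 .. 1}" t]
  by (auto simp: shearlet_generators_def)

lemma \<Psi>h_nonzero: "\<Psi>h \<xi> \<noteq> 0 \<Longrightarrow> \<bar>\<xi> $ i\<bar> \<le> 1/4"
  using generators supp_subsetD[of \<Psi>h "{\<xi>. \<forall>i. \<bar>\<xi> $ i\<bar> \<le> 1/4}" \<xi>]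
  by (auto simp: shearlet_generators_def)

lemma \<Psi>h_schwartz: "\<Psi>h \<in> schwartz"
proof (rule schwartz_compact_support[of _ "real CARD('d)"])
  show "C_infinity \<Psi>h" using generators by (simp add: shearlet_generators_def)
  fix \<xi> :: "real^'d" assume *: "norm \<xi> > real CARD('d)"
  show "\<Psi>h \<xi> = 0"
  proof (rule ccontr)
    assume nz: "\<Psi>h \<xi> \<noteq> 0"
    have "(\<Sum>i\<in>UNIV. \<bar>\<xi> $ i\<bar>) \<le> (\<Sum>i\<in>(UNIV::'d set). 1)"
      by (intro sum_mono order_trans[OF \<Psi>h_nonzero[OF nz]]) auto
    then show False using * norm_le_l1_cart[of \<xi>] by simp
  qed
qed

lemma generator_schwartz: "generator g \<in> schwartz"
  and generator_nonzero: "generator g \<xi> \<noteq> 0 \<Longrightarrow> \<bar>\<xi> $ i\<bar> \<le> 1"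
proof -
  have C: "C_infinity \<psi>1" "C_infinity \<psi>2" using generators by (simp_all add: shearlet_generators_def)
  note s = shearlet_hat_schwartz[OF C \<psi>1_nonzero \<psi>2_nonzero]
  show "generator g \<in> schwartz" by (cases g) (simp_all add: generator_def s(1) \<Psi>h_schwartz)
  show "\<bar>\<xi> $ i\<bar> \<le> 1" if "generator g \<xi> \<noteq> 0"
  proof (cases g)
    case None
    then show ?thesis using that \<Psi>h_nonzero[of \<xi> i] by (simp add: generator_def)
  next
    case (Some k)
    then show ?thesis using that s(2)[of k \<xi> i] by (simp add: generator_def)
  qed
qed

lemma atom_hat_schwartz: "atom_hat a \<in> schwartz"
  unfolding atom_hat_def[abs_def] by (intro schwartz_matrix generator_schwartz det_atom_matrix)

text \<open>A smooth cut-off made from the low-pass function: the scale 1 / (8 R) carries the cube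
  of half-side R to the cube where the modulus of \<open>\<Psi>h\<close> is 1. The squared modulus
  removes the unknown phase.\<close>

definition bump :: "real \<Rightarrow> real^'d \<Rightarrow> complex" where
  "bump R \<xi> = \<Psi>h ((1 / (8 * R)) *\<^sub>R \<xi>) * cnj (\<Psi>h ((1 / (8 * R)) *\<^sub>R \<xi>))"

lemma bump_schwartz: "R > 0 \<Longrightarrow> bump R \<in> schwartz"
proof -
  assume R: "R > 0"
  have "(\<lambda>\<xi>. \<Psi>h (0 + (1 / (8 * R)) *\<^sub>R \<xi>)) \<in> schwartz"
    using R by (intro schwartz_affine \<Psi>h_schwartz) (auto simp: inj_on_def)
  then have "(\<lambda>\<xi>. \<Psi>h ((1 / (8 * R)) *\<^sub>R \<xi>)) \<in> schwartz" by simp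
  then show ?thesis unfolding bump_def[abs_def] by (intro schwartz_mult' schwartz_cnj)
qed

lemma bump_eq_1:
  assumes "R > 0" "\<And>i. \<bar>\<xi> $ i\<bar> \<le> R"
  shows "bump R \<xi> = 1"
proof -
  have "(1 / (8 * R)) *\<^sub>R \<xi> \<in> low_frequency_cube"
    using assms by (auto simp: low_frequency_cube_def abs_mult field_simps)
  then have "norm (\<Psi>h ((1 / (8 * R)) *\<^sub>R \<xi>)) = 1" using generators by (simp add: shearlet_generators_def)
  then show ?thesis by (simp add: bump_def complex_norm_square[symmetric])
qed

text \<open>In terms of slopes a shear acts as a translation, so the angular window is centred at l
  / 2 ^ j with half-width 1 / 2 ^ j. Division by a vanishing coordinate is harmless because
  \<open>\<psi>1\<close> vanishes at 0.\<close>

lemma atom_hat_Some: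
  "atom_hat (Some (k, j, l)) \<xi> = \<psi>1 (\<xi> $ k / 4 ^ j) * (\<Prod>i\<in>UNIV - {k}. \<psi>2 (2 ^ j * (\<xi> $ i / \<xi> $ k) - of_int (l $ i)))"
proof (cases "\<xi> $ k = 0")
  case True
  then have "\<psi>1 (\<xi> $ k / 4 ^ j) = 0" using \<psi>1_nonzero[of 0] by auto
  then show ?thesis
    by (simp add: atom_hat_def generator_def atom_group_def atom_matrix_def shearlet_hat_def vector_shear_matrix)
next
  case False
  have "(\<xi> $ i / 2 ^ j - of_int (l $ i) * \<xi> $ k / 4 ^ j) / (\<xi> $ k / 4 ^ j) = 2 ^ j * (\<xi> $ i / \<xi> $ k) - of_int (l $ i)" for i
    using False by (simp add: power4 field_simps)
  then show ?thesis
    by (simp add: atom_hat_def generator_def atom_group_def atom_matrix_def shearlet_hat_def vector_shear_matrix)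
qed

lemma atom_hat_None: "atom_hat None \<xi> = \<Psi>h \<xi>"
  by (simp add: atom_hat_def generator_def atom_group_def atom_matrix_def)

lemma atom_hat_nonzero_Some:
  assumes "atom_hat (Some (k, j, l)) \<xi> \<noteq> 0"
  shows "4 ^ j / 16 \<le> \<bar>\<xi> $ k\<bar>" "\<bar>\<xi> $ k\<bar> \<le> 4 ^ j / 2" "i \<noteq> k \<Longrightarrow> \<bar>\<xi> $ i / \<xi> $ k - of_int (l $ i) / 2 ^ j\<bar> \<le> 1 / 2 ^ j"
proof -
  have nz: "\<psi>1 (\<xi> $ k / 4 ^ j) \<noteq> 0" "\<And>i. i \<noteq> k \<Longrightarrow> \<psi>2 (2 ^ j * (\<xi> $ i / \<xi> $ k) - of_int (l $ i)) \<noteq> 0"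
    using assms by (auto simp: atom_hat_Some)
  show "4 ^ j / 16 \<le> \<bar>\<xi> $ k\<bar>" "\<bar>\<xi> $ k\<bar> \<le> 4 ^ j / 2"
    using \<psi>1_nonzero[OF nz(1)] by (simp_all add: abs_divide pos_le_divide_eq pos_divide_le_eq)
  show "\<bar>\<xi> $ i / \<xi> $ k - of_int (l $ i) / 2 ^ j\<bar> \<le> 1 / 2 ^ j" if "i \<noteq> k"
  proof -
    have "\<bar>\<xi> $ i / \<xi> $ k - of_int (l $ i) / 2 ^ j\<bar> = \<bar>2 ^ j * (\<xi> $ i / \<xi> $ k) - of_int (l $ i)\<bar> / 2 ^ j"
    proof -
      have "\<xi> $ i / \<xi> $ k - of_int (l $ i) / 2 ^ j = (2 ^ j * (\<xi> $ i / \<xi> $ k) - of_int (l $ i)) / 2 ^ j"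
        by (simp add: diff_divide_distrib)
      then show ?thesis by (simp only: abs_divide) simp
    qed
    then show ?thesis using \<psi>2_nonzero[OF nz(2)[OF that]] by (simp add: divide_right_mono)
  qed
qed

lemma atom_ratio_le:
  assumes a: "Some (k, j, l) \<in> atoms" and nz: "atom_hat (Some (k, j, l)) \<xi> \<noteq> 0"
  shows "\<bar>\<xi> $ i / \<xi> $ k\<bar> \<le> 2"
proof (cases "i = k")
  case False
  have "\<bar>l $ i\<bar> \<le> 2 ^ j" using a by (auto simp: atoms_def shears_def)
  then have "\<bar>real_of_int (l $ i)\<bar> \<le> 2 ^ j" by (metis of_int_abs of_int_le_iff of_int_numeral of_int_power)
  then have "\<bar>real_of_int (l $ i) / 2 ^ j\<bar> \<le> 1" by (simp add: abs_divide)
  moreover have "1 / 2 ^ j \<le> (1::real)" by simp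
  ultimately show ?thesis using atom_hat_nonzero_Some(3)[OF nz False] by linarith
qed (simp add: divide_le_eq)

lemma atom_bound:
  assumes a: "a \<in> atoms" and nz: "atom_hat a \<xi> \<noteq> 0"
  shows "\<bar>\<xi> $ i\<bar> \<le> 4 ^ atom_scale a"
proof (cases a)
  case None
  then show ?thesis using \<Psi>h_nonzero[of \<xi> i] nz by (simp add: atom_hat_None atom_scale_def)
next
  case (Some b)
  then obtain k j l where s: "a = Some (k, j, l)" by (cases b) auto
  note nz' = nz[unfolded s]
  have "0 < (4::real) ^ j" by simp
  then have "0 < \<bar>\<xi> $ k\<bar>" using atom_hat_nonzero_Some(1)[OF nz'] by linarith
  then have "\<bar>\<xi> $ i\<bar> = \<bar>\<xi> $ i / \<xi> $ k\<bar> * \<bar>\<xi> $ k\<bar>" by (simp add: abs_divide)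
  also have "\<dots> \<le> 2 * (4 ^ j / 2)"
    by (intro mult_mono atom_ratio_le[OF a[unfolded s] nz'] atom_hat_nonzero_Some(2)[OF nz']) auto
  finally show ?thesis by (simp add: s atom_scale_def)
qed

text \<open>The supports are thin wedges: cross products of two frequencies in the same support are
  smaller than the trivial bound \<open>16 ^ j\<close> by a factor \<open>2 ^ j\<close>.\<close>

lemma atom_wedge:
  assumes a: "a \<in> atoms" and nz: "atom_hat a \<xi> \<noteq> 0" "atom_hat a \<xi>' \<noteq> 0"
  shows "\<bar>\<xi> $ m * \<xi>' $ n - \<xi> $ n * \<xi>' $ m\<bar> \<le> 2 * 8 ^ atom_scale a"
proof (cases a)
  case None
  have "\<bar>\<xi> $ m * \<xi>' $ n\<bar> \<le> 1/4 * (1/4)" "\<bar>\<xi> $ n * \<xi>' $ m\<bar> \<le> 1/4 * (1/4)"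
    unfolding abs_mult by (intro mult_mono \<Psi>h_nonzero; use nz None in \<open>simp add: atom_hat_None\<close>)+
  then show ?thesis using None by (simp add: atom_scale_def)
next
  case (Some b)
  then obtain k j l where s: "a = Some (k, j, l)" by (cases b) auto
  note nz' = nz[unfolded s]
  let ?t = "\<lambda>i. \<xi> $ i / \<xi> $ k" and ?t' = "\<lambda>i. \<xi>' $ i / \<xi>' $ k"
  have "0 < (4::real) ^ j" by simp
  then have "0 < \<bar>\<xi> $ k\<bar>" "0 < \<bar>\<xi>' $ k\<bar>"
    using atom_hat_nonzero_Some(1)[OF nz'(1)] atom_hat_nonzero_Some(1)[OF nz'(2)] by linarith+
  then have k0: "\<xi> $ k \<noteq> 0" "\<xi>' $ k \<noteq> 0" by auto
  have d: "\<bar>?t i - ?t' i\<bar> \<le> 2 / 2 ^ j" for i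
  proof (cases "i = k")
    case False
    then show ?thesis
      using atom_hat_nonzero_Some(3)[OF nz'(1) False] atom_hat_nonzero_Some(3)[OF nz'(2) False] by linarith
  qed (use k0 in simp)
  have "\<bar>?t m * ?t' n - ?t n * ?t' m\<bar> = \<bar>?t m * (?t' n - ?t n) + ?t n * (?t m - ?t' m)\<bar>"
    by (simp add: algebra_simps)
  also have "\<dots> \<le> \<bar>?t m\<bar> * \<bar>?t n - ?t' n\<bar> + \<bar>?t n\<bar> * \<bar>?t m - ?t' m\<bar>"
    using abs_triangle_ineq[of "?t m * (?t' n - ?t n)" "?t n * (?t m - ?t' m)"]
    by (simp only: abs_mult abs_minus_commute[of "?t' n"])
  also have "\<dots> \<le> 2 * (2 / 2 ^ j) + 2 * (2 / 2 ^ j)"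
    by (intro add_mono mult_mono d atom_ratio_le[OF a[unfolded s] nz'(1)]) auto
  finally have t: "\<bar>?t m * ?t' n - ?t n * ?t' m\<bar> \<le> 8 / 2 ^ j" by simp
  have "\<xi> $ m * \<xi>' $ n - \<xi> $ n * \<xi>' $ m = (\<xi> $ k * \<xi>' $ k) * (?t m * ?t' n - ?t n * ?t' m)"
    using k0 by (simp add: algebra_simps)
  then have "\<bar>\<xi> $ m * \<xi>' $ n - \<xi> $ n * \<xi>' $ m\<bar> = (\<bar>\<xi> $ k\<bar> * \<bar>\<xi>' $ k\<bar>) * \<bar>?t m * ?t' n - ?t n * ?t' m\<bar>"
    by (simp add: abs_mult)
  also have "\<dots> \<le> ((4 ^ j / 2) * (4 ^ j / 2)) * (8 / 2 ^ j)"
    by (intro mult_mono t atom_hat_nonzero_Some(2)[OF nz'(1)] atom_hat_nonzero_Some(2)[OF nz'(2)]) auto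
  also have "\<dots> = 2 * 8 ^ j" by (simp add: power4 power8)
  finally show ?thesis by (simp add: s atom_scale_def)
qed

definition overlap :: "'d atom \<Rightarrow> 'd atom \<Rightarrow> bool" where
  "overlap a b \<longleftrightarrow> (\<exists>\<xi>. atom_hat a \<xi> \<noteq> 0 \<and> atom_hat b \<xi> \<noteq> 0)"

lemma overlap_commute: "overlap a b \<longleftrightarrow> overlap b a"
  by (auto simp: overlap_def)

text \<open>At a common frequency, coordinate k is at least 4 ^ j / 16 for b and at most 4 to the
  scale of a; the 16 accounts for the two additional scales.\<close>

lemma overlap_scale:
  assumes a: "a \<in> atoms" and ab: "overlap a b"
  shows "atom_scale b \<le> atom_scale a + 2"
proof (cases b)
  case (Some b')
  then obtain k j l where s: "b = Some (k, j, l)" by (cases b') auto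
  obtain \<xi> where \<xi>: "atom_hat a \<xi> \<noteq> 0" "atom_hat (Some (k, j, l)) \<xi> \<noteq> 0"
    using ab unfolding overlap_def s by auto
  have "4 ^ j / 16 \<le> (4::real) ^ atom_scale a"
    using atom_hat_nonzero_Some(1)[OF \<xi>(2)] atom_bound[OF a \<xi>(1), of k] by simp
  then have "(4::real) ^ j \<le> 4 ^ (atom_scale a + 2)" by (simp add: power_add)
  then have "j \<le> atom_scale a + 2" by (subst (asm) power_increasing_iff) auto
  then show ?thesis by (simp add: s atom_scale_def)
qed (simp add: atom_scale_def)

text \<open>In the coordinates of b the support of a has bounded size. The shear of b is within 1 /
  2 ^ j of the slope of a common frequency \<xi>, so \<open>\<xi>'\<close> may be sheared along
  \<xi> instead, and then \<open>atom_wedge\<close> for a controls the cross product.\<close>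

lemma overlap_matrix_bound:
  assumes a: "a \<in> atoms" and b: "b \<in> atoms" and ab: "overlap a b" and nz: "atom_hat a \<xi>' \<noteq> 0"
  shows "\<bar>(\<xi>' v* atom_matrix b) $ c\<bar> \<le> 2064"
proof -
  let ?ja = "atom_scale a"
  have ja: "?ja \<le> atom_scale b + 2" using overlap_scale[OF b] ab by (simp add: overlap_commute)
  show ?thesis
  proof (cases b)
    case None
    then have "(4::real) ^ ?ja \<le> 4 ^ 2" using ja by (intro power_increasing) (auto simp: atom_scale_def)
    then show ?thesis using atom_bound[OF a nz, of c] None by (simp add: atom_matrix_def)
  next
    case (Some b')
    then obtain k j l where s: "b = Some (k, j, l)" by (cases b') auto
    obtain \<xi> where \<xi>: "atom_hat a \<xi> \<noteq> 0" "atom_hat (Some (k, j, l)) \<xi> \<noteq> 0"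
      using ab unfolding overlap_def s by auto
    have jb: "?ja \<le> j + 2" using ja by (simp add: s atom_scale_def)
    have p4: "(4::real) ^ ?ja \<le> 16 * 4 ^ j" using power_increasing[OF jb, of "4::real"] by (simp add: power_add)
    have p8: "(8::real) ^ ?ja \<le> 64 * 8 ^ j" using power_increasing[OF jb, of "8::real"] by (simp add: power_add)
    have k1: "4 ^ j / 16 \<le> \<bar>\<xi> $ k\<bar>" by (rule atom_hat_nonzero_Some(1)[OF \<xi>(2)])
    have pos: "0 < (4::real) ^ j" "0 < (2::real) ^ j" by auto
    then have "0 < \<bar>\<xi> $ k\<bar>" using k1 by linarith
    then have k0: "\<xi> $ k \<noteq> 0" by auto
    have \<xi>'k: "\<bar>\<xi>' $ i\<bar> \<le> 16 * 4 ^ j" for i using atom_bound[OF a nz, of i] p4 by simp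
    show ?thesis
    proof (cases "c = k")
      case True
      then show ?thesis using \<xi>'k[of k] by (simp add: s atom_matrix_def vector_shear_matrix abs_divide divide_le_eq)
    next
      case False
      \<comment> \<open>Splitting into the offset of \<open>\<xi>'\<close> from the ray through
        \<xi> and the error of the slope. The parts contribute 2 * 64 * 16 = 2048 and 16, which sum
        to 2064 after division by 2 ^ j.\<close>
      let ?w = "(\<xi>' $ c * \<xi> $ k - \<xi>' $ k * \<xi> $ c) / \<xi> $ k"
      let ?r = "\<xi> $ c / \<xi> $ k - of_int (l $ c) / 2 ^ j"
      have eq: "(\<xi>' v* atom_matrix b) $ c = (?w + \<xi>' $ k * ?r) / 2 ^ j"
        using False k0 by (simp add: s atom_matrix_def vector_shear_matrix power4 field_simps)
      have "\<bar>?w\<bar> = \<bar>\<xi>' $ c * \<xi> $ k - \<xi>' $ k * \<xi> $ c\<bar> / \<bar>\<xi> $ k\<bar>" by (rule abs_divide)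
      also have "\<dots> \<le> (2 * 8 ^ ?ja) / (4 ^ j / 16)"
        using k1 pos by (intro frac_le atom_wedge[OF a nz \<xi>(1)]) auto
      also have "\<dots> \<le> (2 * (64 * 8 ^ j)) / (4 ^ j / 16)"
        using p8 pos by (intro divide_right_mono mult_left_mono) auto
      also have "\<dots> = 2048 * 2 ^ j" by (simp add: power8)
      finally have w: "\<bar>?w\<bar> \<le> 2048 * 2 ^ j" .
      have "\<bar>\<xi>' $ k * ?r\<bar> \<le> (16 * 4 ^ j) * (1 / 2 ^ j)"
        unfolding abs_mult using False by (intro mult_mono \<xi>'k atom_hat_nonzero_Some(3)[OF \<xi>(2)]) auto
      also have "\<dots> = 16 * 2 ^ j" by (simp add: power4)
      finally have "\<bar>?w + \<xi>' $ k * ?r\<bar> \<le> 2048 * 2 ^ j + 16 * 2 ^ j"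
        by (rule order_trans[OF abs_triangle_ineq add_mono[OF w]])
      then have "\<bar>?w + \<xi>' $ k * ?r\<bar> \<le> 2064 * 2 ^ j" by simp
      then show ?thesis unfolding eq by (simp add: abs_divide divide_le_eq)
    qed
  qed
qed

lemma finite_int_box: "finite {l :: int^'d. \<forall>i. \<bar>l $ i - c $ i\<bar> \<le> int n}"
  and card_int_box: "card {l :: int^'d. \<forall>i. \<bar>l $ i - c $ i\<bar> \<le> int n} \<le> (2 * n + 1) ^ CARD('d)"
proof -
  let ?S = "\<lambda>i. {c $ i - int n .. c $ i + int n}"
  let ?X = "{l :: int^'d. \<forall>i. \<bar>l $ i - c $ i\<bar> \<le> int n}"
  have sub: "?X \<subseteq> vec_lambda ` (PiE UNIV ?S)"
  proof
    fix l assume l: "l \<in> ?X"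
    have "vec_nth l \<in> PiE UNIV ?S" using l by (auto simp: PiE_UNIV_domain abs_le_iff algebra_simps)
    then have "vec_lambda (vec_nth l) \<in> vec_lambda ` (PiE UNIV ?S)" by (rule imageI)
    then show "l \<in> vec_lambda ` (PiE UNIV ?S)" by simp
  qed
  have fin: "finite (PiE UNIV ?S)" by (intro finite_PiE) auto
  have "card (?S i) = 2 * n + 1" for i by simp
  then have "card (PiE UNIV ?S) = (2 * n + 1) ^ CARD('d)" by (simp add: card_PiE)
  then show "finite ?X" "card ?X \<le> (2 * n + 1) ^ CARD('d)"
    using finite_subset[OF sub finite_imageI[OF fin]] card_mono[OF finite_imageI[OF fin] sub] card_image_le[OF fin, of vec_lambda]
    by auto
qed

end

section \<open>Counting shearlets and the partition of unity\<close>

context shearlet_system begin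

text \<open>Both shears approximate slopes of frequencies in the support of a, and by
  \<open>atom_wedge\<close> these slopes differ only by a multiple of 1 / 2 ^ j.\<close>

lemma overlap_shear_close:
  assumes a: "a \<in> atoms" and b: "Some (k, j, l) \<in> atoms" "Some (k, j, l') \<in> atoms"
    and ab: "overlap a (Some (k, j, l))" "overlap a (Some (k, j, l'))"
  shows "\<bar>l $ i - l' $ i\<bar> \<le> int 32770"
proof (cases "i = k")
  case True
  then show ?thesis using b by (simp add: atoms_def shears_def)
next
  case False
  let ?ja = "atom_scale a"
  have "?ja \<le> j + 2" using overlap_scale[OF b(1)] ab(1) by (simp add: overlap_commute atom_scale_def)
  then have p8: "(8::real) ^ ?ja \<le> 64 * 8 ^ j"
    using power_increasing[of ?ja "j + 2" "8::real"] by (simp add: power_add)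
  obtain \<xi> where \<xi>: "atom_hat a \<xi> \<noteq> 0" "atom_hat (Some (k, j, l)) \<xi> \<noteq> 0" using ab(1) by (auto simp: overlap_def)
  obtain \<xi>' where \<xi>': "atom_hat a \<xi>' \<noteq> 0" "atom_hat (Some (k, j, l')) \<xi>' \<noteq> 0" using ab(2) by (auto simp: overlap_def)
  have k1: "4 ^ j / 16 \<le> \<bar>\<xi> $ k\<bar>" "4 ^ j / 16 \<le> \<bar>\<xi>' $ k\<bar>"
    by (rule atom_hat_nonzero_Some(1)[OF \<xi>(2)], rule atom_hat_nonzero_Some(1)[OF \<xi>'(2)])
  have pos: "0 < (4::real) ^ j / 16" by simp
  have k0: "0 < \<bar>\<xi> $ k\<bar>" "0 < \<bar>\<xi>' $ k\<bar>" using k1 pos by linarith+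
  have "\<xi> $ i / \<xi> $ k - \<xi>' $ i / \<xi>' $ k = (\<xi> $ i * \<xi>' $ k - \<xi> $ k * \<xi>' $ i) / (\<xi> $ k * \<xi>' $ k)"
    using k0 by (simp add: field_simps)
  then have "\<bar>\<xi> $ i / \<xi> $ k - \<xi>' $ i / \<xi>' $ k\<bar> = \<bar>\<xi> $ i * \<xi>' $ k - \<xi> $ k * \<xi>' $ i\<bar> / (\<bar>\<xi> $ k\<bar> * \<bar>\<xi>' $ k\<bar>)"
    by (simp add: abs_divide abs_mult)
  also have "\<dots> \<le> (2 * 8 ^ ?ja) / ((4 ^ j / 16) * (4 ^ j / 16))"
    by (intro frac_le atom_wedge[OF a \<xi>(1) \<xi>'(1)] mult_mono k1) auto
  also have "\<dots> \<le> (2 * (64 * 8 ^ j)) / ((4 ^ j / 16) * (4 ^ j / 16))"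
    using p8 by (intro divide_right_mono mult_left_mono) auto
  \<comment> \<open>The factor is 2 * 64 * 16 * 16. The two angular half-widths add 2, which gives
    32770.\<close>
  also have "\<dots> = 32768 / 2 ^ j" by (simp add: power4 power8)
  finally have "\<bar>\<xi> $ i / \<xi> $ k - \<xi>' $ i / \<xi>' $ k\<bar> \<le> 32768 / 2 ^ j" .
  with atom_hat_nonzero_Some(3)[OF \<xi>(2) False] atom_hat_nonzero_Some(3)[OF \<xi>'(2) False]
  have "\<bar>real_of_int (l $ i) / 2 ^ j - real_of_int (l' $ i) / 2 ^ j\<bar> \<le> 1 / 2 ^ j + 32768 / 2 ^ j + 1 / 2 ^ j"
    by linarith
  also have "\<dots> = 32770 / 2 ^ j" by (simp flip: add_divide_distrib)
  finally have "\<bar>(real_of_int (l $ i) - real_of_int (l' $ i)) / 2 ^ j\<bar> \<le> 32770 / 2 ^ j"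
    by (simp only: diff_divide_distrib)
  then have "\<bar>real_of_int (l $ i) - real_of_int (l' $ i)\<bar> \<le> 32770" by (simp add: abs_divide divide_le_cancel)
  then show ?thesis by linarith
qed

definition neighbours :: "'d atom \<Rightarrow> 'd option \<Rightarrow> 'd atom set" where
  "neighbours a g = {b \<in> atoms. atom_group b = g \<and> overlap a b}"

text \<open>A direction allows at most five scales, and for each of them the shears lie in an
  integer box with 2 * 32770 + 1 = 65541 points on a side. The low-pass group has only one
  member.\<close>

lemma neighbours:
  assumes a: "a \<in> atoms"
  shows "finite (neighbours a g)" "card (neighbours a g) \<le> 5 * 65541 ^ CARD('d)"
proof -
  have "finite (neighbours a g) \<and> card (neighbours a g) \<le> 5 * 65541 ^ CARD('d)"
  proof (cases g)
    case None
    then have sub: "neighbours a g \<subseteq> {None}" by (auto simp: neighbours_def atom_group_def)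
    have "card (neighbours a g) \<le> 1" using card_mono[OF _ sub] by simp
    also have "1 \<le> 5 * (65541::nat) ^ CARD('d)" using one_le_power[of "65541::nat" "CARD('d)"] by simp
    finally show ?thesis using finite_subset[OF sub] by simp
  next
    case (Some k)
    define L where "L j = {l. Some (k, j, l) \<in> atoms \<and> overlap a (Some (k, j, l))}" for j
    let ?J = "{atom_scale a - 2 .. atom_scale a + 2}"
    have L: "finite (L j) \<and> card (L j) \<le> 65541 ^ CARD('d)" for j
    proof (cases "L j = {}")
      case False
      then obtain l0 where l0: "l0 \<in> L j" by auto
      have sub: "L j \<subseteq> {l. \<forall>i. \<bar>l $ i - l0 $ i\<bar> \<le> int 32770}"
        using l0 overlap_shear_close[OF a] unfolding L_def by blast
      have "card (L j) \<le> (2 * 32770 + 1) ^ CARD('d)"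
        using card_mono[OF finite_int_box sub] card_int_box[of l0 32770] by linarith
      then show ?thesis using finite_subset[OF sub finite_int_box] by simp
    qed simp
    have sub: "neighbours a g \<subseteq> (\<Union>j\<in>?J. (\<lambda>l. Some (k, j, l)) ` L j)"
    proof
      fix b assume b: "b \<in> neighbours a g"
      then obtain j l where s: "b = Some (k, j, l)" using Some by (auto simp: neighbours_def atom_group_def)
      have b': "b \<in> atoms" "overlap a b" using b by (auto simp: neighbours_def)
      have "j \<le> atom_scale a + 2" using overlap_scale[OF a b'(2)] by (simp add: s atom_scale_def)
      moreover have "atom_scale a \<le> j + 2"
        using overlap_scale[OF b'(1), of a] b'(2) by (simp add: overlap_commute s atom_scale_def)
      ultimately show "b \<in> (\<Union>j\<in>?J. (\<lambda>l. Some (k, j, l)) ` L j)" using b' by (auto simp: s L_def)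
    qed
    have fin: "finite (\<Union>j\<in>?J. (\<lambda>l. Some (k, j, l)) ` L j)" using L by auto
    have "card (\<Union>j\<in>?J. (\<lambda>l. Some (k, j, l)) ` L j) \<le> (\<Sum>j\<in>?J. card ((\<lambda>l. Some (k, j, l)) ` L j))"
      by (rule card_UN_le) simp
    also have "\<dots> \<le> (\<Sum>j\<in>?J. 65541 ^ CARD('d))"
      using L by (intro sum_mono order_trans[OF card_image_le]) auto
    also have "\<dots> \<le> 5 * 65541 ^ CARD('d)" by simp
    finally show ?thesis using card_mono[OF fin sub] finite_subset[OF sub fin] by linarith
  qed
  then show "finite (neighbours a g)" "card (neighbours a g) \<le> 5 * 65541 ^ CARD('d)" by auto
qed

end

section \<open>Counting and summing over shear parameters\<close>

lemma shears_eq: "(shears k j :: (int^'d) set) = vec_lambda ` (PiE UNIV (\<lambda>i. if i = k then {0} else {- (2 ^ j) .. 2 ^ j}))"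
proof (rule set_eqI, rule iffI)
  fix l :: "int^'d" assume "l \<in> shears k j"
  then have "vec_nth l \<in> PiE UNIV (\<lambda>i. if i = k then {0} else {- (2 ^ j) .. 2 ^ j})"
    by (auto simp: shears_def PiE_UNIV_domain abs_le_iff minus_le_iff)
  then have "vec_lambda (vec_nth l) \<in> vec_lambda ` (PiE UNIV (\<lambda>i. if i = k then {0} else {- (2 ^ j) .. 2 ^ j}))" by (rule imageI)
  then show "l \<in> vec_lambda ` (PiE UNIV (\<lambda>i. if i = k then {0} else {- (2 ^ j) .. 2 ^ j}))" by simp
next
  fix l :: "int^'d" assume "l \<in> vec_lambda ` (PiE UNIV (\<lambda>i. if i = k then {0} else {- (2 ^ j) .. 2 ^ j}))"
  then obtain f where f: "l = vec_lambda f" "f \<in> PiE UNIV (\<lambda>i. if i = k then {0} else {- (2 ^ j) .. 2 ^ j})" by auto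
  have fk: "f i \<in> (if i = k then {0} else {- (2 ^ j) .. 2 ^ j})" for i using f(2) by (simp add: PiE_UNIV_domain Pi_iff)
  show "l \<in> shears k j"
  proof -
    have "f k = 0" using fk[of k] by simp
    moreover have "\<bar>f i\<bar> \<le> 2 ^ j" for i using fk[of i] by (cases "i = k") (auto simp: abs_le_iff)
    ultimately show ?thesis unfolding f(1) shears_def by simp
  qed
qed

lemma finite_shears: "finite (shears k j :: (int^'d) set)"
  unfolding shears_eq by (intro finite_imageI finite_PiE) auto

text \<open>Position k is frozen at 0 and contributes the factor 1; each of the others has 2 * 2 ^ j
  + 1 values, which is at most 3 * 2 ^ j.\<close>

lemma card_shears: "card (shears k j :: (int^'d) set) \<le> (3 * 2 ^ j) ^ (CARD('d) - 1)"
proof -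
  let ?S = "\<lambda>i. if i = k then {0} else {- (2 ^ j) .. 2 ^ j} :: int set"
  have "card (shears k j :: (int^'d) set) \<le> card (PiE UNIV ?S)"
    unfolding shears_eq by (intro card_image_le finite_PiE) auto
  also have "\<dots> = (\<Prod>i\<in>UNIV. card (?S i))" by (simp add: card_PiE)
  also have "\<dots> = card (?S k) * (\<Prod>i\<in>UNIV - {k}. card (?S i))" by (rule prod.remove) auto
  also have "\<dots> = (\<Prod>i\<in>UNIV - {k}. nat (2 * 2 ^ j + 1))" by (auto intro!: prod.cong)
  also have "\<dots> = (nat (2 * 2 ^ j + 1)) ^ (CARD('d) - 1)" by (simp add: card_Diff_singleton)
  also have "\<dots> \<le> (3 * 2 ^ j) ^ (CARD('d) - 1)"
  proof (rule power_mono)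
    have "nat (2 * 2 ^ j + 1) \<le> nat (3 * 2 ^ j)" using one_le_power[of "2::int" j] by (intro nat_mono) linarith
    also have "\<dots> = 3 * 2 ^ j" by (simp add: nat_mult_distrib nat_power_eq)
    finally show "nat (2 * 2 ^ j + 1) \<le> 3 * 2 ^ j" .
  qed simp
  finally show ?thesis .
qed

text \<open>The shears form a product set, so distributivity separates the variables. The angular
  partition of unity is thereby reduced to the one-dimensional identity for
  \<open>\<psi>2\<close>.\<close>

lemma sum_shears:
  fixes F :: "'d::finite \<Rightarrow> int \<Rightarrow> real"
  shows "(\<Sum>l\<in>shears k j. \<Prod>i\<in>UNIV - {k}. F i (l $ i)) = (\<Prod>i\<in>UNIV - {k}. \<Sum>m = - (2 ^ j)..2 ^ j. F i m)"
proof -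
  let ?S = "\<lambda>i. if i = k then {0} else {- (2 ^ j) .. 2 ^ j} :: int set"
  let ?G = "\<lambda>i m. if i = k then 1 else F i m"
  have inj: "inj_on vec_lambda (PiE UNIV ?S)" by (auto simp: inj_on_def vec_lambda_inject)
  have "(\<Sum>l\<in>shears k j. \<Prod>i\<in>UNIV - {k}. F i (l $ i)) = (\<Sum>f\<in>PiE UNIV ?S. \<Prod>i\<in>UNIV - {k}. F i (f i))"
    unfolding shears_eq by (simp add: sum.reindex[OF inj])
  also have "\<dots> = (\<Sum>f\<in>PiE UNIV ?S. \<Prod>i\<in>UNIV. ?G i (f i))"
  proof (rule sum.cong[OF refl])
    fix f :: "'d \<Rightarrow> int"
    have "(\<Prod>i\<in>UNIV. ?G i (f i)) = ?G k (f k) * (\<Prod>i\<in>UNIV - {k}. ?G i (f i))" by (rule prod.remove) auto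
    also have "\<dots> = (\<Prod>i\<in>UNIV - {k}. F i (f i))" by (auto intro!: prod.cong)
    finally show "(\<Prod>i\<in>UNIV - {k}. F i (f i)) = (\<Prod>i\<in>UNIV. ?G i (f i))" ..
  qed
  also have "\<dots> = (\<Prod>i\<in>UNIV. \<Sum>m\<in>?S i. ?G i m)"
    by (rule prod_sum_PiE[symmetric]) auto
  also have "\<dots> = (\<Prod>i\<in>UNIV - {k}. \<Sum>m = - (2 ^ j)..2 ^ j. F i m)"
    by (subst prod.remove[of UNIV k]) (auto intro!: prod.cong)
  finally show ?thesis .
qed

text \<open>The summand 1 in the count stands for the low-pass atom; each of the d directions has n
  + 1 - m scales, all with at most as many shears as the finest one is allowed.\<close>

lemma atoms_scale_finite:
  "finite {a \<in> atoms :: 'd::finite atom set. m \<le> atom_scale a \<and> atom_scale a \<le> n}" (is "finite ?X")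
  and atoms_scale_card:
  "card {a \<in> atoms :: 'd::finite atom set. m \<le> atom_scale a \<and> atom_scale a \<le> n} \<le>
    1 + CARD('d) * ((n + 1 - m) * (3 * 2 ^ n) ^ (CARD('d) - 1))"
proof -
  let ?Y = "\<Union>k\<in>(UNIV :: 'd set). \<Union>j\<in>{m..n}. (\<lambda>l. Some (k, j, l)) ` shears k j"
  have sub: "?X \<subseteq> insert None ?Y"
    by (force simp: atoms_def atom_scale_def)
  have fin: "finite ?Y" by (auto simp: finite_shears)
  then show "finite ?X" using finite_subset[OF sub] by simp
  have "card ?Y \<le> (\<Sum>k\<in>(UNIV :: 'd set). card (\<Union>j\<in>{m..n}. (\<lambda>l. Some (k, j, l)) ` shears k j))"
    by (rule card_UN_le) simp
  also have "\<dots> \<le> (\<Sum>k\<in>(UNIV :: 'd set). (n + 1 - m) * (3 * 2 ^ n) ^ (CARD('d) - 1))"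
  proof (rule sum_mono)
    fix k :: 'd
    have "card (\<Union>j\<in>{m..n}. (\<lambda>l. Some (k, j, l)) ` (shears k j :: (int^'d) set)) \<le>
        (\<Sum>j\<in>{m..n}. card ((\<lambda>l. Some (k, j, l)) ` (shears k j :: (int^'d) set)))"
      by (rule card_UN_le) simp
    also have "\<dots> \<le> (\<Sum>j\<in>{m..n}. (3 * 2 ^ n) ^ (CARD('d) - 1))"
    proof (rule sum_mono)
      fix j assume j: "j \<in> {m..n}"
      have "card ((\<lambda>l. Some (k, j, l)) ` (shears k j :: (int^'d) set)) \<le> (3 * 2 ^ j) ^ (CARD('d) - 1)"
        by (rule order_trans[OF card_image_le[OF finite_shears] card_shears])
      also have "\<dots> \<le> (3 * 2 ^ n) ^ (CARD('d) - 1)" using j by (intro power_mono mult_left_mono power_increasing) auto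
      finally show "card ((\<lambda>l. Some (k, j, l)) ` (shears k j :: (int^'d) set)) \<le> (3 * 2 ^ n) ^ (CARD('d) - 1)" .
    qed
    also have "\<dots> = (n + 1 - m) * (3 * 2 ^ n) ^ (CARD('d) - 1)" by simp
    finally show "card (\<Union>j\<in>{m..n}. (\<lambda>l. Some (k, j, l)) ` (shears k j :: (int^'d) set)) \<le> (n + 1 - m) * (3 * 2 ^ n) ^ (CARD('d) - 1)" .
  qed
  finally have "card ?Y \<le> CARD('d) * ((n + 1 - m) * (3 * 2 ^ n) ^ (CARD('d) - 1))" by simp
  then show "card ?X \<le> 1 + CARD('d) * ((n + 1 - m) * (3 * 2 ^ n) ^ (CARD('d) - 1))"
    using card_mono[OF _ sub] fin by (simp add: card_insert_if split: if_splits)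
qed

section \<open>The pointwise partition of unity\<close>

context shearlet_system begin

text \<open>Continuity forces the value 0 at the ends of the support interval. This makes the
  truncation of the shears at 2 ^ j exact up to the boundary of the cone.\<close>

lemma \<psi>2_endpoints: "\<psi>2 1 = 0" "\<psi>2 (- 1) = 0"
proof -
  have c: "isCont \<psi>2 t" for t
    using differentiable_imp_continuous_on[OF C_infinity_differentiable] generators
    by (auto simp: shearlet_generators_def continuous_on_eq_continuous_at)
  have z: "\<psi>2 t = 0" if "\<bar>t\<bar> > 1" for t using \<psi>2_nonzero[of t] that by linarith
  define e where "e n = inverse (real (Suc n))" for n
  have e: "0 < e n" "(\<lambda>n. 1 + e n) \<longlonglongrightarrow> 1 + 0" "(\<lambda>n. - 1 - e n) \<longlonglongrightarrow> - 1 - 0" for n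
    unfolding e_def by (simp, (intro tendsto_intros LIMSEQ_inverse_real_of_nat)+)
  have "\<psi>2 (1 + e n) = 0" "\<psi>2 (- 1 - e n) = 0" for n
    using e(1)[of n] by (intro z; simp add: abs_if)+
  then show "\<psi>2 1 = 0" "\<psi>2 (- 1) = 0"
    using isCont_tendsto_compose[OF c, OF e(2)] isCont_tendsto_compose[OF c, OF e(3)]
    by (auto simp: tendsto_const_iff)
qed

lemma \<psi>2_zero: "1 \<le> \<bar>t\<bar> \<Longrightarrow> \<psi>2 t = 0"
  using \<psi>2_nonzero[of t] \<psi>2_endpoints by (cases "\<bar>t\<bar> = 1") (auto simp: abs_if split: if_splits)

text \<open>With n the floor of t, only the translates by n and n + 1 can be nonzero, and of the
  three terms of the hypothesis at the fractional part the one at \<omega> + 1 vanishes.\<close>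

lemma sum_\<psi>2:
  assumes "\<bar>t\<bar> \<le> real N"
  shows "(\<Sum>m = - int N..int N. (norm (\<psi>2 (t - of_int m)))\<^sup>2) = 1"
proof -
  define n where "n = \<lfloor>t\<rfloor>"
  define \<omega> where "\<omega> = t - of_int n"
  have \<omega>: "0 \<le> \<omega>" "\<omega> < 1" unfolding \<omega>_def n_def by linarith+
  let ?f = "\<lambda>m. (norm (\<psi>2 (t - of_int m)))\<^sup>2"
  have "(norm (\<psi>2 (\<omega> - 1)))\<^sup>2 + (norm (\<psi>2 \<omega>))\<^sup>2 + (norm (\<psi>2 (\<omega> + 1)))\<^sup>2 = 1"
    using generators \<omega> by (simp add: shearlet_generators_def)
  moreover have "\<psi>2 (\<omega> + 1) = 0" by (rule \<psi>2_zero) (use \<omega> in simp)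
  moreover have "\<omega> - 1 = t - of_int (n + 1)" by (simp add: \<omega>_def)
  ultimately have two: "?f n + ?f (n + 1) = 1" by (simp add: \<omega>_def diff_diff_eq)
  have zero: "?f m = 0" if "m \<noteq> n" "m \<noteq> n + 1" for m
  proof -
    have "1 \<le> \<bar>t - of_int m\<bar>"
    proof (cases "m < n")
      case True
      then have "of_int m + 1 \<le> (of_int n :: real)" by linarith
      then show ?thesis using \<omega> unfolding \<omega>_def by linarith
    next
      case False
      then have "of_int n + 2 \<le> (of_int m :: real)" using that by linarith
      then show ?thesis using \<omega> unfolding \<omega>_def by linarith
    qed
    then show ?thesis using \<psi>2_zero by simp
  qed
  have n: "- int N \<le> n" "n \<le> int N" unfolding n_def using assms by linarith+
  have "(\<Sum>m = - int N..int N. ?f m) = (\<Sum>m\<in>{n, n + 1} \<inter> {- int N..int N}. ?f m)"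
    by (rule sum.mono_neutral_right) (use zero in auto)
  also have "\<dots> = ?f n + ?f (n + 1)"
  proof (cases "n + 1 \<le> int N")
    case True
    then have "{n, n + 1} \<inter> {- int N..int N} = {n, n + 1}" using n by auto
    then show ?thesis by simp
  next
    \<comment> \<open>Here t is the endpoint N itself; the translate by N + 1 is outside the range
      of summation, but it is \<open>\<psi>2\<close> at -1 and hence 0.\<close>
    case False
    then have "{n, n + 1} \<inter> {- int N..int N} = {n}" using n by auto
    moreover have "t = of_int n" using False n assms \<omega> unfolding \<omega>_def by linarith
    then have "?f (n + 1) = 0" using \<psi>2_endpoints by simp
    ultimately show ?thesis by simp
  qed
  finally show ?thesis using two by simp
qed

text \<open>The bound J makes the set finite, so that sums over it stay smooth without any
  convergence question.\<close>

definition level_atoms :: "'d option \<Rightarrow> nat \<Rightarrow> 'd atom set" where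
  "level_atoms g J = {a \<in> atoms. atom_group a = g \<and> atom_scale a \<le> J}"

lemma finite_level_atoms: "finite (level_atoms g J)"
  by (rule finite_subset[OF _ atoms_scale_finite[of 0 J]]) (auto simp: level_atoms_def)

text \<open>The cube belongs to the low-pass group. Outside it the group is that of a coordinate of
  largest modulus: all slopes are then at most 1, so the angular sums are 1 at every scale, and
  summing over the scales leaves the identity for \<open>\<psi>1\<close>.\<close>

lemma level_atoms_partition:
  assumes \<xi>: "norm \<xi> \<le> 2 * 2 ^ \<nu>"
  shows "\<exists>g. (\<Sum>a\<in>level_atoms g (\<nu> + 5). atom_hat a \<xi> * cnj (atom_hat a \<xi>)) = 1"
proof (cases "\<xi> \<in> low_frequency_cube")
  case True
  have "level_atoms None (\<nu> + 5) = {None}"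
    by (auto simp: level_atoms_def atoms_def atom_group_def atom_scale_def)
  moreover have "norm (\<Psi>h \<xi>) = 1" using generators True by (simp add: shearlet_generators_def)
  ultimately have "(\<Sum>a\<in>level_atoms None (\<nu> + 5). atom_hat a \<xi> * cnj (atom_hat a \<xi>)) = 1"
    by (simp add: atom_hat_None complex_norm_square[symmetric])
  then show ?thesis ..
next
  case False
  have "Max (range (\<lambda>i. \<bar>\<xi> $ i\<bar>)) \<in> range (\<lambda>i. \<bar>\<xi> $ i\<bar>)" by (intro Max_in) auto
  then obtain k where Max: "Max (range (\<lambda>i. \<bar>\<xi> $ i\<bar>)) = \<bar>\<xi> $ k\<bar>" by (rule imageE)
  have k: "\<bar>\<xi> $ i\<bar> \<le> \<bar>\<xi> $ k\<bar>" for i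
    unfolding Max[symmetric] by (rule Max_ge) auto
  obtain i where "\<not> \<bar>\<xi> $ i\<bar> \<le> 1/8" using False by (auto simp: low_frequency_cube_def)
  then have k8: "\<bar>\<xi> $ k\<bar> \<ge> 1/8" using k[of i] by linarith
  then have k0: "\<xi> $ k \<noteq> 0" by auto
  let ?J = "\<nu> + 5"
  let ?w = "\<lambda>a. (norm (atom_hat a \<xi>))\<^sup>2"
  have eq: "level_atoms (Some k) ?J = (\<lambda>(j, l). Some (k, j, l)) ` (SIGMA j:{..?J}. shears k j)"
    by (auto simp: level_atoms_def atoms_def atom_group_def atom_scale_def image_iff)
  have inj: "inj_on (\<lambda>(j, l). Some (k, j, l)) (SIGMA j:{..?J}. shears k j)"
    by (auto simp: inj_on_def)
  have "(\<Sum>a\<in>level_atoms (Some k) ?J. ?w a) = (\<Sum>(j, l)\<in>(SIGMA j:{..?J}. shears k j). ?w (Some (k, j, l)))"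
    unfolding eq by (subst sum.reindex[OF inj]) (simp add: case_prod_unfold)
  also have "\<dots> = (\<Sum>j\<le>?J. \<Sum>l\<in>shears k j. ?w (Some (k, j, l)))"
    by (rule sum.Sigma[symmetric]) (auto simp: finite_shears)
  also have "\<dots> = (\<Sum>j\<le>?J. (norm (\<psi>1 (\<xi> $ k / 4 ^ j)))\<^sup>2)"
  proof (rule sum.cong[OF refl])
    fix j
    have "(\<Sum>l\<in>shears k j. ?w (Some (k, j, l))) =
        (norm (\<psi>1 (\<xi> $ k / 4 ^ j)))\<^sup>2 * (\<Sum>l\<in>shears k j. \<Prod>i\<in>UNIV - {k}. (norm (\<psi>2 (2 ^ j * (\<xi> $ i / \<xi> $ k) - of_int (l $ i))))\<^sup>2)"
      by (simp add: atom_hat_Some norm_mult prod_norm[symmetric] power_mult_distrib prod_power_distrib sum_distrib_left)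
    also have "(\<Sum>l\<in>shears k j. \<Prod>i\<in>UNIV - {k}. (norm (\<psi>2 (2 ^ j * (\<xi> $ i / \<xi> $ k) - of_int (l $ i))))\<^sup>2) =
        (\<Prod>i\<in>UNIV - {k}. \<Sum>m = - (2 ^ j)..2 ^ j. (norm (\<psi>2 (2 ^ j * (\<xi> $ i / \<xi> $ k) - of_int m)))\<^sup>2)"
      by (rule sum_shears)
    also have "\<dots> = 1"
    proof (rule prod.neutral, rule ballI)
      fix i
      have "\<bar>2 ^ j * (\<xi> $ i / \<xi> $ k)\<bar> \<le> real (2 ^ j)" using k[of i] k0 by (simp add: abs_mult abs_divide divide_le_eq)
      from sum_\<psi>2[OF this] show "(\<Sum>m = - (2 ^ j)..2 ^ j. (norm (\<psi>2 (2 ^ j * (\<xi> $ i / \<xi> $ k) - of_int m)))\<^sup>2) = 1" by simp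
    qed
    finally show "(\<Sum>l\<in>shears k j. ?w (Some (k, j, l))) = (norm (\<psi>1 (\<xi> $ k / 4 ^ j)))\<^sup>2" by simp
  qed
  also have "\<dots> = (\<Sum>j. (norm (\<psi>1 (\<xi> $ k / 4 ^ j)))\<^sup>2)"
  proof (rule suminf_finite[symmetric])
    fix j assume "j \<notin> {..?J}"
    then have "\<nu> + 6 \<le> j" by simp
    \<comment> \<open>From scale \<nu> + 6 on, the lower support bound 4 ^ j / 16 is at least 256 *
      4 ^ \<nu>, well above 2 * 2 ^ \<nu>. The scales up to \<nu> + 5 therefore exhaust the
      series.\<close>
    then have "4 ^ \<nu> * 4096 \<le> (4::real) ^ j" using power_increasing[of "\<nu> + 6" j "4::real"] by (simp add: power_add)
    moreover have "\<bar>\<xi> $ k\<bar> \<le> 2 * 2 ^ \<nu>" using component_le_norm_cart[of \<xi> k] \<xi> by linarith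
    moreover have "(2::real) ^ \<nu> \<le> 4 ^ \<nu>" by (intro power_mono) auto
    moreover have "0 < (4::real) ^ \<nu>" by simp
    ultimately have "\<bar>\<xi> $ k\<bar> < 4 ^ j / 16" by linarith
    then have "\<bar>\<xi> $ k / 4 ^ j\<bar> < 1 / 16" by (simp add: abs_divide divide_less_eq)
    then show "(norm (\<psi>1 (\<xi> $ k / 4 ^ j)))\<^sup>2 = 0" using \<psi>1_nonzero[of "\<xi> $ k / 4 ^ j"] by auto
  qed simp
  also have "\<dots> = 1" using generators k8 by (simp add: shearlet_generators_def power_mult)
  finally have "(\<Sum>a\<in>level_atoms (Some k) ?J. ?w a) = 1" .
  moreover have "(\<Sum>a\<in>level_atoms (Some k) ?J. atom_hat a \<xi> * cnj (atom_hat a \<xi>)) = complex_of_real (\<Sum>a\<in>level_atoms (Some k) ?J. ?w a)"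
    by (simp add: complex_norm_square[symmetric])
  ultimately show ?thesis by (intro exI[of _ "Some k"]) simp
qed

end

section \<open>Decomposition of a frequency band\<close>

text \<open>After division by the sum both terms lie between 0 and 1, where t \<le> t powr
  P.\<close>

lemma powr_add_le:
  fixes a b P :: real
  assumes "0 \<le> a" "0 \<le> b" "0 < P" "P \<le> 1"
  shows "(a + b) powr P \<le> a powr P + b powr P"
proof (cases "a + b = 0")
  case False
  define s where "s = a + b"
  have s: "s > 0" using False assms unfolding s_def by linarith
  have le: "t / s \<le> (t / s) powr P" if "0 \<le> t" "t \<le> s" for t
  proof (cases "t = 0")
    case False
    then have "0 < t / s" "t / s \<le> 1" using that s by (auto simp: divide_le_eq)
    then have "(t / s) powr 1 \<le> (t / s) powr P" using assms by (intro powr_mono') auto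
    moreover have "(t / s) powr 1 = t / s" using \<open>0 < t / s\<close> by (intro powr_one) simp
    ultimately show ?thesis by (simp only:)
  qed simp
  have "1 = a / s + b / s" using s by (simp add: s_def flip: add_divide_distrib)
  also have "\<dots> \<le> (a / s) powr P + (b / s) powr P" by (intro add_mono le) (use assms in \<open>auto simp: s_def\<close>)
  also have "\<dots> = (a powr P + b powr P) / s powr P"
    using assms s by (simp add: powr_divide add_divide_distrib)
  finally show ?thesis using s by (simp add: s_def[symmetric] le_divide_eq)
qed (use assms in auto)

text \<open>Subadditivity for P \<le> 1 and the power mean inequality for P > 1; the latter uses the
  tangent at the arithmetic mean, whose linear parts add up to 0.\<close>

lemma powr_sum_le:
  fixes t :: "'i \<Rightarrow> real"
  assumes I: "finite I" and t: "\<And>i. i \<in> I \<Longrightarrow> 0 \<le> t i" and P: "0 < P"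
  shows "(\<Sum>i\<in>I. t i) powr P \<le> real (card I) powr (max P 1 - 1) * (\<Sum>i\<in>I. t i powr P)"
proof (cases "I = {} \<or> (\<Sum>i\<in>I. t i) = 0")
  case True
  then show ?thesis by (auto intro!: mult_nonneg_nonneg sum_nonneg)
next
  case False
  then have n: "real (card I) > 0" using I by (simp add: card_gt_0_iff)
  have S: "(\<Sum>i\<in>I. t i) > 0" using False sum_nonneg[of I t] t by fastforce
  show ?thesis
  proof (cases "P \<le> 1")
    case True
    have "(\<Sum>i\<in>I. t i) powr P \<le> (\<Sum>i\<in>I. t i powr P)"
      using I t
    proof (induction I rule: finite_induct)
      case (insert i I)
      have "(t i + (\<Sum>i\<in>I. t i)) powr P \<le> t i powr P + (\<Sum>i\<in>I. t i) powr P"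
        using insert.prems P True by (intro powr_add_le sum_nonneg) auto
      then show ?case using insert by fastforce
    qed simp
    then show ?thesis using True n by (simp add: max_def)
  next
    case False
    then have P1: "1 \<le> P" by simp
    define c where "c = (\<Sum>i\<in>I. t i) / card I"
    have c: "c > 0" using S n by (simp add: c_def)
    have "(\<Sum>i\<in>I. c powr P + P * c powr (P - 1) * (t i - c)) \<le> (\<Sum>i\<in>I. t i powr P)"
      using t c P1 by (intro sum_mono powr_ge_tangent) auto
    moreover have "(\<Sum>i\<in>I. c powr P + P * c powr (P - 1) * (t i - c)) = card I * c powr P"
    proof -
      have "(\<Sum>i\<in>I. t i - c) = 0" using n by (simp add: sum_subtractf c_def)
      then have "(\<Sum>i\<in>I. P * c powr (P - 1) * (t i - c)) = 0" by (simp flip: sum_distrib_left)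
      then show ?thesis by (simp add: sum.distrib)
    qed
    ultimately have le: "card I * c powr P \<le> (\<Sum>i\<in>I. t i powr P)" by simp
    have "(\<Sum>i\<in>I. t i) powr P = (card I * c) powr P" using n by (simp add: c_def)
    also have "\<dots> = real (card I) powr (P - 1) * (card I * c powr P)"
      using n c by (simp add: powr_mult powr_diff)
    also have "\<dots> \<le> real (card I) powr (P - 1) * (\<Sum>i\<in>I. t i powr P)"
      by (intro mult_left_mono le) auto
    finally show ?thesis using P1 by (simp add: max_def)
  qed
qed

text \<open>The pointwise inequality costs N powr (max P 1 - 1), and adding N integrals costs
  another factor N. The P-th root of their product is N powr max 1 (1 / P).\<close>

lemma Lp_norm_sum_le:
  fixes g :: "'i \<Rightarrow> 'a::euclidean_space \<Rightarrow> complex"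
  assumes p: "0 < p" "p < \<infinity>" and I: "finite I"
    and m: "\<And>i. i \<in> I \<Longrightarrow> g i \<in> borel_measurable borel" and B: "\<And>i. i \<in> I \<Longrightarrow> Lp_norm p (g i) \<le> B"
  shows "Lp_norm p (\<lambda>x. \<Sum>i\<in>I. g i x) \<le> ennreal (real (card I) powr max 1 (1 / enn2real p)) * B"
proof -
  define P where "P = enn2real p"
  have P: "P > 0" using p by (auto simp: P_def enn2real_positive_iff)
  have Lp: "Lp_norm p h = ennreal_powr (\<integral>\<^sup>+x. ennreal (norm (h x) powr P) \<partial>lborel) (1 / P)" for h :: "'a \<Rightarrow> complex"
    using p by (auto simp: Lp_norm_def P_def)
  show ?thesis
  proof (cases "I = {}")
    case True
    have "Lp_norm p (\<lambda>x::'a. 0) = 0" unfolding Lp using P by (simp add: ennreal_powr_def)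
    then show ?thesis using True by simp
  next
    case False
    then have n: "real (card I) > 0" using I by (simp add: card_gt_0_iff)
    have b: "(\<integral>\<^sup>+x. ennreal (norm (g i x) powr P) \<partial>lborel) \<le> ennreal_powr B P" if "i \<in> I" for i
      using ennreal_powr_mono[OF B[OF that], of P] P ennreal_powr_powr[of "1 / P"] unfolding Lp by simp
    let ?n = "real (card I)"
    have "(\<integral>\<^sup>+x. ennreal (norm (\<Sum>i\<in>I. g i x) powr P) \<partial>lborel) \<le>
        (\<integral>\<^sup>+x. ennreal (?n powr (max P 1 - 1)) * (\<Sum>i\<in>I. ennreal (norm (g i x) powr P)) \<partial>lborel)"
    proof (rule nn_integral_mono)
      fix x :: 'a
      have "norm (\<Sum>i\<in>I. g i x) powr P \<le> (\<Sum>i\<in>I. norm (g i x)) powr P"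
        using P by (intro powr_mono2 norm_sum) auto
      also have "\<dots> \<le> ?n powr (max P 1 - 1) * (\<Sum>i\<in>I. norm (g i x) powr P)"
        by (rule powr_sum_le[OF I _ P]) auto
      finally have "ennreal (norm (\<Sum>i\<in>I. g i x) powr P) \<le> ennreal (?n powr (max P 1 - 1) * (\<Sum>i\<in>I. norm (g i x) powr P))"
        by (rule ennreal_leI)
      also have "\<dots> = ennreal (?n powr (max P 1 - 1)) * ennreal (\<Sum>i\<in>I. norm (g i x) powr P)"
        by (rule ennreal_mult) (auto intro: sum_nonneg)
      also have "ennreal (\<Sum>i\<in>I. norm (g i x) powr P) = (\<Sum>i\<in>I. ennreal (norm (g i x) powr P))"
        by (rule sum_ennreal[symmetric]) simp
      finally show "ennreal (norm (\<Sum>i\<in>I. g i x) powr P) \<le> ennreal (?n powr (max P 1 - 1)) * (\<Sum>i\<in>I. ennreal (norm (g i x) powr P))" .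
    qed
    also have "\<dots> = ennreal (?n powr (max P 1 - 1)) * (\<Sum>i\<in>I. \<integral>\<^sup>+x. ennreal (norm (g i x) powr P) \<partial>lborel)"
    proof -
      have gm: "(\<lambda>x. ennreal (norm (g i x) powr P)) \<in> borel_measurable lborel" if "i \<in> I" for i
      proof -
        have [measurable]: "g i \<in> borel_measurable borel" by (rule m[OF that])
        show ?thesis by measurable
      qed
      have sm: "(\<lambda>x. \<Sum>i\<in>I. ennreal (norm (g i x) powr P)) \<in> borel_measurable lborel"
        by (rule borel_measurable_sum[OF gm])
      show ?thesis by (simp only: nn_integral_cmult[OF sm] nn_integral_sum[of I "\<lambda>i x. ennreal (norm (g i x) powr P)", OF gm])
    qed
    also have "\<dots> \<le> ennreal (?n powr (max P 1 - 1)) * (\<Sum>i\<in>I. ennreal_powr B P)"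
      by (intro mult_left_mono sum_mono b) auto
    also have "\<dots> = ennreal (?n powr (max P 1 - 1) * ?n) * ennreal_powr B P"
      by (simp add: ennreal_mult mult.assoc ennreal_of_nat_eq_real_of_nat)
    also have "?n powr (max P 1 - 1) * ?n = ?n powr max P 1" using n by (simp add: powr_diff)
    finally have "Lp_norm p (\<lambda>x. \<Sum>i\<in>I. g i x) \<le> ennreal_powr (ennreal (?n powr max P 1) * ennreal_powr B P) (1 / P)"
      unfolding Lp using P by (intro ennreal_powr_mono) auto
    also have "\<dots> = ennreal ((?n powr max P 1) powr (1 / P)) * B"
      using n P by (simp add: ennreal_powr_mult ennreal_powr_powr)
    also have "(?n powr max P 1) powr (1 / P) = ?n powr max 1 (1 / P)"
      using P by (simp add: powr_powr max_def field_simps)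
    finally show ?thesis unfolding P_def .
  qed
qed

lemma inverse_fourier_sum:
  assumes "finite I" "\<And>i. i \<in> I \<Longrightarrow> u i \<in> schwartz"
  shows "inverse_fourier (\<lambda>\<xi>. \<Sum>i\<in>I. u i \<xi>) x = (\<Sum>i\<in>I. inverse_fourier (u i) x)"
  unfolding inverse_fourier_wave sum_distrib_right
  using assms by (intro Bochner_Integration.integral_sum integrable_mult_wave schwartz_integrable) auto

lemma convolution_sum:
  assumes f: "f \<in> tempered_distributions" and I: "finite I" "\<And>i. i \<in> I \<Longrightarrow> u i \<in> schwartz"
  shows "f \<star> inverse_fourier (\<lambda>\<xi>. \<Sum>i\<in>I. u i \<xi>) = (\<lambda>x. \<Sum>i\<in>I. (f \<star> inverse_fourier (u i)) x)"
proof
  fix x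
  have "f (\<lambda>y. \<Sum>i\<in>I. 1 * inverse_fourier (u i) (x - y)) = (\<Sum>i\<in>I. 1 * f (\<lambda>y. inverse_fourier (u i) (x - y)))"
    using I by (intro tempered_sum f schwartz_reflect schwartz_inverse_fourier)
  then show "(f \<star> inverse_fourier (\<lambda>\<xi>. \<Sum>i\<in>I. u i \<xi>)) x = (\<Sum>i\<in>I. (f \<star> inverse_fourier (u i)) x)"
    using I by (simp add: dist_convolution_def inverse_fourier_sum)
qed

lemma Lp_multiplier_sum_le:
  fixes u :: "'i \<Rightarrow> real^'d \<Rightarrow> complex"
  assumes f: "f \<in> tempered_distributions" and p: "0 < p" "p < \<infinity>"
    and I: "finite I" "\<And>i. i \<in> I \<Longrightarrow> u i \<in> schwartz"
    and B: "\<And>i. i \<in> I \<Longrightarrow> Lp_norm p (f \<star> inverse_fourier (u i)) \<le> B"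
  shows "Lp_norm p (f \<star> inverse_fourier (\<lambda>\<xi>. \<Sum>i\<in>I. u i \<xi>)) \<le> ennreal (real (card I) powr max 1 (1 / enn2real p)) * B"
proof -
  have eq: "f \<star> inverse_fourier (\<lambda>\<xi>. \<Sum>i\<in>I. u i \<xi>) = (\<lambda>x. \<Sum>i\<in>I. (f \<star> inverse_fourier (u i)) x)"
    by (rule convolution_sum[OF f I])
  show ?thesis unfolding eq
    by (rule Lp_norm_sum_le[OF p I(1)]) (use I B convolution_measurable[OF f schwartz_inverse_fourier] in auto)
qed

lemma Lp_norm_minus: "Lp_norm p (\<lambda>x. - g x) = Lp_norm p g"
  by (simp add: Lp_norm_def)

lemma convolution_uminus:
  assumes f: "f \<in> tempered_distributions" and u: "u \<in> schwartz"
  shows "f \<star> inverse_fourier (\<lambda>\<xi>. - u \<xi>) = (\<lambda>x. - (f \<star> inverse_fourier u) x)"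
proof
  fix x
  have "f (\<lambda>y. (- 1) * inverse_fourier u (x - y)) = (- 1) * f (\<lambda>y. inverse_fourier u (x - y))"
    by (intro tempered_scale f schwartz_reflect schwartz_inverse_fourier u)
  then show "(f \<star> inverse_fourier (\<lambda>\<xi>. - u \<xi>)) x = - (f \<star> inverse_fourier u) x"
    using inverse_fourier_scale[of "- 1" u] by (simp add: dist_convolution_def)
qed

section \<open>Multipliers on a dyadic band\<close>

context shearlet_system begin

definition level_sum :: "'d option \<Rightarrow> nat \<Rightarrow> real^'d \<Rightarrow> complex" where
  "level_sum g J \<xi> = (\<Sum>a\<in>level_atoms g J. atom_hat a \<xi> * cnj (atom_hat a \<xi>))"

text \<open>The constant 1 is not a Schwartz function, so 1 - \<open>level_sum\<close> is only used
  together with a Schwartz factor w.\<close>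

lemma schwartz_mult_level:
  assumes "w \<in> schwartz" shows "(\<lambda>\<xi>. w \<xi> * (1 - level_sum g J \<xi>)) \<in> schwartz"
proof -
  have "(\<lambda>\<xi>. w \<xi> + (- 1) * (\<Sum>a\<in>level_atoms g J. w \<xi> * (atom_hat a \<xi> * cnj (atom_hat a \<xi>)))) \<in> schwartz"
    by (intro schwartz_add schwartz_scale schwartz_sum schwartz_mult' schwartz_cnj atom_hat_schwartz finite_level_atoms assms)
  then show ?thesis by (simp add: level_sum_def sum_distrib_left right_diff_distrib sum_negf)
qed

lemma schwartz_mult_levels:
  assumes "w \<in> schwartz" shows "(\<lambda>\<xi>. w \<xi> * (\<Prod>g\<in>G. 1 - level_sum g J \<xi>)) \<in> schwartz"
proof (cases "finite G")
  case True
  then show ?thesis using assms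
  proof (induction G arbitrary: w rule: finite_induct)
    case (insert g G)
    have "(\<lambda>\<xi>. (w \<xi> * (1 - level_sum g J \<xi>)) * (\<Prod>g\<in>G. 1 - level_sum g J \<xi>)) \<in> schwartz"
      by (intro insert.IH schwartz_mult_level insert.prems)
    then show ?case using insert.hyps by (simp add: mult.assoc)
  qed simp
qed (use assms in simp)

text \<open>B is left free so that the size of the individual atoms can be inserted later. The
  dependence on \<nu> is confined to the set A, through the power of its cardinality and the bound
  B.\<close>

theorem multiplier_estimate:
  fixes v :: "real^'d \<Rightarrow> complex" and p :: ennreal
  assumes v: "v \<in> schwartz" and v_supp: "\<And>\<eta>. v \<eta> \<noteq> 0 \<Longrightarrow> norm \<eta> \<le> 2" and p: "0 < p" "p < \<infinity>"
  obtains E :: real where "E > 0"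
    "\<And>f \<nu> B A. f \<in> tempered_distributions \<Longrightarrow>
      A = {a \<in> atoms. \<exists>\<xi>. atom_hat a \<xi> \<noteq> 0 \<and> v ((1 / 2 ^ \<nu>) *\<^sub>R \<xi>) \<noteq> 0} \<Longrightarrow> finite A \<Longrightarrow>
      (\<And>a. a \<in> A \<Longrightarrow> Lp_norm p (f \<star> inverse_fourier (atom_hat a)) \<le> B) \<Longrightarrow>
      Lp_norm p (f \<star> inverse_fourier (\<lambda>\<xi>. v ((1 / 2 ^ \<nu>) *\<^sub>R \<xi>))) \<le>
        ennreal (E * real (card A) powr max 1 (1 / enn2real p)) * B"
proof -
  define m where "m = max 1 (1 / enn2real p)"
  have m: "m > 0" by (simp add: m_def less_max_iff_disj)
  \<comment> \<open>All multipliers that occur are members of this finite set composed with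
    invertible matrices, so finitely many constants suffice for all atoms and all \<nu>.\<close>
  let ?V = "insert v (range generator \<union> range (\<lambda>g \<xi>. cnj (generator g \<xi>)))"
  \<comment> \<open>The difference of a frequency with coordinates up to 2064 and one with
    coordinates up to 2 stays in the cube of half-side 2100, where this function is 1.\<close>
  let ?\<kappa> = "bump 2100"
  have V: "v' \<in> schwartz" "v' \<eta> \<noteq> 0 \<Longrightarrow> \<bar>\<eta> $ i\<bar> \<le> 2" if "v' \<in> ?V" for v' \<eta> i
  proof -
    show "v' \<in> schwartz" using that v generator_schwartz schwartz_cnj[OF generator_schwartz] by auto
    have "\<bar>\<eta> $ i\<bar> \<le> 2" if "v \<eta> \<noteq> 0"
      using v_supp[OF that] component_le_norm_cart[of \<eta> i] by linarith
    moreover have "\<bar>\<eta> $ i\<bar> \<le> 2" if "generator g \<eta> \<noteq> 0" for g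
      using generator_nonzero[OF that, of i] by linarith
    ultimately show "\<bar>\<eta> $ i\<bar> \<le> 2" if "v' \<eta> \<noteq> 0" using that \<open>v' \<in> ?V\<close> by auto
  qed
  \<comment> \<open>Bundling the estimate into a predicate allows the choice of one constant for
    each member of \<open>?V\<close>.\<close>
  define Q where "Q v' C \<longleftrightarrow> C > 0 \<and> (\<forall>f u (M::real^'d^'d). f \<in> tempered_distributions \<longrightarrow> u \<in> schwartz \<longrightarrow> det M \<noteq> 0 \<longrightarrow>
      (\<forall>\<xi> \<eta>. u \<xi> \<noteq> 0 \<longrightarrow> v' \<eta> \<noteq> 0 \<longrightarrow> ?\<kappa> (\<xi> v* M - \<eta>) = 1) \<longrightarrow>
      Lp_norm p (f \<star> inverse_fourier (\<lambda>\<xi>. u \<xi> * v' (\<xi> v* M))) \<le> ennreal C * Lp_norm p (f \<star> inverse_fourier u))"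
    for v' :: "real^'d \<Rightarrow> complex" and C :: real
  have "\<exists>C. Q v' C" if "v' \<in> ?V" for v'
    unfolding Q_def by (rule Lp_multiplier_bound[OF V(1)[OF that] bump_schwartz[of 2100] p]) (simp, blast)
  then have "\<exists>Cf. \<forall>v'\<in>?V. Q v' (Cf v')" by (intro bchoice ballI)
  then obtain Cf where Cf': "Q v' (Cf v')" if "v' \<in> ?V" for v' by blast
  have Cf1: "Cf v' > 0" if "v' \<in> ?V" for v' using Cf'[OF that] unfolding Q_def by (rule conjunct1)
  have Cf2: "Lp_norm p (f \<star> inverse_fourier (\<lambda>\<xi>. u \<xi> * v' (\<xi> v* M))) \<le> ennreal (Cf v') * Lp_norm p (f \<star> inverse_fourier u)"
    if "v' \<in> ?V" "f \<in> tempered_distributions" "u \<in> schwartz" "det M \<noteq> 0"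
      "\<And>\<xi> \<eta>. u \<xi> \<noteq> 0 \<Longrightarrow> v' \<eta> \<noteq> 0 \<Longrightarrow> ?\<kappa> (\<xi> v* M - \<eta>) = 1" for v' f u M
    using Cf'[OF that(1)] that(2-) unfolding Q_def by blast
  define C where "C = 1 + sum Cf ?V"
  have finV: "finite ?V" by simp
  have "0 \<le> sum Cf ?V" by (intro sum_nonneg less_imp_le Cf1)
  then have C1: "C \<ge> 1" by (simp add: C_def)
  have CV: "Cf v' \<le> C" if "v' \<in> ?V" for v'
  proof -
    have "Cf v' \<le> sum Cf ?V" by (rule member_le_sum[OF that _ finV]) (use Cf1 in \<open>auto intro: less_imp_le\<close>)
    then show ?thesis by (simp add: C_def)
  qed
  have step: "Lp_norm p (f \<star> inverse_fourier (\<lambda>\<xi>. u \<xi> * v' (\<xi> v* M))) \<le> ennreal C * Lp_norm p (f \<star> inverse_fourier u)"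
    if f: "f \<in> tempered_distributions" and u: "u \<in> schwartz" and M: "det M \<noteq> 0" and v': "v' \<in> ?V"
      and b: "\<And>\<xi> c. u \<xi> \<noteq> 0 \<Longrightarrow> \<bar>(\<xi> v* M) $ c\<bar> \<le> 2064" for f u M v'
  proof -
    have "Lp_norm p (f \<star> inverse_fourier (\<lambda>\<xi>. u \<xi> * v' (\<xi> v* M))) \<le> ennreal (Cf v') * Lp_norm p (f \<star> inverse_fourier u)"
    proof (rule Cf2[OF v' f u M])
      fix \<xi> \<eta> assume *: "u \<xi> \<noteq> 0" "v' \<eta> \<noteq> 0"
      have "\<bar>(\<xi> v* M - \<eta>) $ c\<bar> \<le> 2100" for c
        using b[OF *(1), of c] V(2)[OF v' *(2), of c] by simp
      then show "?\<kappa> (\<xi> v* M - \<eta>) = 1" by (intro bump_eq_1) auto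
    qed
    also have "\<dots> \<le> ennreal C * Lp_norm p (f \<star> inverse_fourier u)"
      by (intro mult_right_mono ennreal_leI CV v') auto
    finally show ?thesis .
  qed
  define N where "N = (\<lambda>f u. Lp_norm p (f \<star> inverse_fourier (u :: real^'d \<Rightarrow> complex)))"
  \<comment> \<open>A local fact has a fixed index type. With an option type one version serves all
    sums: \<open>None\<close> carries an unmodified term, and \<open>Some\<close> the
    others.\<close>
  have Nsum: "N f (\<lambda>\<xi>. \<Sum>i\<in>I. u i \<xi>) \<le> ennreal (real (card I) powr m) * B"
    if "f \<in> tempered_distributions" "finite I" "\<And>i. i \<in> I \<Longrightarrow> u i \<in> schwartz" "\<And>i. i \<in> I \<Longrightarrow> N f (u i) \<le> B"
    for f B and I :: "'d atom option set" and u
    unfolding N_def m_def by (rule Lp_multiplier_sum_le[OF that(1) p that(2,3)]) (use that(4) in \<open>auto simp: N_def\<close>)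
  have atom_step: "N f (\<lambda>\<xi>. u \<xi> * atom_hat b \<xi>) \<le> ennreal C * N f u"
    "N f (\<lambda>\<xi>. u \<xi> * cnj (atom_hat b \<xi>)) \<le> ennreal C * N f u"
    if f: "f \<in> tempered_distributions" and u: "u \<in> schwartz" and b: "b \<in> atoms" and a: "a \<in> atoms" and ab: "overlap a b"
      and ua: "\<And>\<xi>. u \<xi> \<noteq> 0 \<Longrightarrow> atom_hat a \<xi> \<noteq> 0" for f u a b
    unfolding N_def atom_hat_def
    by (rule step[OF f u det_atom_matrix]; use overlap_matrix_bound[OF a b ab] ua in auto)+
  let ?n = "5 * 65541 ^ CARD('d) :: nat"
  define C3 where "C3 = real (1 + ?n) powr m * C\<^sup>2"
  have C3: "C3 \<ge> 1"
  proof -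
    have "1 * 1 \<le> real (1 + ?n) powr m * C\<^sup>2"
      using C1 m by (intro mult_mono ge_one_powr_ge_zero one_le_power) auto
    then show ?thesis by (simp add: C3_def)
  qed
  \<comment> \<open>Because atom a is a factor, the sum over a whole group shrinks to its
    neighbours. The cost is a constant, independent of J and of the scale of a.\<close>
  have level: "N f (\<lambda>\<xi>. atom_hat a \<xi> * w \<xi> * (1 - level_sum g J \<xi>)) \<le> ennreal C3 * N f (\<lambda>\<xi>. atom_hat a \<xi> * w \<xi>)"
    if f: "f \<in> tempered_distributions" and a: "a \<in> atoms" and w: "w \<in> schwartz" for f a w g J
  proof -
    define u where "u = (\<lambda>\<xi>. atom_hat a \<xi> * w \<xi>)"
    have u: "u \<in> schwartz" unfolding u_def by (intro schwartz_mult' atom_hat_schwartz w)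
    have ua: "atom_hat a \<xi> \<noteq> 0" if "u \<xi> \<noteq> 0" for \<xi> using that by (auto simp: u_def)
    define O' where "O' = neighbours a g \<inter> level_atoms g J"
    have finO: "finite O'" using neighbours(1)[OF a] by (simp add: O'_def)
    have cardO: "card O' \<le> ?n" unfolding O'_def
      by (rule order_trans[OF card_mono[OF neighbours(1)[OF a]] neighbours(2)[OF a]]) auto
    define t where "t i = (case i of None \<Rightarrow> u | Some b \<Rightarrow> (\<lambda>\<xi>. - (u \<xi> * atom_hat b \<xi> * cnj (atom_hat b \<xi>))))" for i
    let ?I = "insert None (Some ` O')"
    have sub: "u \<xi> * atom_hat b \<xi> * cnj (atom_hat b \<xi>) = 0" if "b \<in> level_atoms g J - O'" for b \<xi>
      using that by (auto simp: O'_def neighbours_def level_atoms_def overlap_def u_def)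
    have "u \<xi> * (1 - level_sum g J \<xi>) = (\<Sum>i\<in>?I. t i \<xi>)" for \<xi>
    proof -
      have "u \<xi> * level_sum g J \<xi> = (\<Sum>b\<in>level_atoms g J. u \<xi> * atom_hat b \<xi> * cnj (atom_hat b \<xi>))"
        by (simp add: level_sum_def sum_distrib_left mult.assoc)
      also have "\<dots> = (\<Sum>b\<in>O'. u \<xi> * atom_hat b \<xi> * cnj (atom_hat b \<xi>))"
        by (rule sum.mono_neutral_right[OF finite_level_atoms]) (use sub in \<open>auto simp: O'_def\<close>)
      finally show ?thesis using finO
        by (simp add: t_def sum.reindex right_diff_distrib sum_negf)
    qed
    then have eq: "(\<lambda>\<xi>. u \<xi> * (1 - level_sum g J \<xi>)) = (\<lambda>\<xi>. \<Sum>i\<in>?I. t i \<xi>)" by (rule ext)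
    have ts: "t i \<in> schwartz" and tN: "N f (t i) \<le> ennreal (C\<^sup>2) * N f u" if i: "i \<in> ?I" for i
    proof -
      show "t i \<in> schwartz"
      proof (cases i)
        case (Some b)
        have "(\<lambda>\<xi>. (- 1) * (u \<xi> * atom_hat b \<xi> * cnj (atom_hat b \<xi>))) \<in> schwartz"
          by (intro schwartz_scale schwartz_mult' schwartz_cnj atom_hat_schwartz u)
        then show ?thesis by (simp add: Some t_def)
      qed (simp add: t_def u)
      show "N f (t i) \<le> ennreal (C\<^sup>2) * N f u"
      proof (cases i)
        case None
        have "1 * N f u \<le> ennreal (C\<^sup>2) * N f u"
          using C1 by (intro mult_right_mono) (auto simp: one_le_power)
        then show ?thesis by (simp add: None t_def)
      next
        case (Some b)
        then have b: "b \<in> atoms" "overlap a b" using i by (auto simp: O'_def neighbours_def)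
        have ub: "(\<lambda>\<xi>. u \<xi> * atom_hat b \<xi>) \<in> schwartz" by (intro schwartz_mult' atom_hat_schwartz u)
        have "N f (t i) = N f (\<lambda>\<xi>. u \<xi> * atom_hat b \<xi> * cnj (atom_hat b \<xi>))"
          unfolding N_def Some t_def option.case
          by (subst convolution_uminus[OF f schwartz_mult'[OF ub schwartz_cnj[OF atom_hat_schwartz]]]) (rule Lp_norm_minus)
        also have "\<dots> \<le> ennreal C * N f (\<lambda>\<xi>. u \<xi> * atom_hat b \<xi>)"
          by (rule atom_step(2)[OF f ub b(1) a b(2)]) (use ua in auto)
        also have "\<dots> \<le> ennreal C * (ennreal C * N f u)"
          by (intro mult_left_mono atom_step(1)[OF f u b(1) a b(2)] ua) auto
        also have "\<dots> = ennreal (C\<^sup>2) * N f u" using C1 by (simp add: power2_eq_square ennreal_mult mult.assoc)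
        finally show ?thesis .
      qed
    qed
    have "N f (\<lambda>\<xi>. u \<xi> * (1 - level_sum g J \<xi>)) \<le> ennreal (real (card ?I) powr m) * (ennreal (C\<^sup>2) * N f u)"
      unfolding eq by (rule Nsum[OF f]) (use finO ts tN in auto)
    also have "\<dots> \<le> ennreal (real (1 + ?n) powr m) * (ennreal (C\<^sup>2) * N f u)"
    proof (intro mult_right_mono ennreal_leI powr_mono2)
      have "card ?I = 1 + card O'" using finO by (subst card_insert_disjoint) (auto simp: card_image)
      then have "card ?I \<le> 1 + ?n" using cardO by linarith
      then show "real (card ?I) \<le> real (1 + ?n)" by (rule of_nat_mono)
    qed (use m in auto)
    also have "\<dots> = ennreal C3 * N f u" by (simp add: C3_def ennreal_mult mult.assoc)
    finally show ?thesis by (simp add: u_def)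
  qed
  \<comment> \<open>The induction moves one factor after the other into w, with the atom a kept in
    front throughout.\<close>
  have levels: "N f (\<lambda>\<xi>. atom_hat a \<xi> * w \<xi> * (\<Prod>g\<in>G. 1 - level_sum g J \<xi>)) \<le> ennreal (C3 ^ card G) * N f (\<lambda>\<xi>. atom_hat a \<xi> * w \<xi>)"
    if f: "f \<in> tempered_distributions" and a: "a \<in> atoms" and w: "w \<in> schwartz" and G: "finite G" for f a w G J
    using G w
  proof (induction G arbitrary: w rule: finite_induct)
    case (insert g G)
    have "N f (\<lambda>\<xi>. atom_hat a \<xi> * w \<xi> * (\<Prod>g\<in>insert g G. 1 - level_sum g J \<xi>)) =
        N f (\<lambda>\<xi>. atom_hat a \<xi> * (w \<xi> * (1 - level_sum g J \<xi>)) * (\<Prod>g\<in>G. 1 - level_sum g J \<xi>))"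
      using insert.hyps by (simp add: mult.assoc)
    also have "\<dots> \<le> ennreal (C3 ^ card G) * N f (\<lambda>\<xi>. atom_hat a \<xi> * (w \<xi> * (1 - level_sum g J \<xi>)))"
      by (rule insert.IH[OF schwartz_mult_level[OF insert.prems]])
    also have "\<dots> \<le> ennreal (C3 ^ card G) * (ennreal C3 * N f (\<lambda>\<xi>. atom_hat a \<xi> * w \<xi>))"
      using level[OF f a insert.prems, of g J] by (intro mult_left_mono) (auto simp: mult.assoc)
    also have "\<dots> = ennreal (C3 ^ card (insert g G)) * N f (\<lambda>\<xi>. atom_hat a \<xi> * w \<xi>)"
      using insert.hyps C3 by (simp add: ennreal_mult mult_ac)
    finally show ?case .
  qed simp
  define D where "D = C\<^sup>2 * C3 ^ CARD('d option)"
  have D1: "D \<ge> 1"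
  proof -
    have "1 * 1 \<le> C\<^sup>2 * C3 ^ CARD('d option)" using C1 C3 by (intro mult_mono one_le_power) auto
    then show ?thesis by (simp add: D_def)
  qed
  \<comment> \<open>2 powr m is the price of adding two functions, once for each group; D bounds one
    term a * cnj a * \<theta> with all its remaining factors.\<close>
  define E where "E = 2 powr m * D"
  have E1: "E \<ge> 1"
  proof -
    have "1 * 1 \<le> 2 powr m * D" using D1 m by (intro mult_mono ge_one_powr_ge_zero) auto
    then show ?thesis by (simp add: E_def)
  qed
  show ?thesis
  proof (rule that[of "E ^ CARD('d option)"])
    show "0 < E ^ CARD('d option)" using E1 by simp
    fix f :: "(real^'d \<Rightarrow> complex) \<Rightarrow> complex" and \<nu> :: nat and B :: ennreal and A :: "'d atom set"
    assume f: "f \<in> tempered_distributions"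
      and A: "A = {a \<in> atoms. \<exists>\<xi>. atom_hat a \<xi> \<noteq> 0 \<and> v ((1 / 2 ^ \<nu>) *\<^sub>R \<xi>) \<noteq> 0}" and finA: "finite A"
      and B': "\<And>a. a \<in> A \<Longrightarrow> Lp_norm p (f \<star> inverse_fourier (atom_hat a)) \<le> B"
    let ?M = "(1 / 2 ^ \<nu>) *\<^sub>R mat 1 :: real^'d^'d" and ?J = "\<nu> + 5"
    have M: "\<xi> v* ?M = (1 / 2 ^ \<nu>) *\<^sub>R \<xi>" for \<xi> :: "real^'d"
    proof -
      have "(\<xi> v* ?M) $ c = (\<Sum>i\<in>UNIV. if i = c then \<xi> $ c / 2 ^ \<nu> else 0)" for c
        unfolding vector_matrix_mult_def vec_lambda_beta by (rule sum.cong) (auto simp: mat_def)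
      then show ?thesis by (simp add: vec_eq_iff)
    qed
    have detM: "det ?M \<noteq> 0"
      by (subst det_diagonal) (auto simp: mat_def)
    define \<theta> where "\<theta> = (\<lambda>\<xi>. v ((1 / 2 ^ \<nu>) *\<^sub>R \<xi>))"
    have \<theta>s: "\<theta> \<in> schwartz" using schwartz_matrix[OF v detM] unfolding M \<theta>_def .
    let ?c = "real (card A) powr m"
    have summand: "N f (\<lambda>\<xi>. atom_hat a \<xi> * (cnj (atom_hat a \<xi>) * \<theta> \<xi>) * (\<Prod>g\<in>G. 1 - level_sum g ?J \<xi>)) \<le> ennreal D * B"
      if a: "a \<in> A" for a G
    proof -
      have a': "a \<in> atoms" "overlap a a" using a by (auto simp: A overlap_def)
      obtain \<xi>0 where \<xi>0: "atom_hat a \<xi>0 \<noteq> 0" "v ((1 / 2 ^ \<nu>) *\<^sub>R \<xi>0) \<noteq> 0" using a by (auto simp: A)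
      have "norm ((1 / 2 ^ \<nu>) *\<^sub>R \<xi>0) \<le> 2" by (rule v_supp[OF \<xi>0(2)])
      then have n0: "norm \<xi>0 \<le> 2 * 2 ^ \<nu>" by (simp add: divide_le_eq)
      \<comment> \<open>An atom that meets the band has 4 ^ j / 16 \<le> 2 * 2 ^ \<nu>, so its whole
        support fits into a fixed cube after division by 2 ^ \<nu>. This bound validates the last
        multiplier, \<theta> itself.\<close>
      have scale: "4 ^ atom_scale a \<le> 32 * (2::real) ^ \<nu>"
      proof (cases a)
        case None
        have "(1::real) \<le> 2 ^ \<nu>" by simp
        then show ?thesis using None by (simp add: atom_scale_def del: one_le_power)
      next
        case (Some b)
        then obtain k j l where s: "a = Some (k, j, l)" by (cases b) auto
        have "4 ^ j / 16 \<le> \<bar>\<xi>0 $ k\<bar>" using atom_hat_nonzero_Some(1) \<xi>0(1) s by simp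
        also have "\<dots> \<le> norm \<xi>0" by (rule component_le_norm_cart)
        finally show ?thesis using n0 by (simp add: s atom_scale_def)
      qed
      have bound: "\<bar>(\<xi> v* ?M) $ c\<bar> \<le> 2064" if "atom_hat a \<xi> \<noteq> 0" for \<xi> c
      proof -
        have "\<bar>\<xi> $ c\<bar> \<le> 32 * 2 ^ \<nu>" using atom_bound[OF a'(1) that, of c] scale by linarith
        then have "\<bar>\<xi> $ c\<bar> / 2 ^ \<nu> \<le> 32" by (simp add: divide_le_eq)
        then show ?thesis unfolding M by (simp add: abs_mult)
      qed
      have uc: "(\<lambda>\<xi>. atom_hat a \<xi> * cnj (atom_hat a \<xi>)) \<in> schwartz"
        by (intro schwartz_mult' schwartz_cnj atom_hat_schwartz)
      have "N f (\<lambda>\<xi>. atom_hat a \<xi> * (cnj (atom_hat a \<xi>) * \<theta> \<xi>) * (\<Prod>g\<in>G. 1 - level_sum g ?J \<xi>)) \<le>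
          ennreal (C3 ^ card G) * N f (\<lambda>\<xi>. atom_hat a \<xi> * (cnj (atom_hat a \<xi>) * \<theta> \<xi>))"
        by (rule levels[OF f a'(1)]) (auto intro!: schwartz_mult' schwartz_cnj atom_hat_schwartz \<theta>s)
      also have "\<dots> \<le> ennreal (C3 ^ CARD('d option)) * (ennreal (C\<^sup>2) * B)"
      proof (intro mult_mono ennreal_leI power_increasing C3)
        show "card G \<le> CARD('d option)" by (rule card_mono) auto
        have "N f (\<lambda>\<xi>. atom_hat a \<xi> * cnj (atom_hat a \<xi>) * v (\<xi> v* ?M)) \<le> ennreal C * N f (\<lambda>\<xi>. atom_hat a \<xi> * cnj (atom_hat a \<xi>))"
          unfolding N_def by (rule step[OF f uc detM]) (use bound in auto)
        also have "\<dots> \<le> ennreal C * (ennreal C * N f (atom_hat a))"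
          by (intro mult_left_mono atom_step(2)[OF f atom_hat_schwartz a'(1) a'(1,2)]) auto
        also have "\<dots> \<le> ennreal C * (ennreal C * B)"
          unfolding N_def by (intro mult_left_mono B' a) auto
        also have "\<dots> = ennreal (C\<^sup>2) * B" using C1 by (simp add: power2_eq_square ennreal_mult mult.assoc)
        finally show "N f (\<lambda>\<xi>. atom_hat a \<xi> * (cnj (atom_hat a \<xi>) * \<theta> \<xi>)) \<le> ennreal (C\<^sup>2) * B"
          unfolding M by (simp add: \<theta>_def mult.assoc)
      qed auto
      also have "\<dots> = ennreal D * B" using C3 by (simp add: D_def ennreal_mult mult_ac)
      finally show ?thesis .
    qed
    \<comment> \<open>Telescoping over the groups: a new group g adds the product over the previous
      groups times \<open>level_sum g\<close>, and that sum consists of terms containing an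
      atom.\<close>
    have part: "N f (\<lambda>\<xi>. \<theta> \<xi> - \<theta> \<xi> * (\<Prod>g\<in>G. 1 - level_sum g ?J \<xi>)) \<le> ennreal (E ^ card G * ?c) * B" if "finite G" for G
      using that
    proof (induction G rule: finite_induct)
      case empty
      \<comment> \<open>For no groups the difference is the zero function, whose norm is read off
        from \<open>Nsum\<close> with an empty sum.\<close>
      have "N f (\<lambda>\<xi>. \<Sum>i\<in>({} :: 'd atom option set). 0) \<le> ennreal (real (card ({} :: 'd atom option set)) powr m) * 0"
        by (rule Nsum[OF f]) auto
      then show ?case by simp
    next
      case (insert g G)
      let ?P = "\<lambda>\<xi>. \<Prod>g\<in>G. 1 - level_sum g ?J \<xi>"
      let ?X = "\<lambda>\<xi>. \<theta> \<xi> - \<theta> \<xi> * ?P \<xi>"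
      let ?t = "\<lambda>a \<xi>. atom_hat a \<xi> * (cnj (atom_hat a \<xi>) * \<theta> \<xi>) * ?P \<xi>"
      let ?L = "level_atoms g ?J \<inter> A"
      let ?Y = "\<lambda>\<xi>. \<Sum>a\<in>?L. ?t a \<xi>"
      have ts: "?t a \<in> schwartz" for a
        by (intro schwartz_mult_levels schwartz_mult' schwartz_cnj atom_hat_schwartz \<theta>s)
      have Xs: "?X \<in> schwartz"
      proof -
        have "(\<lambda>\<xi>. \<theta> \<xi> + (- 1) * (\<theta> \<xi> * ?P \<xi>)) \<in> schwartz"
          by (intro schwartz_add schwartz_scale schwartz_mult_levels \<theta>s)
        then show ?thesis by simp
      qed
      have Ys: "?Y \<in> schwartz" by (intro schwartz_sum ts) (simp add: finA)
      have Y: "N f ?Y \<le> ennreal (?c * D) * B"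
      proof -
        have "N f (\<lambda>\<xi>. \<Sum>i\<in>Some ` ?L. ?t (the i) \<xi>) \<le> ennreal (real (card (Some ` ?L)) powr m) * (ennreal D * B)"
          by (rule Nsum[OF f]) (use finA ts summand in auto)
        also have "(\<lambda>\<xi>. \<Sum>i\<in>Some ` ?L. ?t (the i) \<xi>) = ?Y" by (simp add: sum.reindex)
        also have "ennreal (real (card (Some ` ?L)) powr m) * (ennreal D * B) \<le> ennreal ?c * (ennreal D * B)"
          using m card_mono[OF finA, of ?L] by (intro mult_right_mono ennreal_leI powr_mono2) (auto simp: card_image)
        also have "\<dots> = ennreal (?c * D) * B" using D1 by (simp add: ennreal_mult mult.assoc)
        finally show ?thesis .
      qed
      \<comment> \<open>Atoms that do not meet the support of \<theta> drop out, so the sum runs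
        over A only, however large J is.\<close>
      have H: "\<theta> \<xi> * ?P \<xi> * level_sum g ?J \<xi> = ?Y \<xi>" for \<xi>
      proof -
        have "\<theta> \<xi> * ?P \<xi> * level_sum g ?J \<xi> = (\<Sum>a\<in>level_atoms g ?J. ?t a \<xi>)"
          unfolding level_sum_def[of g] sum_distrib_left by (rule sum.cong) (auto simp: mult_ac)
        also have "\<dots> = ?Y \<xi>"
          by (rule sum.mono_neutral_right[OF finite_level_atoms]) (auto simp: A level_atoms_def \<theta>_def)
        finally show ?thesis .
      qed
      let ?Z = "\<lambda>i. case i of None \<Rightarrow> ?X | Some _ \<Rightarrow> ?Y"
      let ?I = "{None, Some None} :: 'd atom option set"
      have eq: "(\<lambda>\<xi>. \<theta> \<xi> - \<theta> \<xi> * (\<Prod>g\<in>insert g G. 1 - level_sum g ?J \<xi>)) = (\<lambda>\<xi>. \<Sum>i\<in>?I. ?Z i \<xi>)"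
      proof
        fix \<xi>
        have "\<theta> \<xi> - \<theta> \<xi> * (\<Prod>g\<in>insert g G. 1 - level_sum g ?J \<xi>) = ?X \<xi> + \<theta> \<xi> * ?P \<xi> * level_sum g ?J \<xi>"
          using insert.hyps by (simp add: algebra_simps)
        also have "\<dots> = ?X \<xi> + ?Y \<xi>" by (simp only: H)
        also have "\<dots> = (\<Sum>i\<in>?I. ?Z i \<xi>)" by simp
        finally show "\<theta> \<xi> - \<theta> \<xi> * (\<Prod>g\<in>insert g G. 1 - level_sum g ?J \<xi>) = (\<Sum>i\<in>?I. ?Z i \<xi>)" .
      qed
      have "N f (\<lambda>\<xi>. \<Sum>i\<in>?I. ?Z i \<xi>) \<le> ennreal (real (card ?I) powr m) * (ennreal (E ^ card G * D * ?c) * B)"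
      proof (rule Nsum[OF f])
        fix i assume "i \<in> ?I"
        show "?Z i \<in> schwartz" using Xs Ys by (cases i) auto
        show "N f (?Z i) \<le> ennreal (E ^ card G * D * ?c) * B"
        proof (cases i)
          case None
          have "E ^ card G * 1 * ?c \<le> E ^ card G * D * ?c"
            using E1 D1 by (intro mult_right_mono mult_left_mono) auto
          then have le: "E ^ card G * ?c \<le> E ^ card G * D * ?c" by (simp only: mult_1_right)
          have "ennreal (E ^ card G * ?c) * B \<le> ennreal (E ^ card G * D * ?c) * B"
            by (rule mult_right_mono[OF ennreal_leI[OF le]]) simp
          then show ?thesis using insert.IH None by simp
        next
          case (Some x)
          have "?c * D = 1 * D * ?c" by simp
          also have "\<dots> \<le> E ^ card G * D * ?c"
            using E1 D1 by (intro mult_right_mono one_le_power) auto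
          finally have le: "?c * D \<le> E ^ card G * D * ?c" .
          have "ennreal (?c * D) * B \<le> ennreal (E ^ card G * D * ?c) * B"
            by (rule mult_right_mono[OF ennreal_leI[OF le]]) simp
          then show ?thesis using Y Some by simp
        qed
      qed simp
      also have "\<dots> = ennreal (2 powr m * (E ^ card G * D * ?c)) * B"
        using E1 D1 by (simp add: ennreal_mult mult.assoc)
      also have "2 powr m * (E ^ card G * D * ?c) = E ^ card (insert g G) * ?c"
        using insert.hyps by (simp add: E_def)
      finally show ?case unfolding eq .
    qed
    \<comment> \<open>On the support of \<theta> one of the groups sums to 1 and annihilates the
      full product. Hence \<open>part\<close> for all groups is an estimate of \<theta>
      itself.\<close>
    have zero: "\<theta> \<xi> * (\<Prod>g\<in>UNIV. 1 - level_sum g ?J \<xi>) = 0" for \<xi>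
    proof (cases "\<theta> \<xi> = 0")
      case False
      then have "norm ((1 / 2 ^ \<nu>) *\<^sub>R \<xi>) \<le> 2" unfolding \<theta>_def by (rule v_supp)
      then have "norm \<xi> \<le> 2 * 2 ^ \<nu>" by (simp add: divide_le_eq)
      then obtain g where "level_sum g ?J \<xi> = 1" using level_atoms_partition unfolding level_sum_def by blast
      then have "(\<Prod>g\<in>UNIV. 1 - level_sum g ?J \<xi>) = 0" by (intro prod_zero) auto
      then show ?thesis by simp
    qed simp
    show "Lp_norm p (f \<star> inverse_fourier (\<lambda>\<xi>. v ((1 / 2 ^ \<nu>) *\<^sub>R \<xi>))) \<le>
        ennreal (E ^ CARD('d option) * real (card A) powr max 1 (1 / enn2real p)) * B"
      using part[of UNIV] unfolding zero by (simp add: N_def \<theta>_def m_def)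
  qed
qed

end

section \<open>The embedding\<close>

lemma dyadic_dilation_inverse_fourier:
  fixes \<phi> :: "real^'d \<Rightarrow> complex"
  assumes \<phi>: "\<phi> \<in> schwartz"
  shows "dyadic_dilation \<nu> \<phi> = inverse_fourier (\<lambda>\<xi>. fourier \<phi> ((1 / 2 ^ \<nu>) *\<^sub>R \<xi>))"
proof
  fix x :: "real^'d"
  define u where "u = fourier \<phi>"
  have u[measurable]: "u \<in> borel_measurable borel"
    unfolding u_def by (intro schwartz_measurable schwartz_fourier \<phi>)
  let ?f = "\<lambda>\<xi>. u ((1 / 2 ^ \<nu>) *\<^sub>R \<xi>) * exp (2 * pi * \<i> * complex_of_real (\<xi> \<bullet> x))"
  have "inverse_fourier (\<lambda>\<xi>. u ((1 / 2 ^ \<nu>) *\<^sub>R \<xi>)) x = (\<integral>\<xi>. ?f \<xi> \<partial>lborel)"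
    by (simp add: inverse_fourier_def)
  also have "\<dots> = \<bar>2 ^ \<nu>\<bar> ^ DIM(real^'d) *\<^sub>R (\<integral>\<xi>. ?f (0 + 2 ^ \<nu> *\<^sub>R \<xi>) \<partial>lborel)"
    by (rule lborel_integral_affine) auto
  also have "(\<integral>\<xi>. ?f (0 + 2 ^ \<nu> *\<^sub>R \<xi>) \<partial>lborel) = inverse_fourier u (2 ^ \<nu> *\<^sub>R x)"
    by (simp add: inverse_fourier_def)
  also have "inverse_fourier u = \<phi>" unfolding u_def by (rule inverse_fourier_fourier[OF \<phi>])
  also have "\<bar>2 ^ \<nu>\<bar> ^ DIM(real^'d) *\<^sub>R \<phi> (2 ^ \<nu> *\<^sub>R x) = dyadic_dilation \<nu> \<phi> x"
    by (simp add: dyadic_dilation_def scaleR_conv_of_real mult.commute[of "CARD('d)"] power_mult)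
  finally show "dyadic_dilation \<nu> \<phi> x = inverse_fourier (\<lambda>\<xi>. fourier \<phi> ((1 / 2 ^ \<nu>) *\<^sub>R \<xi>)) x"
    by (simp add: u_def)
qed

text \<open>Raising to the power q keeps the sequence geometric with ratio r powr q < 1, also for q
  < 1. The factor S is an extended number and may be infinite.\<close>

lemma lq_norm_geometric_le:
  fixes C r :: real and q :: ennreal
  assumes C: "C > 0" and r: "0 < r" "r < 1" and q: "0 < q"
  obtains D :: real where "D > 0"
    "\<And>a S. (\<And>\<nu>. a \<nu> \<le> ennreal (C * r ^ \<nu>) * S) \<Longrightarrow>
      (if q = \<infinity> then SUP \<nu>. a \<nu>
       else ennreal_powr (\<Sum>\<nu>. ennreal_powr (a \<nu>) (enn2real q)) (1 / enn2real q)) \<le> ennreal D * S"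
proof (cases "q = \<infinity>")
  case True
  have "(SUP \<nu>. a \<nu>) \<le> ennreal C * S" if a: "\<And>\<nu>. a \<nu> \<le> ennreal (C * r ^ \<nu>) * S" for a S
  proof (rule SUP_least)
    fix \<nu> :: nat
    have "r ^ \<nu> \<le> 1" using r by (intro power_le_one) auto
    then have "C * r ^ \<nu> \<le> C * 1" using C by (intro mult_left_mono) auto
    then have "ennreal (C * r ^ \<nu>) * S \<le> ennreal C * S" by (intro mult_right_mono ennreal_leI) auto
    then show "a \<nu> \<le> ennreal C * S" by (rule order_trans[OF a])
  qed
  then show ?thesis using that[OF C] True by simp
next
  case False
  define Q where "Q = enn2real q"
  have Q: "Q > 0" using q False by (auto simp: Q_def enn2real_positive_iff less_top)
  have rQ: "0 < r powr Q" "r powr Q < 1" using r Q powr_less_mono2[of Q r 1] by auto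
  define G where "G = C powr Q * (1 / (1 - r powr Q))"
  have G: "G > 0" using C rQ by (simp add: G_def)
  have "ennreal_powr (\<Sum>\<nu>. ennreal_powr (a \<nu>) Q) (1 / Q) \<le> ennreal (G powr (1 / Q)) * S"
    if a: "\<And>\<nu>. a \<nu> \<le> ennreal (C * r ^ \<nu>) * S" for a S
  proof -
    have "ennreal_powr (a \<nu>) Q \<le> ennreal (C powr Q * (r powr Q) ^ \<nu>) * ennreal_powr S Q" for \<nu>
    proof -
      have "ennreal_powr (a \<nu>) Q \<le> ennreal_powr (ennreal (C * r ^ \<nu>) * S) Q"
        using Q by (intro ennreal_powr_mono a) auto
      also have "\<dots> = ennreal ((C * r ^ \<nu>) powr Q) * ennreal_powr S Q"
        using C r by (intro ennreal_powr_mult) simp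
      also have "(C * r ^ \<nu>) powr Q = C powr Q * (r powr Q) ^ \<nu>"
        using C r by (simp add: powr_mult powr_power powr_powr mult.commute flip: powr_realpow)
      finally show ?thesis .
    qed
    then have "(\<Sum>\<nu>. ennreal_powr (a \<nu>) Q) \<le> (\<Sum>\<nu>. ennreal (C powr Q * (r powr Q) ^ \<nu>) * ennreal_powr S Q)"
      by (intro suminf_le summableI) auto
    also have "\<dots> = (\<Sum>\<nu>. ennreal (C powr Q * (r powr Q) ^ \<nu>)) * ennreal_powr S Q"
      by (rule ennreal_suminf_multc)
    also have "(\<Sum>\<nu>. ennreal (C powr Q * (r powr Q) ^ \<nu>)) = ennreal G"
      unfolding G_def using rQ by (intro suminf_ennreal_eq sums_mult geometric_sums) auto
    finally have "ennreal_powr (\<Sum>\<nu>. ennreal_powr (a \<nu>) Q) (1 / Q) \<le> ennreal_powr (ennreal G * ennreal_powr S Q) (1 / Q)"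
      using Q by (intro ennreal_powr_mono) auto
    also have "\<dots> = ennreal (G powr (1 / Q)) * S"
      using Q G by (simp add: ennreal_powr_mult ennreal_powr_powr)
    finally show ?thesis .
  qed
  then show ?thesis using that[of "G powr (1 / Q)"] G False by (simp add: Q_def)
qed

section \<open>From the norms of single atoms to frequency bands\<close>

context shearlet_system begin

lemma inverse_fourier_atom_hat:
  "inverse_fourier (atom_hat (Some (k, j, l))) = matrix_dilation (A_neg_power k j ** B_matrix k (- l)) (shearlet \<psi>1 \<psi>2 k)"
proof -
  have "atom_hat (Some (k, j, l)) = (\<lambda>\<xi>. shearlet_hat \<psi>1 \<psi>2 k (\<xi> v* (A_neg_power k j ** B_matrix k (- l))))"
    by (simp add: fun_eq_iff atom_hat_def generator_def atom_group_def atom_matrix_def)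
  moreover have "shearlet_hat \<psi>1 \<psi>2 k \<in> borel_measurable borel"
    using schwartz_measurable[OF generator_schwartz[of "Some k"]] by (simp add: generator_def)
  ultimately show ?thesis
    unfolding shearlet_def by (simp only: inverse_fourier_matrix[OF det_shear_matrix])
qed

text \<open>A single term is at most the whole supremum or sum. The weight of scale j is 2 powr ((d
  + 1) j \<alpha>), and it is moved to the other side; the low-pass atom has scale 0 and weight
  1.\<close>

lemma atom_norm_le:
  fixes p q :: ennreal and \<alpha> :: real
  assumes q: "0 < q" and a: "a \<in> atoms"
  shows "Lp_norm p (f \<star> inverse_fourier (atom_hat a)) \<le>
    ennreal (2 powr (- (real (CARD('d) + 1) * real (atom_scale a) * \<alpha>))) * shear_besov_norm \<psi>1 \<psi>2 \<Psi>h \<alpha> p q f"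
proof (cases a)
  case None
  have "atom_hat None = \<Psi>h" by (simp add: fun_eq_iff atom_hat_None)
  then show ?thesis
    unfolding None shear_besov_norm_def Let_def by (simp add: atom_scale_def)
next
  case (Some b)
  then obtain k j l where s: "a = Some (k, j, l)" by (cases b) auto
  have l: "l \<in> shears k j" using a by (auto simp: atoms_def s)
  define T where "T k j l = ennreal ((2 powr (- (real (CARD('d) + 1) * real j))) powr (- \<alpha>)) *
      Lp_norm p (f \<star> matrix_dilation (A_neg_power k j ** B_matrix k (- l)) (shearlet \<psi>1 \<psi>2 k))"
    for k :: 'd and j :: nat and l
  let ?S = "shear_besov_norm \<psi>1 \<psi>2 \<Psi>h \<alpha> p q f"
  let ?R = "if q = \<infinity> then SUP k. SUP j. SUP l\<in>shears k j. T k j l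
      else ennreal_powr (\<Sum>k\<in>UNIV. \<Sum>j. \<Sum>l\<in>shears k j. ennreal_powr (T k j l) (enn2real q)) (1 / enn2real q)"
  have S: "?S = Lp_norm p (f \<star> inverse_fourier \<Psi>h) + ?R"
    unfolding shear_besov_norm_def Let_def T_def by (rule refl)
  have "T k j l \<le> ?R"
  proof (cases "q = \<infinity>")
    case True
    have "T k j l \<le> (SUP k. SUP j. SUP l\<in>shears k j. T k j l)"
      by (rule SUP_upper2[of k], simp, rule SUP_upper2[of j], simp, rule SUP_upper2[OF l], simp)
    then show ?thesis using True by simp
  next
    case False
    define Q where "Q = enn2real q"
    have Q: "Q > 0" using q False by (auto simp: Q_def enn2real_positive_iff less_top)
    let ?t = "\<lambda>k j l. ennreal_powr (T k j l) Q"
    have "?t k j l \<le> (\<Sum>l\<in>shears k j. ?t k j l)"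
      by (rule member_le_sum[OF l]) (auto simp: finite_shears)
    also have "\<dots> \<le> (\<Sum>j. \<Sum>l\<in>shears k j. ?t k j l)"
      using sum_le_suminf[OF summableI, of "{j}" "\<lambda>j. \<Sum>l\<in>shears k j. ?t k j l"] by simp
    also have "\<dots> \<le> (\<Sum>k\<in>UNIV. \<Sum>j. \<Sum>l\<in>shears k j. ?t k j l)"
      by (rule member_le_sum) auto
    finally have "ennreal_powr (?t k j l) (1 / Q) \<le> ennreal_powr (\<Sum>k\<in>UNIV. \<Sum>j. \<Sum>l\<in>shears k j. ?t k j l) (1 / Q)"
      using Q by (intro ennreal_powr_mono) auto
    then show ?thesis using False Q by (simp add: ennreal_powr_powr Q_def)
  qed
  also have "?R \<le> ?S" unfolding S by (rule add_increasing) auto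
  finally have le: "T k j l \<le> ?S" .
  let ?e = "real (CARD('d) + 1) * real j * \<alpha>"
  have T: "T k j l = ennreal (2 powr ?e) * Lp_norm p (f \<star> inverse_fourier (atom_hat a))"
    unfolding T_def s inverse_fourier_atom_hat powr_powr by simp
  have "Lp_norm p (f \<star> inverse_fourier (atom_hat a)) =
      ennreal (2 powr (- ?e) * 2 powr ?e) * Lp_norm p (f \<star> inverse_fourier (atom_hat a))"
    by (simp add: powr_minus)
  also have "\<dots> = ennreal (2 powr (- ?e)) * T k j l"
    unfolding T by (subst ennreal_mult) (auto simp: mult.assoc)
  also have "\<dots> \<le> ennreal (2 powr (- ?e)) * ?S" by (intro mult_left_mono le) auto
  finally show ?thesis by (simp add: s atom_scale_def)
qed

text \<open>The lower support bound gives 4 ^ j / 16 \<le> 2 * 2 ^ \<nu>; 16 * 2 = 2 ^ 5 is the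
  additive 5.\<close>

lemma atom_scale_upper:
  assumes nz: "atom_hat a \<xi> \<noteq> 0" and \<xi>: "norm \<xi> \<le> 2 * 2 ^ \<nu>"
  shows "2 * atom_scale a \<le> \<nu> + 5"
proof (cases a)
  case (Some b)
  then obtain k j l where s: "a = Some (k, j, l)" by (cases b) auto
  have "4 ^ j / 16 \<le> norm \<xi>"
    using atom_hat_nonzero_Some(1)[OF nz[unfolded s]] component_le_norm_cart[of \<xi> k] by linarith
  then have "(4::real) ^ j \<le> 32 * 2 ^ \<nu>" using \<xi> by simp
  moreover have "(4::real) ^ j = 2 ^ (2 * j)" by (simp add: power_mult)
  ultimately have "(2::real) ^ (2 * j) \<le> 2 ^ (\<nu> + 5)" by (simp add: power_add)
  then have "2 * j \<le> \<nu> + 5" by (subst (asm) power_increasing_iff) auto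
  then show ?thesis by (simp add: s atom_scale_def)
qed (simp add: atom_scale_def)

text \<open>The l1 bound gives norm \<xi> \<le> d * 4 ^ j, and 2 d \<le> 2 ^ (2 d) puts the constant
  into the exponent. Scale 0 is included, so the low-pass atom can occur only for bounded
  \<nu>.\<close>

lemma atom_scale_lower:
  assumes a: "a \<in> atoms" and nz: "atom_hat a \<xi> \<noteq> 0" and \<xi>: "2 ^ \<nu> / 2 \<le> norm \<xi>"
  shows "\<nu> \<le> 2 * atom_scale a + 2 * CARD('d)"
proof -
  let ?j = "atom_scale a"
  have "norm \<xi> \<le> (\<Sum>i\<in>UNIV. \<bar>\<xi> $ i\<bar>)" by (rule norm_le_l1_cart)
  also have "\<dots> \<le> (\<Sum>i\<in>(UNIV::'d set). 4 ^ ?j)" by (intro sum_mono atom_bound[OF a nz])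
  finally have "2 ^ \<nu> \<le> real (2 * CARD('d)) * 4 ^ ?j" using \<xi> by simp
  also have "\<dots> \<le> 2 ^ (2 * CARD('d)) * 4 ^ ?j" by (intro mult_right_mono of_nat_less_two_power less_imp_le) auto
  also have "\<dots> = 2 ^ (2 * ?j + 2 * CARD('d))" by (simp add: power_add power_mult)
  finally show ?thesis by (subst (asm) power_increasing_iff) auto
qed

text \<open>The scales form a window around \<nu> / 2 whose length depends on d alone, and a scale j
  has O(2 ^ (j (d - 1))) shears.\<close>

lemma card_scale_window:
  fixes A :: "'d atom set"
  assumes A: "A \<subseteq> atoms" and w: "\<And>a. a \<in> A \<Longrightarrow> 2 * atom_scale a \<le> \<nu> + 5 \<and> \<nu> \<le> 2 * atom_scale a + 2 * CARD('d)"
  shows "finite A"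
    "real (card A) \<le> (1 + real CARD('d) * ((real CARD('d) + 5) * 24 ^ (CARD('d) - 1))) * 2 powr (real \<nu> / 2 * (real CARD('d) - 1))"
proof -
  define d where "d = CARD('d)"
  have d: "d \<ge> 1" by (simp add: d_def Suc_le_eq)
  \<comment> \<open>Truncated subtraction and division only lower m, which widens the window; its
    length still stays within d + 5.\<close>
  define m n where "m = (\<nu> - 2 * d) div 2" and "n = (\<nu> + 5) div 2"
  let ?W = "{a \<in> atoms :: 'd atom set. m \<le> atom_scale a \<and> atom_scale a \<le> n}"
  have sub: "A \<subseteq> ?W"
  proof
    fix a assume "a \<in> A"
    moreover from w[OF this] have "m \<le> atom_scale a" "atom_scale a \<le> n" unfolding m_def n_def d_def by linarith+
    ultimately show "a \<in> ?W" using A by auto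
  qed
  show "finite A" by (rule finite_subset[OF sub atoms_scale_finite])
  define R where "R = 2 powr (real \<nu> / 2)"
  have R: "R \<ge> 1" by (simp add: R_def ge_one_powr_ge_zero)
  have "2 * n \<le> \<nu> + 5" by (simp add: n_def)
  then have n': "real n \<le> real \<nu> / 2 + 3" by linarith
  have "(2::real) ^ n = 2 powr real n" by (simp add: powr_realpow)
  also have "\<dots> \<le> 2 powr (real \<nu> / 2 + 3)" by (intro powr_mono n') auto
  also have "\<dots> = 8 * R" by (simp add: powr_add R_def)
  finally have n: "(2::real) ^ n \<le> 8 * R" .
  have mn: "n + 1 - m \<le> d + 5" unfolding m_def n_def by linarith
  have R1: "1 \<le> R ^ (d - 1)" by (rule one_le_power[OF R])
  have "card A \<le> 1 + d * ((n + 1 - m) * (3 * 2 ^ n) ^ (d - 1))"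
    unfolding d_def by (rule order_trans[OF card_mono[OF atoms_scale_finite sub] atoms_scale_card])
  then have "real (card A) \<le> real (1 + d * ((n + 1 - m) * (3 * 2 ^ n) ^ (d - 1)))" by (rule of_nat_mono)
  also have "\<dots> = 1 + real d * (real (n + 1 - m) * (3 * 2 ^ n) ^ (d - 1))" by simp
  \<comment> \<open>24 is 3 from \<open>card_shears\<close> times 8 = 2 ^ 3 from n \<le> \<nu> / 2 +
    3.\<close>
  also have "\<dots> \<le> 1 + real d * ((real d + 5) * (24 * R) ^ (d - 1))"
  proof -
    have "(3 * 2 ^ n) ^ (d - 1) \<le> (24 * R) ^ (d - 1)" by (rule power_mono) (use n in auto)
    moreover have "real (n + 1 - m) \<le> real d + 5" using mn by linarith
    ultimately show ?thesis by (intro add_left_mono mult_left_mono mult_mono) auto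
  qed
  also have "\<dots> \<le> (1 + real d * ((real d + 5) * 24 ^ (d - 1))) * R ^ (d - 1)"
    using R1 by (simp add: power_mult_distrib algebra_simps)
  also have "R ^ (d - 1) = 2 powr (real \<nu> / 2 * (real d - 1))"
    using d by (simp add: R_def powr_power of_nat_diff mult.commute)
  finally show "real (card A) \<le> (1 + real CARD('d) * ((real CARD('d) + 5) * 24 ^ (CARD('d) - 1))) * 2 powr (real \<nu> / 2 * (real CARD('d) - 1))"
    unfolding d_def .
qed

text \<open>The exponent balances the number of atoms to the power m against their weight at scale
  about \<nu> / 2. The alternative \<nu> = 0 admits profiles without a lower frequency bound, as
  needed for the low-pass function of the Besov norm.\<close>

theorem frequency_band_estimate:
  fixes v :: "real^'d \<Rightarrow> complex" and p q :: ennreal and \<alpha> :: real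
  assumes v: "v \<in> schwartz" and v_supp: "\<And>\<eta>. v \<eta> \<noteq> 0 \<Longrightarrow> norm \<eta> \<le> 2" and p: "0 < p" "p < \<infinity>" and q: "0 < q"
  obtains C :: real where "C > 0"
    "\<And>f \<nu>. f \<in> tempered_distributions \<Longrightarrow> \<nu> = 0 \<or> (\<forall>\<eta>. v \<eta> \<noteq> 0 \<longrightarrow> 1/2 \<le> norm \<eta>) \<Longrightarrow>
      Lp_norm p (f \<star> inverse_fourier (\<lambda>\<xi>. v ((1 / 2 ^ \<nu>) *\<^sub>R \<xi>))) \<le>
        ennreal (C * 2 powr (real \<nu> * ((real CARD('d) - 1) / 2 * max 1 (1 / enn2real p) - (real CARD('d) + 1) / 2 * \<alpha>))) *
        shear_besov_norm \<psi>1 \<psi>2 \<Psi>h \<alpha> p q f"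
proof -
  define d where "d = real CARD('d)"
  define m where "m = max 1 (1 / enn2real p)"
  have m: "m \<ge> 1" by (simp add: m_def)
  obtain E where E: "E > 0" and Eb: "\<And>f \<nu> B A. f \<in> tempered_distributions \<Longrightarrow>
      A = {a \<in> atoms. \<exists>\<xi>. atom_hat a \<xi> \<noteq> 0 \<and> v ((1 / 2 ^ \<nu>) *\<^sub>R \<xi>) \<noteq> 0} \<Longrightarrow> finite A \<Longrightarrow>
      (\<And>a. a \<in> A \<Longrightarrow> Lp_norm p (f \<star> inverse_fourier (atom_hat a)) \<le> B) \<Longrightarrow>
      Lp_norm p (f \<star> inverse_fourier (\<lambda>\<xi>. v ((1 / 2 ^ \<nu>) *\<^sub>R \<xi>))) \<le> ennreal (E * real (card A) powr m) * B"
  proof (rule multiplier_estimate[OF v v_supp p])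
    fix E :: real
    assume *: "E > 0" "\<And>f \<nu> B A. f \<in> tempered_distributions \<Longrightarrow>
      A = {a \<in> atoms. \<exists>\<xi>. atom_hat a \<xi> \<noteq> 0 \<and> v ((1 / 2 ^ \<nu>) *\<^sub>R \<xi>) \<noteq> 0} \<Longrightarrow> finite A \<Longrightarrow>
      (\<And>a. a \<in> A \<Longrightarrow> Lp_norm p (f \<star> inverse_fourier (atom_hat a)) \<le> B) \<Longrightarrow>
      Lp_norm p (f \<star> inverse_fourier (\<lambda>\<xi>. v ((1 / 2 ^ \<nu>) *\<^sub>R \<xi>))) \<le>
        ennreal (E * real (card A) powr max 1 (1 / enn2real p)) * B"
    show thesis by (rule that[OF *(1)], unfold m_def, erule *(2), assumption, assumption, blast)
  qed
  define C1 where "C1 = 1 + d * ((d + 5) * 24 ^ (CARD('d) - 1))"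
  have C1: "C1 > 0" by (simp add: C1_def d_def add_pos_nonneg)
  \<comment> \<open>Absorbs the replacement of the scale j by \<nu> / 2 in the weight. The two
    differ by at most d + 3, and the absolute value covers both signs of \<alpha>.\<close>
  define C2 where "C2 = 2 powr ((d + 3) * \<bar>(d + 1) * \<alpha>\<bar>)"
  have C2: "C2 > 0" by (simp add: C2_def)
  show ?thesis
  proof (rule that)
    show "E * C1 powr m * C2 > 0" using E C1 C2 by simp
    fix f :: "(real^'d \<Rightarrow> complex) \<Rightarrow> complex" and \<nu> :: nat
    assume f: "f \<in> tempered_distributions" and \<nu>: "\<nu> = 0 \<or> (\<forall>\<eta>. v \<eta> \<noteq> 0 \<longrightarrow> 1/2 \<le> norm \<eta>)"
    define S where "S = shear_besov_norm \<psi>1 \<psi>2 \<Psi>h \<alpha> p q f"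
    define A where "A = {a \<in> atoms. \<exists>\<xi>. atom_hat a \<xi> \<noteq> 0 \<and> v ((1 / 2 ^ \<nu>) *\<^sub>R \<xi>) \<noteq> 0}"
    have A: "A \<subseteq> atoms" by (auto simp: A_def)
    have w: "2 * atom_scale a \<le> \<nu> + 5 \<and> \<nu> \<le> 2 * atom_scale a + 2 * CARD('d)" if aA: "a \<in> A" for a
    proof -
      obtain \<xi> where a: "a \<in> atoms" and \<xi>: "atom_hat a \<xi> \<noteq> 0" "v ((1 / 2 ^ \<nu>) *\<^sub>R \<xi>) \<noteq> 0"
        using aA by (auto simp: A_def)
      have "norm \<xi> \<le> 2 * 2 ^ \<nu>" using v_supp[OF \<xi>(2)] by (simp add: divide_le_eq)
      moreover have "\<nu> \<le> 2 * atom_scale a + 2 * CARD('d)"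
      proof (cases "\<nu> = 0")
        case False
        then have "1/2 \<le> norm ((1 / 2 ^ \<nu>) *\<^sub>R \<xi>)" using \<nu> \<xi>(2) by blast
        then have "2 ^ \<nu> / 2 \<le> norm \<xi>" by (simp add: le_divide_eq)
        then show ?thesis by (rule atom_scale_lower[OF a \<xi>(1)])
      qed simp
      ultimately show ?thesis using atom_scale_upper[OF \<xi>(1)] by blast
    qed
    note card = card_scale_window[OF A w]
    define W where "W = C2 * 2 powr (- (real \<nu> / 2 * ((d + 1) * \<alpha>)))"
    have le_W: "Lp_norm p (f \<star> inverse_fourier (atom_hat a)) \<le> ennreal W * S" if aA: "a \<in> A" for a
    proof -
      let ?j = "real (atom_scale a)"
      have "2 * ?j \<le> real \<nu> + 5" "real \<nu> \<le> 2 * ?j + 2 * d" using w[OF aA] unfolding d_def by linarith+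
      then have "\<bar>real \<nu> / 2 - ?j\<bar> \<le> d + 3" unfolding d_def by linarith
      then have "\<bar>(real \<nu> / 2 - ?j) * ((d + 1) * \<alpha>)\<bar> \<le> (d + 3) * \<bar>(d + 1) * \<alpha>\<bar>"
        unfolding abs_mult[of "real \<nu> / 2 - ?j"] by (rule mult_right_mono) simp
      then have "(real \<nu> / 2 - ?j) * ((d + 1) * \<alpha>) \<le> (d + 3) * \<bar>(d + 1) * \<alpha>\<bar>"
        by (rule order_trans[OF abs_ge_self])
      then have "- ((d + 1) * ?j * \<alpha>) \<le> (d + 3) * \<bar>(d + 1) * \<alpha>\<bar> + - (real \<nu> / 2 * ((d + 1) * \<alpha>))"
        by (simp add: algebra_simps)
      then have "2 powr (- ((d + 1) * ?j * \<alpha>)) \<le> 2 powr ((d + 3) * \<bar>(d + 1) * \<alpha>\<bar> + - (real \<nu> / 2 * ((d + 1) * \<alpha>)))"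
        by (intro powr_mono) auto
      also have "\<dots> = W" unfolding W_def C2_def by (rule powr_add)
      finally have "ennreal (2 powr (- ((d + 1) * ?j * \<alpha>))) * S \<le> ennreal W * S"
        by (intro mult_right_mono ennreal_leI) auto
      moreover have "Lp_norm p (f \<star> inverse_fourier (atom_hat a)) \<le> ennreal (2 powr (- ((d + 1) * ?j * \<alpha>))) * S"
        using atom_norm_le[OF q, of a p f \<alpha>] aA A by (auto simp: d_def S_def add.commute)
      ultimately show ?thesis by (rule order_trans[rotated])
    qed
    have "Lp_norm p (f \<star> inverse_fourier (\<lambda>\<xi>. v ((1 / 2 ^ \<nu>) *\<^sub>R \<xi>))) \<le> ennreal (E * real (card A) powr m) * (ennreal W * S)"
      by (rule Eb[OF f A_def card(1) le_W])
    also have "\<dots> = ennreal (E * real (card A) powr m * W) * S"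
      using E C2 by (simp add: ennreal_mult W_def mult.assoc)
    also have "\<dots> \<le> ennreal (E * (C1 powr m * 2 powr (real \<nu> / 2 * (d - 1) * m)) * W) * S"
    proof (intro mult_right_mono ennreal_leI mult_left_mono)
      have "real (card A) powr m \<le> (C1 * 2 powr (real \<nu> / 2 * (d - 1))) powr m"
        using card(2) m unfolding C1_def d_def by (intro powr_mono2) auto
      also have "\<dots> = C1 powr m * 2 powr (real \<nu> / 2 * (d - 1) * m)"
        using C1 by (simp add: powr_mult powr_powr)
      finally show "real (card A) powr m \<le> C1 powr m * 2 powr (real \<nu> / 2 * (d - 1) * m)" .
    qed (use E C2 in \<open>auto simp: W_def\<close>)
    also have "E * (C1 powr m * 2 powr (real \<nu> / 2 * (d - 1) * m)) * W =
        (E * C1 powr m * C2) * (2 powr (real \<nu> / 2 * (d - 1) * m) * 2 powr (- (real \<nu> / 2 * ((d + 1) * \<alpha>))))"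
      by (simp add: W_def)
    also have "2 powr (real \<nu> / 2 * (d - 1) * m) * 2 powr (- (real \<nu> / 2 * ((d + 1) * \<alpha>))) =
        2 powr (real \<nu> / 2 * (d - 1) * m + - (real \<nu> / 2 * ((d + 1) * \<alpha>)))"
      by (rule powr_add[symmetric])
    also have "real \<nu> / 2 * (d - 1) * m + - (real \<nu> / 2 * ((d + 1) * \<alpha>)) = real \<nu> * ((d - 1) / 2 * m - (d + 1) / 2 * \<alpha>)"
      by (simp add: algebra_simps)
    finally show "Lp_norm p (f \<star> inverse_fourier (\<lambda>\<xi>. v ((1 / 2 ^ \<nu>) *\<^sub>R \<xi>))) \<le>
        ennreal (E * C1 powr m * C2 * 2 powr (real \<nu> * ((real CARD('d) - 1) / 2 * max 1 (1 / enn2real p) - (real CARD('d) + 1) / 2 * \<alpha>))) *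
        shear_besov_norm \<psi>1 \<psi>2 \<Psi>h \<alpha> p q f"
      unfolding d_def m_def S_def .
  qed
qed

end

theorem theorem7p3:
  fixes \<phi> \<Phi> :: "real^'d \<Rightarrow> complex"
    and \<psi>1 \<psi>2 :: "real \<Rightarrow> complex"
    and \<Psi>h :: "real^'d \<Rightarrow> complex"
    and p q :: ennreal
    and s lam \<alpha>1 \<alpha>2 :: real
  assumes "CARD('d) \<ge> 2"
    and "besov_generators \<phi> \<Phi>"
    and "shearlet_generators \<psi>1 \<psi>2 \<Psi>h"
    and "0 < p" and "0 < q"
    and "s = 1/2 * (max 1 (enn2real (1 / p)) - min 1 (enn2real (1 / q)))"
    and "(p \<le> 1 \<and> lam = 0) \<or>
         (1 < p \<and> p < \<infinity> \<and> lam > real CARD('d) * (enn2real p - 1) / enn2real p)"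
    and "2 * real CARD('d) + lam + 2 * (\<alpha>1 + s * (real CARD('d) - 1))
           < (real CARD('d) + 1) * (\<alpha>2 + 1)"
  shows "embeds (shear_besov_space \<psi>1 \<psi>2 \<Psi>h \<alpha>2 p q) (shear_besov_norm \<psi>1 \<psi>2 \<Psi>h \<alpha>2 p q)
                (besov_space \<phi> \<Phi> \<alpha>1 p q) (besov_norm \<phi> \<Phi> \<alpha>1 p q)"
proof -
  interpret shearlet_system \<psi>1 \<psi>2 \<Psi>h by unfold_locales fact
  \<comment> \<open>Either alternative of the hypothesis on lam makes p finite.\<close>
  have p: "0 < p" "p < \<infinity>" using assms(4,7) by (auto simp: top.not_eq_extremum intro: le_less_trans)
  note q = assms(5)
  obtain P where P: "p = ennreal P" "P > 0" using p by (cases p) auto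
  define d where "d = real CARD('d)"
  have d: "d \<ge> 2" using assms(1) by (simp add: d_def)
  define m where "m = max 1 (1 / enn2real p)"
  define \<kappa> where "\<kappa> = (d - 1) / 2 * m - (d + 1) / 2 * \<alpha>2"
  have "1 / p = ennreal (1 / P)" unfolding P(1) by (subst ennreal_1[symmetric], rule divide_ennreal) (use P in auto)
  then have m: "max 1 (enn2real (1 / p)) = m" using P by (simp add: m_def)
  have lam: "lam \<ge> 0"
    using assms(7)
  proof
    assume *: "1 < p \<and> p < \<infinity> \<and> lam > real CARD('d) * (enn2real p - 1) / enn2real p"
    then have "ennreal 1 < ennreal P" using P(1) by simp
    then have "P > 1" by (simp only: ennreal_less_iff[OF zero_le_one])
    then have "0 \<le> real CARD('d) * (enn2real p - 1) / enn2real p" using P by simp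
    then show ?thesis using * by linarith
  qed simp
  \<comment> \<open>Insert lam \<ge> 0 and 2 s \<ge> m - 1, the latter because the minimum in s is
    at most 1. The terms free of m and of the smoothness parameters cancel by 2 d - (d - 1) = d + 1,
    which leaves 2 \<alpha>1 + (d - 1) m < (d + 1) \<alpha>2.\<close>
  have neg: "\<kappa> + \<alpha>1 < 0"
  proof -
    have "s * 2 = m - min 1 (enn2real (1 / q))" unfolding assms(6) m by simp
    then have "m - 1 \<le> s * 2" by simp
    then have "(m - 1) * (d - 1) \<le> s * 2 * (d - 1)" using d by (intro mult_right_mono) auto
    then show ?thesis using assms(8) lam unfolding d_def[symmetric] \<kappa>_def by (simp add: field_simps)
  qed
  have g: "\<phi> \<in> schwartz" "\<Phi> \<in> schwartz"
    "supp (fourier \<phi>) \<subseteq> {\<xi>. 1/2 \<le> norm \<xi> \<and> norm \<xi> \<le> 2}" "supp (fourier \<Phi>) \<subseteq> {\<xi>. norm \<xi> \<le> 2}"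
    using assms(2) by (auto simp: besov_generators_def)
  have supp: "1/2 \<le> norm \<eta>" "norm \<eta> \<le> 2" if "fourier \<phi> \<eta> \<noteq> 0" for \<eta>
    using supp_subsetD[OF g(3) that] by auto
  have supp': "norm \<eta> \<le> 2" if "fourier \<Phi> \<eta> \<noteq> 0" for \<eta>
    using supp_subsetD[OF g(4) that] by auto
  let ?S = "shear_besov_norm \<psi>1 \<psi>2 \<Psi>h \<alpha>2 p q"
  obtain C where C: "C > 0" and Cb: "\<And>f \<nu>. f \<in> tempered_distributions \<Longrightarrow>
      Lp_norm p (f \<star> dyadic_dilation \<nu> \<phi>) \<le> ennreal (C * 2 powr (real \<nu> * \<kappa>)) * ?S f"
  proof (rule frequency_band_estimate[OF schwartz_fourier[OF g(1)] supp(2) p q, where \<alpha> = \<alpha>2])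
    fix C :: real
    assume *: "C > 0" "\<And>f \<nu>. f \<in> tempered_distributions \<Longrightarrow> \<nu> = 0 \<or> (\<forall>\<eta>. fourier \<phi> \<eta> \<noteq> 0 \<longrightarrow> 1/2 \<le> norm \<eta>) \<Longrightarrow>
      Lp_norm p (f \<star> inverse_fourier (\<lambda>\<xi>. fourier \<phi> ((1 / 2 ^ \<nu>) *\<^sub>R \<xi>))) \<le>
        ennreal (C * 2 powr (real \<nu> * ((real CARD('d) - 1) / 2 * max 1 (1 / enn2real p) - (real CARD('d) + 1) / 2 * \<alpha>2))) * ?S f"
    show thesis
      by (rule that[OF *(1)]) (use *(2) supp(1) in \<open>simp add: dyadic_dilation_inverse_fourier[OF g(1)] \<kappa>_def d_def m_def\<close>)
  qed
  obtain C' where C': "C' > 0" and C'b: "\<And>f. f \<in> tempered_distributions \<Longrightarrow> Lp_norm p (f \<star> \<Phi>) \<le> ennreal C' * ?S f"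
  proof (rule frequency_band_estimate[OF schwartz_fourier[OF g(2)] supp' p q, where \<alpha> = \<alpha>2])
    fix C :: real
    assume *: "C > 0" "\<And>f \<nu>. f \<in> tempered_distributions \<Longrightarrow> \<nu> = 0 \<or> (\<forall>\<eta>. fourier \<Phi> \<eta> \<noteq> 0 \<longrightarrow> 1/2 \<le> norm \<eta>) \<Longrightarrow>
      Lp_norm p (f \<star> inverse_fourier (\<lambda>\<xi>. fourier \<Phi> ((1 / 2 ^ \<nu>) *\<^sub>R \<xi>))) \<le>
        ennreal (C * 2 powr (real \<nu> * ((real CARD('d) - 1) / 2 * max 1 (1 / enn2real p) - (real CARD('d) + 1) / 2 * \<alpha>2))) * ?S f"
    have "inverse_fourier (\<lambda>\<xi>. fourier \<Phi> ((1 / 2 ^ 0) *\<^sub>R \<xi>)) = \<Phi>" using inverse_fourier_fourier[OF g(2)] by simp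
    then show thesis using that[OF *(1)] *(2)[of _ 0] by simp
  qed
  \<comment> \<open>The weight 2 powr (\<nu> \<alpha>1) of the Besov norm is merged with the band
    estimate; \<open>neg\<close> makes the result a convergent geometric ratio.\<close>
  define r where "r = 2 powr (\<kappa> + \<alpha>1)"
  have r: "0 < r" "r < 1" using powr_less_mono[of "\<kappa> + \<alpha>1" 0 "2::real"] neg by (auto simp: r_def)
  obtain D where D: "D > 0" and Db: "\<And>a S. (\<And>\<nu>. a \<nu> \<le> ennreal (C * r ^ \<nu>) * S) \<Longrightarrow>
      (if q = \<infinity> then SUP \<nu>. a \<nu>
       else ennreal_powr (\<Sum>\<nu>. ennreal_powr (a \<nu>) (enn2real q)) (1 / enn2real q)) \<le> ennreal D * S"
    by (rule lq_norm_geometric_le[OF C r q]) blast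
  have main: "besov_norm \<phi> \<Phi> \<alpha>1 p q f \<le> ennreal (C' + D) * ?S f" if f: "f \<in> tempered_distributions" for f
  proof -
    have "ennreal (2 powr (real \<nu> * \<alpha>1)) * Lp_norm p (f \<star> dyadic_dilation \<nu> \<phi>) \<le> ennreal (C * r ^ \<nu>) * ?S f" for \<nu>
    proof -
      have "ennreal (2 powr (real \<nu> * \<alpha>1)) * Lp_norm p (f \<star> dyadic_dilation \<nu> \<phi>) \<le>
          ennreal (2 powr (real \<nu> * \<alpha>1)) * (ennreal (C * 2 powr (real \<nu> * \<kappa>)) * ?S f)"
        by (intro mult_left_mono Cb[OF f]) auto
      also have "\<dots> = ennreal (2 powr (real \<nu> * \<alpha>1) * (C * 2 powr (real \<nu> * \<kappa>))) * ?S f"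
        using C by (subst ennreal_mult) (auto simp: mult.assoc)
      also have "2 powr (real \<nu> * \<alpha>1) * (C * 2 powr (real \<nu> * \<kappa>)) = C * r ^ \<nu>"
        by (simp add: r_def powr_power powr_add[symmetric] algebra_simps)
      finally show ?thesis .
    qed
    from Db[OF this] have "besov_norm \<phi> \<Phi> \<alpha>1 p q f \<le> ennreal C' * ?S f + ennreal D * ?S f"
      unfolding besov_norm_def Let_def by (intro add_mono C'b[OF f])
    also have "\<dots> = ennreal (C' + D) * ?S f" using C' D by (simp add: ring_distribs)
    finally show ?thesis .
  qed
  have "besov_norm \<phi> \<Phi> \<alpha>1 p q f < \<infinity>" if f: "f \<in> tempered_distributions" and fin: "?S f < \<infinity>" for f
    by (rule le_less_trans[OF main[OF f]]) (use fin in \<open>simp add: ennreal_mult_less_top\<close>)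
  moreover have "C' + D > 0" using C' D by simp
  ultimately show ?thesis
    using main unfolding embeds_def besov_space_def shear_besov_space_def finite_norm_space_def by blast
qed

end
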